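(* Let $Q=[u_1,\dots,u_n]\subset\mathbb{S}^2$ with $n\ge 6$ be a spherical polygon not contained in any closed hemisphere. Let $D^+$ be the number of self-intersections of $Q$, $D^-$ the number of antipodal intersections of $Q$, $D=D^++D^-$, and $I$ the number of inflections of $Q$. Then $2D+I\ge 6$.
   Context: A spherical polygon $Q=[u_1,\dots,u_n]$ is a cyclic sequence of points of $\mathbb{S}^2$ (indices mod $n$) whose edges are the minimal great-circle arcs from $u_i$ to $u_{i+1}$. Standing assumption: no three vertices of $Q$ lie on a common great circle. A self-intersection is a pair of non-adjacent edges that intersect; an antipodal intersection is a pair of non-adjacent edges $e,f$ such that $e$ intersects the antipodal arc $-f$. With $[a,b,c]$ the determinant of $a,b,c\in\mathbb{R}^3$, the pair $\{u_i,u_{i+1}\}$ is an inflection if $[u_{i-1},u_i,u_{i+1}]$ and $[u_i,u_{i+1},u_{i+2}]$ have opposite signs. *)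

theory Defs
  imports "HOL-Analysis.Analysis"
begin

definition det3 :: "real^3 \<Rightarrow> real^3 \<Rightarrow> real^3 \<Rightarrow> real" where
  "det3 a b c = det (vector [a, b, c] :: real^3^3)"

text \<open>Minimal great-circle arc between two non-antipodal points of the unit sphere:
  the unit vectors in the cone spanned by a and b.\<close>
definition sarc :: "real^3 \<Rightarrow> real^3 \<Rightarrow> (real^3) set" where
  "sarc a b = {x. norm x = 1 \<and> (\<exists>s t. s \<ge> 0 \<and> t \<ge> 0 \<and> x = s *\<^sub>R a + t *\<^sub>R b)}"

text \<open>A spherical polygon with n vertices is u 0, ..., u (n-1), indices taken mod n.
  Edge i goes from u i to u ((i+1) mod n).\<close>
definition edge :: "(nat \<Rightarrow> real^3) \<Rightarrow> nat \<Rightarrow> nat \<Rightarrow> (real^3) set" where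
  "edge u n i = sarc (u (i mod n)) (u (Suc i mod n))"

definition nonadjacent :: "nat \<Rightarrow> nat \<Rightarrow> nat \<Rightarrow> bool" where
  "nonadjacent n i j \<longleftrightarrow> i \<noteq> j \<and> j \<noteq> Suc i mod n \<and> i \<noteq> Suc j mod n"

definition num_self_int :: "(nat \<Rightarrow> real^3) \<Rightarrow> nat \<Rightarrow> nat" where
  "num_self_int u n = card {(i, j). i < j \<and> j < n \<and> nonadjacent n i j
                                 \<and> edge u n i \<inter> edge u n j \<noteq> {}}"

definition num_antipodal_int :: "(nat \<Rightarrow> real^3) \<Rightarrow> nat \<Rightarrow> nat" where
  "num_antipodal_int u n = card {(i, j). i < j \<and> j < n \<and> nonadjacent n i j
                                 \<and> edge u n i \<inter> uminus ` edge u n j \<noteq> {}}"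

definition num_inflections :: "(nat \<Rightarrow> real^3) \<Rightarrow> nat \<Rightarrow> nat" where
  "num_inflections u n = card {i. i < n \<and>
     det3 (u ((i + n - 1) mod n)) (u (i mod n)) (u (Suc i mod n))
       * det3 (u (i mod n)) (u (Suc i mod n)) (u (Suc (Suc i) mod n)) < 0}"

end

theory Submission
  imports Defs "HOL-Library.Sublist"
begin

text \<open>
  No three vertices are linearly dependent, so crossings and sides are decided by determinant signs,
  and I is the number of cyclic sign changes of the turning determinants.

  If no edge of Q meets another edge or its antipode, then I \<ge> 6. By induction on n: if the removal of
  some vertex u leaves a polygon inside an open hemisphere, a supporting edge a, b of the remaining
  vertices splits Q into three arcs at u, a, b, each of which must turn the wrong way somewhere while
  all three of u, a, b turn the right way. Otherwise a diagonal free of crossings with Q and -Q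
  exists; choosing one that cuts off a smallest polygon that still lies in no closed hemisphere,
  cutting does not increase I.

  Crossings are removed one at a time. At a crossing x of (r, p) and (q, t), reconnecting the two
  edges near x and reversing one of the two arcs of Q (also negating it, if the crossing is with an
  antipodal edge) gives a polygon with fewer crossings. For an ordinary crossing I grows by at most 2
  and the polygon still lies in no closed hemisphere. For an antipodal crossing the result cannot be
  free of crossings: the two new vertices would lie on different sides of it, although each antipode
  of a vertex lies on the same side. Hence the case D = 1 reduces to D = 0, and D = 2 reduces to
  D = 1 unless both crossings are antipodal; then Q is an embedded polygon on the sphere, and one
  that turns only in one direction is convex, hence contained in a hemisphere, so I \<ge> 2.
\<close>

section \<open>Determinant signs and crossing arcs\<close>

text \<open>No topology is used: the side of a polygon is a crossing parity built from determinant
  signs, and contradictions arise by reading the same side at two different vertices. The obstacle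
  is that antipodes of vertices have to be treated along with the vertices. Then opposite points
  occur and determinants vanish, hence the separate antipodal cases.

  The embedded case is run by contradiction. With fewer than six inflections no free diagonal may
  leave a part that lies in no closed hemisphere. A free diagonal with the fewest vertices behind it
  then cuts off a piece inside an open hemisphere, and at a hull vertex of this piece a point turns
  up inside although it is joined, without meeting the piece, to a point outside. When that point is
  an antipode, the joining path runs along -Q; this is why crossings with -Q must be excluded too.

  The vertices added by a reconnection are x + e r + e^2 q and x + e p + e^2 t: to first order they
  stay on an old edge, so the second order is needed for general position. A crossing weighs 2 in 2D
  + I, just what removing an ordinary one may cost in I; for D \<ge> 3 nothing is to be
  shown.\<close>

lemma det3_expand: "det3 a b c = a$1*(b$2*c$3 - b$3*c$2) - a$2*(b$1*c$3 - b$3*c$1) + a$3*(b$1*c$2 - b$2*c$1)"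
  by (simp add: det3_def det_3 vector_3 algebra_simps)

lemma det3_rot: "det3 b c a = det3 a b c" and det3_swap: "det3 b a c = - det3 a b c"
  by (simp_all add: det3_expand algebra_simps)

lemma det3_rot': "det3 c a b = det3 a b c"
  by (simp add: det3_expand algebra_simps)

lemma det3_swap': "det3 a c b = - det3 a b c" "det3 c b a = - det3 a b c"
  by (simp_all add: det3_expand algebra_simps)

lemma det3_perms: "det3 y x z = - det3 x y z" "det3 y z x = det3 x y z" "det3 z x y = det3 x y z"
    "det3 x z y = - det3 x y z" "det3 z y x = - det3 x y z"
  by (simp_all add: det3_expand algebra_simps)

lemma det3_same [simp]: "det3 a a c = 0" "det3 a c a = 0" "det3 c a a = 0"
  by (simp_all add: det3_expand algebra_simps)

lemma det3_zero [simp]: "det3 0 b c = 0" "det3 b 0 c = 0" "det3 b c 0 = 0"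
  by (simp_all add: det3_expand)

lemma det3_minus [simp]: "det3 (- a) b c = - det3 a b c" "det3 a (- b) c = - det3 a b c" "det3 a b (- c) = - det3 a b c"
  by (simp_all add: det3_expand algebra_simps)

lemma det3_add: "det3 (a + a') b c = det3 a b c + det3 a' b c" "det3 a (b + b') c = det3 a b c + det3 a b' c"
  "det3 a b (c + c') = det3 a b c + det3 a b c'"
  by (simp_all add: det3_expand algebra_simps)

lemma det3_scale: "det3 (t *\<^sub>R a) b c = t * det3 a b c" "det3 a (t *\<^sub>R b) c = t * det3 a b c" "det3 a b (t *\<^sub>R c) = t * det3 a b c"
  by (simp_all add: det3_expand algebra_simps)

lemmas det3_lin = det3_add det3_scale

text \<open>The three-term Pluecker relation for the directions of \<open>a\<close>,
  \<open>b\<close>, \<open>c\<close>, \<open>d\<close> seen from \<open>o'\<close>; many sign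
  deductions below are instances of it.\<close>

lemma grassmann: "det3 o' a b * det3 o' c d - det3 o' a c * det3 o' b d + det3 o' a d * det3 o' b c = 0"
  unfolding det3_expand by algebra

text \<open>The coefficients are those of the linear dependence between four vectors of 3-space.
  Applying a linear functional to this relation is the usual way below to compare signs.\<close>

lemma cramer: "det3 b c d *\<^sub>R a - det3 a c d *\<^sub>R b + det3 a b d *\<^sub>R c - det3 a b c *\<^sub>R d = 0"
  unfolding vec_eq_iff forall_3 by (simp add: det3_expand; algebra)

text \<open>The terms \<open>p\<close>, \<open>- q\<close>, \<open>r\<close> sum to zero and so
  cannot share a strict sign. Everything is phrased with \<open>> 0\<close> so that it can serve as
  an axiom for propositional reasoning.\<close>

lemma grassmann_sign:
  assumes "det3 o' a b \<noteq> 0" "det3 o' c d \<noteq> 0" "det3 o' a c \<noteq> 0" "det3 o' b d \<noteq> 0" "det3 o' a d \<noteq> 0" "det3 o' b c \<noteq> 0"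
  shows "\<not> ((det3 o' a b > 0 \<longleftrightarrow> det3 o' c d > 0) \<and> \<not> (det3 o' a c > 0 \<longleftrightarrow> det3 o' b d > 0) \<and> (det3 o' a d > 0 \<longleftrightarrow> det3 o' b c > 0))"
    "\<not> (\<not> (det3 o' a b > 0 \<longleftrightarrow> det3 o' c d > 0) \<and> (det3 o' a c > 0 \<longleftrightarrow> det3 o' b d > 0) \<and> \<not> (det3 o' a d > 0 \<longleftrightarrow> det3 o' b c > 0))"
proof -
  define p q r where "p = det3 o' a b * det3 o' c d" and "q = det3 o' a c * det3 o' b d" and "r = det3 o' a d * det3 o' b c"
  have e: "p - q + r = 0" unfolding p_def q_def r_def by (rule grassmann)
  have s: "(p > 0 \<longleftrightarrow> (det3 o' a b > 0 \<longleftrightarrow> det3 o' c d > 0))" "(q > 0 \<longleftrightarrow> (det3 o' a c > 0 \<longleftrightarrow> det3 o' b d > 0))"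
     "(r > 0 \<longleftrightarrow> (det3 o' a d > 0 \<longleftrightarrow> det3 o' b c > 0))"  "p \<noteq> 0" "q \<noteq> 0" "r \<noteq> 0"
    using assms unfolding p_def q_def r_def by (auto simp: zero_less_mult_iff)
  show "\<not> ((det3 o' a b > 0 \<longleftrightarrow> det3 o' c d > 0) \<and> \<not> (det3 o' a c > 0 \<longleftrightarrow> det3 o' b d > 0) \<and> (det3 o' a d > 0 \<longleftrightarrow> det3 o' b c > 0))"
    unfolding s(1-3)[symmetric] using e s(4-6) by linarith
  show "\<not> (\<not> (det3 o' a b > 0 \<longleftrightarrow> det3 o' c d > 0) \<and> (det3 o' a c > 0 \<longleftrightarrow> det3 o' b d > 0) \<and> \<not> (det3 o' a d > 0 \<longleftrightarrow> det3 o' b c > 0))"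
    unfolding s(1-3)[symmetric] using e s(4-6) by linarith
qed

text \<open>Transversal crossing of the open arcs \<open>a b\<close> and \<open>c d\<close>. By Cramer's rule the signs below are those of the
  coefficients of a relation between the four vectors. It fails whenever the arcs share an endpoint
  or have antipodal endpoints.\<close>

definition crosses :: "real^3 \<Rightarrow> real^3 \<Rightarrow> real^3 \<Rightarrow> real^3 \<Rightarrow> bool" where
  "crosses a b c d \<longleftrightarrow> (det3 b c d > 0 \<and> det3 a c d < 0 \<and> det3 a b d < 0 \<and> det3 a b c > 0)
     \<or> (det3 b c d < 0 \<and> det3 a c d > 0 \<and> det3 a b d > 0 \<and> det3 a b c < 0)"

text \<open>By Cramer's rule all three coordinates of \<open>p\<close> in the basis
  \<open>x\<close>, \<open>y\<close>, \<open>z\<close> are positive, for either orientation of the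
  triangle.\<close>

definition in_triangle :: "real^3 \<Rightarrow> real^3 \<Rightarrow> real^3 \<Rightarrow> real^3 \<Rightarrow> bool" where
  "in_triangle x y z p \<longleftrightarrow> (det3 x y z > 0 \<and> det3 p y z > 0 \<and> det3 x p z > 0 \<and> det3 x y p > 0)
     \<or> (det3 x y z < 0 \<and> det3 p y z < 0 \<and> det3 x p z < 0 \<and> det3 x y p < 0)"

text \<open>Only the coordinates along \<open>y\<close> and \<open>z\<close> have to be positive:
  \<open>q\<close> lies in the open lune from \<open>x\<close> to \<open>- x\<close> between the
  half circles through \<open>y\<close> and \<open>z\<close>.\<close>

definition in_wedge :: "real^3 \<Rightarrow> real^3 \<Rightarrow> real^3 \<Rightarrow> real^3 \<Rightarrow> bool" where
  "in_wedge x y z q \<longleftrightarrow> (det3 x y z > 0 \<and> det3 x y q > 0 \<and> det3 x q z > 0)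
     \<or> (det3 x y z < 0 \<and> det3 x y q < 0 \<and> det3 x q z < 0)"

text \<open>The directions from \<open>x\<close> to \<open>a\<close>, \<open>b\<close>, \<open>c\<close> occur in this cyclic order; unlike the three determinants
  separately, this is meaningful also when two of the points are antipodal.\<close>

definition ccw :: "real^3 \<Rightarrow> real^3 \<Rightarrow> real^3 \<Rightarrow> real^3 \<Rightarrow> bool" where
  "ccw x a b c \<longleftrightarrow> (det3 x a b > 0 \<and> det3 x b c > 0) \<or> (det3 x b c > 0 \<and> det3 x c a > 0) \<or> (det3 x c a > 0 \<and> det3 x a b > 0)"

definition npar :: "real^3 \<Rightarrow> real^3 \<Rightarrow> bool" where "npar a b \<longleftrightarrow> a \<noteq> b \<and> a \<noteq> - b"

lemma npar_sym: "npar a b \<longleftrightarrow> npar b a"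
  unfolding npar_def by (metis minus_minus)

lemma npar_minus [simp]: "npar (- a) b \<longleftrightarrow> npar a b" "npar a (- b) \<longleftrightarrow> npar a b"
  unfolding npar_def by (metis minus_minus)+

text \<open>The set will contain the antipodes of the vertices as well, so triples with an equal or
  opposite pair must be exempt.\<close>

definition general_position :: "(real^3) set \<Rightarrow> bool" where
  "general_position V \<longleftrightarrow> (\<forall>a\<in>V. \<forall>b\<in>V. \<forall>c\<in>V. npar a b \<longrightarrow> npar b c \<longrightarrow> npar a c \<longrightarrow> det3 a b c \<noteq> 0)"

lemma general_positionD: "general_position V \<Longrightarrow> a \<in> V \<Longrightarrow> b \<in> V \<Longrightarrow> c \<in> V \<Longrightarrow> npar a b \<Longrightarrow> npar b c \<Longrightarrow> npar a c \<Longrightarrow> det3 a b c \<noteq> 0"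
  unfolding general_position_def by blast

text \<open>Jordan's theorem modulo 2 for a triangle. Only the ten signs of the triples among five
  points matter, and the Grassmann relations based at each of the five points exclude enough sign
  patterns to leave a propositional problem.\<close>

lemma triangle_parity_gen:
  assumes "det3 x y z \<noteq> 0" "det3 x y p \<noteq> 0" "det3 x y q \<noteq> 0" "det3 x z p \<noteq> 0" "det3 x z q \<noteq> 0" "det3 x p q \<noteq> 0"
    "det3 y z p \<noteq> 0" "det3 y z q \<noteq> 0" "det3 y p q \<noteq> 0" "det3 z p q \<noteq> 0"
  shows "(crosses x y p q \<noteq> (crosses y z p q \<noteq> crosses z x p q)) = (in_triangle x y z p \<noteq> in_triangle x y z q)"
proof -
  have n: "det3 a b c < 0 \<longleftrightarrow> \<not> det3 a b c > 0" if "det3 a b c \<noteq> 0" for a b c using that by linarith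
  note N = n[OF assms(1)] n[OF assms(2)] n[OF assms(3)] n[OF assms(4)] n[OF assms(5)] n[OF assms(6)] n[OF assms(7)] n[OF assms(8)] n[OF assms(9)] n[OF assms(10)]
  note P = det3_perms[where x=x and y=y and z=z] det3_perms[where x=x and y=y and z=p] det3_perms[where x=x and y=y and z=q] det3_perms[where x=x and y=z and z=p] det3_perms[where x=x and y=z and z=q] det3_perms[where x=x and y=p and z=q]
    det3_perms[where x=y and y=z and z=p] det3_perms[where x=y and y=z and z=q] det3_perms[where x=y and y=p and z=q] det3_perms[where x=z and y=p and z=q]
  have g1: "\<not> ((det3 x y z > 0 \<longleftrightarrow> det3 x p q > 0) \<and> \<not> (det3 x y p > 0 \<longleftrightarrow> det3 x z q > 0) \<and> (det3 x y q > 0 \<longleftrightarrow> det3 x z p > 0))"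
    "\<not> (\<not> (det3 x y z > 0 \<longleftrightarrow> det3 x p q > 0) \<and> (det3 x y p > 0 \<longleftrightarrow> det3 x z q > 0) \<and> \<not> (det3 x y q > 0 \<longleftrightarrow> det3 x z p > 0))"
    using grassmann_sign[of x y z p q] assms by auto
  have g2: "\<not> ((det3 y x z > 0 \<longleftrightarrow> det3 y p q > 0) \<and> \<not> (det3 y x p > 0 \<longleftrightarrow> det3 y z q > 0) \<and> (det3 y x q > 0 \<longleftrightarrow> det3 y z p > 0))"
    "\<not> (\<not> (det3 y x z > 0 \<longleftrightarrow> det3 y p q > 0) \<and> (det3 y x p > 0 \<longleftrightarrow> det3 y z q > 0) \<and> \<not> (det3 y x q > 0 \<longleftrightarrow> det3 y z p > 0))"
    using grassmann_sign[of y x z p q] assms P by auto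
  have g3: "\<not> ((det3 z x y > 0 \<longleftrightarrow> det3 z p q > 0) \<and> \<not> (det3 z x p > 0 \<longleftrightarrow> det3 z y q > 0) \<and> (det3 z x q > 0 \<longleftrightarrow> det3 z y p > 0))"
    "\<not> (\<not> (det3 z x y > 0 \<longleftrightarrow> det3 z p q > 0) \<and> (det3 z x p > 0 \<longleftrightarrow> det3 z y q > 0) \<and> \<not> (det3 z x q > 0 \<longleftrightarrow> det3 z y p > 0))"
    using grassmann_sign[of z x y p q] assms P by auto
  have g4: "\<not> ((det3 p x y > 0 \<longleftrightarrow> det3 p z q > 0) \<and> \<not> (det3 p x z > 0 \<longleftrightarrow> det3 p y q > 0) \<and> (det3 p x q > 0 \<longleftrightarrow> det3 p y z > 0))"
    "\<not> (\<not> (det3 p x y > 0 \<longleftrightarrow> det3 p z q > 0) \<and> (det3 p x z > 0 \<longleftrightarrow> det3 p y q > 0) \<and> \<not> (det3 p x q > 0 \<longleftrightarrow> det3 p y z > 0))"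
    using grassmann_sign[of p x y z q] assms P by auto
  have g5: "\<not> ((det3 q x y > 0 \<longleftrightarrow> det3 q z p > 0) \<and> \<not> (det3 q x z > 0 \<longleftrightarrow> det3 q y p > 0) \<and> (det3 q x p > 0 \<longleftrightarrow> det3 q y z > 0))"
    "\<not> (\<not> (det3 q x y > 0 \<longleftrightarrow> det3 q z p > 0) \<and> (det3 q x z > 0 \<longleftrightarrow> det3 q y p > 0) \<and> \<not> (det3 q x p > 0 \<longleftrightarrow> det3 q y z > 0))"
    using grassmann_sign[of q x y z p] assms P by auto
  define b1 b2 b3 b4 b5 b6 b7 b8 b9 b0 where
   b: "b1 \<longleftrightarrow> det3 x y z > 0" "b2 \<longleftrightarrow> det3 x y p > 0" "b3 \<longleftrightarrow> det3 x y q > 0" "b4 \<longleftrightarrow> det3 x z p > 0" "b5 \<longleftrightarrow> det3 x z q > 0"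
    "b6 \<longleftrightarrow> det3 x p q > 0" "b7 \<longleftrightarrow> det3 y z p > 0" "b8 \<longleftrightarrow> det3 y z q > 0" "b9 \<longleftrightarrow> det3 y p q > 0" "b0 \<longleftrightarrow> det3 z p q > 0"
  show ?thesis
    using g1 g2 g3 g4 g5 unfolding crosses_def in_triangle_def P neg_less_0_iff_less neg_0_less_iff_less N b[symmetric]
    by satx
qed

lemma det3_neg_iff: "det3 a b c \<noteq> 0 \<Longrightarrow> (det3 a b c < 0) = (\<not> det3 a b c > 0)"
  by linarith

lemma crosses_sym: "crosses a b c d = crosses b a c d" "crosses a b c d = crosses a b d c" "crosses a b c d = crosses c d a b"
  unfolding crosses_def
  using det3_perms[where x=a and y=b and z=c] det3_perms[where x=a and y=b and z=d]
     det3_perms[where x=a and y=c and z=d] det3_perms[where x=b and y=c and z=d] by auto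

lemma crosses_minus [simp]: "crosses (- a) (- b) (- c) (- d) = crosses a b c d"
  unfolding crosses_def by auto

lemma crosses_degen [simp]: "crosses a b a d = False" "crosses a b c a = False" "crosses a b b d = False" "crosses a b c b = False"
  "crosses a b (-a) d = False" "crosses a b c (-a) = False" "crosses a b (-b) d = False" "crosses a b c (-b) = False"
  unfolding crosses_def by auto

lemma in_triangle_rot: "in_triangle y z x p = in_triangle x y z p"
  unfolding in_triangle_def det3_perms[where x=x and y=y and z=z] det3_perms[where x=x and y=y and z=p]
    det3_perms[where x=x and y=z and z=p] det3_perms[where x=y and y=z and z=p] neg_less_0_iff_less neg_0_less_iff_less by blast

lemma in_triangle_flip: "in_triangle y x z p = in_triangle x y z p"
  unfolding in_triangle_def det3_perms[where x=x and y=y and z=z] det3_perms[where x=x and y=y and z=p]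
    det3_perms[where x=x and y=z and z=p] det3_perms[where x=y and y=z and z=p] neg_less_0_iff_less neg_0_less_iff_less by blast

lemma triangle_parity_antipode:
  assumes "det3 x y z \<noteq> 0" "q = - y \<or> q = - z \<or> (det3 x y q \<noteq> 0 \<and> det3 x z q \<noteq> 0 \<and> det3 y z q \<noteq> 0)"
  shows "(crosses x y (-x) q \<noteq> (crosses y z (-x) q \<noteq> crosses z x (-x) q)) = (in_triangle x y z (-x) \<noteq> in_triangle x y z q)"
proof -
  note P = det3_perms[where x=x and y=y and z=z] det3_perms[where x=x and y=y and z=q] det3_perms[where x=x and y=z and z=q] 
    det3_perms[where x=y and y=z and z=q] 
  from assms(2) show ?thesis
  proof (elim disjE)
    assume "q = - y" then show ?thesis using assms(1) P unfolding crosses_def in_triangle_def by auto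
  next
    assume "q = - z" then show ?thesis using assms(1) P unfolding crosses_def in_triangle_def by auto
  next
    assume a: "det3 x y q \<noteq> 0 \<and> det3 x z q \<noteq> 0 \<and> det3 y z q \<noteq> 0"
    note N = det3_neg_iff[OF assms(1)] det3_neg_iff[OF a[THEN conjunct1]] det3_neg_iff[OF a[THEN conjunct2, THEN conjunct1]]
       det3_neg_iff[OF a[THEN conjunct2, THEN conjunct2]]
    show ?thesis unfolding crosses_def in_triangle_def det3_minus det3_same neg_less_0_iff_less neg_0_less_iff_less P N less_irrefl minus_zero by satx
  qed
qed

lemma triangle_parity:
  assumes V: "general_position V" "x \<in> V" "y \<in> V" "z \<in> V" "p \<in> V" "q \<in> V"
    and n: "npar x y" "npar y z" "npar x z" "npar p q" 
    and d: "p \<noteq> x" "p \<noteq> y" "p \<noteq> z" "q \<noteq> x" "q \<noteq> y" "q \<noteq> z" 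
  shows "(crosses x y p q \<noteq> (crosses y z p q \<noteq> crosses z x p q)) = (in_triangle x y z p \<noteq> in_triangle x y z q)"
proof -
  have aux: "(crosses x y p q \<noteq> (crosses y z p q \<noteq> crosses z x p q)) = (in_triangle x y z p \<noteq> in_triangle x y z q)"
    if V: "x \<in> V" "y \<in> V" "z \<in> V" "p \<in> V" "q \<in> V" 
    and n: "npar x y" "npar y z" "npar x z" "npar p q" 
    and d: "p = - x" "q \<noteq> x" "q \<noteq> y" "q \<noteq> z" for x y z p q
  proof -
    have "q = - y \<or> q = - z \<or> npar y q \<and> npar z q \<and> npar x q"
      using n d unfolding npar_def by auto
    then have "q = - y \<or> q = - z \<or> (det3 x y q \<noteq> 0 \<and> det3 x z q \<noteq> 0 \<and> det3 y z q \<noteq> 0)"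
      using general_positionD[OF assms(1)] V n by (meson)
    from triangle_parity_antipode[OF general_positionD[OF assms(1) V(1-3)] this] n d(1) show ?thesis by simp
  qed
  have aux2: "(crosses x y p q \<noteq> (crosses y z p q \<noteq> crosses z x p q)) = (in_triangle x y z p \<noteq> in_triangle x y z q)"
    if V: "x \<in> V" "y \<in> V" "z \<in> V" "p \<in> V" "q \<in> V" 
    and n: "npar x y" "npar y z" "npar x z" "npar p q" 
    and d: "p = - x \<or> p = - y \<or> p = - z" "q \<noteq> x" "q \<noteq> y" "q \<noteq> z" for p q
    using d(1)
  proof (elim disjE)
    assume "p = - x" then show ?thesis using aux[OF V n _ d(2-)] by simp
  next
    assume a: "p = - y" show ?thesis
      using aux[of y z x p q] a V n d by (auto simp: in_triangle_rot npar_sym)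
  next
    assume a: "p = - z" show ?thesis
      using aux[of z x y p q] a V n d by (auto simp: in_triangle_rot npar_sym)
  qed
  consider (a) "p = - x \<or> p = - y \<or> p = - z" | (b) "q = - x \<or> q = - y \<or> q = - z" 
    | (c) "npar p x" "npar p y" "npar p z" "npar q x" "npar q y" "npar q z" using d unfolding npar_def by auto
  then show ?thesis
  proof cases
    case a then show ?thesis using aux2[OF V(2-) n] d by blast
  next
    case b then show ?thesis using aux2[of q p] V n d npar_sym[of p q] crosses_sym(2) by (smt (verit))
  next
    case c then show ?thesis using V n by (intro triangle_parity_gen) (simp_all add: general_positionD[OF V(1)] npar_sym)
  qed
qed

text \<open>An arc that leaves the corner \<open>x\<close> into the angle of the triangle either
  ends inside or passes the opposite side; an arc that leaves outside the angle does
  neither.\<close>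

lemma triangle_parity_vertex:
  assumes V: "general_position V" "x \<in> V" "y \<in> V" "z \<in> V" "q \<in> V"
    and n: "npar x y" "npar y z" "npar x z" "npar x q" and d: "q \<noteq> y" "q \<noteq> z" 
  shows "(crosses y z x q \<noteq> in_triangle x y z q) = in_wedge x y z q"
proof -
  note P = det3_perms[where x=x and y=y and z=z] det3_perms[where x=x and y=y and z=q] det3_perms[where x=x and y=z and z=q] 
    det3_perms[where x=y and y=z and z=q] 
  have "q = - y \<or> q = - z \<or> npar y q \<and> npar z q" using d unfolding npar_def by auto
  then have "q = - y \<or> q = - z \<or> (det3 x y q \<noteq> 0 \<and> det3 x z q \<noteq> 0 \<and> det3 y z q \<noteq> 0)"
    using general_positionD[OF V(1)] V n by (meson)
  moreover have 0: "det3 x y z \<noteq> 0" using general_positionD[OF V(1)] V n by blast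
  ultimately show ?thesis
  proof (elim disjE)
    assume "q = - y" then show ?thesis using 0 P unfolding crosses_def in_triangle_def in_wedge_def by auto
  next
    assume "q = - z" then show ?thesis using 0 P unfolding crosses_def in_triangle_def in_wedge_def by auto
  next
    assume a: "det3 x y q \<noteq> 0 \<and> det3 x z q \<noteq> 0 \<and> det3 y z q \<noteq> 0"
    note N = det3_neg_iff[OF 0] det3_neg_iff[OF a[THEN conjunct1]] det3_neg_iff[OF a[THEN conjunct2, THEN conjunct1]]
       det3_neg_iff[OF a[THEN conjunct2, THEN conjunct2]]
    show ?thesis unfolding crosses_def in_triangle_def in_wedge_def neg_less_0_iff_less neg_0_less_iff_less P N by satx
  qed
qed

lemma ccw_rot: "ccw x b c a = ccw x a b c"
  unfolding ccw_def by auto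

text \<open>The convex angle between \<open>p\<close> and \<open>y\<close> runs counterclockwise
  from \<open>p\<close> exactly when \<open>det3 l p y > 0\<close>; this accounts for the exclusive
  or.\<close>

lemma ccw_in_wedge:
  assumes "det3 l p y \<noteq> 0" "det3 l p t \<noteq> 0" "t = - y \<or> det3 l y t \<noteq> 0"
  shows "ccw l p y t = ((det3 l p y > 0) \<noteq> in_wedge l p y t)" "ccw l p t y = (\<not> ccw l p y t)"
proof -
  note P = det3_perms[where x=l and y=p and z=y] det3_perms[where x=l and y=p and z=t] det3_perms[where x=l and y=y and z=t]
  have "ccw l p y t = ((det3 l p y > 0) \<noteq> in_wedge l p y t) \<and> ccw l p t y = (\<not> ccw l p y t)"
  proof (cases "t = - y")
    case True
    show ?thesis unfolding True ccw_def in_wedge_def det3_minus det3_same neg_less_0_iff_less neg_0_less_iff_less P det3_neg_iff[OF assms(1)]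
      less_irrefl minus_zero by satx
  next
    case False
    then have a: "det3 l y t \<noteq> 0" using assms by blast
    show ?thesis unfolding ccw_def in_wedge_def neg_less_0_iff_less neg_0_less_iff_less P det3_neg_iff[OF assms(1)] det3_neg_iff[OF assms(2)] det3_neg_iff[OF a]
      by satx
  qed
  then show "ccw l p y t = ((det3 l p y > 0) \<noteq> in_wedge l p y t)" "ccw l p t y = (\<not> ccw l p y t)" by blast+
qed

text \<open>Separation of two pairs of directions on a circle is symmetric: \<open>y\<close>,
  \<open>y'\<close> separate \<open>a\<close> from \<open>b\<close> exactly when \<open>a\<close>,
  \<open>b\<close> separate \<open>y\<close> from \<open>y'\<close>. Antipodal coincidences are
  split off because their determinants vanish.\<close>

lemma in_wedge_ccw:
  assumes V: "general_position V" "l \<in> V" "a \<in> V" "b \<in> V" "y \<in> V" "y' \<in> V"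
    and n: "npar l a" "npar l b" "npar a b" "npar l y" "npar l y'" "npar y y'"
    and d: "y \<noteq> a" "y \<noteq> b" "y' \<noteq> a" "y' \<noteq> b"
  shows "(in_wedge l y y' a \<noteq> in_wedge l y y' b) = (ccw l a y b \<noteq> ccw l a y' b)"
proof -
  note P = det3_perms[where x=l and y=a and z=b] det3_perms[where x=l and y=a and z=y] det3_perms[where x=l and y=a and z="y'"] 
    det3_perms[where x=l and y=b and z=y] det3_perms[where x=l and y=b and z="y'"] det3_perms[where x=l and y=y and z="y'"]
  have D: "det3 l a b \<noteq> 0" "det3 l y y' \<noteq> 0" using general_positionD[OF V(1)] V n by blast+
  note N = D[THEN det3_neg_iff]
  have A: "y = -a \<or> det3 l a y \<noteq> 0" "y = -b \<or> det3 l b y \<noteq> 0" "y' = -a \<or> det3 l a y' \<noteq> 0" "y' = -b \<or> det3 l b y' \<noteq> 0"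
    using general_positionD[OF V(1)] V n d unfolding npar_def by (metis minus_minus)+
  show ?thesis
  proof (cases "det3 l a y \<noteq> 0 \<and> det3 l b y \<noteq> 0 \<and> det3 l a y' \<noteq> 0 \<and> det3 l b y' \<noteq> 0")
    case True
    then have e: "det3 l a y \<noteq> 0" "det3 l b y \<noteq> 0" "det3 l a y' \<noteq> 0" "det3 l b y' \<noteq> 0" by auto
    note g = grassmann_sign[OF D(1) D(2) e(1) e(4) e(3) e(2)]
    show ?thesis using g unfolding ccw_def in_wedge_def neg_less_0_iff_less neg_0_less_iff_less P N e[THEN det3_neg_iff] by satx
  next
    case False
    then consider "y = - a" "y' = - b" | "y = - b" "y' = - a" | "y = - a" "det3 l a y' \<noteq> 0" "det3 l b y' \<noteq> 0"
      | "y = - b" "det3 l a y' \<noteq> 0" "det3 l b y' \<noteq> 0" | "y' = - a" "det3 l a y \<noteq> 0" "det3 l b y \<noteq> 0"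
      | "y' = - b" "det3 l a y \<noteq> 0" "det3 l b y \<noteq> 0" using A n(6) unfolding npar_def by auto
    then show ?thesis
    proof cases
      case 1 show ?thesis unfolding 1 ccw_def in_wedge_def det3_minus det3_same neg_less_0_iff_less neg_0_less_iff_less P N less_irrefl minus_zero minus_minus by satx
    next
      case 2 show ?thesis unfolding 2 ccw_def in_wedge_def det3_minus det3_same neg_less_0_iff_less neg_0_less_iff_less P N less_irrefl minus_zero minus_minus by satx
    next
      case 3 show ?thesis unfolding 3(1) ccw_def in_wedge_def det3_minus det3_same neg_less_0_iff_less neg_0_less_iff_less P N 3(2-)[THEN det3_neg_iff] less_irrefl minus_zero minus_minus by satx
    next
      case 4 show ?thesis unfolding 4(1) ccw_def in_wedge_def det3_minus det3_same neg_less_0_iff_less neg_0_less_iff_less P N 4(2-)[THEN det3_neg_iff] less_irrefl minus_zero minus_minus by satx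
    next
      case 5 show ?thesis unfolding 5(1) ccw_def in_wedge_def det3_minus det3_same neg_less_0_iff_less neg_0_less_iff_less P N 5(2-)[THEN det3_neg_iff] less_irrefl minus_zero minus_minus by satx
    next
      case 6 show ?thesis unfolding 6(1) ccw_def in_wedge_def det3_minus det3_same neg_less_0_iff_less neg_0_less_iff_less P N 6(2-)[THEN det3_neg_iff] less_irrefl minus_zero minus_minus by satx
    qed
  qed
qed

section \<open>Crossing parities and the two sides of a closed polygon\<close>

fun crossing_parity :: "real^3 \<Rightarrow> real^3 \<Rightarrow> (real^3) list \<Rightarrow> bool" where
  "crossing_parity x y (a # b # l) = (crosses x y a b \<noteq> crossing_parity x y (b # l))"
| "crossing_parity x y [a] = False"
| "crossing_parity x y [] = False"

lemma crossing_parity_sym: "crossing_parity x y ps = crossing_parity y x ps"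
  by (induction x y ps rule: crossing_parity.induct) (simp_all add: crosses_sym(1))

lemma crossing_parity_Cons: "ps \<noteq> [] \<Longrightarrow> crossing_parity x y (a # ps) = (crosses x y a (hd ps) \<noteq> crossing_parity x y ps)"
  by (cases ps) auto

lemma crossing_parity_snoc: "ps \<noteq> [] \<Longrightarrow> crossing_parity x y (ps @ [a]) = (crossing_parity x y ps \<noteq> crosses x y (last ps) a)"
  by (induction x y ps rule: crossing_parity.induct) auto

definition pairwise_npar :: "(real^3) set \<Rightarrow> bool" where
  "pairwise_npar S \<longleftrightarrow> (\<forall>a\<in>S. \<forall>b\<in>S. a \<noteq> b \<longrightarrow> npar a b)"

lemma pairwise_npar_subset: "pairwise_npar S \<Longrightarrow> T \<subseteq> S \<Longrightarrow> pairwise_npar T" unfolding pairwise_npar_def by blast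

text \<open>\<open>triangle_parity\<close> summed modulo 2 over the edges of the path; the
  contributions of inner vertices cancel.\<close>

lemma triangle_crossing_parity:
  assumes V: "general_position V" "x \<in> V" "y \<in> V" "z \<in> V" and n: "npar x y" "npar y z" "npar x z"
  shows "ps \<noteq> [] \<Longrightarrow> set ps \<subseteq> V \<Longrightarrow> distinct ps \<Longrightarrow> pairwise_npar (set ps) \<Longrightarrow> x \<notin> set ps \<Longrightarrow> y \<notin> set ps \<Longrightarrow> z \<notin> set ps \<Longrightarrow>
    (crossing_parity x y ps \<noteq> (crossing_parity y z ps \<noteq> crossing_parity z x ps)) = (in_triangle x y z (hd ps) \<noteq> in_triangle x y z (last ps))"
proof (induction ps rule: induct_list012)
  case (3 a b l)
  have IH: "(crossing_parity x y (b#l) \<noteq> (crossing_parity y z (b#l) \<noteq> crossing_parity z x (b#l))) = (in_triangle x y z (hd (b#l)) \<noteq> in_triangle x y z (last (b#l)))"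
  proof (rule 3)
    show "pairwise_npar (set (b # l))" using 3(6) by (rule pairwise_npar_subset) auto
  qed (use 3 in auto)
  have "npar a b" using 3(5,6) unfolding pairwise_npar_def by auto
  then have "(crosses x y a b \<noteq> (crosses y z a b \<noteq> crosses z x a b)) = (in_triangle x y z a \<noteq> in_triangle x y z b)"
    using 3 by (intro triangle_parity[OF V _ _ n]) auto
  with IH show ?case by auto
qed auto

text \<open>The side of the closed polygon \<open>K\<close> on which \<open>y\<close> lies, without the Jordan curve theorem: the parity of
  crossings of \<open>K\<close> with the arc from its first vertex to \<open>y\<close>, corrected by the position of that arc
  between the two edges at this vertex.\<close>

definition polygon_side :: "(real^3) list \<Rightarrow> real^3 \<Rightarrow> bool" where
  "polygon_side K y = (crossing_parity (hd K) y (tl K) \<noteq> ccw (hd K) (hd (tl K)) y (last K))"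

text \<open>The triangle \<open>p\<close>, \<open>y\<close>, \<open>q\<close> compares the crossings
  of \<open>ps\<close> with the arcs from \<open>p\<close> and from \<open>q\<close> to
  \<open>y\<close>, since its third side is not crossed by \<open>ps\<close>. The edges at
  \<open>p\<close> and \<open>q\<close> are settled by \<open>triangle_parity_vertex\<close> and
  translated into cyclic order.\<close>

lemma polygon_side_rot:
  assumes V: "general_position V" "set (p # q # ps) \<subseteq> V" "pairwise_npar (set (p # q # ps))" "distinct (p # q # ps)" "ps \<noteq> []"
    and y: "y \<in> V" "y \<notin> set (p # q # ps)" "y \<noteq> - p" "y \<noteq> - q" and s: "\<not> crossing_parity p q ps"
  shows "polygon_side (p # q # ps) y = polygon_side (q # ps @ [p]) y"
proof -
  let ?h = "hd ps" and ?t = "last ps"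
  have ht: "?h \<in> set ps" "?t \<in> set ps" using V(5) by auto
  have n: "npar p q" "npar p ?h" "npar p ?t" "npar q ?h" "npar q ?t" 
    using V(3,4) ht unfolding pairwise_npar_def by auto
  have ny: "npar p y" "npar y q" using y unfolding npar_def by auto
  have f1: "(crossing_parity p y ps \<noteq> (crossing_parity y q ps \<noteq> crossing_parity q p ps)) = (in_triangle p y q ?h \<noteq> in_triangle p y q ?t)"
    using V y n ny by (intro triangle_crossing_parity[OF V(1)]) (auto intro: pairwise_npar_subset)
  have f2: "(crosses p y q ?h \<noteq> in_triangle q p y ?h) = in_wedge q p y ?h"
    using V y n ny ht by (intro triangle_parity_vertex[OF V(1)]) (auto simp: npar_sym)
  have f3: "(crosses q y p ?t \<noteq> in_triangle p q y ?t) = in_wedge p q y ?t"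
    using V y n ny ht by (intro triangle_parity_vertex[OF V(1)]) (auto simp: npar_sym)
  have f4: "ccw p q y ?t = ((det3 p q y > 0) \<noteq> in_wedge p q y ?t)"
  proof (intro ccw_in_wedge)
    show "det3 p q y \<noteq> 0" "det3 p q ?t \<noteq> 0" using V y n ny ht by (simp_all add: general_positionD[OF V(1)] npar_sym subset_iff)
    have "?t = - y \<or> npar y ?t" using y(2) ht unfolding npar_def by auto
    then show "?t = - y \<or> det3 p y ?t \<noteq> 0" using V y n ny ht by (auto simp: general_positionD[OF V(1)] npar_sym subset_iff)
  qed
  have f5: "ccw q p y ?h = ((det3 q p y > 0) \<noteq> in_wedge q p y ?h) \<and> ccw q p ?h y = (\<not> ccw q p y ?h)"
  proof (intro conjI ccw_in_wedge)
    show *: "det3 q p y \<noteq> 0" "det3 q p ?h \<noteq> 0" using V y n ny ht by (simp_all add: general_positionD[OF V(1)] npar_sym subset_iff)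
    show "det3 q p y \<noteq> 0" "det3 q p ?h \<noteq> 0" by fact+
    have "?h = - y \<or> npar y ?h" using y(2) ht unfolding npar_def by auto
    then show "?h = - y \<or> det3 q y ?h \<noteq> 0" "?h = - y \<or> det3 q y ?h \<noteq> 0" using V y n ny ht by (auto simp: general_positionD[OF V(1)] npar_sym subset_iff)
  qed
  have f6: "(det3 q p y > 0) = (\<not> det3 p q y > 0)"
    using general_positionD[OF V(1), of p q y] V(2) y(1) n(1) ny det3_swap[of p q y] by (auto simp: npar_sym)
  have f7: "in_triangle q p y ?h = in_triangle p y q ?h" "in_triangle p q y ?t = in_triangle p y q ?t"
    by (metis in_triangle_rot in_triangle_flip)+
  have f8: "ccw q ?h y p = ccw q p ?h y" by (rule ccw_rot)
  have g1: "polygon_side (p # q # ps) y = ((crosses p y q ?h \<noteq> crossing_parity p y ps) \<noteq> ccw p q y ?t)"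
    using V(5) by (simp add: polygon_side_def crossing_parity_Cons)
  have g2: "polygon_side (q # ps @ [p]) y = ((crossing_parity y q ps \<noteq> crosses q y p ?t) \<noteq> ccw q ?h y p)"
    using V(5) by (simp add: polygon_side_def crossing_parity_snoc crossing_parity_sym[of q] crosses_sym(1)[of y q] crosses_sym(2)[of q y "last ps"])
  have g3: "\<not> crossing_parity q p ps" using s by (simp add: crossing_parity_sym)
  show ?thesis using f1 f2 f3 f4 f5 f6 g3 unfolding g1 g2 f7 f8 by satx
qed

text \<open>In the triangle \<open>p\<close>, \<open>y\<close>, \<open>y'\<close> the two arcs from
  the base point \<open>p\<close> are traded for the third side. The two edges at \<open>p\<close>
  are accounted for by \<open>in_wedge_ccw\<close>.\<close>

lemma polygon_side_diff:
  assumes V: "general_position V" "set (p # ps) \<subseteq> V" "pairwise_npar (set (p # ps))" "distinct (p # ps)" "length ps \<ge> 2"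
    and y: "y \<in> V" "y \<notin> set (p # ps)" "y \<noteq> - p" "y' \<in> V" "y' \<notin> set (p # ps)" "y' \<noteq> - p" "npar y y'"
  shows "(polygon_side (p # ps) y \<noteq> polygon_side (p # ps) y') = crossing_parity y y' (p # ps @ [p])"
proof -
  let ?h = "hd ps" and ?t = "last ps"
  have ps: "ps \<noteq> []" using V(5) by auto
  have ht: "?h \<in> set ps" "?t \<in> set ps" "?h \<noteq> ?t" using V(4,5) ps
    apply auto by (cases ps; auto split: if_splits)
  have n: "npar p ?h" "npar p ?t" "npar ?h ?t"
    using V(3,4) ht unfolding pairwise_npar_def by auto
  have ny: "npar p y" "npar p y'" using y unfolding npar_def by auto
  have f1: "(crossing_parity p y ps \<noteq> (crossing_parity y y' ps \<noteq> crossing_parity y' p ps)) = (in_triangle p y y' ?h \<noteq> in_triangle p y y' ?t)"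
    using V y n ny ps by (intro triangle_crossing_parity[OF V(1)]) (auto intro: pairwise_npar_subset)
  have f2: "(crosses y y' p ?h \<noteq> in_triangle p y y' ?h) = in_wedge p y y' ?h"
    using V y n ny ht by (intro triangle_parity_vertex[OF V(1)]) (auto simp: npar_sym)
  have f3: "(crosses y y' p ?t \<noteq> in_triangle p y y' ?t) = in_wedge p y y' ?t"
    using V y n ny ht by (intro triangle_parity_vertex[OF V(1)]) (auto simp: npar_sym)
  have f4: "(in_wedge p y y' ?h \<noteq> in_wedge p y y' ?t) = (ccw p ?h y ?t \<noteq> ccw p ?h y' ?t)"
    using V y n ny ht by (intro in_wedge_ccw[OF V(1)]) auto
  have f5: "crossing_parity y y' (p # ps @ [p]) = (crosses y y' p ?h \<noteq> (crossing_parity y y' ps \<noteq> crosses y y' p ?t))"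
    using ps by (simp add: crossing_parity_Cons crossing_parity_snoc crosses_sym(2)[of y y' "last ps"])
  have g1: "polygon_side (p # ps) y = (crossing_parity p y ps \<noteq> ccw p ?h y ?t)" "polygon_side (p # ps) y' = (crossing_parity y' p ps \<noteq> ccw p ?h y' ?t)"
    using ps by (simp_all add: polygon_side_def crossing_parity_sym[of y' p])
  show ?thesis using f1 f2 f3 f4 unfolding f5 g1 by satx
qed

section \<open>Polygonal paths and turning signs\<close>

definition adj :: "'a list \<Rightarrow> ('a \<times> 'a) set" where "adj ps = set (zip ps (tl ps))"

lemma adj_simps [simp]: "adj [] = {}" "adj [a] = {}" "adj (a # b # l) = insert (a, b) (adj (b # l))"
  unfolding adj_def by auto

lemma adj_Cons: "l \<noteq> [] \<Longrightarrow> adj (a # l) = insert (a, hd l) (adj l)"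
  by (cases l) auto

lemma adj_append: "xs \<noteq> [] \<Longrightarrow> ys \<noteq> [] \<Longrightarrow> adj (xs @ ys) = adj xs \<union> {(last xs, hd ys)} \<union> adj ys"
  by (induction xs rule: induct_list012) (auto simp: adj_Cons)

lemma adj_mid: "adj (xs @ a # ys) = adj (xs @ [a]) \<union> adj (a # ys)"
  by (cases "xs = []"; cases "ys = []") (auto simp: adj_append adj_Cons)

lemma adj_set: "(c, d) \<in> adj l \<Longrightarrow> c \<in> set l \<and> d \<in> set l"
  by (induction l rule: induct_list012) auto

lemma adj_neq: "distinct l \<Longrightarrow> (c, d) \<in> adj l \<Longrightarrow> c \<noteq> d"
  by (induction l rule: induct_list012) (auto dest: adj_set)

lemma adj_map: "adj (map f l) = (\<lambda>(a, b). (f a, f b)) ` adj l"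
  by (induction l rule: induct_list012) auto

lemma adj_rev: "adj (rev l) = (\<lambda>(a, b). (b, a)) ` adj l"
proof (induction l rule: induct_list012)
  case (3 x y zs)
  have "adj (rev (x # y # zs)) = adj (rev (y # zs)) \<union> {(y, x)}"
    using adj_append[of "rev (y # zs)" "[x]"] by (simp add: last_rev)
  then show ?case using 3 by auto
qed auto

lemma crossing_parity_free: "(\<And>c d. (c, d) \<in> adj ps \<Longrightarrow> \<not> crosses x y c d) \<Longrightarrow> \<not> crossing_parity x y ps"
  by (induction x y ps rule: crossing_parity.induct) auto

definition generic :: "(real^3) set \<Rightarrow> (real^3) list \<Rightarrow> bool" where
  "generic V K \<longleftrightarrow> general_position V \<and> set K \<subseteq> V \<and> pairwise_npar (set K) \<and> distinct K"

lemma genericD: assumes "generic V K" shows "general_position V" "x \<in> set K \<Longrightarrow> x \<in> V" "distinct K" "pairwise_npar (set K)"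
    "x \<in> set K \<Longrightarrow> y \<in> set K \<Longrightarrow> x \<noteq> y \<Longrightarrow> npar x y" 
  using assms unfolding generic_def pairwise_npar_def by auto

lemma generic_neg: assumes "generic V K" "x \<in> set K" "y \<in> set K" "x \<noteq> y" shows "x \<noteq> - y" "y \<noteq> - x" "- x \<noteq> y"
  using genericD(5)[OF assms] unfolding npar_def by (metis minus_minus)+

lemma generic_det: "generic V K \<Longrightarrow> a \<in> set K \<Longrightarrow> b \<in> set K \<Longrightarrow> c \<in> set K \<Longrightarrow> a \<noteq> b \<Longrightarrow> b \<noteq> c \<Longrightarrow> a \<noteq> c \<Longrightarrow> det3 a b c \<noteq> 0"
  by (intro general_positionD[of V]) (auto dest: genericD)

lemma generic_subset: "generic V K \<Longrightarrow> set L \<subseteq> set K \<Longrightarrow> distinct L \<Longrightarrow> generic V L"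
  unfolding generic_def using pairwise_npar_subset by blast

lemma polygon_side_const:
  assumes K: "generic V (p # ps)" "length ps \<ge> 2"
    and free: "\<And>c d e f. (c, d) \<in> adj zs \<Longrightarrow> (e, f) \<in> adj (p # ps @ [p]) \<Longrightarrow> \<not> crosses c d e f"
    and zs: "set zs \<subseteq> V" "set zs \<inter> set (p # ps) = {}" "- p \<notin> set zs" "pairwise_npar (set zs)" "distinct zs"
    and y: "y \<in> set zs" "y' \<in> set zs"
  shows "polygon_side (p # ps) y = polygon_side (p # ps) y'"
proof -
  have "\<forall>y\<in>set zs. polygon_side (p # ps) y = polygon_side (p # ps) (hd zs)"
    using free zs
  proof (induction zs rule: induct_list012)
    case (3 a b l)
    have IH: "\<forall>y\<in>set (b # l). polygon_side (p # ps) y = polygon_side (p # ps) (hd (b # l))"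
    proof (rule 3(2))
      show "pairwise_npar (set (b # l))" using 3(7) by (rule pairwise_npar_subset) auto
    qed (use 3 in auto)
    have "npar a b" using 3(7,8) unfolding pairwise_npar_def by auto
    then have "(polygon_side (p # ps) a \<noteq> polygon_side (p # ps) b) = crossing_parity a b (p # ps @ [p])"
      using 3 K by (intro polygon_side_diff) (auto simp: generic_def)
    moreover have "\<not> crossing_parity a b (p # ps @ [p])" using 3(3) by (intro crossing_parity_free) auto
    ultimately have e: "polygon_side (p # ps) a = polygon_side (p # ps) b" by blast
    show ?case
    proof
      fix y assume "y \<in> set (a # b # l)"
      then consider "y = a" | "y \<in> set (b # l)" by auto
      then show "polygon_side (p # ps) y = polygon_side (p # ps) (hd (a # b # l))"
      proof cases
        case 2
        then have "polygon_side (p # ps) y = polygon_side (p # ps) (hd (b # l))" using IH by blast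
        then show ?thesis using e by simp
      qed simp
    qed
  qed simp_all
  then show ?thesis using y by blast
qed

text \<open>\<open>R\<close> does not meet the closed polygon formed by \<open>P\<close> and the
  chord from \<open>l\<close> to \<open>p\<close>, so it lies on one side. Reading this side at
  \<open>l\<close> on the edge to \<open>hd R\<close>, and at \<open>p\<close> on the arc to
  \<open>last R\<close>, relates the cyclic orders at both ends of the chord. \<open>R\<close> may
  be a truncated arc: by \<open>h3\<close> the arc from \<open>p\<close> to \<open>last R\<close>
  only has to avoid \<open>P @ [l]\<close>.\<close>

lemma chord_side:
  assumes K: "generic V (p # P @ l # R)" "P \<noteq> []" "R \<noteq> []"
    and h1: "\<And>c d e f. (c, d) \<in> adj (p # P @ [l]) \<Longrightarrow> (e, f) \<in> adj (l # R) \<Longrightarrow> \<not> crosses c d e f"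
    and h2: "\<And>e f. (e, f) \<in> adj R \<Longrightarrow> \<not> crosses p l e f"
    and h3: "\<And>c d. (c, d) \<in> adj (P @ [l]) \<Longrightarrow> \<not> crosses p (last R) c d"
    and h4: "\<And>c d. (c, d) \<in> adj P \<Longrightarrow> \<not> crosses p l c d"
  shows "ccw l p (hd R) (last P) = ccw p (hd P) (last R) l"
proof -
  have VV: "set (p # P @ l # R) \<subseteq> V" and dd: "distinct (p # P @ l # R)" using K(1) unfolding generic_def by auto
  have R: "hd R \<in> set R" "last R \<in> set R" using K(3) by auto
  have okK: "generic V (l # p # P)" using K(1) by (rule generic_subset) (use dd in auto)
  have len: "length (p # P) \<ge> 2" using K(2) by (cases P) auto
  have rot: "polygon_side (l # p # P) y = polygon_side (p # P @ [l]) y" if "y \<in> set R" for y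
  proof (rule polygon_side_rot[of V])
    show "\<not> crossing_parity l p P" using h4 by (intro crossing_parity_free) (auto simp: crosses_sym(1)[of l])
    have "npar l y" "npar p y" using genericD(5)[OF K(1), of l y] genericD(5)[OF K(1), of p y] that dd by auto
    then show "y \<noteq> - l" "y \<noteq> - p" unfolding npar_def by auto
    show "distinct (l # p # P)" using dd by auto
    show "y \<notin> set (l # p # P)" "y \<in> V" using VV dd that by auto
  qed (use okK K(2) in \<open>auto simp: generic_def\<close>)
  have const: "polygon_side (l # p # P) (hd R) = polygon_side (l # p # P) (last R)"
  proof (rule polygon_side_const[OF okK len, of R])
    fix c d e f assume a: "(c, d) \<in> adj R" "(e, f) \<in> adj (l # (p # P) @ [l])"
    have "adj (l # R) = insert (l, hd R) (adj R)" by (rule adj_Cons[OF K(3)])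
    then have "(c, d) \<in> adj (l # R)" using a by auto
    moreover have "(e, f) = (l, p) \<or> (e, f) \<in> adj (p # P @ [l])" using a(2) by auto
    ultimately show "\<not> crosses c d e f" using h1[of e f c d] h2[of c d] a(1) crosses_sym(3)[of c d e f] crosses_sym(1)[of l p] crosses_sym(2)[of c d l p] by auto
  next
    show "- l \<notin> set R"
    proof
      assume a: "- l \<in> set R"
      have "l \<notin> set R" using dd by auto
      then have "l \<noteq> - l" using a by metis
      with a have "npar l (- l)" by (intro genericD(5)[OF K(1)]) auto
      then show False unfolding npar_def by auto
    qed
    show "pairwise_npar (set R)" using genericD(4)[OF K(1)] by (rule pairwise_npar_subset) auto
  qed (use R VV dd in auto)
  have "\<not> crossing_parity l (hd R) (p # P)"
  proof (rule crossing_parity_free)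
    fix c d assume "(c, d) \<in> adj (p # P)"
    then have "(c, d) \<in> adj (p # P @ [l])" using K(2) adj_append[of "p # P" "[l]"] by auto
    then show "\<not> crosses l (hd R) c d" using h1[of c d l "hd R"] crosses_sym(3)[of c d l "hd R"] K(3) by (cases R) auto
  qed
  then have 1: "polygon_side (l # p # P) (hd R) = ccw l p (hd R) (last P)" using K(2) by (simp add: polygon_side_def)
  have "\<not> crossing_parity p (last R) (P @ [l])" using h3 by (rule crossing_parity_free)
  then have 2: "polygon_side (p # P @ [l]) (last R) = ccw p (hd P) (last R) l" using K(2) by (simp add: polygon_side_def)
  show ?thesis using 1 2 rot[OF R(2)] const by simp
qed

text \<open>Both neighbours of \<open>l\<close> are seen on the same side of the chord, so the
  cyclic order inherited from \<open>p\<close> decides the turn at \<open>l\<close>.\<close>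

lemma chord_extreme:
  assumes K: "generic V (p # P @ l # R)" "P \<noteq> []" "R \<noteq> []"
    and c: "ccw l p (hd R) (last P) = ccw p (hd P) (last R) l"
    and d: "det3 p l (last P) < 0" "det3 p l (hd R) < 0" "\<not> ccw p (hd P) (last R) l" 
  shows "det3 (last P) l (hd R) < 0"
proof -
  have "hd R \<in> set R" "last P \<in> set P" using K by auto
  then have "det3 (last P) l (hd R) \<noteq> 0" using genericD(3)[OF K(1)] by (intro generic_det[OF K(1)]) auto
  moreover have "\<not> ccw l p (hd R) (last P)" using c d by simp
  moreover have "det3 l p (hd R) > 0" using d det3_swap[of p l "hd R"] by linarith
  ultimately show ?thesis unfolding ccw_def using det3_rot[of l "hd R" "last P"] by auto
qed

section \<open>Turning signs and cyclic sign changes\<close>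

fun turn_signs :: "(real^3) list \<Rightarrow> bool list" where
  "turn_signs (a # b # c # l) = (det3 a b c > 0) # turn_signs (b # c # l)"
| "turn_signs [a, b] = []" | "turn_signs [a] = []" | "turn_signs [] = []"

lemma turn_signs_append: "U \<noteq> [] \<Longrightarrow> W \<noteq> [] \<Longrightarrow> turn_signs (U @ a # W) = turn_signs (U @ [a]) @ (det3 (last U) a (hd W) > 0) # turn_signs (a # W)"
proof (induction U rule: induct_list012)
  case (2 x) then show ?case by (cases W) auto
next
  case (3 x y zs) then show ?case by (cases zs) auto
qed auto

definition cyclic_signs :: "(real^3) list \<Rightarrow> bool list" where "cyclic_signs Q = turn_signs (last Q # Q @ [hd Q])"

lemma cyclic_signs_split: assumes "as \<noteq> []" "bs \<noteq> []"
  shows "cyclic_signs (k # as @ l # bs) = (det3 (last bs) k (hd as) > 0) # turn_signs (k # as @ [l]) @ (det3 (last as) l (hd bs) > 0) # turn_signs (l # bs @ [k])"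
  using turn_signs_append[of "[last bs]" "as @ l # bs @ [k]" k] turn_signs_append[of "k # as" "bs @ [k]" l] assms by (simp add: cyclic_signs_def)

lemma cyclic_signs_close: assumes "as \<noteq> []"
  shows "cyclic_signs (k # as @ [l]) = (det3 l k (hd as) > 0) # turn_signs (k # as @ [l]) @ [det3 (last as) l k > 0]"
  using turn_signs_append[of "[l]" "as @ l # [k]" k] turn_signs_append[of "k # as" "[k]" l] assms by (simp add: cyclic_signs_def)

text \<open>A Boolean sign identifies zero with negative, so reversal negates the entries only if no
  determinant vanishes.\<close>

lemma turn_signs_rev: "turn_signs (rev l) = rev (map Not (turn_signs l))" if "\<And>U x y z W. l = U @ x # y # z # W \<Longrightarrow> det3 x y z \<noteq> 0"
  using that
proof (induction l rule: turn_signs.induct)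
  case (1 a b c l)
  have IH: "turn_signs (rev (b # c # l)) = rev (map Not (turn_signs (b # c # l)))"
    using 1(2) by (intro 1(1)) (metis append_Cons)
  have "det3 a b c \<noteq> 0" using 1(2)[of "[]"] by auto
  then have d: "(det3 c b a > 0) = (\<not> det3 a b c > 0)" using det3_swap'(2)[of a b c] by auto
  show ?case
  proof (cases l)
    case Nil then show ?thesis using d by simp
  next
    case (Cons e l')
    have "turn_signs (rev l @ c # [b, a]) = turn_signs (rev l @ [c]) @ (det3 (last (rev l)) c b > 0) # turn_signs [c, b, a]"
      using turn_signs_append[of "rev l" "[b, a]" c] Cons by simp
    moreover have "turn_signs (rev l @ c # [b]) = turn_signs (rev l @ [c]) @ (det3 (last (rev l)) c b > 0) # turn_signs [c, b]"
      using turn_signs_append[of "rev l" "[b]" c] Cons by simp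
    ultimately show ?thesis using IH d by simp
  qed
qed auto

lemma turn_signs_uminus: "turn_signs (map uminus l) = map Not (turn_signs l)" if "\<And>U x y z W. l = U @ x # y # z # W \<Longrightarrow> det3 x y z \<noteq> 0"
  using that
proof (induction l rule: turn_signs.induct)
  case (1 a b c l)
  have "turn_signs (map uminus (b # c # l)) = map Not (turn_signs (b # c # l))" using 1(2) by (intro 1(1)) (metis append_Cons)
  moreover have "det3 a b c \<noteq> 0" using 1(2)[of "[]"] by auto
  ultimately show ?case by auto
qed auto

fun changes :: "bool list \<Rightarrow> nat" where
  "changes (a # b # l) = (if a = b then 0 else 1) + changes (b # l)" | "changes [a] = 0" | "changes [] = 0"

definition cyclic_changes :: "bool list \<Rightarrow> nat" where "cyclic_changes l = changes (l @ [hd l])"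

lemma changes_Cons_le: "changes l \<le> changes (a # l)" by (cases l) auto

lemma changes_drop2: "changes (a # l) \<le> changes (a # b # l)" by (cases l) auto

text \<open>Deleting entries cannot create sign changes. The second conjunct, which keeps a common
  first entry, is the strengthening that the induction needs.\<close>

lemma changes_subseq: "subseq xs ys \<Longrightarrow> changes xs \<le> changes ys \<and> (xs \<noteq> [] \<longrightarrow> (\<forall>c. changes (c # xs) \<le> changes (c # ys)))"
proof (induction rule: list_emb.induct)
  case (list_emb_Nil ys) then show ?case by auto
next
  case (list_emb_Cons xs ys y)
  then show ?case using changes_Cons_le[of ys y] changes_drop2[of _ ys y] by (meson order_trans)
next
  case (list_emb_Cons2 x y xs ys)
  have "changes (x # xs) \<le> changes (x # ys)" using list_emb_Cons2 by (cases "xs = []") auto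
  then show ?case using list_emb_Cons2 by auto
qed

lemma cyclic_changes_subseq: assumes "subseq xs ys" "hd xs = hd ys" shows "cyclic_changes xs \<le> cyclic_changes ys"
  unfolding cyclic_changes_def using changes_subseq[of "xs @ [hd xs]" "ys @ [hd ys]"] assms by auto

lemma changes_append: "xs \<noteq> [] \<Longrightarrow> ys \<noteq> [] \<Longrightarrow> changes (xs @ ys) = changes xs + (if last xs = hd ys then 0 else 1) + changes ys"
proof (induction xs rule: induct_list012)
  case (2 x) then show ?case by (cases ys) auto
qed auto

lemma cyclic_changes_rotate: "cyclic_changes (xs @ ys) = cyclic_changes (ys @ xs)"
  unfolding cyclic_changes_def by (cases "xs = []"; cases "ys = []") (auto simp: changes_append)

lemma changes_map_Not: "changes (map Not l) = changes l"
  by (induction l rule: changes.induct) auto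

lemma changes_rev: "changes (rev l) = changes l"
proof (induction l rule: changes.induct)
  case (1 a b l)
  have "changes (rev (b # l) @ [a]) = changes (rev (b # l)) + (if b = a then 0 else 1)"
    by (subst changes_append) (auto simp: last_rev)
  then show ?case using 1 by simp
qed auto

lemma cyclic_changes_map_Not: "l \<noteq> [] \<Longrightarrow> cyclic_changes (map Not l) = cyclic_changes l"
  unfolding cyclic_changes_def using changes_map_Not[of "l @ [hd l]"] by (simp add: hd_map)

lemma det3_diff: "det3 (a - a') b c = det3 a b c - det3 a' b c" "det3 a (b - b') c = det3 a b c - det3 a b' c"
  "det3 a b (c - c') = det3 a b c - det3 a b c'"
  by (simp_all add: det3_expand algebra_simps)

lemma linear_det3: "linear (\<lambda>x. det3 a b x)" "linear (\<lambda>x. det3 a x b)" "linear (\<lambda>x. det3 x a b)"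
  by (auto intro!: linearI simp: det3_lin)

text \<open>One nonzero determinant suffices: applied to the positive relation, the determinant
  functionals force the signs of the other three.\<close>

lemma crossesI:
  assumes "0 < p" "0 < q" "0 < r" "0 < s" and e: "p *\<^sub>R a + q *\<^sub>R b = r *\<^sub>R c + s *\<^sub>R d" and n: "det3 a b c \<noteq> 0"
  shows "crosses a b c d"
proof -
  have 1: "r * det3 a b c + s * det3 a b d = 0" using arg_cong[OF e, of "det3 a b"] by (simp add: det3_lin)
  have 2: "p * det3 b a d = r * det3 b c d" using arg_cong[OF e, of "\<lambda>x. det3 b x d"] by (simp add: det3_lin)
  have 3: "p * det3 a c d + q * det3 b c d = 0" using arg_cong[OF e, of "\<lambda>x. det3 x c d"] by (simp add: det3_lin)
  have 4: "det3 b a d = - det3 a b d" by (rule det3_swap)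
  have pm: "(y > 0 \<longrightarrow> w < 0) \<and> (y < 0 \<longrightarrow> w > 0)" if h: "x > 0" "x * y + z * w = 0" "z > 0" for x y z w :: real
  proof (intro conjI impI)
    assume "y > 0"
    then have "x * y > 0" using h by simp
    then have "z * w < 0" using h by linarith
    then show "w < 0" using h by (simp add: mult_less_0_iff)
  next
    assume "y < 0"
    then have "x * y < 0" using h by (simp add: mult_less_0_iff)
    then have "z * w > 0" using h by linarith
    then show "w > 0" using h by (simp add: zero_less_mult_iff)
  qed
  have 5: "r * det3 b c d + p * det3 a b d = 0" using 2 4 by simp
  have 6: "q * det3 b c d + p * det3 a c d = 0" using 3 by simp
  have 7: "p * det3 a b d + r * det3 b c d = 0" using 5 by simp
  show ?thesis
  proof (cases "det3 a b c > 0")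
    case True
    then have "det3 a b d < 0" using pm[OF assms(3) 1 assms(4)] by blast
    then have "det3 b c d > 0" using pm[OF assms(1) 7 assms(3)] by blast
    then have "det3 a c d < 0" using pm[OF assms(2) 6 assms(1)] by blast
    then show ?thesis using True \<open>det3 a b d < 0\<close> \<open>det3 b c d > 0\<close> unfolding crosses_def by blast
  next
    case False
    then have F: "det3 a b c < 0" using n by linarith
    then have "det3 a b d > 0" using pm[OF assms(3) 1 assms(4)] by blast
    then have "det3 b c d < 0" using pm[OF assms(1) 7 assms(3)] by blast
    then have "det3 a c d > 0" using pm[OF assms(2) 6 assms(1)] by blast
    then show ?thesis using F \<open>det3 a b d > 0\<close> \<open>det3 b c d < 0\<close> unfolding crosses_def by blast
  qed
qed

lemma crossesE:
  assumes "crosses a b c d"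
  obtains p q r s where "0 < p" "0 < q" "0 < r" "0 < s" "p *\<^sub>R a + q *\<^sub>R b = r *\<^sub>R c + s *\<^sub>R d"
proof -
  note c = cramer[of b c d a]
  have "\<exists>p q r s. 0 < p \<and> 0 < q \<and> 0 < r \<and> 0 < s \<and> p *\<^sub>R a + q *\<^sub>R b = r *\<^sub>R c + s *\<^sub>R d"
    using assms unfolding crosses_def
  proof
    assume a: "det3 b c d > 0 \<and> det3 a c d < 0 \<and> det3 a b d < 0 \<and> det3 a b c > 0"
    have "det3 b c d *\<^sub>R a + (- det3 a c d) *\<^sub>R b = (- det3 a b d) *\<^sub>R c + det3 a b c *\<^sub>R d" using c by (simp add: algebra_simps)
    then show ?thesis using a by (metis neg_0_less_iff_less)
  next
    assume a: "det3 b c d < 0 \<and> det3 a c d > 0 \<and> det3 a b d > 0 \<and> det3 a b c < 0"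
    have "(- det3 b c d) *\<^sub>R a + det3 a c d *\<^sub>R b = det3 a b d *\<^sub>R c + (- det3 a b c) *\<^sub>R d" using c by (simp add: algebra_simps)
    then show ?thesis using a by (metis neg_0_less_iff_less)
  qed
  then show ?thesis using that by blast
qed

lemma crosses_sep:
  fixes f :: "real^3 \<Rightarrow> real"
  assumes "linear f" "f a \<le> 0" "f b \<le> 0" "0 \<le> f c" "0 \<le> f d" "f a < 0 \<or> f b < 0 \<or> 0 < f c \<or> 0 < f d"
  shows "\<not> crosses a b c d"
proof
  assume "crosses a b c d"
  then obtain p q r s where p: "0 < p" "0 < q" "0 < r" "0 < s" and e: "p *\<^sub>R a + q *\<^sub>R b = r *\<^sub>R c + s *\<^sub>R d" by (rule crossesE)
  have 1: "p * f a + q * f b = r * f c + s * f d" using arg_cong[OF e, of f] assms(1) by (simp add: linear_add linear_scale)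
  have "p * f a \<le> 0" "q * f b \<le> 0" "0 \<le> r * f c" "0 \<le> s * f d" using p assms by (auto simp: mult_le_0_iff)
  then have "p * f a = 0" "q * f b = 0" "r * f c = 0" "s * f d = 0" using 1 by linarith+
  then show False using p assms(6) by auto
qed

lemma crosses_sep':
  assumes "det3 a b c < 0 \<and> det3 a b d < 0 \<or> det3 a b c > 0 \<and> det3 a b d > 0"
  shows "\<not> crosses a b c d"
  using assms unfolding crosses_def by auto

section \<open>Arcs that are forced to have a negative turn\<close>

text \<open>Points on one side of a great circle through \<open>u\<close> are linearly ordered by
  angle at \<open>u\<close>, transitivity being a Grassmann relation; \<open>c\<close> is the last
  one counterclockwise.\<close>

lemma extreme_exists:
  assumes "finite X" "X \<noteq> {}" "\<And>x. x \<in> X \<Longrightarrow> det3 u p x > 0" "\<And>x y. x \<in> X \<Longrightarrow> y \<in> X \<Longrightarrow> x \<noteq> y \<Longrightarrow> det3 u x y \<noteq> 0"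
  shows "\<exists>c\<in>X. \<forall>x\<in>X. x \<noteq> c \<longrightarrow> det3 u c x < 0"
  using assms
proof (induction X rule: finite_ne_induct)
  case (insert y X)
  then obtain c where c: "c \<in> X" "\<forall>x\<in>X. x \<noteq> c \<longrightarrow> det3 u c x < 0" by (metis insertCI)
  show ?case
  proof (cases "det3 u c y < 0")
    case True then show ?thesis using c by blast
  next
    case False
    then have cy: "det3 u c y > 0" using insert(6)[of c y] c insert(3) by force
    have "det3 u y x < 0" if x: "x \<in> X" for x
    proof -
      have g: "det3 u p c * det3 u y x - det3 u p y * det3 u c x + det3 u p x * det3 u c y = 0" by (rule grassmann)
      have "det3 u c x \<le> 0" using c x by (cases "x = c") force+
      moreover have "det3 u p y > 0" "det3 u p x > 0" "det3 u p c > 0" using insert(5) x c by auto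
      ultimately have "det3 u p y * det3 u c x \<le> 0" "det3 u p x * det3 u c y > 0" using cy by (auto simp: mult_le_0_iff)
      then have "det3 u p c * det3 u y x < 0" using g by linarith
      then show ?thesis using \<open>det3 u p c > 0\<close> by (simp add: mult_less_0_iff)
    qed
    then show ?thesis by blast
  qed
qed auto

lemma turn_signs_memI: "U \<noteq> [] \<Longrightarrow> W \<noteq> [] \<Longrightarrow> (det3 (last U) a (hd W) > 0) \<in> set (turn_signs (U @ a # W))"
  by (simp add: turn_signs_append)

text \<open>Among the inner vertices let \<open>c\<close> be the one at the largest angle from
  \<open>b\<close>, as seen from \<open>a\<close>. All other vertices lie to the right of the chord
  from \<open>a\<close> to \<open>c\<close>, and \<open>chord_side\<close> carries the cyclic order
  at \<open>a\<close> over to \<open>c\<close>, which makes the turn at \<open>c\<close>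
  negative.\<close>

lemma reflex_on_hull_edge:
  assumes K: "generic V (a # X @ [b])" "X \<noteq> []" and h: "\<And>x. x \<in> set X \<Longrightarrow> det3 a b x > 0"
    and s: "\<And>c d e f. (c, d) \<in> adj (a # X @ [b]) \<Longrightarrow> (e, f) \<in> adj (a # X @ [b]) \<Longrightarrow> \<not> crosses c d e f"
  shows "False \<in> set (turn_signs (a # X @ [b]))"
proof -
  have dd: "distinct (a # X @ [b])" using genericD(3)[OF K(1)] .
  have "\<exists>c\<in>set X. \<forall>x\<in>set X. x \<noteq> c \<longrightarrow> det3 a c x < 0"
  proof (rule extreme_exists)
    fix x y assume "x \<in> set X" "y \<in> set X" "x \<noteq> y"
    then show "det3 a x y \<noteq> 0" using dd by (intro generic_det[OF K(1)]) auto
  qed (use K h in auto)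
  then obtain c where c: "c \<in> set X" "\<And>x. x \<in> set X \<Longrightarrow> x \<noteq> c \<Longrightarrow> det3 a c x < 0" by blast
  obtain X1 X2 where X: "X = X1 @ c # X2" using c(1) by (meson split_list)
  have cb: "det3 a c b < 0" using h[OF c(1)] det3_swap'(1)[of a b c] by linarith
  let ?R = "X2 @ [b]"
  have inR: "det3 a c x < 0" if "x \<in> set X1 \<union> set ?R" for x using that c(2)[of x] cb dd X by auto
  have whole: "a # X @ [b] = (a # X1) @ c # ?R" using X by simp
  have hdR: "hd ?R \<in> set ?R" by (cases X2) auto
  show ?thesis
  proof (cases "X1 = []")
    case True
    have "(det3 (last [a]) c (hd ?R) > 0) \<in> set (turn_signs ([a] @ c # ?R))" by (rule turn_signs_memI) auto
    then show ?thesis using inR[of "hd ?R"] hdR whole True by (auto simp del: hd_append2)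
  next
    case False
    have sub: "adj (a # X1 @ [c]) \<subseteq> adj (a # X @ [b])" "adj (c # ?R) \<subseteq> adj (a # X @ [b])" 
      unfolding whole using adj_mid[of "a # X1" c ?R] by auto
    have sub2: "adj ?R \<subseteq> adj (c # ?R)" "adj (X1 @ [c]) \<subseteq> adj (a # X1 @ [c])" using adj_Cons[of ?R c] adj_Cons[of "X1 @ [c]" a] by auto
    have side: "ccw c a (hd ?R) (last X1) = ccw a (hd X1) (last ?R) c"
    proof (rule chord_side[of V])
      show "generic V (a # X1 @ c # ?R)" using K whole by simp
      fix e f assume "(e, f) \<in> adj ?R" 
      then have "e \<in> set ?R" "f \<in> set ?R" using adj_set by fast+
      then show "\<not> crosses a c e f" using inR by (intro crosses_sep') blast
    next
      fix e f assume "(e, f) \<in> adj (X1 @ [c])" 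
      then have "e \<in> set X" "f \<in> set X" using adj_set[of e f "X1 @ [c]"] X by auto
      then show "\<not> crosses a (last ?R) e f" using h by (intro crosses_sep') simp
    next
      fix e f assume "(e, f) \<in> adj X1" 
      then have "e \<in> set X1" "f \<in> set X1" using adj_set by fast+
      then show "\<not> crosses a c e f" using inR by (intro crosses_sep') blast
    next
      fix e f e' f' assume "(e, f) \<in> adj (a # X1 @ [c])" "(e', f') \<in> adj (c # ?R)"
      then show "\<not> crosses e f e' f'" using s[of e f e' f'] sub by (simp add: subset_iff)
    qed (use False in simp_all)
    have "det3 (last X1) c (hd ?R) < 0"
    proof (rule chord_extreme[OF _ _ _ side])
      show "generic V (a # X1 @ c # ?R)" using K whole by simp
      show "det3 a c (last X1) < 0" "det3 a c (hd ?R) < 0" using inR hdR False by auto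
      have "hd X1 \<in> set X1" using False by auto
      then have 1: "det3 a b (hd X1) > 0" "det3 a c (hd X1) < 0" using h inR X by auto
      have "det3 a (hd X1) b < 0" using 1 det3_swap'(1)[of a b "hd X1"] by linarith
      then show "\<not> ccw a (hd X1) (last ?R) c" using 1 unfolding ccw_def by auto
    qed (use False in auto)
    moreover have "(det3 (last (a # X1)) c (hd ?R) > 0) \<in> set (turn_signs ((a # X1) @ c # ?R))" by (rule turn_signs_memI) auto
    ultimately show ?thesis using whole False by auto
  qed
qed

text \<open>The arc ends to the right of the great circle from \<open>u\<close> to
  \<open>p = hd P\<close>. Unless the turn at \<open>p\<close> is negative already, it first runs on
  the left, and the edge on which it returns to the right passes this circle beyond
  \<open>p\<close>. The vertex of the left part that is extreme as seen from \<open>u\<close> is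
  then a negative turn, as in \<open>reflex_on_hull_edge\<close>.\<close>

lemma reflex_from_apex:
  fixes v :: "real^3 \<Rightarrow> real"
  assumes K: "generic V (u # P @ [a])" "P \<noteq> []" and v: "linear v" "v u < 0" "v (hd P) > 0" "\<And>x. x \<in> set P \<Longrightarrow> v x > 0" "v a > 0"
    and h: "det3 u (hd P) a < 0"
    and s: "\<And>c d e f. (c, d) \<in> adj (u # P @ [a]) \<Longrightarrow> (e, f) \<in> adj (u # P @ [a]) \<Longrightarrow> \<not> crosses c d e f"
    and s': "\<And>c d. (c, d) \<in> adj (P @ [a]) \<Longrightarrow> \<not> crosses u (hd P) (- c) (- d)"
  shows "False \<in> set (turn_signs (u # P @ [a]))"
proof -
  obtain p X' where P: "P = p # X'" using K(2) by (cases P) auto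
  have dd: "distinct (u # p # X' @ [a])" using genericD(3)[OF K(1)] P by simp
  have okK: "generic V (u # p # X' @ [a])" using K(1) P by simp
  define p2 where "p2 = hd (X' @ [a])"
  have p2: "X' @ [a] = p2 # tl (X' @ [a])" unfolding p2_def by (cases X') auto
  have p2s: "p2 \<in> set (X' @ [a])" using p2 by (metis list.set_intros(1))
  show ?thesis
  proof (cases "det3 u p p2 < 0")
    case True
    have "u # P @ [a] = u # p # p2 # tl (X' @ [a])" using P p2 by simp
    then show ?thesis using True by auto
  next
    case False
    have "\<exists>x\<in>set (X' @ [a]). det3 u p x < 0" using h P by auto
    then obtain X y Y where XY: "X' @ [a] = X @ y # Y" "det3 u p y < 0" "\<forall>x\<in>set X. \<not> det3 u p x < 0"
      by (rule split_list_first_propE)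
    have Xne: "X \<noteq> []" using XY False p2 by (metis append_Nil list.inject)
    have pos: "det3 u p x > 0" if x: "x \<in> set X" for x
    proof -
      have "x \<in> set (X' @ [a])" using x XY(1) by simp
      then have "det3 u p x \<noteq> 0" using dd by (intro generic_det[OF okK]) auto
      then show ?thesis using XY(3) x by force
    qed
    have dd2: "distinct (u # p # X @ y # Y)" using dd XY(1) by simp
    have okK2: "generic V (u # p # X @ y # Y)" using okK XY(1) by simp
    have "\<exists>c\<in>set X. \<forall>x\<in>set X. x \<noteq> c \<longrightarrow> det3 u c x < 0"
    proof (rule extreme_exists)
      fix x y assume "x \<in> set X" "y \<in> set X" "x \<noteq> y"
      then show "det3 u x y \<noteq> 0" using dd2 by (intro generic_det[OF okK2]) auto
    qed (use Xne pos in auto)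
    then obtain c where c: "c \<in> set X" "\<And>x. x \<in> set X \<Longrightarrow> x \<noteq> c \<Longrightarrow> det3 u c x < 0" by blast
    obtain X1 X2 where X: "X = X1 @ c # X2" using c(1) by (meson split_list)
    have cp: "det3 u c p < 0" using pos[OF c(1)] det3_swap'(1)[of u p c] by linarith
    let ?P = "p # X1" and ?R = "X2 @ [y]" and ?k = "last X"
    have k: "?k \<in> set X" using Xne by auto
    have inX: "det3 u c x < 0" if "x \<in> set ?P \<union> set X2" for x using that c(2)[of x] cp dd2 X by auto
    have whole: "u # P @ [a] = (u # ?P) @ c # ?R @ Y" using X P XY(1) by simp
    have whole2: "u # P @ [a] = (u # p # butlast X) @ ?k # y # Y" using P XY(1) Xne by simp
    have edge: "(?k, y) \<in> adj (u # P @ [a])" "(?k, y) \<in> adj (P @ [a])"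
    proof -
      show "(?k, y) \<in> adj (u # P @ [a])" unfolding whole2 using adj_mid[of "u # p # butlast X" ?k "y # Y"] by simp
      have "P @ [a] = (p # butlast X) @ ?k # y # Y" using whole2 by simp
      then show "(?k, y) \<in> adj (P @ [a])" using adj_mid[of "p # butlast X" ?k "y # Y"] by simp
    qed
    have up: "(u, p) \<in> adj (u # P @ [a])" using P by simp
    \<comment> \<open>Coordinates of the point where the returning edge meets the great circle of
      \<open>u\<close> and \<open>p\<close>. It is beyond \<open>p\<close>: the edge crosses neither
      the edge from \<open>u\<close> to \<open>p\<close> nor its antipode, and
      \<open>xi > 0\<close>, \<open>eta < 0\<close> is excluded because \<open>v\<close> is positive
      along the edge.\<close>
    define xi eta where "xi = det3 p ?k y" and "eta = - det3 u ?k y"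
    have id: "(- det3 u p y) *\<^sub>R ?k + det3 u p ?k *\<^sub>R y = xi *\<^sub>R u + eta *\<^sub>R p"
      using cramer[of p ?k y u] unfolding xi_def eta_def by (simp add: algebra_simps)
    have pk: "det3 u p ?k > 0" using pos k by blast
    have vpos: "xi * v u + eta * v p > 0"
    proof -
      have y: "y \<in> set (P @ [a])" "?k \<in> set (P @ [a])" using XY(1) P k by (simp_all del: last_in_set)
      then have "v y > 0" "v ?k > 0" using v(4,5) by auto
      moreover have "(- det3 u p y) * v ?k + det3 u p ?k * v y = xi * v u + eta * v p"
        using arg_cong[OF id, of v] v(1) by (simp add: linear_add linear_scale linear_diff linear_neg)
      ultimately show ?thesis using XY(2) pk by (smt (verit) mult_pos_pos)
    qed
    have nz: "xi \<noteq> 0" "eta \<noteq> 0" unfolding xi_def eta_def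
    proof -
      have "?k \<noteq> y" "p \<noteq> ?k" "p \<noteq> y" "u \<noteq> ?k" "u \<noteq> y" using dd2 k by auto
      then show "det3 p ?k y \<noteq> 0" "- det3 u ?k y \<noteq> 0" using generic_det[OF okK2, of p ?k y] generic_det[OF okK2, of u ?k y] k by auto
    qed
    have "\<not> (xi > 0 \<and> eta > 0)"
    proof
      assume "xi > 0 \<and> eta > 0"
      then have "crosses u p ?k y" using crossesI[of xi eta "- det3 u p y" "det3 u p ?k" u p ?k y] id XY(2) pk by simp
      then show False using s[OF up edge(1)] by blast
    qed
    moreover have "\<not> (xi < 0 \<and> eta < 0)"
    proof
      assume a: "xi < 0 \<and> eta < 0"
      have "(- xi) *\<^sub>R u + (- eta) *\<^sub>R p = (- det3 u p y) *\<^sub>R (- ?k) + det3 u p ?k *\<^sub>R (- y)"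
        using arg_cong[OF id, of uminus] by simp
      then have "crosses u p (- ?k) (- y)" using crossesI[of "- xi" "- eta" "- det3 u p y" "det3 u p ?k" u p "- ?k" "- y"] a XY(2) pk by simp
      then show False using s'[OF edge(2)] P by simp
    qed
    moreover have "\<not> (xi > 0 \<and> eta < 0)"
    proof
      assume "xi > 0 \<and> eta < 0"
      then have "xi * v u < 0" "eta * v p < 0" using v P by (auto simp: mult_less_0_iff)
      then show False using vpos by linarith
    qed
    ultimately have eta: "eta > 0" using nz by argo
    \<comment> \<open>The meeting point, being beyond \<open>p\<close>, lies to the right of the
      circle from \<open>u\<close> to \<open>c\<close>. This gives the side of \<open>hd ?R\<close>
      when it is \<open>y\<close>, and keeps the returning edge off the chord from \<open>u\<close>
      to \<open>c\<close>.\<close>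
    have cid: "(- det3 u p y) * det3 u c ?k + det3 u p ?k * det3 u c y < 0"
    proof -
      have "(- det3 u p y) * det3 u c ?k + det3 u p ?k * det3 u c y = eta * det3 u c p"
        using arg_cong[OF id, of "det3 u c"] by (simp add: det3_lin det3_diff)
      then show ?thesis using eta cp by (simp add: mult_less_0_iff)
    qed
    have hdR: "det3 u c (hd ?R) < 0"
    proof (cases X2)
      case Nil
      then have "?k = c" using X by simp
      then show ?thesis using cid pk Nil by (simp add: mult_less_0_iff)
    next
      case (Cons x X3) then show ?thesis using inX[of x] by simp
    qed
    have sub: "adj (u # ?P @ [c]) \<subseteq> adj (u # P @ [a])" "adj (c # ?R) \<subseteq> adj (u # P @ [a])" 
    proof -
      have "adj (c # ?R @ Y) \<subseteq> adj (u # P @ [a])" "adj (u # ?P @ [c]) \<subseteq> adj (u # P @ [a])"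
         unfolding whole using adj_mid[of "u # ?P" c "?R @ Y"] by auto
      moreover have "adj (c # ?R) \<subseteq> adj (c # ?R @ Y)" using adj_mid[of "c # X2" y Y] by auto
      ultimately show "adj (u # ?P @ [c]) \<subseteq> adj (u # P @ [a])" "adj (c # ?R) \<subseteq> adj (u # P @ [a])" by auto
    qed
    have okc: "generic V (u # ?P @ c # ?R)" using okK2 by (rule generic_subset) (use dd2 X in auto)
    have side: "ccw c u (hd ?R) (last ?P) = ccw u (hd ?P) (last ?R) c"
    proof (rule chord_side[OF okc])
      fix e f assume ef: "(e, f) \<in> adj ?R" 
      show "\<not> crosses u c e f"
      proof (cases "X2 = []")
        case True then show ?thesis using ef by auto
      next
        case ne: False
        then have "adj ?R = adj X2 \<union> {(last X2, y)}" using adj_append[of X2 "[y]"] by auto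
        moreover have "last X2 = ?k" using X ne by simp
        ultimately consider "(e, f) \<in> adj X2" | "e = ?k" "f = y" using ef by auto
        then show ?thesis
        proof cases
          case 1 then have "e \<in> set X2" "f \<in> set X2" using adj_set by fast+
          then show ?thesis using inX by (intro crosses_sep') blast
        next
          case 2
          show ?thesis
          proof
            assume "crosses u c e f"
            then obtain p' q r t where p': "0 < p'" "0 < q" "0 < r" "0 < t" and e: "p' *\<^sub>R u + q *\<^sub>R c = r *\<^sub>R ?k + t *\<^sub>R y" 
              using 2 by (auto elim: crossesE)
            have 1: "0 = r * det3 u c ?k + t * det3 u c y" using arg_cong[OF e, of "det3 u c"] by (simp add: det3_lin)
            have 2: "q * det3 u p c = r * det3 u p ?k + t * det3 u p y" using arg_cong[OF e, of "det3 u p"] by (simp add: det3_lin)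
            have k0: "det3 u c ?k < 0" using inX[of ?k] \<open>last X2 = ?k\<close> ne by (metis UnCI last_in_set)
            have "t * ((- det3 u p y) * det3 u c ?k + det3 u p ?k * det3 u c y) < 0" using cid p' by (simp add: mult_less_0_iff)
            moreover have "t * ((- det3 u p y) * det3 u c ?k + det3 u p ?k * det3 u c y) = - det3 u c ?k * (r * det3 u p ?k + t * det3 u p y) + det3 u p ?k * (r * det3 u c ?k + t * det3 u c y)"
              by (simp add: algebra_simps)
            ultimately have "- det3 u c ?k * (q * det3 u p c) < 0" using 1 2 by simp
            moreover have "q * det3 u p c > 0" using p' pos c by simp
            ultimately show False using mult_neg_pos[OF k0, of "q * det3 u p c"] by simp
          qed
        qed
      qed
    next
      fix e f assume "(e, f) \<in> adj (?P @ [c])" 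
      then have "e = p \<or> e \<in> set X" "f = p \<or> f \<in> set X" "e \<noteq> f" using adj_set[of e f "?P @ [c]"] adj_neq[of "?P @ [c]" e f] dd2 X by auto
      then have "det3 u p e \<ge> 0" "det3 u p f \<ge> 0" using pos by fastforce+
      then show "\<not> crosses u (last ?R) e f" using XY(2) by (intro crosses_sep[of "det3 u p"] linear_det3) auto
    next
      fix e f assume "(e, f) \<in> adj ?P" 
      then have "e \<in> set ?P" "f \<in> set ?P" using adj_set by fast+
      then show "\<not> crosses u c e f" using inX by (intro crosses_sep') blast
    next
      fix e f e' f' assume "(e, f) \<in> adj (u # ?P @ [c])" "(e', f') \<in> adj (c # ?R)"
      then have "(e, f) \<in> adj (u # P @ [a])" "(e', f') \<in> adj (u # P @ [a])" using sub by blast+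
      then show "\<not> crosses e f e' f'" by (rule s)
    qed simp_all
    have "det3 (last ?P) c (hd ?R) < 0"
    proof (rule chord_extreme[OF okc _ _ side])
      have "last ?P \<in> set ?P" by simp
      then show "det3 u c (last ?P) < 0" using inX by blast
      show "\<not> ccw u (hd ?P) (last ?R) c" using XY(2) cp unfolding ccw_def by auto
    qed (use hdR in auto)
    moreover have "(det3 (last (u # ?P)) c (hd (?R @ Y)) > 0) \<in> set (turn_signs ((u # ?P) @ c # (?R @ Y)))" by (rule turn_signs_memI) auto
    moreover have "hd (?R @ Y) = hd ?R" by (cases X2) auto
    ultimately show ?thesis using whole by auto
  qed
qed

section \<open>Points not contained in a closed hemisphere\<close>

text \<open>For finite sets this says that the origin is an interior point of the convex
  hull.\<close>

definition balanced :: "(real^3) set \<Rightarrow> bool" where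
  "balanced S \<longleftrightarrow> \<not> (\<exists>v. v \<noteq> 0 \<and> (\<forall>x\<in>S. v \<bullet> x \<ge> 0))"

lemma linear_inner_rep:
  fixes f :: "real^3 \<Rightarrow> real"
  assumes "linear f" obtains v where "\<And>x. f x = v \<bullet> x"
proof
  fix x :: "real^3"
  have "f x = f (\<Sum>i\<in>UNIV. x $ i *\<^sub>R axis i 1)" by (simp add: basis_expansion scalar_mult_eq_scaleR[symmetric])
  also have "\<dots> = (\<Sum>i\<in>UNIV. x $ i * f (axis i 1))" using assms by (simp add: linear_sum linear_scale)
  also have "\<dots> = (\<chi> i. f (axis i 1)) \<bullet> x" by (simp add: inner_vec_def mult.commute)
  finally show "f x = (\<chi> i. f (axis i 1)) \<bullet> x" .
qed

lemma balanced_linear: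
  fixes f :: "real^3 \<Rightarrow> real"
  assumes "balanced S" "linear f" "f y \<noteq> 0" obtains x where "x \<in> S" "f x < 0"
proof -
  obtain v where v: "\<And>x. f x = v \<bullet> x" using linear_inner_rep[OF assms(2)] by blast
  have "v \<noteq> 0" using assms(3) v by auto
  then show ?thesis using assms(1) that unfolding balanced_def v by (meson not_le)
qed

lemma balanced_mono: "balanced S \<Longrightarrow> S \<subseteq> T \<Longrightarrow> balanced T"
  unfolding balanced_def by blast

lemma orthogonal_independent:
  assumes "det3 a b c \<noteq> 0" "v \<bullet> a = 0" "v \<bullet> b = 0" "v \<bullet> c = (0::real)" shows "v = 0"
proof -
  have "det3 a b c *\<^sub>R v = det3 b c v *\<^sub>R a - det3 a c v *\<^sub>R b + det3 a b v *\<^sub>R c" using cramer[of b c v a] by simp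
  then have "v \<bullet> (det3 a b c *\<^sub>R v) = 0" using assms by (simp add: inner_add_right inner_diff_right)
  then show ?thesis using assms by simp
qed

text \<open>General position leaves at most two vertices on the boundary of the hemisphere, so its
  functional can be tilted slightly to become positive on them as well.\<close>

lemma unbalanced_strict:
  assumes K: "generic V K" "length K \<ge> 3" and u: "\<not> balanced (set K)"
  obtains f :: "real^3 \<Rightarrow> real" where "linear f" "\<And>x. x \<in> set K \<Longrightarrow> f x > 0"
proof -
  obtain v where v: "v \<noteq> 0" "\<And>x. x \<in> set K \<Longrightarrow> v \<bullet> x \<ge> 0" using u unfolding balanced_def by blast
  define Z where "Z = {x \<in> set K. v \<bullet> x = 0}"
  have finZ: "finite Z" "Z \<subseteq> set K" unfolding Z_def by auto
  have nZ: "x = y \<or> y = z \<or> x = z" if "x \<in> Z" "y \<in> Z" "z \<in> Z" for x y z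
    using orthogonal_independent[OF generic_det[OF K(1)], of x y z v] that v(1) unfolding Z_def by auto
  have cK: "card (set K) \<ge> 3" using K genericD(3)[OF K(1)] by (simp add: distinct_card)
  have "\<exists>a b c. a \<in> set K \<and> b \<in> set K \<and> c \<in> set K \<and> a \<noteq> b \<and> b \<noteq> c \<and> a \<noteq> c \<and> Z \<subseteq> {a, b}"
  proof -
    have ex: "\<exists>x\<in>set K. x \<notin> A" if "finite A" "card A < 3" for A
      using that cK by (metis card_mono linorder_not_less order_trans subsetI)
    show ?thesis
    proof (cases "\<exists>a b. a \<in> Z \<and> b \<in> Z \<and> a \<noteq> b")
      case True
      then obtain a b where ab: "a \<in> Z" "b \<in> Z" "a \<noteq> b" by blast
      obtain c where c: "c \<in> set K" "c \<notin> {a, b}" using ex[of "{a, b}"] ab by auto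
      have "Z \<subseteq> {a, b}" using nZ ab by blast
      then show ?thesis using ab c finZ by blast
    next
      case False
      have "\<exists>a\<in>set K. Z \<subseteq> {a}"
      proof (cases "Z = {}")
        case True then show ?thesis using ex[of "{}"] by auto
      next
        case ne: False
        then obtain z where "z \<in> Z" by blast
        then show ?thesis using False finZ by blast
      qed
      then obtain a where a: "a \<in> set K" "Z \<subseteq> {a}" by blast
      obtain b where b: "b \<in> set K" "b \<notin> {a}" using ex[of "{a}"] by auto
      obtain c where c: "c \<in> set K" "c \<notin> {a, b}" using ex[of "{a, b}"] b by auto
      show ?thesis using a b c by blast
    qed
  qed
  then obtain a b c where abc: "a \<in> set K" "b \<in> set K" "c \<in> set K" "a \<noteq> b" "b \<noteq> c" "a \<noteq> c" "Z \<subseteq> {a, b}" by blast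
  \<comment> \<open>The square of \<open>det3 a b c\<close> times the sum of the coordinates along
    \<open>a\<close> and \<open>b\<close>, hence positive at both possible boundary points.\<close>
  define h where "h x = det3 a b c * (det3 x b c + det3 a x c)" for x
  have lh: "linear h" unfolding h_def by (auto intro!: linearI simp: det3_lin algebra_simps)
  have "det3 a b c \<noteq> 0" using generic_det[OF K(1)] abc by blast
  then have hp: "h x > 0" if "x \<in> Z" for x using that abc(7) unfolding h_def by (auto simp: zero_less_mult_iff linorder_neq_iff)
  have "\<forall>x\<in>set K. eventually (\<lambda>e. v \<bullet> x + e * h x > 0) (at_right (0::real))"
  proof
    fix x assume x: "x \<in> set K"
    show "eventually (\<lambda>e. v \<bullet> x + e * h x > 0) (at_right 0)"
    proof (cases "x \<in> Z")
      case True
      then have "v \<bullet> x = 0" "h x > 0" using hp unfolding Z_def by auto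
      then show ?thesis using eventually_at_right_less[of 0] by (auto elim!: eventually_mono)
    next
      case False
      then have p: "v \<bullet> x > 0" using v(2)[OF x] x unfolding Z_def by auto
      have "((\<lambda>e. v \<bullet> x + e * h x) \<longlongrightarrow> v \<bullet> x + 0 * h x) (at_right 0)" by (intro tendsto_intros)
      then show ?thesis using p by (intro order_tendstoD(1)[of _ "v \<bullet> x"]) auto
    qed
  qed
  then have "eventually (\<lambda>e. \<forall>x\<in>set K. v \<bullet> x + e * h x > 0) (at_right (0::real))" by (simp add: eventually_ball_finite)
  then obtain e where e: "\<forall>x\<in>set K. v \<bullet> x + e * h x > 0" using eventually_happens'[OF trivial_limit_at_right_real] by blast
  have "linear (\<lambda>x. v \<bullet> x + e * h x)" using lh by (auto intro!: linearI simp: linear_add linear_scale inner_add_right algebra_simps)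
  then show ?thesis using that e by blast
qed

lemma exists_max: "finite S \<Longrightarrow> S \<noteq> {} \<Longrightarrow> \<exists>m\<in>S. \<forall>x\<in>S. (f x :: real) \<le> f m"
proof (induction S rule: finite_ne_induct)
  case (insert x F)
  then obtain m where m: "m \<in> F" "\<forall>y\<in>F. f y \<le> f m" by blast
  show ?case
  proof (cases "f x \<le> f m")
    case True then show ?thesis using m by blast
  next
    case False then have "\<forall>y\<in>insert x F. f y \<le> f x" using m by force
    then show ?thesis by blast
  qed
qed auto

text \<open>In the affine chart \<open>v = 1\<close> take \<open>m\<close> farthest from the line
  through \<open>k\<close> and \<open>l\<close>, on the side of \<open>hd as\<close>. The parallel
  line through \<open>m\<close> is \<open>g = 0\<close>.\<close>

lemma hull_vertex:
  assumes K: "generic V (k # as @ [l])" "as \<noteq> []" and v: "linear v" "\<And>x. x \<in> set (k # as @ [l]) \<Longrightarrow> v x > (0::real)"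
  obtains m g where "m \<in> set as" "linear g" "g m = (0::real)" "\<And>x. x \<in> set (k # as @ [l]) \<Longrightarrow> g x \<ge> 0" "g k > 0" "g l > 0"
proof -
  define s where "s = sgn (det3 k l (hd as))"
  have dd: "distinct (k # as @ [l])" using genericD(3)[OF K(1)] .
  have hd: "hd as \<in> set as" using K(2) by simp
  have "det3 k l (hd as) \<noteq> 0" using dd hd by (intro generic_det[OF K(1)]) auto
  then have s0: "s * det3 k l (hd as) > 0" unfolding s_def by (simp add: sgn_if)
  obtain m where m: "m \<in> set as" "\<And>x. x \<in> set as \<Longrightarrow> s * det3 k l x / v x \<le> s * det3 k l m / v m"
    using exists_max[of "set as" "\<lambda>x. s * det3 k l x / v x"] K(2) by auto
  define M where "M = s * det3 k l m / v m"
  have "s * det3 k l (hd as) / v (hd as) > 0" using s0 v(2)[of "hd as"] hd by simp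
  then have M: "M > 0" using m(2)[OF hd] unfolding M_def by linarith
  define g where "g x = M * v x - s * det3 k l x" for x
  have "linear g" unfolding g_def using v(1) by (auto intro!: linearI simp: linear_add linear_scale det3_lin algebra_simps)
  moreover have "g m = 0" unfolding g_def M_def using v(2)[of m] m(1) by simp
  moreover have kl: "g k > 0" "g l > 0" unfolding g_def using M v(2)[of k] v(2)[of l] by auto
  moreover have "g x \<ge> 0" if "x \<in> set (k # as @ [l])" for x
  proof -
    have "g x \<ge> 0" if x: "x \<in> set as"
    proof -
      have "v x > 0" using v(2) x by auto
      moreover have "s * det3 k l x / v x \<le> M" using m(2)[OF x] unfolding M_def .
      ultimately show ?thesis unfolding g_def by (simp add: pos_divide_le_eq mult.commute)
    qed
    then show ?thesis using that kl by auto
  qed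
  ultimately show ?thesis using that m(1) by blast
qed

text \<open>In the triangle \<open>x o' y\<close> with barycentric coordinates \<open>A\<close>, \<open>B\<close>, \<open>C\<close>, a point minimizing \<open>(A + C) / B\<close> is joined
  to \<open>o'\<close> by an arc that no edge can cross without crossing one of the two sides at \<open>o'\<close>; \<open>H\<close> vanishes on the
  level set of this ratio.\<close>

lemma nearest_point_separates:
  assumes V: "general_position V" "x \<in> V" "o' \<in> V" "y \<in> V" "c \<in> V" "d \<in> V" and n: "npar x o'" "npar o' y" "npar x y" "npar c d" "npar c o'" "npar d o'"
    and D: "D = det3 x o' y" and A: "\<And>w. A w = det3 w o' y / D" and B: "\<And>w. B w = det3 x w y / D" and C: "\<And>w. C w = det3 x o' w / D"
    and H: "\<And>w. H w = A w + C w - t * B w" and t: "t > 0"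
    and w0: "w0 = p *\<^sub>R c + q *\<^sub>R d" "p \<ge> 0" "q > 0" "A w0 > 0" "C w0 > 0" "H w0 \<le> 0"
    and c: "H c < 0" "\<not> in_triangle x o' y c"
  shows "crosses x o' c d \<or> crosses o' y c d"
proof -
  have D0: "D \<noteq> 0" unfolding D using V n by (intro general_positionD[OF V(1)])
  have lin: "A (w0 + s *\<^sub>R c) = A w0 + s * A c" "B (w0 + s *\<^sub>R c) = B w0 + s * B c" "C (w0 + s *\<^sub>R c) = C w0 + s * C c" for s
    unfolding A B C by (simp_all add: det3_lin add_divide_distrib)
  have rep: "w = A w *\<^sub>R x + B w *\<^sub>R o' + C w *\<^sub>R y" for w
  proof -
    have "D *\<^sub>R w = D *\<^sub>R (A w *\<^sub>R x + B w *\<^sub>R o' + C w *\<^sub>R y)"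
      using cramer[of o' y w x] D0 D det3_perms[where x=o' and y=y and z=w] det3_perms[where x=x and y=y and z=w]
      unfolding A B C by (simp add: scaleR_add_right algebra_simps)
    then show ?thesis using D0 scaleR_cancel_left by blast
  qed
  have Hs: "H (w0 + s *\<^sub>R c) < 0" if "s > 0" for s
  proof -
    have "H (w0 + s *\<^sub>R c) = H w0 + s * H c" unfolding H lin by (simp add: algebra_simps)
    then show ?thesis using that w0(6) c(1) by (smt (verit) mult_pos_neg)
  qed
  have Hxy: "H x = 1" "H y = 1" "H (-x) = -1" "A y = 0" "C x = 0" "C (-x) = 0" "A (-y) = 0" "A (-x) = -1" "C (-y) = - 1"
    unfolding H A B C using D0 D by auto
  have Bpos: "B w > 0" if "H w < 0" "A w \<ge> 0" "C w \<ge> 0" "A w > 0 \<or> C w > 0" for w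
    using that t unfolding H by (smt (verit) mult_nonneg_nonpos)
  have in_iff: "in_triangle x o' y c" if "A c > 0" "B c > 0" "C c > 0"
    using that D0 unfolding in_triangle_def A B C D by (auto simp: zero_less_divide_iff)
  have A0: "c = y \<or> c = - y" if "A c = 0"
    using that D0 general_positionD[OF V(1) V(5,3,4)] n unfolding A npar_def by auto
  have C0: "c = x \<or> c = - x" if "C c = 0"
    using that D0 general_positionD[OF V(1) V(2,3,5)] n npar_sym[of c o'] unfolding C npar_def by (metis divide_eq_0_iff minus_minus)
  have neg: "A c < 0 \<or> C c < 0"
  proof (rule ccontr)
    assume a: "\<not> (A c < 0 \<or> C c < 0)"
    have "A c \<noteq> 0"
    proof
      assume "A c = 0" then have "c = y \<or> c = - y" by (rule A0)
      then show False using a c(1) Hxy by auto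
    qed
    moreover have "C c \<noteq> 0"
    proof
      assume "C c = 0" then have "c = x \<or> c = - x" by (rule C0)
      then show False using a c(1) Hxy by auto
    qed
    ultimately have "A c > 0" "C c > 0" using a by linarith+
    then show False using in_iff Bpos[OF c(1)] c(2) by auto
  qed
  have cA: "crosses o' y c d" if s: "s > 0" "A (w0 + s *\<^sub>R c) = 0" "C (w0 + s *\<^sub>R c) > 0" "A c < 0" for s
  proof (rule crossesI[where p="B (w0 + s *\<^sub>R c)" and q="C (w0 + s *\<^sub>R c)" and r="p + s" and s=q])
    let ?w = "w0 + s *\<^sub>R c"
    show "B ?w > 0" using Bpos[OF Hs[OF s(1)]] s by auto
    show "C ?w > 0" by fact
    show "p + s > 0" "q > 0" using s w0 by auto
    show "B ?w *\<^sub>R o' + C ?w *\<^sub>R y = (p + s) *\<^sub>R c + q *\<^sub>R d" using rep[of ?w] s(2) w0(1) by (simp add: algebra_simps)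
    have "det3 c o' y \<noteq> 0" using s(4) unfolding A by auto
    then show "det3 o' y c \<noteq> 0" using det3_rot[of o' y c] by simp
  qed
  have cC: "crosses x o' c d" if s: "s > 0" "C (w0 + s *\<^sub>R c) = 0" "A (w0 + s *\<^sub>R c) > 0" "C c < 0" for s
  proof (rule crossesI[where p="A (w0 + s *\<^sub>R c)" and q="B (w0 + s *\<^sub>R c)" and r="p + s" and s=q])
    let ?w = "w0 + s *\<^sub>R c"
    show "B ?w > 0" using Bpos[OF Hs[OF s(1)]] s by auto
    show "A ?w > 0" by fact
    show "p + s > 0" "q > 0" using s w0 by auto
    show "A ?w *\<^sub>R x + B ?w *\<^sub>R o' = (p + s) *\<^sub>R c + q *\<^sub>R d" using rep[of ?w] s(2) w0(1) by (simp add: algebra_simps)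
    show "det3 x o' c \<noteq> 0" using s(4) unfolding C by auto
  qed
  \<comment> \<open>On the way from \<open>w0\<close> towards \<open>c\<close>, \<open>H\<close> is
    negative and hence \<open>B\<close> is positive as long as \<open>A\<close> and \<open>C\<close>
    are nonnegative. \<open>A\<close> vanishes at \<open>s1\<close> and \<open>C\<close> at
    \<open>s2\<close>; the smaller parameter marks a crossing with a side at \<open>o'\<close>.
    Equality would put \<open>o'\<close> on the great circle of \<open>c\<close> and
    \<open>d\<close>, against general position.\<close>
  define s1 s2 where "s1 = A w0 / (- A c)" and "s2 = C w0 / (- C c)"
  have s1: "s1 > 0" "A (w0 + s1 *\<^sub>R c) = 0" if "A c < 0"
    using that w0(4) unfolding s1_def lin by (simp_all add: divide_pos_neg)
  have s2: "s2 > 0" "C (w0 + s2 *\<^sub>R c) = 0" if "C c < 0"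
    using that w0(5) unfolding s2_def lin by (simp_all add: divide_pos_neg)
  show ?thesis
  proof (cases "A c < 0 \<and> C c < 0")
    case True
    consider "s1 < s2" | "s2 < s1" | "s1 = s2" by linarith
    then show ?thesis
    proof cases
      case 1
      have "C (w0 + s1 *\<^sub>R c) - C (w0 + s2 *\<^sub>R c) = (s1 - s2) * C c" unfolding lin by (simp add: algebra_simps)
      then have "C (w0 + s1 *\<^sub>R c) > 0" using 1 True s2 by (simp add: mult_neg_neg)
      then show ?thesis using cA[OF s1] True by blast
    next
      case 2
      have "A (w0 + s2 *\<^sub>R c) - A (w0 + s1 *\<^sub>R c) = (s2 - s1) * A c" unfolding lin by (simp add: algebra_simps)
      then have "A (w0 + s2 *\<^sub>R c) > 0" using 2 True s1 by (simp add: mult_neg_neg)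
      then show ?thesis using cC[OF s2] True by blast
    next
      case 3
      then have "w0 + s1 *\<^sub>R c = B (w0 + s1 *\<^sub>R c) *\<^sub>R o'" using rep[of "w0 + s1 *\<^sub>R c"] s1 s2 True by simp
      then have e: "(p + s1) *\<^sub>R c + q *\<^sub>R d = B (w0 + s1 *\<^sub>R c) *\<^sub>R o'" using w0(1) by (simp add: algebra_simps)
      have "q * det3 c d o' = 0" using arg_cong[OF e, of "\<lambda>w. det3 c w o'"] by (simp add: det3_lin)
      then show ?thesis using general_positionD[OF V(1) V(5,6,3)] n w0(3) by simp
    qed
  next
    case False
    then consider "A c < 0" "C c \<ge> 0" | "C c < 0" "A c \<ge> 0" using neg by linarith
    then show ?thesis
    proof cases
      case 1
      then have "C (w0 + s1 *\<^sub>R c) > 0" using s1 w0 unfolding lin by (simp add: add_pos_nonneg)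
      then show ?thesis using cA[OF s1] 1 by blast
    next
      case 2
      then have "A (w0 + s2 *\<^sub>R c) > 0" using s2 w0 unfolding lin by (simp add: add_pos_nonneg)
      then show ?thesis using cC[OF s2] 2 by blast
    qed
  qed
qed

text \<open>\<open>z\<close> minimizes the ratio \<open>(A + C) / B\<close> over the points of
  \<open>S\<close> in the triangle, and \<open>h\<close> is \<open>H\<close> for the minimal ratio.
  The two closing conclusions apply \<open>nearest_point_separates\<close> to the point where an
  edge meets the arc to \<open>z\<close>, and to \<open>z\<close> itself.\<close>

lemma nearest_in_triangle:
  assumes V: "general_position V" "x \<in> V" "o' \<in> V" "y \<in> V" "S \<subseteq> V" "finite S" and n: "npar x o'" "npar o' y" "npar x y"
    and ex: "\<exists>z\<in>S. in_triangle x o' y z"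
  obtains z h where "z \<in> S" "in_triangle x o' y z" "linear h" "h z = (0::real)" "h o' < 0"
    "\<And>c d. c \<in> S \<Longrightarrow> d \<in> S \<Longrightarrow> npar c d \<Longrightarrow> npar c o' \<Longrightarrow> npar d o' \<Longrightarrow> \<not> crosses x o' c d \<Longrightarrow> \<not> crosses o' y c d \<Longrightarrow> \<not> crosses o' z c d"
    "\<And>w. w \<in> S \<Longrightarrow> npar z w \<Longrightarrow> npar w o' \<Longrightarrow> \<not> crosses x o' z w \<Longrightarrow> \<not> crosses o' y z w \<Longrightarrow> h w \<ge> 0"
proof -
  define D where "D = det3 x o' y"
  define A B C where "A w = det3 w o' y / D" and "B w = det3 x w y / D" and "C w = det3 x o' w / D" for w
  have D0: "D \<noteq> 0" unfolding D_def using V n by (intro general_positionD[OF V(1)])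
  have in_iff: "in_triangle x o' y c \<longleftrightarrow> A c > 0 \<and> B c > 0 \<and> C c > 0" for c
    using D0 unfolding in_triangle_def A_def B_def C_def D_def by (auto simp: zero_less_divide_iff)
  let ?T = "{z \<in> S. in_triangle x o' y z}"
  obtain z where z: "z \<in> S" "in_triangle x o' y z" "\<And>c. c \<in> ?T \<Longrightarrow> - ((A c + C c) / B c) \<le> - ((A z + C z) / B z)"
    using exists_max[of ?T "\<lambda>c. - ((A c + C c) / B c)"] ex V(6) by auto
  define t where "t = (A z + C z) / B z"
  have zp: "A z > 0" "B z > 0" "C z > 0" using z(2) in_iff by auto
  have t: "t > 0" unfolding t_def using zp by simp
  define h where "h w = A w + C w - t * B w" for w
  have lh: "linear h" unfolding h_def A_def B_def C_def by (auto intro!: linearI simp: det3_lin add_divide_distrib algebra_simps)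
  have hz: "h z = 0" unfolding h_def t_def using zp by simp
  have ho: "h o' = - t" unfolding h_def A_def B_def C_def using D0 D_def by simp
  have out: "\<not> in_triangle x o' y c" if "c \<in> S" "h c < 0" for c
  proof
    assume a: "in_triangle x o' y c"
    then have "(A c + C c) / B c \<ge> t" using z(3)[of c] that(1) unfolding t_def by auto
    moreover have "B c > 0" using a in_iff by auto
    ultimately show False using that(2) unfolding h_def by (simp add: pos_le_divide_eq mult.commute)
  qed
  note core = nearest_point_separates[OF V(1-4) _ _ n _ _ _ D_def A_def B_def C_def h_def t]
  have 2: "\<not> crosses o' z c d" if cd: "c \<in> S" "d \<in> S" "npar c d" "npar c o'" "npar d o'" "\<not> crosses x o' c d" "\<not> crosses o' y c d" for c d
  proof
    assume "crosses o' z c d"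
    then obtain p q r s where p: "0 < p" "0 < q" "0 < r" "0 < s" and e: "p *\<^sub>R o' + q *\<^sub>R z = r *\<^sub>R c + s *\<^sub>R d" by (rule crossesE)
    have lA: "linear A" "linear C" unfolding A_def C_def by (auto intro!: linearI simp: det3_lin add_divide_distrib)
    let ?w = "p *\<^sub>R o' + q *\<^sub>R z"
    have "A o' = 0" "C o' = 0" unfolding A_def C_def by simp_all
    then have w: "A ?w > 0" "C ?w > 0" "h ?w < 0" using lA lh zp p hz ho t by (simp_all add: linear_add linear_scale)
    have "r * h c + s * h d < 0" using w(3) lh unfolding e by (simp add: linear_add linear_scale)
    then have "h c < 0 \<or> h d < 0" using p by (smt (verit) mult_nonneg_nonneg)
    then show False
    proof
      assume h: "h c < 0"
      show False using core[of c d ?w r s] out[OF cd(1) h] cd V(5) w p e h by auto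
    next
      assume h: "h d < 0"
      have "crosses x o' d c \<or> crosses o' y d c" using core[of d c ?w s r] out[OF cd(2) h] cd V(5) w p e h npar_sym[of c d] by (auto simp: add.commute)
      then show False using cd crosses_sym(2) by blast
    qed
  qed
  have 3: "h w \<ge> 0" if w: "w \<in> S" "npar z w" "npar w o'" "\<not> crosses x o' z w" "\<not> crosses o' y z w" for w
  proof (rule ccontr)
    assume "\<not> h w \<ge> 0"
    then have h: "h w < 0" by simp
    have nz: "npar z o'"
    proof -
      have "z \<noteq> o'" "z \<noteq> - o'" using zp unfolding A_def by auto
      then show ?thesis unfolding npar_def by simp
    qed
    have "crosses x o' w z \<or> crosses o' y w z" using core[of w z z 0 1] out[OF w(1) h] w z V(5) zp hz h npar_sym[of w z] nz by auto
    then show False using w crosses_sym(2) by blast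
  qed
  show ?thesis using that[of z h] z lh hz ho t 2 3 by auto
qed

section \<open>Polygons without crossings\<close>

definition edges :: "(real^3) list \<Rightarrow> ((real^3) \<times> (real^3)) set" where "edges Q = adj (Q @ [hd Q])"

text \<open>\<open>simple\<close> is embeddedness on the sphere, \<open>simple_pm\<close> embeddedness in the projective plane.\<close>

definition simple :: "(real^3) list \<Rightarrow> bool" where
  "simple Q \<longleftrightarrow> (\<forall>(a, b)\<in>edges Q. \<forall>(c, d)\<in>edges Q. \<not> crosses a b c d)"

definition simple_pm :: "(real^3) list \<Rightarrow> bool" where
  "simple_pm Q \<longleftrightarrow> simple Q \<and> (\<forall>(a, b)\<in>edges Q. \<forall>(c, d)\<in>edges Q. \<not> crosses a b (- c) (- d))"

lemma simpleD: "simple Q \<Longrightarrow> (a, b) \<in> edges Q \<Longrightarrow> (c, d) \<in> edges Q \<Longrightarrow> \<not> crosses a b c d"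
  "simple_pm Q \<Longrightarrow> (a, b) \<in> edges Q \<Longrightarrow> (c, d) \<in> edges Q \<Longrightarrow> \<not> crosses a b c d"
  "simple_pm Q \<Longrightarrow> (a, b) \<in> edges Q \<Longrightarrow> (c, d) \<in> edges Q \<Longrightarrow> \<not> crosses a b (- c) (- d)"
  unfolding simple_pm_def simple_def by blast+

lemma path_const: "(\<And>c d. (c, d) \<in> adj l \<Longrightarrow> f c = f d) \<Longrightarrow> x \<in> set l \<Longrightarrow> f x = f (hd l)"
proof (induction l arbitrary: x rule: induct_list012)
  case (3 a b l)
  have IH: "f y = f (hd (b # l))" if "y \<in> set (b # l)" for y using 3(2)[OF _ that] 3(3) by simp
  have "f a = f b" using 3(3)[of a b] by simp
  then show ?case using 3(4) IH[of x] by (cases "x = a") auto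
qed auto

lemma edges_uminus: "Q \<noteq> [] \<Longrightarrow> edges (map uminus Q) = (\<lambda>(a, b). (- a, - b)) ` edges Q"
  unfolding edges_def using adj_map[of uminus "Q @ [hd Q]"] by (simp add: hd_map)

lemma simple_pm_uminus: "Q \<noteq> [] \<Longrightarrow> simple_pm Q \<Longrightarrow> simple_pm (map uminus Q)"
  unfolding simple_pm_def simple_def edges_uminus
  by (auto split: prod.splits)

lemma generic_uminus:
  assumes "generic V Q" "\<And>x. x \<in> V \<Longrightarrow> - x \<in> V" shows "generic V (map uminus Q)"
  using assms unfolding generic_def pairwise_npar_def by (auto simp: distinct_map inj_on_def)

lemma balanced_uminus: "balanced S \<Longrightarrow> balanced (uminus ` S)"
  unfolding balanced_def by (metis image_eqI inner_minus_left inner_minus_right minus_equation_iff neg_equal_0_iff_equal)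

lemma cyclic_signs_uminus:
  assumes "generic V Q" "length Q \<ge> 3" shows "cyclic_signs (map uminus Q) = map Not (cyclic_signs Q)"
proof -
  have dd: "distinct Q" using genericD(3)[OF assms(1)] .
  have "det3 x y z \<noteq> 0" if e: "last Q # Q @ [hd Q] = U @ x # y # z # W" for U x y z W
  proof -
    have n: "x \<noteq> y \<and> y \<noteq> z \<and> x \<noteq> z \<and> x \<in> set Q \<and> y \<in> set Q \<and> z \<in> set Q"
    proof (cases U)
      case Nil
      then have "x = last Q" "Q @ [hd Q] = y # z # W" using e by auto
      moreover obtain q1 q2 q3 R where "Q = q1 # q2 # q3 # R" using assms(2) by (metis Suc_le_length_iff numeral_3_eq_3)
      ultimately show ?thesis using dd by auto
    next
      case (Cons u U')
      then have e': "Q @ [hd Q] = U' @ x # y # z # W" using e by simp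
      show ?thesis
      proof (cases W rule: rev_cases)
        case Nil
        then have "z = hd Q" "Q = U' @ [x, y]" using e' by (auto simp: append_eq_append_conv2 append_eq_Cons_conv Cons_eq_append_conv)
        moreover then obtain q U'' where "U' = q # U''" using assms(2) by (cases U') auto
        ultimately show ?thesis using dd by auto
      next
        case (snoc W' w)
        then have "Q = U' @ x # y # z # W'" using e' by auto
        then show ?thesis using dd by auto
      qed
    qed
    then show ?thesis by (intro generic_det[OF assms(1)]) auto
  qed
  then have "turn_signs (map uminus (last Q # Q @ [hd Q])) = map Not (turn_signs (last Q # Q @ [hd Q]))" by (rule turn_signs_uminus)
  moreover have "Q \<noteq> []" using assms(2) by auto
  ultimately show ?thesis unfolding cyclic_signs_def by (simp add: hd_map last_map)
qed

text \<open>The three \<open>True\<close> entries and one \<open>False\<close> from each block form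
  an alternating subsequence of length six, whose cyclic closure has six changes.\<close>

lemma cyclic_changes_six: assumes "False \<in> set X" "False \<in> set Y" "False \<in> set Z"
  shows "6 \<le> cyclic_changes (True # X @ True # Y @ True # Z)"
proof -
  have s: "subseq [False] X" "subseq [False] Y" "subseq [False] Z" using assms by (simp_all add: subseq_singleton_left)
  have "subseq (True # [False] @ True # [False] @ True # [False]) (True # X @ True # Y @ True # Z)"
    by (intro subseq_Cons2 list_emb_append_mono s)
  then have "cyclic_changes [True, False, True, False, True, False] \<le> cyclic_changes (True # X @ True # Y @ True # Z)"
    by (intro cyclic_changes_subseq) auto
  moreover have "cyclic_changes [True, False, True, False, True, False] = 6" by (simp add: cyclic_changes_def)
  ultimately show ?thesis by linarith
qed

section \<open>A vertex whose removal leaves the polygon in an open hemisphere\<close>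

text \<open>In the chart \<open>v = 1\<close> balance places \<open>- u\<close> inside the convex
  hull of the other vertices. The ray from \<open>p\<close> through \<open>- u\<close> leaves this
  hull through an edge, and \<open>a\<close>, \<open>b\<close> are its ends.\<close>

lemma supporting_edge:
  fixes v :: "real^3 \<Rightarrow> real"
  assumes K: "generic V (u # p # ps)" "ps \<noteq> []" and bal: "balanced (set (u # p # ps))"
    and v: "linear v" "v u < 0" "\<And>x. x \<in> set (p # ps) \<Longrightarrow> v x > 0"
  obtains a b where "a \<in> set ps" "b \<in> set ps" "det3 u p a < 0" "det3 u p b > 0" "det3 u a b < 0"
    "\<And>x. x \<in> set (p # ps) \<Longrightarrow> x \<noteq> a \<Longrightarrow> x \<noteq> b \<Longrightarrow> det3 a b x > 0"
proof -
  have dd: "distinct (u # p # ps)" using genericD(3)[OF K(1)] .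
  define F where "F = det3 u p"
  have lF: "linear F" unfolding F_def by (rule linear_det3)
  define w where "w = last ps"
  have w: "w \<in> set ps" using K(2) w_def by simp
  have F0: "F x \<noteq> 0" if "x \<in> set ps" for x unfolding F_def using that dd by (intro generic_det[OF K(1)]) auto
  \<comment> \<open>On the great circle of \<open>u\<close> and \<open>p\<close> the quotient
    \<open>ka / v\<close> is a coordinate of the chart: negative at \<open>p\<close>, zero at
    \<open>- u\<close>, and increasing along the ray.\<close>
  define ka where "ka x = - det3 u x w / F w" for x
  have lk: "linear ka" unfolding ka_def by (auto intro!: linearI simp: det3_lin add_divide_distrib)
  have ku: "ka u = 0" "ka p = -1" "F u = 0" "F p = 0" unfolding ka_def using F0[OF w] unfolding F_def by auto
  obtain a0 where a0: "a0 \<in> set (u # p # ps)" "- F a0 < 0" using balanced_linear[OF bal linear_compose_neg[OF lF], of w] F0[OF w] by auto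
  obtain b0 where b0: "b0 \<in> set (u # p # ps)" "F b0 < 0" using balanced_linear[OF bal lF, of w] F0[OF w] by auto
  define T where "T = {(a, b). a \<in> set ps \<and> b \<in> set ps \<and> F a > 0 \<and> F b < 0}"
  have "T \<subseteq> set ps \<times> set ps" unfolding T_def by auto
  then have fT: "finite T" by (rule finite_subset) auto
  have neT: "T \<noteq> {}" using a0 b0 ku unfolding T_def by auto
  \<comment> \<open>The point where the segment between the two members of a pair meets the circle
    \<open>F = 0\<close>. Maximizing \<open>ka / v\<close> over these points finds the exit from the
    hull.\<close>
  define e where "e ab = (- F (snd ab)) *\<^sub>R fst ab + F (fst ab) *\<^sub>R snd ab" for ab
  have ve: "v (e ab) > 0" if "ab \<in> T" for ab
  proof -
    have "v (fst ab) > 0" "v (snd ab) > 0" "F (fst ab) > 0" "F (snd ab) < 0" using that v(3) unfolding T_def by auto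
    then show ?thesis unfolding e_def using v(1) by (simp add: linear_diff linear_scale linear_add linear_neg) (smt (verit) mult_pos_pos mult_neg_pos)
  qed
  obtain ab where ab: "ab \<in> T" "\<And>cd. cd \<in> T \<Longrightarrow> ka (e cd) / v (e cd) \<le> ka (e ab) / v (e ab)"
    using exists_max[OF fT neT, of "\<lambda>c. ka (e c) / v (e c)"] by blast
  obtain a b where [simp]: "ab = (a, b)" by (cases ab)
  have abT: "a \<in> set ps" "b \<in> set ps" "F a > 0" "F b < 0" using ab(1) unfolding T_def by auto
  define M where "M = ka (e (a, b)) / v (e (a, b))"
  define g0 where "g0 x = M * v x - ka x" for x
  have lg0: "linear g0" unfolding g0_def using v(1) lk by (auto intro!: linearI simp: linear_add linear_scale algebra_simps)
  have g0e: "g0 (e cd) \<ge> 0" if "cd \<in> T" for cd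
    using ab(2)[OF that] ve[OF that] unfolding g0_def M_def by (simp add: pos_divide_le_eq)
  have g0e': "g0 (e (a, b)) = 0" unfolding g0_def M_def using ve[OF ab(1)] by simp
  have g0ex: "g0 (e (x, y)) = - F y * g0 x + F x * g0 y" for x y
    unfolding e_def using lg0 by (simp add: linear_add linear_scale linear_diff linear_neg)
  \<comment> \<open>Subtracting a multiple of \<open>F\<close> does not affect the circle through
    \<open>u\<close> and \<open>p\<close>. By \<open>g0e'\<close> the multiple that makes
    \<open>g\<close> vanish at \<open>a\<close> is the one that works at \<open>b\<close>.\<close>
  define g where "g x = g0 x - (g0 a / F a) * F x" for x
  have lg: "linear g" unfolding g_def using lg0 lF by (auto intro!: linearI simp: linear_add linear_scale algebra_simps add_divide_distrib)
  have sab: "g0 a / F a = g0 b / F b" using g0e' abT unfolding g0ex by (simp add: field_simps)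
  have gab: "g a = 0" unfolding g_def using abT by simp
  moreover have "g b = 0" unfolding g_def sab using abT by simp
  ultimately have gab: "g a = 0" "g b = 0" by blast+
  have gpos: "g x \<ge> 0" if x: "x \<in> set ps" for x
  proof (cases "F x > 0")
    case True
    then have "g0 (e (x, b)) \<ge> 0" using g0e[of "(x, b)"] x abT unfolding T_def by auto
    then have "- F b * g x \<ge> 0" unfolding g_def sab g0ex using abT by (simp add: field_simps)
    then show ?thesis using abT by (simp add: mult_le_0_iff zero_le_mult_iff)
  next
    case False
    then have "F x < 0" using F0[OF x] by linarith
    then have "g0 (e (a, x)) \<ge> 0" using g0e[of "(a, x)"] x abT unfolding T_def by auto
    then have "F a * g x \<ge> 0" unfolding g_def g0ex using abT by (simp add: field_simps)
    then show ?thesis using abT by (simp add: zero_le_mult_iff)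
  qed
  have gp: "g p = M * v p + 1" "g u = M * v u" unfolding g_def g0_def using ku by auto
  have vp: "v p > 0" using v(3) by auto
  \<comment> \<open>Otherwise the exit would not lie beyond \<open>- u\<close>. Adding to
    \<open>g\<close> the least nonnegative multiple of \<open>v\<close> that makes it nonnegative at
    \<open>p\<close> would give a nonzero functional that is nonnegative at all vertices, against
    balance.\<close>
  have M: "M > 0"
  proof (rule ccontr)
    assume "\<not> M > 0"
    then have M: "M \<le> 0" by simp
    define c where "c = max 0 (- g p / v p)"
    define f where "f x = g x + c * v x" for x
    have lf: "linear f" unfolding f_def using lg v(1) by (auto intro!: linearI simp: linear_add linear_scale algebra_simps)
    have c: "c \<ge> 0" unfolding c_def by simp
    have 1: "f x \<ge> 0" if "x \<in> set ps" for x unfolding f_def using gpos[OF that] v(3)[of x] that c by simp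
    have "c * v p \<ge> (- g p / v p) * v p" using vp unfolding c_def by (intro mult_right_mono) auto
    then have 2: "f p \<ge> 0" unfolding f_def using vp by simp
    have 3: "f u \<ge> 0 \<and> (f u \<noteq> 0 \<or> f p \<noteq> 0)"
    proof (cases "g p \<ge> 0")
      case True
      then have "c = 0" unfolding c_def using vp by (simp add: max_def divide_le_0_iff)
      then have "f u = M * v u" "f p = M * v p + 1" unfolding f_def gp by auto
      then show ?thesis using M v(2) by (cases "M = 0") (auto simp: zero_le_mult_iff)
    next
      case False
      then have "c = - g p / v p" unfolding c_def using vp by (simp add: max_def divide_le_0_iff)
      then have cv: "c * v p = - (M * v p + 1)" unfolding gp using vp by simp
      have "f u * v p = (M * v p + c * v p) * v u" unfolding f_def gp by (simp add: algebra_simps)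
      then have "f u * v p = - v u" unfolding cv by simp
      then have "f u = - v u / v p" using vp by (simp add: field_simps)
      moreover have "- v u / v p > 0" using v(2) vp by (simp add: divide_neg_pos)
      ultimately show ?thesis by auto
    qed
    then obtain x where "x \<in> set (u # p # ps)" "f x < 0" using balanced_linear[OF bal lf] by metis
    then show False using 1 2 3 by fastforce
  qed
  have gup: "g u < 0" "g p > 0" using M v(2) vp unfolding gp by (auto simp: mult_less_0_iff add_pos_pos)
  have id: "e (a, b) = det3 p a b *\<^sub>R u - det3 u a b *\<^sub>R p"
    using cramer[of p a b u] unfolding e_def F_def by (simp add: algebra_simps)
  have "ka (e (a, b)) > 0" using M ve[OF ab(1)] unfolding M_def by (simp add: zero_less_divide_iff)
  moreover have "ka (e (a, b)) = det3 u a b" unfolding id using lk ku by (simp add: linear_diff linear_scale)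
  ultimately have uab: "det3 u a b > 0" by simp
  have "g (e (a, b)) = 0" unfolding e_def using lg gab by (simp add: linear_diff linear_scale linear_add)
  then have "det3 p a b * g u = det3 u a b * g p" unfolding id using lg by (simp add: linear_diff linear_scale)
  moreover have "det3 u a b * g p > 0" using uab gup by simp
  ultimately have "det3 p a b * g u > 0" by linarith
  then have pab: "det3 p a b < 0" using gup(1) by (simp add: zero_less_mult_iff)
  have bap: "det3 b a p > 0" using pab det3_perms[where x=p and y=a and z=b] by linarith
  have pos: "det3 b a x > 0" if x: "x \<in> set (p # ps)" "x \<noteq> a" "x \<noteq> b" for x
  proof -
    have "a \<noteq> b" using abT by auto
    have "g x \<ge> 0" using gpos gup(2) x by auto
    moreover have "g x \<noteq> 0"
    proof
      assume g: "g x = 0"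
      obtain v' where v': "\<And>y. g y = v' \<bullet> y" using linear_inner_rep[OF lg] by blast
      have "det3 a b x \<noteq> 0" using x abT \<open>a \<noteq> b\<close> dd by (intro generic_det[OF K(1)]) auto
      then have "v' = 0" using orthogonal_independent[of a b x v'] gab g v' by auto
      then show False using v'[of u] gup by simp
    qed
    ultimately have "g x > 0" by simp
    have i: "det3 b a x *\<^sub>R p - det3 b a p *\<^sub>R x = det3 b p x *\<^sub>R a - det3 a p x *\<^sub>R b"
      using cramer[of a p x b] by (simp add: algebra_simps)
    have "det3 b a x * g p - det3 b a p * g x = 0" using arg_cong[OF i, of g] lg gab by (simp add: linear_diff linear_scale)
    moreover have "det3 b a p * g x > 0" using bap \<open>g x > 0\<close> by simp
    ultimately show ?thesis using gup(2) by (smt (verit) mult_nonpos_nonneg)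
  qed
  \<comment> \<open>The roles are exchanged: here \<open>a\<close> is the end with
    \<open>F > 0\<close>, while the statement lists the end with \<open>F < 0\<close> first.\<close>
  show ?thesis
  proof (rule that[of b a])
    show "det3 u b a < 0" using uab det3_swap'(1)[of u a b] by linarith
    show "det3 u p b < 0" "det3 u p a > 0" using abT unfolding F_def by auto
  qed (use abT pos in auto)
qed

text \<open>Besides the negative turns this needs the positive turns at \<open>a\<close> and
  \<open>b\<close> and their order along the polygon. Both come from cyclic orders at the chords
  from \<open>u\<close>: the great circle of \<open>a\<close> and \<open>b\<close> separates
  \<open>u\<close> from the rest, so these chords cross no edge between vertices of
  \<open>ps\<close>.\<close>

lemma essential_vertex_six_pos:
  fixes v :: "real^3 \<Rightarrow> real"
  assumes K: "generic V (u # ps)" "length ps \<ge> 3" and Vs: "\<And>x. x \<in> V \<Longrightarrow> - x \<in> V" 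
    and bal: "balanced (set (u # ps))" and sim: "simple_pm (u # ps)"
    and v: "linear v" "\<And>x. x \<in> set ps \<Longrightarrow> v x > 0"
    and o': "det3 (last ps) u (hd ps) > 0"
  shows "6 \<le> cyclic_changes (cyclic_signs (u # ps))"
proof -
  obtain p qs where ps: "ps = p # qs" using K(2) by (cases ps) auto
  have qs: "qs \<noteq> []" using ps K(2) by auto
  have dd: "distinct (u # p # qs)" using genericD(3)[OF K(1)] ps by simp
  have gV: "general_position V" using genericD(1)[OF K(1)] .
  have VV: "x \<in> V" if "x \<in> set (u # ps)" for x using K(1) that unfolding generic_def by auto
  have vu: "v u < 0"
  proof -
    have "v p \<noteq> 0" using v(2)[of p] ps by auto
    then obtain x where "x \<in> set (u # ps)" "v x < 0" by (rule balanced_linear[OF bal v(1)])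
    then show ?thesis using v(2) by force
  qed
  obtain a b where ab: "a \<in> set qs" "b \<in> set qs" "det3 u p a < 0" "det3 u p b > 0" "det3 u a b < 0"
    "\<And>x. x \<in> set ps \<Longrightarrow> x \<noteq> a \<Longrightarrow> x \<noteq> b \<Longrightarrow> det3 a b x > 0"
    using supporting_edge[of V u p qs v] K(1) qs bal v vu unfolding ps by blast
  define z where "z = last ps"
  have z: "z \<in> set qs" "z \<in> set ps" unfolding z_def ps using qs by auto
  have oz: "det3 z u p > 0" using o' unfolding z_def ps by simp
  have pz: "det3 u p z > 0" using o' det3_rot[of u p z] unfolding z_def ps by simp
  have az: "a \<noteq> z" using ab(3) pz by auto
  have abne: "a \<noteq> b" using ab by auto
  have abp: "det3 a b p > 0" using ab(1,2) ab(6)[of p] dd ps by auto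
  have E: "(u, p) \<in> edges (u # ps)" "(z, u) \<in> edges (u # ps)" "adj ps \<subseteq> edges (u # ps)"
    unfolding edges_def z_def ps using qs adj_append[of "u # p # qs" "[u]"] by auto
  have npu: "npar u x" if "x \<in> set ps" for x using genericD(5)[OF K(1), of u x] that dd ps by auto
  \<comment> \<open>Walk along the antipodal path from \<open>- p\<close>, which is not in the
    triangle. The two sides at \<open>u\<close> are edges and are not crossed, and \<open>v\<close>
    separates the path from the side between \<open>p\<close> and \<open>z\<close>.\<close>
  have noV: "\<not> in_triangle z u p (- c)" if c: "c \<in> set ps" for c
  proof -
    have "in_triangle z u p (- c) = in_triangle z u p (- hd ps)"
    proof (rule path_const[of ps "\<lambda>c. in_triangle z u p (- c)", OF _ c])
      fix c d assume cd: "(c, d) \<in> adj ps"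
      then have cs: "c \<in> set ps" "d \<in> set ps" "c \<noteq> d" using adj_set[OF cd] adj_neq[OF _ cd] dd ps by auto
      have vv: "v c > 0" "v d > 0" "v z > 0" "v p > 0" using v(2) cs z ps by auto
      have vm: "v (- x) = - v x" for x using v(1) by (simp add: linear_neg)
      have "(crosses z u (-c) (-d) \<noteq> (crosses u p (-c) (-d) \<noteq> crosses p z (-c) (-d))) = (in_triangle z u p (-c) \<noteq> in_triangle z u p (-d))"
      proof (rule triangle_parity[OF gV])
        show "npar z u" "npar u p" "npar z p" "npar (-c) (-d)" using npu[OF z(2)] npu[of p] ps npar_sym[of z u] genericD(5)[OF K(1), of z p] genericD(5)[OF K(1), of c d] z cs dd by auto
        show "- c \<noteq> z" "- c \<noteq> p" "- d \<noteq> z" "- d \<noteq> p" using vv vm by (metis less_asym neg_less_0_iff_less)+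
        show "- c \<noteq> u" "- d \<noteq> u" using npu[OF cs(1)] npu[OF cs(2)] unfolding npar_def by auto
      qed (use VV Vs z cs ps in auto)
      moreover have "\<not> crosses z u (-c) (-d)" "\<not> crosses u p (-c) (-d)" using simpleD(3)[OF sim] E cd by auto
      moreover have "\<not> crosses p z (-c) (-d)"
        by (rule crosses_sep[of "\<lambda>x. - v x"]) (use v(1) vv vm in \<open>auto intro: linear_compose_neg\<close>)
      ultimately show "in_triangle z u p (- c) = in_triangle z u p (- d)" by blast
    qed
    moreover have "\<not> in_triangle z u p (- hd ps)" unfolding ps in_triangle_def by auto
    ultimately show ?thesis by blast
  qed
  \<comment> \<open>Otherwise the antipode of \<open>a\<close> would lie in the triangle
    \<open>z u p\<close>.\<close>
  have uzb: "b \<noteq> z \<and> det3 u z b > 0"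
  proof (rule ccontr)
    assume neg: "\<not> (b \<noteq> z \<and> det3 u z b > 0)"
    have "det3 u z a > 0 \<and> det3 z a p < 0"
    proof (cases "b = z")
      case True
      then show ?thesis using ab(5) abp det3_perms[where x=u and y=a and z=b] det3_perms[where x=a and y=b and z=p] by auto
    next
      case False
      have "det3 u z b \<noteq> 0" using False z ab dd ps by (intro generic_det[OF K(1)]) auto
      then have n: "det3 u z b < 0" using neg False by auto
      have "det3 u p z * det3 u a b < 0" "det3 u p a * det3 u z b > 0" using pz ab(3,5) n by (auto simp: mult_pos_neg mult_neg_neg)
      then have "det3 u p b * det3 u z a > 0" using grassmann[of u p z a b] by linarith
      then have uza: "det3 u z a > 0" using ab(4) by (simp add: zero_less_mult_iff)
      have g: "det3 a u b * det3 a p z - det3 a u p * det3 a b z + det3 a u z * det3 a b p = 0" by (rule grassmann)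
      have s: "det3 a u b > 0" "det3 a u p < 0" "det3 a u z > 0" "det3 a b z > 0"
        using ab(3,5) uza ab(6)[OF z(2)] az False det3_perms[where x=a and y=u and z=b] det3_perms[where x=a and y=u and z=p] det3_perms[where x=a and y=u and z=z] by auto
      have "det3 a u p * det3 a b z < 0" "det3 a u z * det3 a b p > 0" using s abp by (auto simp: mult_neg_pos)
      then have "det3 a u b * det3 a p z < 0" using g by linarith
      then have "det3 a p z < 0" using s by (simp add: mult_less_0_iff)
      then show ?thesis using uza det3_rot[of a p z] by simp
    qed
    then have "in_triangle z u p (- a)" unfolding in_triangle_def
      using o' ab(3) det3_rot[of u p a] det3_swap[of u z a] unfolding z_def ps by (auto simp: det3_perms(1)[of u z a])
    then show False using noV ab(1) ps by auto
  qed
  \<comment> \<open>The remainder \<open>R'\<close> may be cut off so that the second arc ends at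
    \<open>a\<close> instead of \<open>z\<close>; this variant serves to exclude that
    \<open>b\<close> precedes \<open>a\<close>.\<close>
  have side: "ccw l u (hd R) (last P) = ccw u p (last R) l"
    if s: "ps = P @ l # R @ R'" "P \<noteq> []" "R \<noteq> []" "l = a \<or> l = b" "last R = z \<and> R' = [] \<or> last R = a" for P l R R'
  proof -
    have hP: "hd P = p" using s(1,2) ps by (cases P) auto
    have okc: "generic V (u # P @ l # R)" using K(1) by (rule generic_subset) (use s(1) genericD(3)[OF K(1)] in auto)
    have ge: "det3 a b x \<ge> 0" if "x \<in> set ps" for x using ab(6)[OF that] by (cases "x = a"; cases "x = b") (auto intro: less_imp_le)
    have u: "det3 a b u < 0" using ab(5) det3_perms[where x=u and y=a and z=b] by auto
    have free: "\<not> crosses u q e f" if "q = a \<or> q = b" "e \<in> set ps" "f \<in> set ps" for q e f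
      by (rule crosses_sep[of "det3 a b"]) (use that ge u linear_det3 in auto)
    have sub: "adj (P @ [l]) \<subseteq> adj ps" "adj (l # R) \<subseteq> adj ps" "adj R \<subseteq> adj ps" "adj P \<subseteq> adj ps"
    proof -
      have 1: "adj ps = adj (P @ [l]) \<union> adj (l # R @ R')" unfolding s(1) by (rule adj_mid)
      have "adj (l # R) \<subseteq> adj (l # R @ R')" using adj_append[of "l # R" R'] by (cases "R' = []") auto
      moreover have "adj R \<subseteq> adj (l # R)" "adj P \<subseteq> adj (P @ [l])" using adj_Cons[OF s(3), of l] adj_append[of P "[l]"] s by auto
      ultimately show "adj (P @ [l]) \<subseteq> adj ps" "adj (l # R) \<subseteq> adj ps" "adj R \<subseteq> adj ps" "adj P \<subseteq> adj ps" using 1 by auto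
    qed
    have "ccw l u (hd R) (last P) = ccw u (hd P) (last R) l"
    proof (rule chord_side[OF okc s(2,3)])
      fix c d e f assume cd: "(c, d) \<in> adj (u # P @ [l])" "(e, f) \<in> adj (l # R)"
      have "(c, d) = (u, p) \<or> (c, d) \<in> adj ps" using cd(1) sub s(2) hP adj_Cons[of "P @ [l]" u] by auto
      then show "\<not> crosses c d e f" using simpleD(2)[OF sim] E cd(2) sub by blast
    next
      fix e f assume "(e, f) \<in> adj R"
      then have "(e, f) \<in> adj ps" using sub by auto
      then show "\<not> crosses u l e f" using free s(4) adj_set by fast
    next
      fix c d assume "(c, d) \<in> adj (P @ [l])"
      then have cd: "(c, d) \<in> adj ps" using sub by auto
      show "\<not> crosses u (last R) c d"
      proof (cases "last R = a")
        case True then show ?thesis using free adj_set[OF cd] by blast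
      next
        case False then have "last R = z" using s(5) by blast
        then show ?thesis using simpleD(2)[OF sim E(2), of c d] E(3) cd crosses_sym(1) by blast
      qed
    next
      fix e f assume "(e, f) \<in> adj P"
      then have "(e, f) \<in> adj ps" using sub by auto
      then show "\<not> crosses u l e f" using free s(4) adj_set by fast
    qed
    then show ?thesis using hP by simp
  qed
  have Ta: "ccw u p z a" unfolding ccw_def using pz ab(3) det3_swap'(2)[of a p u] det3_perms[where x=u and y=p and z=a] by auto
  have Tb: "ccw u p z b" unfolding ccw_def using pz uzb by auto
  \<comment> \<open>A negative turn at \<open>l\<close> would place the direction to
    \<open>u\<close> in the angle between its neighbours \<open>r\<close> and \<open>t\<close>, both
    of which lie weakly beyond the circle of \<open>a\<close> and \<open>b\<close>, while
    \<open>u\<close> does not. The Grassmann relation at \<open>l\<close> expresses this.\<close>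
  have vertex_pos: "det3 t l r > 0"
    if c: "ccw l u r t" "l = a \<or> l = b" "r \<in> set ps" "t \<in> set ps" "r \<noteq> t" "r \<noteq> l" "t \<noteq> l" for l r t
  proof (rule ccontr)
    assume "\<not> ?thesis"
    moreover have "det3 l r t \<noteq> 0" using that dd ps ab(1,2) by (intro generic_det[OF K(1)]) auto
    ultimately have n: "det3 l r t < 0" using det3_rot[of l r t] by simp
    then have m: "det3 l u r > 0" "det3 l t u > 0" using c(1) unfolding ccw_def by auto
    define b' where "b' = (if l = a then b else a)"
    have g: "det3 l b' u * det3 l r t - det3 l b' r * det3 l u t + det3 l b' t * det3 l u r = 0" by (rule grassmann)
    define sg where "sg = (if l = a then 1 else -1 :: real)"
    have ge: "det3 a b x \<ge> 0" if "x \<in> set ps" for x using ab(6)[OF that] by (cases "x = a"; cases "x = b") (auto intro: less_imp_le)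
    have lb: "det3 l b' x = sg * det3 a b x" for x unfolding b'_def sg_def using c(2) abne det3_swap[of a b x] by auto
    have u: "det3 a b u < 0" using ab(5) det3_perms[where x=u and y=a and z=b] by auto
    have lut: "det3 l u t < 0" using m det3_swap'(1)[of l u t] by linarith
    have "sg * (det3 a b u * det3 l r t - det3 a b r * det3 l u t + det3 a b t * det3 l u r) = 0" using g unfolding lb by (simp add: algebra_simps)
    then have "det3 a b u * det3 l r t - det3 a b r * det3 l u t + det3 a b t * det3 l u r = 0" unfolding sg_def by (auto split: if_splits)
    moreover have "det3 a b u * det3 l r t > 0" using u n by (simp add: mult_neg_neg)
    moreover have "det3 a b r * det3 l u t \<le> 0" "det3 a b t * det3 l u r \<ge> 0" using ge[OF c(3)] ge[OF c(4)] lut m by (auto simp: mult_le_0_iff)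
    ultimately show False by linarith
  qed
  have "a \<in> set ps" "b \<in> set ps" using ab ps by auto
  then obtain P1 P2 P3 where "ps = P1 @ a # P2 @ b # P3 \<or> ps = P1 @ b # P2 @ a # P3"
    using abne by (metis split_list append.assoc append_Cons Un_iff set_append set_ConsD)
  \<comment> \<open>If \<open>b\<close> came first, the chord from \<open>u\<close> to
    \<open>b\<close> could be compared at \<open>u\<close> with the directions to \<open>z\<close>
    and to \<open>a\<close>. These give opposite cyclic orders, but both must agree with the same
    order at \<open>b\<close>.\<close>
  then have spl: "ps = P1 @ a # P2 @ b # P3"
  proof
    assume s: "ps = P1 @ b # P2 @ a # P3"
    have P1: "P1 \<noteq> []" using s ps ab(2) dd by (cases P1) auto
    have 1: "ccw b u (hd (P2 @ a # P3)) (last P1) = ccw u p (last (P2 @ a # P3)) b"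
      by (rule side[of P1 b "P2 @ a # P3" "[]"]) (use s P1 z_def in auto)
    have 2: "ccw b u (hd (P2 @ [a])) (last P1) = ccw u p (last (P2 @ [a])) b"
      by (rule side[of P1 b "P2 @ [a]" P3]) (use s P1 in auto)
    have "last (P2 @ a # P3) = z" unfolding z_def s by (simp add: last_append)
    moreover have "hd (P2 @ [a]) = hd (P2 @ a # P3)" by (cases P2) auto
    moreover have "\<not> ccw u p a b" unfolding ccw_def using ab(3,5) by auto
    ultimately show ?thesis using 1 2 Tb by simp
  qed
  have P1: "P1 \<noteq> []" and hP1: "hd P1 = p" using spl ps ab(1) dd by (cases P1; auto)+
  have P3: "P3 \<noteq> []" and lP3: "last P3 = z" using spl uzb z_def by (cases "P3 = []"; auto)+
  have dps: "distinct ps" using dd ps by simp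
  have sa: "det3 (last P1) a (hd (P2 @ b # P3)) > 0"
  proof (rule vertex_pos)
    have "ccw a u (hd (P2 @ b # P3)) (last P1) = ccw u p (last (P2 @ b # P3)) a"
      by (rule side[of P1 a "P2 @ b # P3" "[]"]) (use spl P1 z_def in auto)
    then show "ccw a u (hd (P2 @ b # P3)) (last P1)" using Ta lP3 P3 by simp
    have "hd (P2 @ b # P3) \<in> set (P2 @ b # P3)" "last P1 \<in> set P1" using P1 by (metis append_is_Nil_conv list.distinct(1) list.set_sel(1), simp)
    then show "hd (P2 @ b # P3) \<in> set ps" "last P1 \<in> set ps" "hd (P2 @ b # P3) \<noteq> last P1" "hd (P2 @ b # P3) \<noteq> a" "last P1 \<noteq> a"
      using spl dps by auto
  qed simp
  have sb: "det3 (last (a # P2)) b (hd P3) > 0"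
  proof (rule vertex_pos)
    have "ccw b u (hd P3) (last (P1 @ a # P2)) = ccw u p (last P3) b"
      by (rule side[of "P1 @ a # P2" b "P3" "[]"]) (use spl P1 P3 z_def in auto)
    then show "ccw b u (hd P3) (last (a # P2))" using Tb lP3 by simp
    have "hd P3 \<in> set P3" "last (a # P2) \<in> set (a # P2)" using P3 by auto
    then show "hd P3 \<in> set ps" "last (a # P2) \<in> set ps" "hd P3 \<noteq> last (a # P2)" "hd P3 \<noteq> b" "last (a # P2) \<noteq> b"
      using spl dps by auto
  qed simp
  have edg: "edges (u # ps) = insert (u, p) (insert (z, u) (adj ps))"
    unfolding edges_def z_def ps using qs adj_append[of "u # p # qs" "[u]"] by auto
  have adjps: "adj ps = adj (P1 @ [a]) \<union> adj (a # P2 @ [b]) \<union> adj (b # P3)"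
    unfolding spl using adj_mid[of P1 a "P2 @ b # P3"] adj_mid[of "a # P2" b P3] by auto
  have P2: "P2 \<noteq> []"
  proof
    assume "P2 = []"
    then have "(a, b) \<in> edges (u # ps)" using adjps edg by auto
    then have "\<not> crosses u p (- a) (- b)" using simpleD(3)[OF sim E(1)] by blast
    moreover have "crosses u p (- a) (- b)" unfolding crosses_def using ab(3,4,5) abp det3_rot[of a b p] det3_rot[of b p a] by auto
    ultimately show False by blast
  qed
  have F1: "False \<in> set (turn_signs (u # P1 @ [a]))"
  proof (rule reflex_from_apex[of V u P1 a v])
    show "generic V (u # P1 @ [a])" using K(1) by (rule generic_subset) (use spl dd ps in auto)
    fix c d e f assume "(c, d) \<in> adj (u # P1 @ [a])" "(e, f) \<in> adj (u # P1 @ [a])"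
    moreover have "adj (u # P1 @ [a]) \<subseteq> edges (u # ps)" unfolding edg adjps using hP1 P1 adj_Cons[of "P1 @ [a]" u] by auto
    ultimately show "\<not> crosses c d e f" using simpleD(2)[OF sim] by blast
  next
    fix c d assume "(c, d) \<in> adj (P1 @ [a])"
    then show "\<not> crosses u (hd P1) (- c) (- d)" using simpleD(3)[OF sim E(1)] edg adjps hP1 by blast
  next
    show "0 < v x" if "x \<in> set P1" for x using that v(2)[of x] spl by auto
    have "p \<in> set ps" "a \<in> set ps" using ps ab(1) by auto
    then show "0 < v (hd P1)" "0 < v a" using v(2) hP1 by auto
    show "det3 u (hd P1) a < 0" using ab(3) hP1 by simp
  qed (use P1 v vu in auto)
  have F2: "False \<in> set (turn_signs (a # P2 @ [b]))"
  proof (rule reflex_on_hull_edge[of V])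
    show "generic V (a # P2 @ [b])" using K(1) by (rule generic_subset) (use spl dd ps in auto)
    fix c d e f assume "(c, d) \<in> adj (a # P2 @ [b])" "(e, f) \<in> adj (a # P2 @ [b])"
    then show "\<not> crosses c d e f" using simpleD(2)[OF sim] edg adjps by blast
  next
    fix x assume "x \<in> set P2" then show "det3 a b x > 0" using ab(6)[of x] spl dps by auto
  qed (use P2 in auto)
  \<comment> \<open>Reversal and the antipodal map each negate all turns, so together they preserve
    them. They turn the last arc into one that starts at \<open>- u\<close>, to which
    \<open>reflex_from_apex\<close> applies.\<close>
  have F3: "False \<in> set (turn_signs (b # P3 @ [u]))"
  proof -
    let ?L = "b # P3 @ [u]"
    let ?M = "(- u) # map uminus (rev P3) @ [- b]"
    have M: "?M = map uminus (rev ?L)" by simp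
    have okL: "generic V ?L" using K(1) by (rule generic_subset) (use spl dd ps in auto)
    have okrL: "generic V (rev ?L)" using okL by (rule generic_subset) (use genericD(3)[OF okL] in auto)
    have adjM: "adj ?M = (\<lambda>(a, b). (- b, - a)) ` adj ?L" unfolding M adj_map adj_rev by (auto simp: image_iff split: prod.splits)
    have sL: "adj ?L \<subseteq> edges (u # ps)" unfolding edg adjps using adj_append[of "b # P3" "[u]"] P3 lP3 by auto
    have "False \<in> set (turn_signs ?M)"
    proof (rule reflex_from_apex[of V "- u" "map uminus (rev P3)" "- b" "\<lambda>x. - v x"])
      show "generic V ?M" unfolding M by (rule generic_uminus[OF okrL Vs])
      show "linear (\<lambda>x. - v x)" using v(1) by (rule linear_compose_neg)
      have vm: "v (- x) = - v x" for x using v(1) by (simp add: linear_neg)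
      show "- v (- u) < 0" "- v (- b) > 0" using vu vm v(2)[of b] spl by auto
      show "\<And>x. x \<in> set (map uminus (rev P3)) \<Longrightarrow> 0 < - v x" using vm v(2) spl by auto
      have hz: "hd (map uminus (rev P3)) = - z" using P3 lP3 by (simp add: hd_map hd_rev)
      show "0 < - v (hd (map uminus (rev P3)))" unfolding hz using vm v(2)[OF z(2)] by auto
      show "det3 (- u) (hd (map uminus (rev P3))) (- b) < 0" unfolding hz using uzb by simp
      fix c d assume cd: "(c, d) \<in> adj ?M"
      then have "(- d, - c) \<in> adj ?L" unfolding adjM by auto
      then have cd': "(- d, - c) \<in> edges (u # ps)" using sL by auto
      { fix e f assume "(e, f) \<in> adj ?M"
        then have "(- f, - e) \<in> adj ?L" unfolding adjM by auto
        then have "(- f, - e) \<in> edges (u # ps)" using sL by auto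
        then have "\<not> crosses (- d) (- c) (- f) (- e)" using simpleD(2)[OF sim cd'] by blast
        then show "\<not> crosses c d e f" using crosses_sym(1)[of c d e f] crosses_sym(2)[of d c e f] by simp }
    next
      fix c d assume cd: "(c, d) \<in> adj (map uminus (rev P3) @ [- b])"
      have hz: "hd (map uminus (rev P3)) = - z" using P3 lP3 by (simp add: hd_map hd_rev)
      have "(c, d) \<in> adj ?M" using cd adj_Cons[of "map uminus (rev P3) @ [- b]" "- u"] by auto
      then have "(- d, - c) \<in> adj ?L" unfolding adjM by auto
      then have "\<not> crosses z u (- (- d)) (- (- c))" using simpleD(3)[OF sim E(2)] sL by blast
      then have "\<not> crosses (- z) (- u) (- d) (- c)" using crosses_minus[of z u d c] by simp
      then show "\<not> crosses (- u) (hd (map uminus (rev P3))) (- c) (- d)" unfolding hz using crosses_sym(1)[of "- z" "- u"] crosses_sym(2)[of "- u" "- z" "- d"] by blast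
    qed (use P3 in auto)
    moreover have "turn_signs ?M = rev (turn_signs ?L)"
    proof -
      have nz: "det3 x y z \<noteq> 0" if "l = U @ x # y # z # W" "generic V l" for l U x y z W
        using that(1) genericD(3)[OF that(2)] by (intro generic_det[OF that(2)]) auto
      have "turn_signs ?M = map Not (turn_signs (rev ?L))" unfolding M by (rule turn_signs_uminus) (use nz okrL in blast)
      also have "turn_signs (rev ?L) = rev (map Not (turn_signs ?L))" by (rule turn_signs_rev) (use nz okL in blast)
      finally show ?thesis by (simp add: rev_map comp_def)
    qed
    ultimately show ?thesis by simp
  qed
  have "cyclic_signs (u # ps) = True # turn_signs (u # P1 @ [a]) @ True # turn_signs (a # P2 @ [b]) @ True # turn_signs (b # P3 @ [u])"
  proof -
    have "cyclic_signs (u # P1 @ a # (P2 @ b # P3)) = (det3 (last (P2 @ b # P3)) u (hd P1) > 0) # turn_signs (u # P1 @ [a]) @ (det3 (last P1) a (hd (P2 @ b # P3)) > 0) # turn_signs (a # (P2 @ b # P3) @ [u])"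
      using P1 by (intro cyclic_signs_split) auto
    moreover have "turn_signs ((a # P2) @ b # (P3 @ [u])) = turn_signs ((a # P2) @ [b]) @ (det3 (last (a # P2)) b (hd (P3 @ [u])) > 0) # turn_signs (b # P3 @ [u])"
      by (rule turn_signs_append) auto
    moreover have "det3 (last (P2 @ b # P3)) u (hd P1) > 0" using oz hP1 lP3 P3 by simp
    ultimately show ?thesis using sa sb P3 spl by simp
  qed
  then show ?thesis using cyclic_changes_six[OF F1 F2 F3] by simp
qed

text \<open>The antipodal map negates every turn and preserves the remaining hypotheses, so the turn
  at \<open>u\<close> may be taken to be positive.\<close>

lemma essential_vertex_six:
  assumes K: "generic V (u # ps)" "length ps \<ge> 3" and Vs: "\<And>x. x \<in> V \<Longrightarrow> - x \<in> V" 
    and bal: "balanced (set (u # ps))" and sim: "simple_pm (u # ps)" and un: "\<not> balanced (set ps)"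
  shows "6 \<le> cyclic_changes (cyclic_signs (u # ps))"
proof -
  have okps: "generic V ps" using K(1) by (rule generic_subset) (use genericD(3)[OF K(1)] in auto)
  obtain v :: "real^3 \<Rightarrow> real" where v: "linear v" "\<And>x. x \<in> set ps \<Longrightarrow> v x > 0"
    using unbalanced_strict[OF okps K(2) un] by blast
  have "hd ps \<in> set ps" "last ps \<in> set ps" "hd ps \<noteq> last ps"
    using K(2) genericD(3)[OF okps] by (cases ps; auto)+
  then have nz: "det3 (last ps) u (hd ps) \<noteq> 0" using genericD(3)[OF K(1)] by (intro generic_det[OF K(1)]) auto
  show ?thesis
  proof (cases "det3 (last ps) u (hd ps) > 0")
    case True then show ?thesis using essential_vertex_six_pos[OF K Vs bal sim v] by simp
  next
    case False
    have ne: "ps \<noteq> []" using K(2) by auto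
    have "6 \<le> cyclic_changes (cyclic_signs (- u # map uminus ps))"
    proof (rule essential_vertex_six_pos[of V "- u" "map uminus ps" "\<lambda>x. - v x"])
      show "generic V (- u # map uminus ps)" using generic_uminus[OF K(1) Vs] by simp
      show "balanced (set (- u # map uminus ps))" using balanced_uminus[OF bal] by simp
      show "simple_pm (- u # map uminus ps)" using simple_pm_uminus[OF _ sim] by simp
      show "linear (\<lambda>x. - v x)" using v(1) by (rule linear_compose_neg)
      show "\<And>x. x \<in> set (map uminus ps) \<Longrightarrow> 0 < - v x" using v by (auto simp: linear_neg)
      show "0 < det3 (last (map uminus ps)) (- u) (hd (map uminus ps))" using False nz ne by (simp add: last_map hd_map)
    qed (use K Vs in auto)
    also have "cyclic_signs (- u # map uminus ps) = map Not (cyclic_signs (u # ps))" using cyclic_signs_uminus[OF K(1)] K(2) by simp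
    also have "cyclic_changes (map Not (cyclic_signs (u # ps))) = cyclic_changes (cyclic_signs (u # ps))" using ne by (intro cyclic_changes_map_Not) (auto simp: cyclic_signs_def neq_Nil_conv)
    finally show ?thesis .
  qed
qed

lemma generic_self_neg: "generic V K \<Longrightarrow> x \<in> set K \<Longrightarrow> - x \<in> set K \<Longrightarrow> x = - x"
  using generic_neg(1)[of V K x "- x"] by auto

lemma edges_append: "xs \<noteq> [] \<Longrightarrow> ys \<noteq> [] \<Longrightarrow> edges (xs @ ys) = adj xs \<union> {(last xs, hd ys)} \<union> adj ys \<union> {(last ys, hd xs)}"
  unfolding edges_def using adj_append[of "xs @ ys" "[hd xs]"] adj_append[of xs ys] by auto

lemma edges_rotate: "edges (rotate n Q) = edges Q"
proof -
  have "edges (xs @ ys) = edges (ys @ xs)" for xs ys :: "(real^3) list"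
    by (cases "xs = []"; cases "ys = []") (auto simp: edges_append)
  then show ?thesis unfolding rotate_drop_take by (metis append_take_drop_id)
qed

lemma edges_set: "(c, d) \<in> edges Q \<Longrightarrow> c \<in> set Q \<and> d \<in> set Q"
  unfolding edges_def using adj_set[of c d "Q @ [hd Q]"] by (cases Q) auto

lemma edges_neq: "distinct Q \<Longrightarrow> length Q \<ge> 2 \<Longrightarrow> (c, d) \<in> edges Q \<Longrightarrow> c \<noteq> d"
proof -
  assume a: "distinct Q" "length Q \<ge> 2" "(c, d) \<in> edges Q"
  have "Q \<noteq> []" using a(2) by auto
  then have "edges Q = adj Q \<union> {(last Q, hd Q)}" unfolding edges_def using adj_append[of Q "[hd Q]"] by auto
  moreover have "last Q \<noteq> hd Q" using a(1,2) by (cases Q) auto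
  ultimately show "c \<noteq> d" using a(3) adj_neq[OF a(1), of c d] by auto
qed

lemma edges_Cons: "W \<noteq> [] \<Longrightarrow> edges (m # W) = {(m, hd W), (last W, m)} \<union> adj W"
  using edges_append[of "[m]" W] by auto

lemma edges_split: assumes "as \<noteq> []" "bs \<noteq> []"
  shows "edges (k # as @ l # bs) = adj (k # as @ [l]) \<union> adj (l # bs @ [k])"
    "edges (k # as @ [l]) = adj (k # as @ [l]) \<union> {(l, k)}"
proof -
  show "edges (k # as @ l # bs) = adj (k # as @ [l]) \<union> adj (l # bs @ [k])"
    unfolding edges_def using adj_mid[of "k # as" l "bs @ [k]"] by simp
  show "edges (k # as @ [l]) = adj (k # as @ [l]) \<union> {(l, k)}"
    unfolding edges_def using adj_append[of "k # as @ [l]" "[k]"] by auto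
qed

lemma turn_signs_overlap: "turn_signs (xs @ a # b # ys) = turn_signs (xs @ [a, b]) @ turn_signs (a # b # ys)"
proof (induction xs rule: induct_list012)
  case (2 x) then show ?case by simp
next
  case (3 x y zs) then show ?case by (cases zs) auto
qed simp

lemma cyclic_signs_append:
  assumes ne: "xs \<noteq> []" "ys \<noteq> []"
  shows "cyclic_signs (xs @ ys) = turn_signs (last ys # xs @ [hd ys]) @ turn_signs (last xs # ys @ [hd xs])"
proof -
  obtain xs' a where x: "xs = xs' @ [a]" using ne(1) by (cases xs rule: rev_cases) auto
  obtain b ys' where y: "ys = b # ys'" using ne(2) by (cases ys) auto
  define h w where "h = hd xs" and "w = last ys"
  have 2: "cyclic_signs (xs @ ys) = turn_signs (w # xs @ ys @ [h])" using ne by (simp add: cyclic_signs_def h_def w_def)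
  have 3: "hd ys = b" "last xs = a" using x y by auto
  show ?thesis using turn_signs_overlap[of "w # xs'" a b "ys' @ [h]"] unfolding 2 3 h_def[symmetric] w_def[symmetric] by (simp add: x y)
qed

lemma cyclic_changes_rotate_polygon: "cyclic_changes (cyclic_signs (rotate n Q)) = cyclic_changes (cyclic_signs Q)"
proof -
  have *: "cyclic_changes (cyclic_signs (xs @ ys)) = cyclic_changes (cyclic_signs (ys @ xs))" if "xs \<noteq> []" "ys \<noteq> []" for xs ys :: "(real^3) list"
  proof -
    show ?thesis unfolding cyclic_signs_append[OF that] cyclic_signs_append[OF that(2,1)] by (rule cyclic_changes_rotate)
  qed
  have **: "cyclic_changes (cyclic_signs (xs @ ys)) = cyclic_changes (cyclic_signs (ys @ xs))" for xs ys :: "(real^3) list"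
    by (cases "xs = []"; cases "ys = []") (simp_all add: *)
  show ?thesis unfolding rotate_drop_take using **[of "drop (n mod length Q) Q" "take (n mod length Q) Q"] by simp
qed

lemma generic_rotate: "generic V (rotate n Q) = generic V Q" unfolding generic_def by simp

lemma simple_pm_rotate: "simple_pm (rotate n Q) = simple_pm Q" "simple (rotate n Q) = simple Q"
  unfolding simple_pm_def simple_def edges_rotate by auto

section \<open>Recognizing inside and outside at a single vertex\<close>

text \<open>A point beyond a supporting circle at \<open>m\<close> is not seen within the angle at
  \<open>m\<close>, so its place in the cyclic order depends on the turn alone.\<close>

lemma ccw_outside:
  fixes g :: "real^3 \<Rightarrow> real"
  assumes "linear g" "g m = 0" "g a \<ge> 0" "g b \<ge> 0" "g z < 0" "det3 m a b \<noteq> 0"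
  shows "ccw m a z b \<longleftrightarrow> \<not> det3 b m a > 0"
proof -
  have r: "det3 m a b *\<^sub>R z = det3 m z b *\<^sub>R a - det3 a z b *\<^sub>R m + det3 m a z *\<^sub>R b" using cramer[of a z b m] by (simp add: algebra_simps)
  have e: "det3 m a b * g z = det3 m z b * g a + det3 m a z * g b"
    using arg_cong[OF r, of g] assms(1,2) by (simp add: linear_add linear_diff linear_scale)
  have r: "det3 b m a = det3 m a b" "det3 m b a = - det3 m a b" using det3_rot[of m a b] det3_swap'(1)[of m a b] by auto
  show ?thesis
  proof (cases "det3 m a b > 0")
    case True
    then have "det3 m a b * g z < 0" using assms(5) by (simp add: mult_pos_neg)
    then have "\<not> (det3 m z b \<ge> 0 \<and> det3 m a z \<ge> 0)" using e assms(3,4) by (smt (verit) mult_nonneg_nonneg)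
    then show ?thesis unfolding ccw_def r using True by auto
  next
    case False
    then have "det3 m a b < 0" using assms(6) by linarith
    then have "det3 m a b * g z > 0" using assms(5) by (simp add: mult_neg_neg)
    then have "det3 m z b > 0 \<or> det3 m a z > 0" using e assms(3,4) by (smt (verit) mult_nonpos_nonneg)
    then show ?thesis unfolding ccw_def r using False \<open>det3 m a b < 0\<close> by auto
  qed
qed

lemma ccw_inside: "in_triangle x m y z \<Longrightarrow> ccw m y z x \<longleftrightarrow> det3 x m y > 0"
  unfolding in_triangle_def ccw_def
  using det3_perms[where x=x and y=m and z=y] det3_perms[where x=m and y=y and z=z] det3_perms[where x=x and y=m and z=z] by auto

lemma crossing_parity_outside:
  fixes g :: "real^3 \<Rightarrow> real"
  assumes "linear g" "g m = 0" "\<And>x. x \<in> set W \<Longrightarrow> g x \<ge> 0" "g z < 0"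
  shows "\<not> crossing_parity m z W"
proof (rule crossing_parity_free)
  fix c d assume "(c, d) \<in> adj W"
  then have "g c \<ge> 0" "g d \<ge> 0" using adj_set[of c d W] assms(3) by auto
  then show "\<not> crosses m z c d" using assms by (intro crosses_sep[of g]) auto
qed

text \<open>\<open>polygon_side\<close> itself does not tell which value means outside; the turn at
  a hull vertex does. \<open>polygon_side_inside\<close> yields the opposite value, and the clash of
  the two ends several arguments below.\<close>

lemma polygon_side_outside:
  fixes g :: "real^3 \<Rightarrow> real"
  assumes "generic V (m # W)" "length W \<ge> 2" "linear g" "g m = 0" "\<And>x. x \<in> set W \<Longrightarrow> g x \<ge> 0" "g z < 0"
  shows "polygon_side (m # W) z \<longleftrightarrow> \<not> det3 (last W) m (hd W) > 0"
proof -
  have d: "distinct (m # W)" using genericD(3)[OF assms(1)] .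
  have W: "hd W \<in> set W" "last W \<in> set W" "hd W \<noteq> last W" using assms(2) d by (cases W; auto)+
  have "det3 m (hd W) (last W) \<noteq> 0" using W d by (intro generic_det[OF assms(1)]) auto
  then have "ccw m (hd W) z (last W) \<longleftrightarrow> \<not> det3 (last W) m (hd W) > 0" using W assms by (intro ccw_outside[of g]) auto
  moreover have "W \<noteq> []" using W by auto
  ultimately show ?thesis using crossing_parity_outside[OF assms(3-6)] by (simp add: polygon_side_def)
qed

lemma polygon_side_inside:
  assumes "W \<noteq> []" "in_triangle (last W) m (hd W) z" "\<And>c d. (c, d) \<in> adj W \<Longrightarrow> \<not> crosses m z c d"
  shows "polygon_side (m # W) z \<longleftrightarrow> det3 (last W) m (hd W) > 0"
  using ccw_inside[OF assms(2)] crossing_parity_free[of W m z] assms(1,3) by (simp add: polygon_side_def)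

lemma polygon_side_rotate_to:
  assumes K: "generic V (xs @ z # ys)" "simple (xs @ z # ys)" "length (xs @ z # ys) \<ge> 3"
    and y: "y \<in> V" "y \<notin> set (xs @ z # ys)" "- y \<notin> set (xs @ [z])"
  shows "polygon_side (xs @ z # ys) y = polygon_side (z # ys @ xs) y"
  using assms
proof (induction xs arbitrary: ys)
  case (Cons x xs)
  obtain q ps where qps: "xs @ z # ys = q # ps" by (metis append_is_Nil_conv list.distinct(1) neq_Nil_conv)
  have "q \<in> set (xs @ [z])" using qps by (cases xs) auto
  have "length (xs @ z # ys) \<ge> 2" using Cons(4) by simp
  then have ps: "ps \<noteq> []" unfolding qps by auto
  have "polygon_side (x # q # ps) y = polygon_side (q # ps @ [x]) y"
  proof (rule polygon_side_rot[of V])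
    show "y \<noteq> - x" "y \<noteq> - q" using Cons(7) \<open>q \<in> set (xs @ [z])\<close> by auto
    show "\<not> crossing_parity x q ps"
    proof (rule crossing_parity_free)
      fix c d assume "(c, d) \<in> adj ps"
      then have "(c, d) \<in> edges (x # q # ps)" "(x, q) \<in> edges (x # q # ps)" using edges_Cons[of "q # ps" x] adj_Cons[OF ps, of q] by auto
      then show "\<not> crosses x q c d" using simpleD(1)[OF Cons(3)] qps by simp
    qed
  qed (use Cons(2,5,6) qps ps in \<open>auto simp: generic_def\<close>)
  moreover have "polygon_side (xs @ z # (ys @ [x])) y = polygon_side (z # (ys @ [x]) @ xs) y"
  proof (rule Cons.IH)
    have r: "xs @ z # ys @ [x] = rotate 1 (x # xs @ z # ys)" by simp
    show "generic V (xs @ z # ys @ [x])" "simple (xs @ z # ys @ [x])" using Cons(2,3) unfolding r generic_rotate simple_pm_rotate by simp_all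
  qed (use Cons in auto)
  moreover have "q # ps @ [x] = xs @ z # (ys @ [x])" using qps by (metis append_Cons append_assoc)
  ultimately show ?case using qps by simp
qed simp

text \<open>Bookkeeping for a cut along a chord: \<open>sk\<close>, \<open>sl\<close> are the turns
  at its ends before the cut, \<open>g\<close>, \<open>a\<close> those after it, \<open>S\<close>
  the turns that remain and \<open>T\<close> those that disappear. A turn that changes becomes
  \<open>t\<close>, and an entry \<open>t\<close> of \<open>T\<close> can take its place.\<close>

lemma cyclic_changes_compare:
  assumes "g = t \<or> sk = g" "a = t \<or> sl = a" "t \<in> set T"
  shows "cyclic_changes (g # S @ [a]) \<le> cyclic_changes (sk # S @ sl # T)"
proof -
  obtain T1 T2 where T: "T = T1 @ t # T2" using assms(3) by (meson split_list)
  show ?thesis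
  proof (cases "sk = g")
    case True
    show ?thesis
    proof (cases "sl = a")
      case s: True
      have "subseq (S @ [a]) (S @ sl # T)" unfolding s by (intro list_emb_append_mono) (auto intro: subseq_Cons2)
      then show ?thesis using True by (intro cyclic_changes_subseq) auto
    next
      case False
      then have "a = t" using assms(2) by auto
      then have "subseq (S @ [a]) (S @ sl # T)" using T by (intro list_emb_append_mono) (auto simp: subseq_singleton_left)
      then show ?thesis using True by (intro cyclic_changes_subseq) auto
    qed
  next
    case False
    then have g: "g = t" using assms(1) by auto
    have r: "cyclic_changes (sk # S @ sl # T) = cyclic_changes ((t # T2) @ sk # S @ sl # T1)" using cyclic_changes_rotate[of "sk # S @ sl # T1" "t # T2"] T by simp
    show ?thesis
    proof (cases "sl = a")
      case True
      have "subseq (S @ [a]) (S @ sl # T1)" unfolding True by (intro list_emb_append_mono) (auto intro: subseq_Cons2)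
      then have "subseq (S @ [a]) (T2 @ sk # S @ sl # T1)" by (metis list_emb_append2 list_emb_Cons)
      then show ?thesis unfolding r g by (intro cyclic_changes_subseq) auto
    next
      case False
      then have a: "a = t" using assms(2) by auto
      \<comment> \<open>Both ends ask for a \<open>t\<close>, but the two copies are neighbours in
        the cyclic order, so the single one found in \<open>T\<close> is enough.\<close>
      have e: "cyclic_changes (t # S @ [t]) = cyclic_changes (t # S)" unfolding cyclic_changes_def using changes_append[of "t # S @ [t]" "[t]"] by simp
      have "subseq S (S @ sl # T1)" by (metis append_Nil2 list_emb_Nil list_emb_append_mono subseq_order.refl)
      then have "subseq S (T2 @ sk # S @ sl # T1)" by (metis list_emb_append2 list_emb_Cons)
      then show ?thesis unfolding r g a e by (intro cyclic_changes_subseq) auto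
    qed
  qed
qed

lemma cyclic_changes_block: assumes "\<forall>x\<in>set S. x = t" shows "cyclic_changes (a # S @ [b]) \<le> 2"
proof -
  have "changes (S @ [b, a]) \<le> 2 \<and> (S \<noteq> [] \<longrightarrow> hd S = t \<and> changes (S @ [b, a]) = (if t = b then 0 else 1) + (if b = a then 0 else 1))"
    using assms
  proof (induction S)
    case (Cons x S) then show ?case by (cases S) auto
  qed auto
  then show ?thesis unfolding cyclic_changes_def by (cases S) auto
qed

section \<open>Diagonals free of crossings with the polygon and its antipode\<close>

definition free_chord :: "(real^3) list \<Rightarrow> real^3 \<Rightarrow> real^3 \<Rightarrow> bool" where
  "free_chord Q k l \<longleftrightarrow> (\<forall>(c, d)\<in>edges Q. \<not> crosses k l c d \<and> \<not> crosses k l (- c) (- d))"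

lemma free_chordD: "free_chord Q k l \<Longrightarrow> (c, d) \<in> edges Q \<Longrightarrow> \<not> crosses k l c d" "free_chord Q k l \<Longrightarrow> (c, d) \<in> edges Q \<Longrightarrow> \<not> crosses k l (- c) (- d)"
  unfolding free_chord_def by blast+

lemma free_chord_sym: "free_chord Q k l \<longleftrightarrow> free_chord Q l k"
  unfolding free_chord_def by (auto simp: crosses_sym(1)[of k l])

lemma crosses_neg2: "crosses (- a) (- b) c d = crosses a b (- c) (- d)"
  using crosses_minus[of a b "- c" "- d"] by simp

lemma simple_pm_split:
  assumes "simple_pm (k # as @ l # bs)" "free_chord (k # as @ l # bs) k l" "as \<noteq> []" "bs \<noteq> []"
  shows "simple_pm (k # as @ [l])"
proof -
  let ?Q = "k # as @ l # bs"
  have E: "(c, d) \<in> edges ?Q \<or> (c, d) = (l, k)" if "(c, d) \<in> edges (k # as @ [l])" for c d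
    using that edges_split[OF assms(3,4)] by auto
  have f: "free_chord ?Q l k" using assms(2) free_chord_sym by blast
  have 1: "\<not> crosses a b c d" if "(a, b) \<in> edges (k # as @ [l])" "(c, d) \<in> edges (k # as @ [l])" for a b c d
    using E[OF that(1)] E[OF that(2)] simpleD(2)[OF assms(1), of a b c d] free_chordD(1)[OF f, of a b] free_chordD(1)[OF f, of c d] crosses_sym(3)[of a b c d] by auto
  have 2: "\<not> crosses a b (- c) (- d)" if "(a, b) \<in> edges (k # as @ [l])" "(c, d) \<in> edges (k # as @ [l])" for a b c d
    using E[OF that(1)] E[OF that(2)] simpleD(3)[OF assms(1), of a b c d] free_chordD(2)[OF f, of a b] free_chordD(2)[OF f, of c d]
      crosses_sym(3)[of a b "- c" "- d"] crosses_neg2[of c d a b] by auto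
  show ?thesis unfolding simple_pm_def simple_def using 1 2 by blast
qed

text \<open>A turn at \<open>k\<close> or \<open>l\<close> that changes becomes
  \<open>\<not> t\<close>, with \<open>t\<close> the cyclic order that \<open>chord_side\<close>
  finds at both ends. Such a turn occurs in the discarded part: if that part is balanced,
  \<open>IH\<close> gives it both signs. If not, it has a hull vertex, and the turn there is fixed
  by the side on which the vertices of \<open>as\<close> lie.\<close>

lemma free_chord_changes:
  assumes K: "generic V (k # as @ l # bs)" "as \<noteq> []" "bs \<noteq> []" and Vs: "\<And>x. x \<in> V \<Longrightarrow> - x \<in> V"
    and sim: "simple_pm (k # as @ l # bs)" and fr: "free_chord (k # as @ l # bs) k l" and bal: "balanced (set (k # as @ l # bs))"
    and IH: "balanced (set (l # bs @ [k])) \<Longrightarrow> 6 \<le> cyclic_changes (cyclic_signs (l # bs @ [k]))"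
  shows "cyclic_changes (cyclic_signs (k # as @ [l])) \<le> cyclic_changes (cyclic_signs (k # as @ l # bs))"
proof -
  let ?Q = "k # as @ l # bs"
  have dd: "distinct ?Q" using genericD(3)[OF K(1)] .
  have E: "edges ?Q = adj (k # as @ [l]) \<union> adj (l # bs @ [k])" using edges_split(1)[OF K(2,3)] .
  have sub: "adj (l # bs) \<subseteq> edges ?Q" "adj bs \<subseteq> edges ?Q" "adj (as @ [l]) \<subseteq> edges ?Q" "adj as \<subseteq> edges ?Q" "(last bs, k) \<in> edges ?Q" "(k, hd as) \<in> edges ?Q"
    unfolding E using adj_append[of "l # bs" "[k]"] adj_Cons[OF K(3), of l] adj_Cons[of "as @ [l]" k] adj_append[of as "[l]"] K(2,3) by auto
  define t where "t = ccw k (hd as) (last bs) l"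
  have t2: "ccw l k (hd bs) (last as) = t" unfolding t_def
  proof (rule chord_side[OF K(1-3)])
    fix c d e f assume "(c, d) \<in> adj (k # as @ [l])" "(e, f) \<in> adj (l # bs)"
    then show "\<not> crosses c d e f" using simpleD(2)[OF sim, of c d e f] E sub by blast
  next
    fix e f assume "(e, f) \<in> adj bs" then show "\<not> crosses k l e f" using free_chordD[OF fr] sub by blast
  next
    fix c d assume "(c, d) \<in> adj (as @ [l])" 
    then show "\<not> crosses k (last bs) c d" using simpleD(2)[OF sim sub(5), of c d] sub crosses_sym(1) by blast
  next
    fix e f assume "(e, f) \<in> adj as" then show "\<not> crosses k l e f" using free_chordD[OF fr] sub by blast
  qed
  have hl: "hd as \<in> set as" "last as \<in> set as" "hd bs \<in> set bs" "last bs \<in> set bs" using K by auto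
  have nz: "det3 k (hd as) l \<noteq> 0" "det3 l k (last as) \<noteq> 0" "det3 (last bs) k (hd as) \<noteq> 0" "det3 (last as) l (hd bs) \<noteq> 0"
    by (rule generic_det[OF K(1)]; use dd hl in auto)+
  have mem: "(\<not> t) \<in> set (turn_signs (l # bs @ [k]))"
  proof (cases "balanced (set (l # bs @ [k]))")
    case True
    then have 6: "6 \<le> cyclic_changes (cyclic_signs (l # bs @ [k]))" by (rule IH)
    show ?thesis
    proof (rule ccontr)
      assume n: "(\<not> t) \<notin> set (turn_signs (l # bs @ [k]))"
      have "x = t" if "x \<in> set (turn_signs (l # bs @ [k]))" for x
      proof (rule ccontr)
        assume "x \<noteq> t"
        then have "x = (\<not> t)" by blast
        then show False using that n by simp
      qed
      then have "\<forall>x\<in>set (turn_signs (l # bs @ [k])). x = t" by blast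
      then have "cyclic_changes (cyclic_signs (l # bs @ [k])) \<le> 2" unfolding cyclic_signs_close[OF K(3)] by (rule cyclic_changes_block)
      then show False using 6 by simp
    qed
  next
    case False
    have okB: "generic V (l # bs @ [k])" using K(1) by (rule generic_subset) (use dd in auto)
    have len: "3 \<le> length (l # bs @ [k])" using K(3) by (cases bs) auto
    obtain v :: "real^3 \<Rightarrow> real" where v: "linear v" "\<And>x. x \<in> set (l # bs @ [k]) \<Longrightarrow> v x > 0"
      using unbalanced_strict[OF okB len False] by blast
    obtain m g where m: "m \<in> set bs" "linear g" "g m = (0::real)" "\<And>x. x \<in> set (l # bs @ [k]) \<Longrightarrow> g x \<ge> 0" "g l > 0" "g k > 0"
      using hull_vertex[OF okB K(3) v] by blast
    \<comment> \<open>Balance of the whole polygon supplies a vertex beyond the supporting circle at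
      \<open>m\<close>. It belongs to \<open>as\<close>, and all of \<open>as\<close> is on one side
      of the discarded part.\<close>
    obtain x where x: "x \<in> set ?Q" "g x < 0" using balanced_linear[OF bal m(2), of l] m(5) by auto
    have xa: "x \<in> set as" using x m(4)[of x] by auto
    obtain b1 b2 where bs: "bs = b1 @ m # b2" using m(1) by (meson split_list)
    have okK: "generic V (k # l # bs)" using K(1) by (rule generic_subset) (use dd in auto)
    have rl: "l # bs @ k # as = rotate (length (k # as)) ?Q" using rotate_append[of "k # as" "l # bs"] by simp
    have sB: "simple_pm (l # bs @ [k])"
    proof (rule simple_pm_split)
      show "simple_pm (l # bs @ k # as)" unfolding rl simple_pm_rotate by (rule sim)
      show "free_chord (l # bs @ k # as) l k" unfolding rl using free_chord_sym[of ?Q k l] fr unfolding free_chord_def edges_rotate by simp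
    qed (use K in auto)
    have sK: "simple_pm (k # l # bs)"
    proof -
      have "rotate 1 (k # l # bs) = l # bs @ [k]" by simp
      then show ?thesis using sB simple_pm_rotate(1)[of 1 "k # l # bs"] by simp
    qed
    have edK: "edges (k # l # bs) \<subseteq> edges ?Q \<union> {(k, l)}"
    proof -
      have "edges (k # l # bs) = {(k, l), (last bs, k)} \<union> adj (l # bs)" using edges_Cons[of "l # bs" k] K(3) by simp
      then show ?thesis using sub(1,5) by blast
    qed
    have Vset: "set ?Q \<subseteq> V" using K(1) unfolding generic_def by auto
    have "polygon_side (k # l # bs) (hd as) = polygon_side (k # l # bs) x"
    proof (rule polygon_side_const[OF okK _ _ _ _ _ _ _ hl(1) xa])
      show "2 \<le> length (l # bs)" using K(3) by (cases bs) auto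
      fix c d e f assume cd: "(c, d) \<in> adj as" "(e, f) \<in> adj (k # (l # bs) @ [k])"
      have ef: "(e, f) \<in> edges (k # l # bs)" using cd(2) unfolding edges_def by simp
      have cd': "(c, d) \<in> edges ?Q" using cd(1) sub(4) by blast
      from ef edK consider "(e, f) \<in> edges ?Q" | "e = k" "f = l" by blast
      then show "\<not> crosses c d e f"
      proof cases
        case 1 then show ?thesis by (rule simpleD(2)[OF sim cd'])
      next
        case 2 then show ?thesis using free_chordD(1)[OF fr cd'] crosses_sym(3)[of c d k l] by simp
      qed
    next
      show "- k \<notin> set as"
      proof
        assume a: "- k \<in> set as"
        then have "k = - k" using generic_self_neg[OF K(1), of k] by auto
        then have "k \<in> set as" using a by metis
        then show False using dd by simp
      qed
    qed (use dd Vset genericD(4)[OF K(1)] in \<open>auto intro: pairwise_npar_subset\<close>)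
    moreover have "polygon_side (k # l # bs) (hd as) = t"
    proof -
      have "\<not> crossing_parity k (hd as) (l # bs)"
        by (rule crossing_parity_free) (use simpleD(2)[OF sim sub(6)] sub(1) in blast)
      then have "polygon_side (k # l # bs) (hd as) = ccw k l (hd as) (last bs)" using K(3) by (simp add: polygon_side_def)
      then show ?thesis unfolding t_def by (simp add: ccw_rot)
    qed
    moreover have "polygon_side (k # l # bs) x = polygon_side (m # b2 @ k # l # b1) x"
    proof -
      have "polygon_side ((k # l # b1) @ m # b2) x = polygon_side (m # b2 @ k # l # b1) x"
      proof (rule polygon_side_rotate_to[of V])
        have "- x \<notin> set (k # l # bs)"
        proof
          assume a: "- x \<in> set (k # l # bs)"
          then have "x = - x" using generic_self_neg[OF K(1), of x] xa by auto
          then have "x \<in> set (k # l # bs)" using a by metis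
          then show False using xa dd by auto
        qed
        then show "- x \<notin> set ((k # l # b1) @ [m])" using bs by auto
      qed (use okK sK bs xa dd Vset in \<open>auto simp: simple_pm_def\<close>)
      then show ?thesis using bs by simp
    qed
    moreover have "polygon_side (m # b2 @ k # l # b1) x = (\<not> det3 (last (b2 @ k # l # b1)) m (hd (b2 @ k # l # b1)) > 0)"
    proof (rule polygon_side_outside[of V _ _ g])
      show "generic V (m # b2 @ k # l # b1)" using okK by (rule generic_subset) (use dd bs in auto)
    qed (use m x bs in auto)
    moreover have "last (b2 @ k # l # b1) = last (l # b1)" "hd (b2 @ k # l # b1) = hd (b2 @ [k])" by (auto simp: hd_append)
    ultimately have "t = (\<not> det3 (last (l # b1)) m (hd (b2 @ [k])) > 0)" by simp
    moreover have "(det3 (last (l # b1)) m (hd (b2 @ [k])) > 0) \<in> set (turn_signs ((l # b1) @ m # (b2 @ [k])))" by (rule turn_signs_memI) auto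
    ultimately show ?thesis using bs by simp
  qed
  let ?g = "det3 l k (hd as) > 0" and ?a = "det3 (last as) l k > 0" and ?sk = "det3 (last bs) k (hd as) > 0" and ?sl = "det3 (last as) l (hd bs) > 0"
  have 1: "?g = (\<not> t) \<or> ?sk = ?g"
  proof -
    have "det3 k l (hd as) = - det3 k (hd as) l" "det3 l k (hd as) = det3 k (hd as) l" by (rule det3_swap'(1), rule det3_rot[symmetric])
    then have "?g = (\<not> det3 k l (hd as) > 0)" using nz(1) by linarith
    moreover have "?sk = (det3 k (hd as) (last bs) > 0)" using det3_rot[of k "hd as" "last bs"] by simp
    ultimately show ?thesis unfolding t_def ccw_def by satx
  qed
  have 2: "?a = (\<not> t) \<or> ?sl = ?a"
  proof -
    have "det3 l (last as) k = - det3 l k (last as)" "det3 (last as) l k = det3 l k (last as)" by (rule det3_swap'(1), rule det3_rot[symmetric])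
    then have "?a = (\<not> det3 l (last as) k > 0)" using nz(2) by linarith
    moreover have "?sl = (det3 l (hd bs) (last as) > 0)" using det3_rot[of l "hd bs" "last as"] by simp
    ultimately show ?thesis unfolding t2[symmetric] ccw_def by satx
  qed
  show ?thesis unfolding cyclic_signs_close[OF K(2)] cyclic_signs_split[OF K(2,3)] by (rule cyclic_changes_compare[OF 1 2 mem])
qed

text \<open>A vertex whose antipode is a vertex would be its own antipode, hence zero, while its
  determinant with two further vertices is not.\<close>

lemma generic_neg_notin:
  assumes "generic V K" "length K \<ge> 3" "x \<in> set K" shows "- x \<notin> set K"
proof
  assume "- x \<in> set K"
  then have "x = - x" by (rule generic_self_neg[OF assms(1,3)])
  then have "x + x = 0" by (metis add.right_inverse)
  then have x0: "x = 0" by (metis scaleR_2 scale_eq_0_iff zero_neq_numeral)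
  have c: "card (set K) \<ge> 3" using assms(2) genericD(3)[OF assms(1)] by (simp add: distinct_card)
  have ex: "\<exists>y\<in>set K. y \<notin> A" if "finite A" "card A < 3" for A
    using that c by (metis card_mono linorder_not_less order_trans subsetI)
  obtain a where a: "a \<in> set K" "a \<notin> {x}" using ex[of "{x}"] by auto
  obtain b where b: "b \<in> set K" "b \<notin> {x, a}" using ex[of "{x, a}"] a by auto
  have "det3 x a b \<noteq> 0" using a b assms(3) by (intro generic_det[OF assms(1)]) auto
  then show False using x0 by simp
qed

text \<open>The antipodal path \<open>map uminus W\<close> does not meet the polygon. Which side it
  lies on is left open; only the agreement is exploited.\<close>

lemma polygon_side_neg_const:
  assumes K: "generic V (m # W)" "simple_pm (m # W)" "length W \<ge> 2" "\<And>x. x \<in> V \<Longrightarrow> - x \<in> V" and ab: "a \<in> set W" "b \<in> set W"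
  shows "polygon_side (m # W) (- a) = polygon_side (m # W) (- b)"
proof (rule polygon_side_const[OF K(1,3), where zs = "map uminus W"])
  have nn: "- x \<notin> set (m # W)" if "x \<in> set (m # W)" for x using generic_neg_notin[OF K(1) _ that] K(3) by auto
  have dd: "distinct (m # W)" using genericD(3)[OF K(1)] .
  fix c d e f assume cd: "(c, d) \<in> adj (map uminus W)" "(e, f) \<in> adj (m # W @ [m])"
  obtain c' d' where c': "c = - c'" "d = - d'" "(c', d') \<in> adj W" using cd(1) unfolding adj_map by auto
  have "W \<noteq> []" using K(3) by auto
  then have "(c', d') \<in> edges (m # W)" using c'(3) edges_Cons[of W m] by blast
  moreover have "(e, f) \<in> edges (m # W)" using cd(2) unfolding edges_def by simp
  ultimately have "(e, f) \<in> edges (m # W)" "(c', d') \<in> edges (m # W)" by blast+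
  then show "\<not> crosses c d e f" using simpleD(3)[OF K(2), of e f c' d'] crosses_sym(3)[of c d e f] c' by simp
next
  have nn: "- x \<notin> set (m # W)" if "x \<in> set (m # W)" for x using generic_neg_notin[OF K(1) _ that] K(3) by auto
  have dd: "distinct (m # W)" using genericD(3)[OF K(1)] .
  show "set (map uminus W) \<inter> set (m # W) = {}" using nn by auto
  show "- m \<notin> set (map uminus W)" using dd by auto
  show "set (map uminus W) \<subseteq> V" using genericD(2)[OF K(1)] K(4) by auto
  show "distinct (map uminus W)" using dd by (simp add: distinct_map inj_on_def)
  show "pairwise_npar (set (map uminus W))" using genericD(4)[OF K(1)] unfolding pairwise_npar_def by auto
  show "- a \<in> set (map uminus W)" "- b \<in> set (map uminus W)" using ab by auto
qed

lemma balanced_four: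
  assumes "generic V K" "length K \<ge> 3" "balanced (set K)" shows "length K \<ge> 4"
proof (rule ccontr)
  assume "\<not> ?thesis"
  then have "length K = 3" using assms(2) by simp
  then obtain a b c where K: "K = [a, b, c]" by (metis (no_types, lifting) length_0_conv length_Suc_conv numeral_3_eq_3)
  have nz: "det3 a b c \<noteq> 0" using genericD(3)[OF assms(1)] K by (intro generic_det[OF assms(1)]) auto
  define f where "f x = det3 a b c * det3 a b x" for x
  have "linear f" unfolding f_def by (auto intro!: linearI simp: det3_lin algebra_simps)
  moreover have "f c \<noteq> 0" unfolding f_def using nz by simp
  ultimately obtain x where "x \<in> set K" "f x < 0" by (rule balanced_linear[OF assms(3)])
  then show False unfolding K f_def by (auto simp: mult_less_0_iff)
qed

text \<open>The sides of the ear triangle at \<open>m\<close> are edges, so no edge of the polygon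
  or of its antipode crosses them, and the nearest point is joined to \<open>m\<close> by a free
  chord. \<open>S\<close> contains antipodes, so \<open>z\<close> may be some \<open>- j\<close>;
  the last conclusion then says that \<open>h\<close> supports the antipodal polygon at
  \<open>- j\<close>.\<close>

lemma nearest_chord:
  assumes K: "generic V (m # W)" "length W \<ge> 3" "simple_pm (m # W)" and Vs: "\<And>x. x \<in> V \<Longrightarrow> - x \<in> V"
    and S: "S = set (m # W) \<union> uminus ` set (m # W)" and ex: "\<exists>z\<in>S. in_triangle (last W) m (hd W) z"
  obtains z h where "z \<in> S" "in_triangle (last W) m (hd W) z" "linear h" "h z = (0::real)" "h m < 0" "free_chord (m # W) m z"
    "\<And>c d. c \<in> S \<Longrightarrow> d \<in> S \<Longrightarrow> npar c d \<Longrightarrow> npar c m \<Longrightarrow> npar d m \<Longrightarrow> \<not> crosses (last W) m c d \<Longrightarrow> \<not> crosses m (hd W) c d \<Longrightarrow> \<not> crosses m z c d"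
    "\<And>j w. z = - j \<Longrightarrow> (j, w) \<in> edges (m # W) \<or> (w, j) \<in> edges (m # W) \<Longrightarrow> w \<noteq> m \<Longrightarrow> h (- w) \<ge> 0"
proof -
  let ?x = "last W" and ?y = "hd W"
  have dd: "distinct (m # W)" using genericD(3)[OF K(1)] .
  have W: "W \<noteq> []" "?x \<in> set W" "?y \<in> set W" "?x \<noteq> ?y" using K(2) dd by (cases W; auto)+
  have SV: "S \<subseteq> V" "finite S" unfolding S using K(1) Vs unfolding generic_def by auto
  have npar_vertices: "npar a b" if "a \<in> set (m # W)" "b \<in> set (m # W)" "a \<noteq> b" for a b using genericD(5)[OF K(1) that] .
  have E: "(m, ?y) \<in> edges (m # W)" "(?x, m) \<in> edges (m # W)" using edges_Cons[OF W(1), of m] by auto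
  have ends_in_V: "?x \<in> V" "m \<in> V" "?y \<in> V" using SV W unfolding S by auto
  have mW: "?x \<noteq> m" "m \<noteq> ?y" using dd W(2,3) by (metis distinct.simps(2))+
  have n3: "npar ?x m" "npar m ?y" "npar ?x ?y" by (rule npar_vertices; use W mW in simp)+
  show ?thesis
  proof (rule nearest_in_triangle[OF genericD(1)[OF K(1)] ends_in_V SV n3 ex])
  fix z and h :: "real^3 \<Rightarrow> real"
  assume z: "z \<in> S" "in_triangle ?x m ?y z" "linear h" "h z = 0" "h m < 0"
    "\<And>c d. c \<in> S \<Longrightarrow> d \<in> S \<Longrightarrow> npar c d \<Longrightarrow> npar c m \<Longrightarrow> npar d m \<Longrightarrow> \<not> crosses ?x m c d \<Longrightarrow> \<not> crosses m ?y c d \<Longrightarrow> \<not> crosses m z c d"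
    "\<And>w. w \<in> S \<Longrightarrow> npar z w \<Longrightarrow> npar w m \<Longrightarrow> \<not> crosses ?x m z w \<Longrightarrow> \<not> crosses m ?y z w \<Longrightarrow> h w \<ge> 0"
  have free: "free_chord (m # W) m z" unfolding free_chord_def
  proof (clarify, intro conjI)
    fix c d assume cd: "(c, d) \<in> edges (m # W)"
    have cs: "c \<in> set (m # W)" "d \<in> set (m # W)" "c \<noteq> d" using edges_set[OF cd] edges_neq[OF dd _ cd] K(2) by auto
    show "\<not> crosses m z c d"
    proof (cases "c = m \<or> d = m")
      case True then show ?thesis by auto
    next
      case False
      then show ?thesis using cs npar_vertices simpleD(2)[OF K(3) E(1) cd] simpleD(2)[OF K(3) E(2) cd] by (intro z(6)) (auto simp: S)
    qed
    show "\<not> crosses m z (- c) (- d)"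
    proof (cases "c = m \<or> d = m")
      case True then show ?thesis by auto
    next
      case False
      then show ?thesis using cs npar_vertices simpleD(3)[OF K(3) E(1) cd] simpleD(3)[OF K(3) E(2) cd] by (intro z(6)) (auto simp: S)
    qed
  qed
  have nb: "h (- w) \<ge> 0" if j: "z = - j" "(j, w) \<in> edges (m # W) \<or> (w, j) \<in> edges (m # W)" "w \<noteq> m" for j w
  proof (rule z(7))
    have cs: "j \<in> set (m # W)" "w \<in> set (m # W)" "j \<noteq> w" using j(2) edges_set edges_neq[OF dd] K(2) by fastforce+
    show "- w \<in> S" "npar z (- w)" "npar (- w) m" using cs npar_vertices j unfolding S by auto
    show "\<not> crosses ?x m z (- w)" using simpleD(3)[OF K(3) E(2), of j w] simpleD(3)[OF K(3) E(2), of w j] j crosses_sym(2)[of ?x m "- j" "- w"] by auto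
    show "\<not> crosses m ?y z (- w)" using simpleD(3)[OF K(3) E(1), of j w] simpleD(3)[OF K(3) E(1), of w j] j crosses_sym(2)[of m ?y "- j" "- w"] by auto
  qed
  show thesis by (rule that[OF z(1-5) free z(6) nb])
  qed
qed

lemma nearest_chord_ex:
  assumes "generic V (m # W)" "length W \<ge> 3" "simple_pm (m # W)" "\<forall>x\<in>V. - x \<in> V"
    "S = set (m # W) \<union> uminus ` set (m # W)" "\<exists>z\<in>S. in_triangle (last W) m (hd W) z"
  shows "\<exists>z h. z \<in> S \<and> in_triangle (last W) m (hd W) z \<and> linear h \<and> h z = (0::real) \<and> h m < 0 \<and> free_chord (m # W) m z \<and>
    (\<forall>c d. c \<in> S \<longrightarrow> d \<in> S \<longrightarrow> npar c d \<longrightarrow> npar c m \<longrightarrow> npar d m \<longrightarrow> \<not> crosses (last W) m c d \<longrightarrow> \<not> crosses m (hd W) c d \<longrightarrow> \<not> crosses m z c d) \<and>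
    (\<forall>j w. z = - j \<longrightarrow> (j, w) \<in> edges (m # W) \<or> (w, j) \<in> edges (m # W) \<longrightarrow> w \<noteq> m \<longrightarrow> h (- w) \<ge> 0)"
proof (rule nearest_chord[OF assms(1-3) _ assms(5,6)])
  fix x assume "x \<in> V" then show "- x \<in> V" using assms(4) by blast
next
  fix z and h :: "real^3 \<Rightarrow> real"
  assume z: "z \<in> S" "in_triangle (last W) m (hd W) z" "linear h" "h z = 0" "h m < 0" "free_chord (m # W) m z"
    "\<And>c d. c \<in> S \<Longrightarrow> d \<in> S \<Longrightarrow> npar c d \<Longrightarrow> npar c m \<Longrightarrow> npar d m \<Longrightarrow> \<not> crosses (last W) m c d \<Longrightarrow> \<not> crosses m (hd W) c d \<Longrightarrow> \<not> crosses m z c d"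
    "\<And>j w. z = - j \<Longrightarrow> (j, w) \<in> edges (m # W) \<or> (w, j) \<in> edges (m # W) \<Longrightarrow> w \<noteq> m \<Longrightarrow> h (- w) \<ge> 0"
  show ?thesis
    by (rule exI[of _ z], rule exI[of _ h], intro conjI allI impI) (rule z; assumption)+
qed

text \<open>By \<open>triangle_parity\<close> an edge that crosses the third side of an ear triangle
  without points of \<open>S\<close> would have to cross one of the other two sides, which are
  edges.\<close>

lemma empty_chord:
  assumes K: "generic V (m # W)" "length W \<ge> 3" "simple_pm (m # W)" and Vs: "\<forall>x\<in>V. - x \<in> V"
    and S: "S = set (m # W) \<union> uminus ` set (m # W)" and ex: "\<not> (\<exists>z\<in>S. in_triangle (last W) m (hd W) z)"
  shows "free_chord (m # W) (hd W) (last W)"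
proof -
  let ?x = "last W" and ?y = "hd W"
  have dd: "distinct (m # W)" using genericD(3)[OF K(1)] .
  have W: "W \<noteq> []" "?x \<in> set W" "?y \<in> set W" "?x \<noteq> ?y" using K(2) dd by (cases W; auto)+
  have SV: "S \<subseteq> V" unfolding S using K(1) Vs unfolding generic_def by auto
  have npar_vertices: "npar a b" if "a \<in> set (m # W)" "b \<in> set (m # W)" "a \<noteq> b" for a b using genericD(5)[OF K(1) that] .
  have E: "(m, ?y) \<in> edges (m # W)" "(?x, m) \<in> edges (m # W)" using edges_Cons[OF W(1), of m] by auto
  have ends_in_V: "?x \<in> V" "m \<in> V" "?y \<in> V" using SV W unfolding S by auto
  have mW: "?x \<noteq> m" "m \<noteq> ?y" using dd W(2,3) by (metis distinct.simps(2))+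
  have n3: "npar ?x m" "npar m ?y" "npar ?x ?y" by (rule npar_vertices; use W mW in simp)+
  have main: "\<not> crosses ?y ?x p q" if pq: "p \<in> S" "q \<in> S" "npar p q" "p \<notin> {?x, m, ?y}" "q \<notin> {?x, m, ?y}" "\<not> crosses ?x m p q" "\<not> crosses m ?y p q" for p q
  proof -
    have "(crosses ?x m p q \<noteq> (crosses m ?y p q \<noteq> crosses ?y ?x p q)) = (in_triangle ?x m ?y p \<noteq> in_triangle ?x m ?y q)"
      using pq SV ends_in_V n3 by (intro triangle_parity[OF genericD(1)[OF K(1)]]) auto
    then show ?thesis using pq ex by blast
  qed
  show ?thesis unfolding free_chord_def
  proof (clarify, intro conjI)
    fix c d assume cd: "(c, d) \<in> edges (m # W)"
    have cs: "c \<in> set (m # W)" "d \<in> set (m # W)" "c \<noteq> d" using edges_set[OF cd] edges_neq[OF dd _ cd] K(2) by auto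
    have em: "c = m \<or> d = m \<Longrightarrow> c \<in> {?x, ?y} \<or> d \<in> {?x, ?y}"
      using cd edges_Cons[OF W(1), of m] dd adj_set[of c d W] by auto
    show "\<not> crosses ?y ?x c d"
    proof (cases "c \<in> {?x, ?y} \<or> d \<in> {?x, ?y}")
      case True then show ?thesis by auto
    next
      case False
      then show ?thesis using em cs npar_vertices simpleD(2)[OF K(3) E(1) cd] simpleD(2)[OF K(3) E(2) cd] by (intro main) (auto simp: S)
    qed
    show "\<not> crosses ?y ?x (- c) (- d)"
    proof (cases "c \<in> {?x, ?y} \<or> d \<in> {?x, ?y}")
      case True then show ?thesis by auto
    next
      case False
      have ne: "- a \<noteq> b" if "a \<in> set (m # W)" "b \<in> set (m # W)" "a \<noteq> b" for a b using generic_neg(3)[OF K(1) that] .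
      show ?thesis
      proof (rule main)
        show "- c \<notin> {?x, m, ?y}" "- d \<notin> {?x, m, ?y}" using False em cs W ne[of c] ne[of d] by auto
      qed (use cs npar_vertices simpleD(3)[OF K(3) E(1) cd] simpleD(3)[OF K(3) E(2) cd] in \<open>auto simp: S\<close>)
    qed
  qed
qed

text \<open>Fewer than six changes are refuted in two steps: no free chord leaves a balanced part,
  since the induction hypothesis and \<open>free_chord_changes\<close> would give six; and a
  shortest free chord yields a point that is both inside and outside the part it cuts off.\<close>

theorem simple_pm_balanced_six:
  assumes Vs: "\<And>x. x \<in> V \<Longrightarrow> - x \<in> V"
  shows "generic V Q \<Longrightarrow> simple_pm Q \<Longrightarrow> balanced (set Q) \<Longrightarrow> length Q \<ge> 3 \<Longrightarrow> 6 \<le> cyclic_changes (cyclic_signs Q)"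
proof (induction "length Q" arbitrary: Q rule: less_induct)
  case less
  have Vs': "\<forall>x\<in>V. - x \<in> V" using Vs by blast
  note okQ = less.prems(1) and sQ = less.prems(2) and bQ = less.prems(3)
  have l4: "length Q \<ge> 4" using balanced_four[OF okQ less.prems(4) bQ] .
  have dQ: "distinct Q" using genericD(3)[OF okQ] .
  have VQ: "set Q \<subseteq> V" using okQ unfolding generic_def by auto
  show ?case
  proof (rule ccontr)
    assume n6: "\<not> 6 \<le> cyclic_changes (cyclic_signs Q)"
    define S where "S = set Q \<union> uminus ` set Q"
    have fr_rot: "free_chord (rotate n Q) = free_chord Q" for n unfolding free_chord_def edges_rotate by auto
    have ess: "balanced (set Q - {i})" if i: "i \<in> set Q" for i
    proof (rule ccontr)
      assume nb: "\<not> balanced (set Q - {i})"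
      obtain xs ys where s: "Q = xs @ i # ys" using i by (meson split_list)
      have r: "rotate (length xs) Q = i # ys @ xs" using s rotate_append[of xs "i # ys"] by simp
      have "6 \<le> cyclic_changes (cyclic_signs (i # ys @ xs))"
      proof (rule essential_vertex_six[OF _ _ Vs])
        have "set (ys @ xs) = set Q - {i}" using dQ s by auto
        then show "\<not> balanced (set (ys @ xs))" using nb by simp
        show "balanced (set (i # ys @ xs))" unfolding r[symmetric] using bQ by simp
      qed (use okQ sQ l4 s in \<open>auto simp: r[symmetric] generic_rotate simple_pm_rotate\<close>)
      then show False using n6 unfolding r[symmetric] cyclic_changes_rotate_polygon by simp
    qed
    have unb: "\<not> balanced (set (k # as @ [l]))" if R: "rotate n Q = k # as @ l # bs" "as \<noteq> []" "bs \<noteq> []" "free_chord Q k l" for n k as l bs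
    proof
      assume bA: "balanced (set (k # as @ [l]))"
      let ?R = "k # as @ l # bs"
      have okR: "generic V ?R" "simple_pm ?R" "balanced (set ?R)" "free_chord ?R k l" 
        unfolding R(1)[symmetric] generic_rotate simple_pm_rotate fr_rot using okQ sQ bQ R(4) by simp_all
      have dR: "distinct ?R" using genericD(3)[OF okR(1)] .
      have lR: "length Q = length ?R" unfolding R(1)[symmetric] by simp
      have "6 \<le> cyclic_changes (cyclic_signs (k # as @ [l]))"
      proof (rule less.hyps)
        show "generic V (k # as @ [l])" using okR(1) by (rule generic_subset) (use dR in auto)
        show "simple_pm (k # as @ [l])" by (rule simple_pm_split[OF okR(2,4) R(2,3)])
        show "length (k # as @ [l]) < length Q" using lR R(3) by (cases bs) auto
        show "3 \<le> length (k # as @ [l])" using R(2) by (cases as) auto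
      qed (rule bA)
      also have "\<dots> \<le> cyclic_changes (cyclic_signs ?R)"
      proof (rule free_chord_changes[OF okR(1) R(2,3) Vs okR(2,4,3)])
        assume bB: "balanced (set (l # bs @ [k]))"
        have rl: "l # bs @ k # as = rotate (length (k # as)) ?R" using rotate_append[of "k # as" "l # bs"] by simp
        show "6 \<le> cyclic_changes (cyclic_signs (l # bs @ [k]))"
        proof (rule less.hyps)
          show "generic V (l # bs @ [k])" using okR(1) by (rule generic_subset) (use dR in auto)
          show "simple_pm (l # bs @ [k])"
          proof (rule simple_pm_split)
            show "simple_pm (l # bs @ k # as)" unfolding rl simple_pm_rotate by (rule okR(2))
            show "free_chord (l # bs @ k # as) l k" unfolding rl using free_chord_sym[of ?R k l] okR(4) unfolding free_chord_def edges_rotate by simp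
          qed (use R in auto)
          show "length (l # bs @ [k]) < length Q" using lR R(2) by (cases as) auto
          show "3 \<le> length (l # bs @ [k])" using R(3) by (cases bs) auto
        qed (rule bB)
      qed
      also have "\<dots> = cyclic_changes (cyclic_signs Q)" unfolding R(1)[symmetric] by (rule cyclic_changes_rotate_polygon)
      finally show False using n6 by simp
    qed
    have rotP: "generic V (m # W)" "simple_pm (m # W)" "length W \<ge> 3" "S = set (m # W) \<union> uminus ` set (m # W)" "free_chord (m # W) = free_chord Q" "edges (m # W) = edges Q" "distinct (m # W)"
      if R: "rotate n Q = m # W" for n m W
    proof -
      show "generic V (m # W)" "simple_pm (m # W)" "free_chord (m # W) = free_chord Q" "edges (m # W) = edges Q" unfolding R[symmetric] generic_rotate simple_pm_rotate fr_rot edges_rotate using okQ sQ by simp_all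
      have "length (m # W) \<ge> 4" unfolding R[symmetric] using l4 by simp
      then show "length W \<ge> 3" by simp
      show "S = set (m # W) \<union> uminus ` set (m # W)" unfolding R[symmetric] S_def by simp
      show "distinct (m # W)" unfolding R[symmetric] using dQ by simp
    qed
    \<comment> \<open>Over an empty ear triangle the chord between the neighbours of
      \<open>m\<close> is free. It leaves all vertices but \<open>m\<close>, a balanced set by
      \<open>ess\<close>, contrary to \<open>unb\<close>.\<close>
    have ear: "\<exists>z\<in>S. in_triangle (last W) m (hd W) z" if R: "rotate n Q = m # W" for n m W
    proof (rule ccontr)
      assume nz: "\<not> ?thesis"
      note rp = rotP[OF R]
      have f: "free_chord Q (hd W) (last W)" using empty_chord[OF rp(1,3,2) Vs' rp(4) nz] unfolding rp(5) .
      obtain y W1 where W1: "W = y # W1" using rp(3) by (cases W) auto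
      obtain mid x where W2: "W1 = mid @ [x]" using rp(3) W1 by (cases W1 rule: rev_cases) auto
      have mid: "mid \<noteq> []" using rp(3) W1 W2 by auto
      have "rotate (Suc n) Q = y # mid @ x # [m]" using R W1 W2 by simp
      then have "\<not> balanced (set (y # mid @ [x]))" by (rule unb) (use mid f W1 W2 in auto)
      moreover have "set (y # mid @ [x]) = set Q - {m}"
      proof -
        have "set Q = set (m # W)" using R by (metis set_rotate)
        then show ?thesis using rp(7) W1 W2 by auto
      qed
      moreover have "m \<in> set Q" using R by (metis list.set_intros(1) set_rotate)
      ultimately show False using ess by simp
    qed
    have chord_of: "\<exists>k as l bs. rotate n Q = k # as @ l # bs \<and> as \<noteq> [] \<and> bs \<noteq> [] \<and> free_chord Q k l"
      if R: "rotate n Q = m # W" and z: "z \<in> set Q" "in_triangle (last W) m (hd W) z" "free_chord (m # W) m z" for n m W z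
    proof -
      note rp = rotP[OF R]
      have "z \<noteq> m" "z \<noteq> hd W" "z \<noteq> last W" using z(2) unfolding in_triangle_def by auto
      moreover have "z \<in> set (m # W)" using z(1) R by (metis set_rotate)
      ultimately obtain c1 c2 where W: "W = c1 @ z # c2" by (metis set_ConsD split_list)
      have "c1 \<noteq> []" "c2 \<noteq> []" using W \<open>z \<noteq> hd W\<close> \<open>z \<noteq> last W\<close> by auto
      then show ?thesis using R W z(3) unfolding rp(5) by blast
    qed
    have negW: "\<exists>j. z = - j \<and> j \<in> set W \<and> j \<noteq> hd W \<and> j \<noteq> last W" if R: "rotate n Q = m # W" and z: "z \<in> S" "z \<notin> set Q" "in_triangle (last W) m (hd W) z" for n m W z
    proof -
      obtain j where j: "z = - j" "j \<in> set Q" using z(1,2) unfolding S_def by auto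
      have "j \<noteq> m" "j \<noteq> hd W" "j \<noteq> last W" using z(3) unfolding in_triangle_def j by auto
      moreover have "j \<in> set (m # W)" using j(2) R by (metis set_rotate)
      ultimately show ?thesis using j by auto
    qed
    have polygon_side_neg: "polygon_side (m # W) (- a) = polygon_side (m # W) (- b)" if R: "rotate n Q = m # W" and ab: "a \<in> set W" "b \<in> set W" for n m W a b
      using polygon_side_neg_const[OF rotP(1,2)[OF R] _ Vs ab] rotP(3)[OF R] by simp
    \<comment> \<open>If the nearest point at \<open>m\<close> is an antipode \<open>- j\<close>,
      the search is repeated at \<open>j\<close>. Should it end at an antipode \<open>- l\<close>
      again, then \<open>- l\<close> is inside at \<open>j\<close> and \<open>- m\<close> is
      outside, although all antipodes of vertices lie on one side.\<close>
    have ex_chord: "\<exists>n k as l bs. rotate n Q = k # as @ l # bs \<and> as \<noteq> [] \<and> bs \<noteq> [] \<and> free_chord Q k l"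
    proof -
      obtain m W where R: "rotate 0 Q = m # W" using l4 by (cases Q) auto
      note rp = rotP[OF R]
      obtain z h where z: "z \<in> S" "in_triangle (last W) m (hd W) z" "linear h" "h z = (0::real)" "h m < 0" "free_chord (m # W) m z"
        "\<forall>j w. z = - j \<longrightarrow> (j, w) \<in> edges (m # W) \<or> (w, j) \<in> edges (m # W) \<longrightarrow> w \<noteq> m \<longrightarrow> h (- w) \<ge> 0"
        using nearest_chord_ex[OF rp(1,3,2) Vs' rp(4) ear[OF R]] by (elim exE conjE) (rule that; assumption)
      show ?thesis
      proof (cases "z \<in> set Q")
        case True then show ?thesis using chord_of[OF R True z(2,6)] by blast
      next
        case False
        obtain j where j: "z = - j" "j \<in> set W" "j \<noteq> hd W" "j \<noteq> last W" using negW[OF R z(1) False z(2)] by blast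
        obtain a b where W: "W = a @ j # b" using j(2) by (meson split_list)
        have ab: "a \<noteq> []" "b \<noteq> []" using j W by auto
        define W' where "W' = b @ m # a"
        have R': "rotate (length (m # a)) Q = j # W'" using R W rotate_append[of "m # a" "j # b"] unfolding W'_def by simp
        note rp' = rotP[OF R']
        obtain z' h' where z': "z' \<in> S" "in_triangle (last W') j (hd W') z'" "linear h'" "h' z' = (0::real)" "h' j < 0" "free_chord (j # W') j z'"
          using nearest_chord_ex[OF rp'(1,3,2) Vs' rp'(4) ear[OF R']] by (elim exE conjE) (rule that; assumption)
        show ?thesis
        proof (cases "z' \<in> set Q")
          case True then show ?thesis using chord_of[OF R' True z'(2,6)] by blast
        next
          case F': False
          obtain l where l: "z' = - l" "l \<in> set W'" using negW[OF R' z'(1) F' z'(2)] by blast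
          have W'ne: "W' \<noteq> []" unfolding W'_def by simp
          have hW: "hd W' = hd b" "last W' = last a" unfolding W'_def using ab by auto
          have hm: "hd W' \<noteq> m" "last W' \<noteq> m" "hd W' \<in> set W'" "last W' \<in> set W'" "hd W' \<noteq> last W'"
          proof -
            show "hd W' \<in> set W'" "last W' \<in> set W'" using W'ne by auto
            have "hd b \<in> set b" "last a \<in> set a" using ab by auto
            then show "hd W' \<noteq> m" "last W' \<noteq> m" "hd W' \<noteq> last W'" unfolding hW using rp(7) W by auto
          qed
          have adjW: "adj W' \<subseteq> edges (j # W')" "(j, hd W') \<in> edges (j # W')" "(last W', j) \<in> edges (j # W')" using edges_Cons[OF W'ne, of j] by auto
          have ee: "edges (j # W') = edges (m # W)" unfolding rp(6) rp'(6) ..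
          have 1: "polygon_side (j # W') z' \<longleftrightarrow> det3 (last W') j (hd W') > 0"
            using polygon_side_inside[OF W'ne z'(2)] free_chordD(1)[OF z'(6)] adjW by blast
          \<comment> \<open>Under the antipodal map the free chord from \<open>m\<close> to
            \<open>- j\<close> becomes one from \<open>- m\<close> to \<open>j\<close>, and
            \<open>- h\<close> is a supporting functional at \<open>j\<close> that is negative at
            \<open>- m\<close>.\<close>
          have 2: "polygon_side (j # W') (- m) \<longleftrightarrow> \<not> det3 (last W') j (hd W') > 0"
          proof -
            have "\<not> crossing_parity j (- m) W'"
            proof (rule crossing_parity_free)
              fix c d assume "(c, d) \<in> adj W'"
              then have "(c, d) \<in> edges (m # W)" using adjW ee by auto
              then have "\<not> crosses m z (- c) (- d)" using free_chordD(2)[OF z(6)] by blast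
              then show "\<not> crosses j (- m) c d" unfolding j(1) using crosses_minus[of j "- m" c d] crosses_sym(1)[of m "- j"] by simp
            qed
            moreover have "ccw j (hd W') (- m) (last W') \<longleftrightarrow> \<not> det3 (last W') j (hd W') > 0"
            proof (rule ccw_outside[of "\<lambda>x. - h x"])
              have hn: "h (- x) = - h x" for x using z(3) by (simp add: linear_neg)
              show "linear (\<lambda>x. - h x)" using z(3) by (rule linear_compose_neg)
              show "- h j = 0" using z(4) hn unfolding j(1) by simp
              show "- h (- m) < 0" using z(5) hn by simp
              show "0 \<le> - h (hd W')" "0 \<le> - h (last W')" using z(7)[rule_format, OF j(1), of "hd W'"] z(7)[rule_format, OF j(1), of "last W'"] hm adjW ee hn by auto
              show "det3 j (hd W') (last W') \<noteq> 0" using hm rp'(7) by (intro generic_det[OF rp'(1)]) auto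
            qed
            ultimately show ?thesis using W'ne by (simp add: polygon_side_def)
          qed
          have "m \<in> set W'" unfolding W'_def by simp
          then have "polygon_side (j # W') (- m) = polygon_side (j # W') (- l)" using l(2) by (intro polygon_side_neg[OF R'])
          then show ?thesis using 1 2 l(1) by simp
        qed
      qed
    qed
    \<comment> \<open>The free chord is chosen with as few vertices as possible on the arc
      \<open>as\<close>. Rotations are quantified over, so either arc of any free chord
      competes.\<close>
    define P where "P N \<longleftrightarrow> (\<exists>n k as l bs. rotate n Q = k # as @ l # bs \<and> as \<noteq> [] \<and> bs \<noteq> [] \<and> free_chord Q k l \<and> length as = N)" for N
    have "\<exists>N. P N" unfolding P_def using ex_chord by blast
    then have PL: "P (LEAST N. P N)" by (rule LeastI_ex)
    then obtain n k as l bs where R: "rotate n Q = k # as @ l # bs" "as \<noteq> []" "bs \<noteq> []" "free_chord Q k l" and lN: "length as = (LEAST N. P N)"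
      unfolding P_def by blast
    have min: False if "rotate n' Q = k' # as' @ l' # bs'" "as' \<noteq> []" "bs' \<noteq> []" "free_chord Q k' l'" "length as' < length as" for n' k' as' l' bs'
    proof -
      have "P (length as')" unfolding P_def using that by blast
      then show False using that(5) not_less_Least[of "length as'" P] lN by simp
    qed
    have okR: "generic V (k # as @ l # bs)" using okQ R(1) generic_rotate by metis
    have dR: "distinct (k # as @ l # bs)" using genericD(3)[OF okR] .
    have okA: "generic V (k # as @ [l])" using okR by (rule generic_subset) (use dR in auto)
    have lA: "length (k # as @ [l]) \<ge> 3" using R(2) by (cases as) auto
    obtain v :: "real^3 \<Rightarrow> real" where v: "linear v" "\<And>x. x \<in> set (k # as @ [l]) \<Longrightarrow> v x > 0"
      using unbalanced_strict[OF okA lA unb[OF R]] by blast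
    \<comment> \<open>By \<open>unb\<close> the part cut off lies in an open hemisphere, so it has a
      hull vertex away from the chord.\<close>
    obtain m g where m: "m \<in> set as" "linear g" "g m = (0::real)" "\<And>x. x \<in> set (k # as @ [l]) \<Longrightarrow> g x \<ge> 0" "g k > 0" "g l > 0"
      using hull_vertex[OF okA R(2) v] by blast
    obtain a1 a2 where as: "as = a1 @ m # a2" using m(1) by (meson split_list)
    define W where "W = a2 @ l # bs @ k # a1"
    define WA where "WA = a2 @ l # k # a1"
    have RR: "rotate (length (k # a1) + n) Q = m # W"
      using R(1) rotate_append[of "k # a1" "m # a2 @ l # bs"] unfolding W_def as rotate_rotate[symmetric] by simp
    note rp = rotP[OF RR]
    have lasts: "last W = last (k # a1)" "last WA = last (k # a1)" "hd W = hd (a2 @ [l])" "hd WA = hd (a2 @ [l])" "W \<noteq> []" "WA \<noteq> []"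
      unfolding W_def WA_def by (auto simp: hd_append)
    obtain z h where z: "z \<in> S" "in_triangle (last W) m (hd W) z" "linear h" "h z = (0::real)" "h m < 0" "free_chord (m # W) m z"
        and z7: "\<forall>c d. c \<in> S \<longrightarrow> d \<in> S \<longrightarrow> npar c d \<longrightarrow> npar c m \<longrightarrow> npar d m \<longrightarrow> \<not> crosses (last W) m c d \<longrightarrow> \<not> crosses m (hd W) c d \<longrightarrow> \<not> crosses m z c d"
      using nearest_chord_ex[OF rp(1,3,2) Vs' rp(4) ear[OF RR]] by (elim exE conjE) (rule that; assumption)
    have zne: "z \<noteq> m" "z \<noteq> hd (a2 @ [l])" "z \<noteq> last (k # a1)" using z(2) unfolding lasts in_triangle_def by auto
    have fz: "free_chord Q m z" using z(6) unfolding rp(5) .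
    have setQ: "set Q = set (k # as @ l # bs)" using R(1) by (metis set_rotate)
    \<comment> \<open>A nearest point \<open>z\<close> among the vertices of the part cut off would
      be the end of a free chord from \<open>m\<close> with fewer vertices behind it;
      \<open>n2\<close> is the same on the other arc.\<close>
    have n1: "z \<notin> set (a2 @ [l])"
    proof
      assume "z \<in> set (a2 @ [l])"
      then obtain c1 c2 where c: "a2 @ [l] = c1 @ z # c2" by (meson split_list)
      have "c1 \<noteq> []" using c zne(2) by (metis append_Nil list.sel(1))
      moreover have "m # W = m # c1 @ z # (c2 @ bs @ k # a1)"
      proof -
        have "W = (a2 @ [l]) @ bs @ k # a1" unfolding W_def by simp
        then show ?thesis unfolding c by simp
      qed
      moreover have "length c1 < length as" using arg_cong[OF c, of length] unfolding as by simp
      ultimately show False using min[of "length (k # a1) + n" m c1 z "c2 @ bs @ k # a1"] RR fz by simp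
    qed
    have n2: "z \<notin> set (k # a1)"
    proof
      assume "z \<in> set (k # a1)"
      then obtain c1 c2 where c: "k # a1 = c1 @ z # c2" by (meson split_list)
      have ne: "c2 \<noteq> []" using c zne(3) by auto
      have "rotate n Q = (k # a1) @ m # a2 @ l # bs" using R(1) as by simp
      then have "rotate n Q = c1 @ (z # c2 @ m # a2 @ l # bs)" unfolding c by simp
      then have "rotate (length c1 + n) Q = z # c2 @ m # (a2 @ l # bs @ c1)" using rotate_append[of c1 "z # c2 @ m # a2 @ l # bs"] by (simp add: rotate_rotate[symmetric])
      moreover have "length c2 < length as" using arg_cong[OF c, of length] unfolding as by simp
      ultimately show False using min[of "length c1 + n" z c2 m "a2 @ l # bs @ c1"] ne fz free_chord_sym by auto
    qed
    have adjWA: "adj WA = adj (a2 @ [l]) \<union> {(l, k)} \<union> adj (k # a1)"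
      unfolding WA_def using adj_mid[of a2 l "k # a1"] adj_Cons[of "k # a1" l] by auto
    have adjW: "adj (a2 @ [l]) \<subseteq> adj W" "adj (k # a1) \<subseteq> adj W" "adj bs \<subseteq> adj W"
    proof -
      have "adj W = adj (a2 @ [l]) \<union> adj (l # bs @ k # a1)" unfolding W_def by (rule adj_mid)
      moreover have "adj (l # bs @ k # a1) = adj (l # bs) \<union> {(last (l # bs), k)} \<union> adj (k # a1)" using adj_append[of "l # bs" "k # a1"] by simp
      moreover have "adj bs \<subseteq> adj (l # bs)" using adj_Cons[OF R(3), of l] by auto
      ultimately show "adj (a2 @ [l]) \<subseteq> adj W" "adj (k # a1) \<subseteq> adj W" "adj bs \<subseteq> adj W" by auto
    qed
    have eW: "edges (m # W) = {(m, hd W), (last W, m)} \<union> adj W" using edges_Cons[OF lasts(5), of m] .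
    have eWA: "(e, f) \<in> edges (m # W) \<or> (e, f) = (l, k)" if "(e, f) \<in> edges (m # WA)" for e f
    proof -
      have "hd WA = hd W" "last WA = last W" by (simp_all only: lasts)
      then have eK: "edges (m # WA) = {(m, hd W), (last W, m)} \<union> adj WA" using edges_Cons[OF lasts(6), of m] by simp
      show ?thesis using that adjW unfolding eK adjWA eW by blast
    qed
    have fkl: "\<not> crosses c d l k" "\<not> crosses (- c) (- d) l k" if "(c, d) \<in> edges (m # W)" for c d
    proof -
      have cd: "(c, d) \<in> edges Q" using that rp(6) by simp
      have f: "free_chord Q l k" using R(4) free_chord_sym by blast
      show "\<not> crosses c d l k" using free_chordD(1)[OF f cd] crosses_sym(3)[of c d l k] by simp
      show "\<not> crosses (- c) (- d) l k" using free_chordD(2)[OF f cd] crosses_sym(3)[of "- c" "- d" l k] by simp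
    qed
    have okK: "generic V (m # WA)" using okR by (rule generic_subset) (use dR in \<open>auto simp: WA_def as\<close>)
    have lW: "length WA \<ge> 2" unfolding WA_def by simp
    \<comment> \<open>\<open>z\<close> is inside the part cut off, whose vertices from
      \<open>m\<close> on are \<open>m # WA\<close>. The chord from \<open>m\<close> to
      \<open>z\<close> also avoids the new edge between \<open>l\<close> and \<open>k\<close>, by
      the extra conclusion \<open>z7\<close>, because that edge crosses neither side of the
      ear.\<close>
    have in1: "polygon_side (m # WA) z \<longleftrightarrow> det3 (last W) m (hd W) > 0"
    proof -
      have "\<not> crosses m z c d" if "(c, d) \<in> adj WA" for c d
      proof -
        from that consider "(c, d) \<in> edges (m # W)" | "c = l" "d = k" unfolding adjWA eW using adjW by blast
        then show ?thesis
        proof cases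
          case 1 then show ?thesis using free_chordD(1)[OF z(6)] by blast
        next
          case 2
          have ks: "l \<in> set (m # W)" "k \<in> set (m # W)" "l \<noteq> k" "l \<noteq> m" "k \<noteq> m" "m \<in> set (m # W)" unfolding W_def using dR as by auto
          show ?thesis unfolding 2
          proof (rule z7[rule_format])
            show "npar l k" "npar l m" "npar k m" using genericD(5)[OF rp(1)] ks by blast+
            show "l \<in> S" "k \<in> S" unfolding rp(4) using ks by blast+
            show "\<not> crosses (last W) m l k" "\<not> crosses m (hd W) l k" by (rule fkl; simp add: eW)+
          qed
        qed
      qed
      then show ?thesis using polygon_side_inside[of WA m z] z(2) lasts by metis
    qed
    have out1: "polygon_side (m # WA) y \<longleftrightarrow> \<not> det3 (last W) m (hd W) > 0" if "g y < 0" for y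
    proof -
      have "polygon_side (m # WA) y \<longleftrightarrow> \<not> det3 (last WA) m (hd WA) > 0"
        by (rule polygon_side_outside[OF okK lW m(2,3) _ that]) (use m(4) as in \<open>auto simp: WA_def\<close>)
      then show ?thesis unfolding lasts .
    qed
    show False
    proof (cases "z \<in> set Q")
      case True
      then have zb: "z \<in> set bs" using n1 n2 zne(1) unfolding setQ as by auto
      \<comment> \<open>Balance gives a vertex outside the part cut off. It lies on
        \<open>bs\<close> like \<open>z\<close>, and \<open>bs\<close> does not meet that
        part.\<close>
      obtain y where y: "y \<in> set Q" "g y < 0" using balanced_linear[OF bQ m(2), of k] m(5) by auto
      have yb: "y \<in> set bs" using y m(4)[of y] unfolding setQ by auto
      have "polygon_side (m # WA) z = polygon_side (m # WA) y"
      proof (rule polygon_side_const[OF okK lW _ _ _ _ _ _ zb yb])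
        fix c d e f assume cd: "(c, d) \<in> adj bs" "(e, f) \<in> adj (m # WA @ [m])"
        have "(c, d) \<in> edges (m # W)" using cd(1) adjW eW by auto
        moreover have "(e, f) \<in> edges (m # WA)" using cd(2) unfolding edges_def by simp
        ultimately show "\<not> crosses c d e f" using eWA[of e f] simpleD(2)[OF rp(2), of c d e f] fkl(1)[of c d] by auto
      next
        show "- m \<notin> set bs"
        proof
          assume "- m \<in> set bs"
          then have "- m \<in> set (k # as @ l # bs)" by simp
          then show False using generic_neg_notin[OF okR, of m] m(1) R(2) by (cases as) auto
        qed
        show "set bs \<subseteq> V" using okR unfolding generic_def by auto
        show "pairwise_npar (set bs)" using genericD(4)[OF okR] by (rule pairwise_npar_subset) auto
        show "set bs \<inter> set (m # WA) = {}" "distinct bs" using dR as unfolding WA_def by auto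
      qed
      then show False using in1 out1[OF y(2)] by simp
    next
      case False
      obtain j where j: "z = - j" "j \<in> set W" using negW[OF RR z(1) False z(2)] by blast
      have nn: "- x \<notin> set (m # W)" if "x \<in> set (m # W)" for x using generic_neg_notin[OF rp(1) _ that] rp(3) by auto
      have sub: "set WA \<subseteq> set W" unfolding WA_def W_def by auto
      have kW: "k \<in> set W" unfolding W_def by simp
      \<comment> \<open>Now \<open>z\<close> is the antipode \<open>- j\<close>. The antipodal path
        joins it to \<open>- k\<close>, which is outside because \<open>g\<close> is positive at
        \<open>k\<close>.\<close>
      have "polygon_side (m # WA) (- j) = polygon_side (m # WA) (- k)"
      proof (rule polygon_side_const[OF okK lW, where zs = "map uminus W"])
        fix c d e f assume cd: "(c, d) \<in> adj (map uminus W)" "(e, f) \<in> adj (m # WA @ [m])"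
        obtain c' d' where c': "c = - c'" "d = - d'" "(c', d') \<in> adj W" using cd(1) unfolding adj_map by auto
        have c'e: "(c', d') \<in> edges (m # W)" using c'(3) eW by auto
        have "(e, f) \<in> edges (m # WA)" using cd(2) unfolding edges_def by simp
        then show "\<not> crosses c d e f" using eWA[of e f] simpleD(3)[OF rp(2) _ c'e, of e f] fkl(2)[OF c'e] crosses_sym(3)[of c d e f] c' by auto
      next
        show "set (map uminus W) \<inter> set (m # WA) = {}" using nn sub by auto
        show "- m \<notin> set (map uminus W)" using rp(7) by auto
        show "set (map uminus W) \<subseteq> V" using rp(1) Vs unfolding generic_def by auto
        show "distinct (map uminus W)" using rp(7) by (simp add: distinct_map inj_on_def)
        have "pairwise_npar (set W)" using genericD(4)[OF rp(1)] by (rule pairwise_npar_subset) auto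
        then show "pairwise_npar (set (map uminus W))" unfolding pairwise_npar_def by auto
        show "- j \<in> set (map uminus W)" "- k \<in> set (map uminus W)" using j(2) kW by auto
      qed
      moreover have "g (- k) < 0" using m(2,5) by (simp add: linear_neg)
      ultimately show False using in1 out1[of "- k"] j(1) by simp
    qed
  qed
qed

section \<open>Embedded polygons that turn in one direction only\<close>

lemma set_cyclic_signs_rotate: "set (cyclic_signs (rotate n Q)) = set (cyclic_signs Q)"
proof -
  have "set (cyclic_signs (xs @ ys)) = set (cyclic_signs (ys @ xs))" for xs ys :: "(real^3) list"
    by (cases "xs = []"; cases "ys = []") (auto simp: cyclic_signs_append)
  from this[of "drop (n mod length Q) Q" "take (n mod length Q) Q"] show ?thesis unfolding rotate_drop_take by simp
qed

definition convex_poly :: "(real^3) list \<Rightarrow> bool" where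
  "convex_poly Q \<longleftrightarrow> (\<forall>(a, b)\<in>edges Q. \<forall>x\<in>set Q. x \<noteq> a \<longrightarrow> x \<noteq> b \<longrightarrow> det3 a b x > 0)"

lemma convex_polyD: "convex_poly Q \<Longrightarrow> (a, b) \<in> edges Q \<Longrightarrow> x \<in> set Q \<Longrightarrow> x \<noteq> a \<Longrightarrow> x \<noteq> b \<Longrightarrow> det3 a b x > 0"
  unfolding convex_poly_def by blast

lemma convex_poly_rotate: "convex_poly (rotate n Q) = convex_poly Q"
  unfolding convex_poly_def edges_rotate by simp

lemma edges_next: "x \<in> set Q \<Longrightarrow> \<exists>y. (x, y) \<in> edges Q"
proof -
  assume "x \<in> set Q"
  then obtain a b where Q: "Q = a @ x # b" by (meson split_list)
  then have "edges Q = adj (a @ [x]) \<union> adj (x # b @ [hd Q])" unfolding edges_def using adj_mid[of a x "b @ [hd Q]"] by simp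
  then show ?thesis by (cases b) auto
qed

text \<open>Cutting off an empty ear keeps the polygon embedded and all turns positive, so
  \<open>IH\<close> makes the rest convex. The position of the tip \<open>j\<close> relative to the
  other edges, and of the other vertices relative to the edges at \<open>j\<close>, then follows
  from sign relations.\<close>

lemma convex_ear:
  assumes K: "generic V (k # j # l # bs)" "bs \<noteq> []" "simple (k # j # l # bs)" "\<forall>s\<in>set (cyclic_signs (k # j # l # bs)). s"
    and em: "\<And>x. x \<in> set bs \<Longrightarrow> \<not> in_triangle k j l x"
    and IH: "generic V (k # l # bs) \<Longrightarrow> simple (k # l # bs) \<Longrightarrow> \<forall>s\<in>set (cyclic_signs (k # l # bs)). s \<Longrightarrow> convex_poly (k # l # bs)"
  shows "convex_poly (k # j # l # bs)"
proof -
  let ?Q = "k # j # l # bs" and ?Q' = "k # l # bs" and ?h = "hd bs" and ?t = "last bs"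
  have dd: "distinct ?Q" using genericD(3)[OF K(1)] .
  have ht: "?h \<in> set bs" "?t \<in> set bs" using K(2) by auto
  have okQ': "generic V ?Q'" using K(1) by (rule generic_subset) (use dd in auto)
  have npar_vertices: "npar a b" if "a \<in> set ?Q" "b \<in> set ?Q" "a \<noteq> b" for a b using genericD(5)[OF K(1) that] .
  have VQ: "set ?Q \<subseteq> V" using K(1) unfolding generic_def by auto
  have gV: "general_position V" using genericD(1)[OF K(1)] .
  have csgQ: "cyclic_signs ?Q = (det3 ?t k j > 0) # turn_signs [k, j, l] @ (det3 j l ?h > 0) # turn_signs (l # bs @ [k])"
    using cyclic_signs_split[of "[j]" bs k l] K(2) by simp
  have sg: "det3 ?t k j > 0" "det3 k j l > 0" "det3 j l ?h > 0" "\<forall>s\<in>set (turn_signs (l # bs @ [k])). s"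
    using K(4) unfolding csgQ by auto
  have eQ: "edges ?Q = {(k, j), (j, l)} \<union> adj (l # bs @ [k])" using edges_split(1)[of "[j]" bs k l] K(2) by auto
  have abs: "adj (l # bs @ [k]) = insert (l, ?h) (insert (?t, k) (adj bs))"
    using adj_Cons[of "bs @ [k]" l] adj_append[of bs "[k]"] K(2) by auto
  have eQ': "edges ?Q' = insert (k, l) (adj (l # bs @ [k]))" unfolding edges_def by simp
  have inQ: "k \<in> set ?Q" "j \<in> set ?Q" "l \<in> set ?Q" by auto
  have jn: "j \<noteq> k" "j \<noteq> l" "k \<noteq> l" "j \<notin> set bs" "k \<notin> set bs" "l \<notin> set bs" using dd by auto
  have free: "\<not> crosses k l c d" if cd: "(c, d) \<in> edges ?Q" for c d
  proof (cases "c \<in> {k, l} \<or> d \<in> {k, l}")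
    case True then show ?thesis by auto
  next
    case False
    then have cb: "c \<in> set bs" "d \<in> set bs" "c \<noteq> d" using cd adj_set[of c d bs] adj_neq[of bs c d] dd unfolding eQ abs by auto
    have "(crosses k j c d \<noteq> (crosses j l c d \<noteq> crosses l k c d)) = (in_triangle k j l c \<noteq> in_triangle k j l d)"
      by (rule triangle_parity[OF gV]) (use cb VQ jn npar_vertices[OF inQ(1,2)] npar_vertices[OF inQ(2,3)] npar_vertices[OF inQ(1,3)] npar_vertices[of c d] in auto)
    moreover have "\<not> crosses k j c d" "\<not> crosses j l c d" using simpleD(1)[OF K(3) _ cd] eQ by auto
    ultimately show ?thesis using em cb crosses_sym(1)[of k l] by blast
  qed
  have sQ': "simple ?Q'" unfolding simple_def
  proof (clarify)
    fix a b c d assume a: "(a, b) \<in> edges ?Q'" "(c, d) \<in> edges ?Q'" "crosses a b c d"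
    have 1: "(a, b) = (k, l) \<or> (a, b) \<in> edges ?Q" "(c, d) = (k, l) \<or> (c, d) \<in> edges ?Q" using a unfolding eQ' eQ by auto
    show False
    proof (cases "(a, b) = (k, l)")
      case True then show ?thesis using 1(2) free a(3) by auto
    next
      case False then show ?thesis using 1 free[of a b] a(3) simpleD(1)[OF K(3), of a b c d] crosses_sym(3)[of a b c d] by auto
    qed
  qed
  define t where "t = ccw k j ?t l"
  have t2: "ccw l k ?h j = t"
  proof -
    have "ccw l k (hd bs) (last [j]) = ccw k (hd [j]) (last bs) l"
    proof (rule chord_side[of V])
      show "generic V (k # [j] @ l # bs)" using K(1) by simp
      fix c d e f assume cd: "(c, d) \<in> adj (k # [j] @ [l])" "(e, f) \<in> adj (l # bs)"
      have "(e, f) \<in> edges ?Q" using cd(2) adj_append[of "l # bs" "[k]"] unfolding eQ by auto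
      moreover have "(c, d) \<in> edges ?Q" using cd(1) unfolding eQ by auto
      ultimately show "\<not> crosses c d e f" using simpleD(1)[OF K(3)] by blast
    next
      fix e f assume "(e, f) \<in> adj bs" then show "\<not> crosses k l e f" using free unfolding eQ abs by auto
    next
      fix c d assume "(c, d) \<in> adj ([j] @ [l])"
      then have "(c, d) \<in> edges ?Q" "(?t, k) \<in> edges ?Q" unfolding eQ abs by auto
      then show "\<not> crosses k (last bs) c d" using simpleD(1)[OF K(3), of ?t k c d] crosses_sym(1) by blast
    qed (use K(2) in auto)
    then show ?thesis unfolding t_def by simp
  qed
  \<comment> \<open>Otherwise \<open>?t\<close> would be seen from \<open>k\<close> in the angle of
    the ear. Then it would lie in the ear, or the edge from \<open>?t\<close> to \<open>k\<close>
    would cross the edge from \<open>j\<close> to \<open>l\<close>.\<close>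
  have nt: "\<not> t"
  proof
    assume t: t
    have E: "(j, l) \<in> edges ?Q" "(?t, k) \<in> edges ?Q" unfolding eQ abs by auto
    have "(crosses j l k ?t \<noteq> in_triangle k j l ?t) = in_wedge k j l ?t"
      by (rule triangle_parity_vertex[OF gV]) (use ht VQ jn npar_vertices[OF inQ(1,2)] npar_vertices[OF inQ(2,3)] npar_vertices[OF inQ(1,3)] npar_vertices[of k ?t] in auto)
    moreover have "\<not> crosses j l k ?t" using simpleD(1)[OF K(3) E] crosses_sym(2) by blast
    ultimately have "\<not> in_wedge k j l ?t" using em ht by blast
    moreover have "det3 k j ?t > 0" using sg(1) det3_rot[of k j ?t] by simp
    ultimately have "\<not> det3 k ?t l > 0" unfolding in_wedge_def using sg(2) by auto
    moreover have "\<not> det3 k l j > 0" using sg(2) det3_swap'(1)[of k j l] by linarith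
    ultimately show False using t unfolding t_def ccw_def by auto
  qed
  have kj: "det3 k j ?t > 0" "det3 l ?h j > 0" using sg(1,3) det3_rot[of k j ?t] det3_rot[of l ?h j] by auto
  have k1: "det3 k ?t l < 0" 
  proof -
    have "det3 k ?t l \<noteq> 0" using ht jn by (intro generic_det[OF K(1)]) auto
    moreover have "\<not> det3 k ?t l > 0" using nt kj unfolding t_def ccw_def by auto
    ultimately show ?thesis by linarith
  qed
  have l1: "det3 l k ?h < 0" 
  proof -
    have "det3 l k ?h \<noteq> 0" using ht jn by (intro generic_det[OF K(1)]) auto
    moreover have "\<not> det3 l k ?h > 0" using nt kj unfolding t2[symmetric] ccw_def by auto
    ultimately show ?thesis by linarith
  qed
  have sQ: "\<forall>s\<in>set (cyclic_signs ?Q'). s"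
  proof -
    obtain b bs' where b: "bs = b # bs'" using K(2) by (cases bs) auto
    have "cyclic_signs ?Q' = (det3 ?t k l > 0) # (det3 k l ?h > 0) # turn_signs (l # bs @ [k])" unfolding cyclic_signs_def using b by simp
    moreover have "det3 ?t k l > 0" using k1 det3_swap[of k ?t l] by linarith
    moreover have "det3 k l ?h > 0" using l1 det3_swap[of k l ?h] by linarith
    ultimately show ?thesis using sg(4) by auto
  qed
  note cv = convex_polyD[OF IH[OF okQ' sQ' sQ]]
  have klx: "det3 k l x > 0" if "x \<in> set bs" for x using cv[of k l x] that jn unfolding eQ' by auto
  have c1: "det3 l x j > 0" if x: "x \<in> set bs" for x
  proof (cases "x = ?h")
    case True then show ?thesis using kj by simp
  next
    case False
    have e: "(l, ?h) \<in> edges ?Q'" unfolding eQ' abs by simp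
    have p: "det3 l ?h x > 0" "det3 l ?h k > 0" using cv[OF e] x False jn ht by auto
    have "det3 l k x < 0" using klx[OF x] det3_swap[of k l x] by linarith
    moreover have "det3 l k j > 0" using sg(2) det3_perms[where x=k and y=j and z=l] by linarith
    ultimately have "det3 l ?h x * det3 l k j > 0" "det3 l ?h j * det3 l k x < 0" using p kj by (auto simp: mult_pos_neg)
    then have "det3 l ?h k * det3 l x j > 0" using grassmann[of l ?h k x j] by linarith
    then show ?thesis using p(2) by (simp add: zero_less_mult_iff)
  qed
  have c2: "det3 k x j < 0" if x: "x \<in> set bs" for x
  proof (cases "x = ?t")
    case True then show ?thesis using kj det3_swap'(1)[of k j ?t] by simp
  next
    case False
    have e: "(?t, k) \<in> edges ?Q'" unfolding eQ' abs by simp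
    have p: "det3 ?t k x > 0" "det3 ?t k l > 0" using cv[OF e] x False jn ht by auto
    then have p: "det3 k ?t x < 0" "det3 k ?t l < 0" using det3_swap[of k ?t x] det3_swap[of k ?t l] by linarith+
    have "det3 k l j < 0" using sg(2) det3_perms[where x=k and y=j and z=l] by linarith
    moreover have "det3 k ?t j < 0" using kj det3_swap'(1)[of k j ?t] by simp
    ultimately have "det3 k ?t x * det3 k l j > 0" "det3 k ?t j * det3 k l x < 0" using p klx[OF x] by (auto simp: mult_neg_neg mult_neg_pos)
    then have "det3 k ?t l * det3 k x j > 0" using grassmann[of k ?t l x j] by linarith
    then show ?thesis using p(2) by (simp add: zero_less_mult_iff)
  qed
  show ?thesis unfolding convex_poly_def
  proof (clarify)
    fix a b x assume ab: "(a, b) \<in> edges ?Q" and x: "x \<in> set ?Q" "x \<noteq> a" "x \<noteq> b"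
    consider (1) "a = k" "b = j" | (2) "a = j" "b = l" | (3) "(a, b) \<in> adj (l # bs @ [k])" using ab unfolding eQ by auto
    then show "det3 a b x > 0"
    proof cases
      case 1
      then have "x = l \<or> x \<in> set bs" using x by auto
      then show ?thesis using 1 sg(2) c2[of x] det3_swap'(1)[of k x j] by auto
    next
      case 2
      then have "x = k \<or> x \<in> set bs" using x by auto
      then show ?thesis using 2 sg(2) c1[of x] det3_rot[of j l k] det3_rot[of l x j] by auto
    next
      case 3
      have e: "(a, b) \<in> edges ?Q'" using 3 eQ' by auto
      show ?thesis
      proof (cases "x = j")
        case False then show ?thesis using cv[OF e, of x] x by auto
      next
        case True
        consider "a = l" "b = ?h" | "a = ?t" "b = k" | "(a, b) \<in> adj bs" using 3 unfolding abs by auto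
        then show ?thesis
        proof cases
          case 1 then show ?thesis using True kj by simp
        next
          case 2 then show ?thesis using True sg(1) by simp
        next
          case 3
          then have abb: "a \<in> set bs" "b \<in> set bs" using adj_set by fast+
          have p: "det3 a b k > 0" "det3 a b l > 0" using cv[OF e, of k] cv[OF e, of l] abb jn by auto
          have s: "det3 a k l > 0" "det3 a l j < 0" "det3 a k j > 0"
            using klx[OF abb(1)] c1[OF abb(1)] c2[OF abb(1)] det3_rot[of k l a] det3_swap[of l a j] det3_swap[of k a j] by auto
          have id: "det3 a k l *\<^sub>R j = det3 k l j *\<^sub>R a - det3 a l j *\<^sub>R k + det3 a k j *\<^sub>R l"
            using cramer[of k l j a] by (simp add: algebra_simps)
          have "det3 a k l * det3 a b j = - det3 a l j * det3 a b k + det3 a k j * det3 a b l"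
            using arg_cong[OF id, of "det3 a b"] by (simp add: det3_lin det3_diff)
          moreover have "- det3 a l j * det3 a b k > 0" "det3 a k j * det3 a b l > 0" using s p by (auto simp: mult_neg_pos)
          ultimately have "det3 a k l * det3 a b j > 0" by linarith
          then show ?thesis using True s(1) by (simp add: zero_less_mult_iff)
        qed
      qed
    qed
  qed
qed

lemma in_triangle_combo:
  assumes "in_triangle x y z p"
  shows "\<exists>a b c d. 0 < a \<and> 0 < b \<and> 0 < c \<and> 0 < d \<and> d *\<^sub>R p = a *\<^sub>R x + b *\<^sub>R y + c *\<^sub>R z"
proof -
  have id: "det3 x y z *\<^sub>R p = det3 p y z *\<^sub>R x + det3 x p z *\<^sub>R y + det3 x y p *\<^sub>R z"
    using cramer[of y z p x] det3_rot[of y z p] det3_swap'(1)[of x z p] by (simp add: algebra_simps)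
  show ?thesis
  proof (cases "det3 x y z > 0")
    case True then show ?thesis using assms id unfolding in_triangle_def by (intro exI[of _ "det3 p y z"] exI[of _ "det3 x p z"] exI[of _ "det3 x y p"] exI[of _ "det3 x y z"]) auto
  next
    case False
    have "(- det3 x y z) *\<^sub>R p = (- det3 p y z) *\<^sub>R x + (- det3 x p z) *\<^sub>R y + (- det3 x y p) *\<^sub>R z"
      using arg_cong[OF id, of uminus] by simp
    then show ?thesis using assms False unfolding in_triangle_def by (intro exI[of _ "- det3 p y z"] exI[of _ "- det3 x p z"] exI[of _ "- det3 x y p"] exI[of _ "- det3 x y z"]) auto
  qed
qed

text \<open>Induction by cutting off an empty ear. If the ear at \<open>m\<close> is not empty, the
  chord to its nearest vertex \<open>z\<close> splits the polygon into two parts that are convex by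
  induction, and the ear with tip \<open>y\<close>, the vertex next to \<open>m\<close>, is then
  empty in the whole polygon.\<close>

lemma locally_convex_convex:
  "generic V Q \<Longrightarrow> simple Q \<Longrightarrow> length Q \<ge> 3 \<Longrightarrow> \<forall>s\<in>set (cyclic_signs Q). s \<Longrightarrow> convex_poly Q"
proof (induction "length Q" arbitrary: Q rule: less_induct)
  case less
  note okQ = less.prems(1) and sQ = less.prems(2) and cQ = less.prems(4)
  have dQ: "distinct Q" using genericD(3)[OF okQ] .
  show ?case
  proof (cases "length Q = 3")
    case True
    then obtain a b c where Q: "Q = [a, b, c]" by (metis (no_types, lifting) length_0_conv length_Suc_conv numeral_3_eq_3)
    have "det3 c a b > 0" "det3 a b c > 0" "det3 b c a > 0" using cQ unfolding Q cyclic_signs_def by auto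
    then show ?thesis unfolding convex_poly_def edges_def Q by auto
  next
    case False
    then have l4: "length Q \<ge> 4" using less.prems(3) by simp
    have earI: "convex_poly Q" if R: "rotate n Q = k # j # l # bs" and em: "\<And>x. x \<in> set bs \<Longrightarrow> \<not> in_triangle k j l x" for n k j l bs
    proof -
      have lR: "length (k # j # l # bs) = length Q" unfolding R[symmetric] by simp
      have "convex_poly (k # j # l # bs)"
      proof (rule convex_ear[OF _ _ _ _ em])
        show "generic V (k # j # l # bs)" "simple (k # j # l # bs)" "\<forall>s\<in>set (cyclic_signs (k # j # l # bs)). s"
          unfolding R[symmetric] generic_rotate simple_pm_rotate set_cyclic_signs_rotate using okQ sQ cQ by auto
        show "bs \<noteq> []" using lR l4 by auto
        assume "generic V (k # l # bs)" "simple (k # l # bs)" "\<forall>s\<in>set (cyclic_signs (k # l # bs)). s"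
        then show "convex_poly (k # l # bs)" using lR l4 by (intro less.hyps) auto
      qed
      then show ?thesis unfolding R[symmetric] convex_poly_rotate .
    qed
    obtain m W where Q: "Q = m # W" using l4 by (cases Q) auto
    have lW: "length W \<ge> 3" using l4 Q by simp
    obtain y mid x where W: "W = y # mid @ [x]"
    proof -
      obtain y W1 where "W = y # W1" using lW by (cases W) auto
      moreover then obtain mid x where "W1 = mid @ [x]" using lW by (cases W1 rule: rev_cases) auto
      ultimately show ?thesis using that by blast
    qed
    have hl: "hd W = y" "last W = x" using W by auto
    show ?thesis
    proof (cases "\<exists>z\<in>set Q. in_triangle x m y z")
      case False
      have "rotate (length (m # y # mid)) Q = x # m # y # mid" using rotate_append[of "m # y # mid" "[x]"] unfolding Q W by simp
      then show ?thesis using earI[of "length (m # y # mid)" x m y mid] False unfolding Q W by auto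
    next
      case True
      have E: "(m, y) \<in> edges Q" "(x, m) \<in> edges Q" using edges_Cons[of W m] unfolding Q hl[symmetric] using W by auto
      have VQ: "set Q \<subseteq> V" using okQ unfolding generic_def by auto
      have inQ: "x \<in> set Q" "m \<in> set Q" "y \<in> set Q" "x \<noteq> m" "m \<noteq> y" "x \<noteq> y" using dQ unfolding Q W by auto
      have npar_vertices: "npar a b" if "a \<in> set Q" "b \<in> set Q" "a \<noteq> b" for a b using genericD(5)[OF okQ that] .
      have "\<exists>z. z \<in> set Q \<and> in_triangle x m y z \<and> (\<forall>(c, d)\<in>edges Q. \<not> crosses m z c d)"
      proof (rule nearest_in_triangle[OF genericD(1)[OF okQ] _ _ _ VQ _ _ _ _ True])
        show "x \<in> V" "m \<in> V" "y \<in> V" using VQ inQ by auto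
        show "npar x m" "npar m y" "npar x y" using npar_vertices inQ by auto
        fix z and h :: "real^3 \<Rightarrow> real"
        assume z: "z \<in> set Q" "in_triangle x m y z"
          and z6: "\<And>c d. c \<in> set Q \<Longrightarrow> d \<in> set Q \<Longrightarrow> npar c d \<Longrightarrow> npar c m \<Longrightarrow> npar d m \<Longrightarrow> \<not> crosses x m c d \<Longrightarrow> \<not> crosses m y c d \<Longrightarrow> \<not> crosses m z c d"
        have "\<not> crosses m z c d" if cd: "(c, d) \<in> edges Q" for c d
        proof (cases "c = m \<or> d = m")
          case True then show ?thesis by auto
        next
          case False
          have cs: "c \<in> set Q" "d \<in> set Q" "c \<noteq> d" using edges_set[OF cd] edges_neq[OF dQ _ cd] l4 by auto
          show ?thesis using False cs npar_vertices inQ simpleD(1)[OF sQ E(1) cd] simpleD(1)[OF sQ E(2) cd] by (intro z6) auto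
        qed
        then show ?thesis using z by blast
      qed auto
      then obtain z where z: "z \<in> set Q" "in_triangle x m y z" "\<And>c d. (c, d) \<in> edges Q \<Longrightarrow> \<not> crosses m z c d" by blast
      have zn: "z \<noteq> m" "z \<noteq> y" "z \<noteq> x" using z(2) unfolding in_triangle_def by auto
      then have "z \<in> set W" using z(1) Q by auto
      then obtain as bs where Wz: "W = as @ z # bs" by (meson split_list)
      have as: "as \<noteq> []" and bs: "bs \<noteq> []" using Wz hl zn by auto
      have hd: "hd as = y" "last bs = x" using hl as bs unfolding Wz by auto
      have QQ: "Q = m # as @ z # bs" using Q Wz by simp
      have eQ: "edges Q = adj (m # as @ [z]) \<union> adj (z # bs @ [m])" using edges_split(1)[OF as bs] QQ by simp
      have eA: "edges (m # as @ [z]) = adj (m # as @ [z]) \<union> {(z, m)}" "edges (z # bs @ [m]) = adj (z # bs @ [m]) \<union> {(m, z)}"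
        using edges_split(2)[OF as bs] edges_split(2)[OF bs as] by auto
      have s1: "simple P" if P: "edges P \<subseteq> insert (m, z) (insert (z, m) (edges Q))" for P
        unfolding simple_def
      proof (clarify)
        fix a b c d assume a: "(a, b) \<in> edges P" "(c, d) \<in> edges P" "crosses a b c d"
        have n: "\<not> crosses m z c d" "\<not> crosses z m c d" "\<not> crosses c d m z" "\<not> crosses c d z m" if "(c, d) \<in> edges Q" for c d 
          using z(3)[OF that] crosses_sym(1)[of m z c d] crosses_sym(3)[of c d m z] crosses_sym(3)[of c d z m] by auto
        have 1: "(a, b) = (m, z) \<or> (a, b) = (z, m) \<or> (a, b) \<in> edges Q" "(c, d) = (m, z) \<or> (c, d) = (z, m) \<or> (c, d) \<in> edges Q" using a P by blast+
        show False
        proof (cases "(a, b) \<in> edges Q \<and> (c, d) \<in> edges Q")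
          case True then show ?thesis using simpleD(1)[OF sQ] a(3) by blast
        next
          case False then show ?thesis using 1 n a(3) by auto
        qed
      qed
      have okA: "generic V (m # as @ [z])" "generic V (z # bs @ [m])" using okQ by (rule generic_subset; use dQ QQ in auto)+
      define t where "t = ccw m (hd as) (last bs) z"
      have t2: "ccw z m (hd bs) (last as) = t" unfolding t_def
      proof (rule chord_side[OF _ as bs])
        show "generic V (m # as @ z # bs)" using okQ QQ by simp
        fix c d e f assume cd: "(c, d) \<in> adj (m # as @ [z])" "(e, f) \<in> adj (z # bs)"
        then have "(c, d) \<in> edges Q" "(e, f) \<in> edges Q" using adj_append[of "z # bs" "[m]"] unfolding eQ by auto
        then show "\<not> crosses c d e f" using simpleD(1)[OF sQ] by blast
      next
        fix e f assume "(e, f) \<in> adj bs"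
        then have "(e, f) \<in> edges Q" using adj_append[of "z # bs" "[m]"] adj_Cons[OF bs, of z] unfolding eQ by auto
        then show "\<not> crosses m z e f" by (rule z(3))
      next
        fix c d assume "(c, d) \<in> adj (as @ [z])"
        then have "(c, d) \<in> edges Q" using adj_Cons[of "as @ [z]" m] unfolding eQ by auto
        then show "\<not> crosses m (last bs) c d" using simpleD(1)[OF sQ E(2), of c d] crosses_sym(1)[of m x] hd(2) by simp
      next
        fix e f assume "(e, f) \<in> adj as"
        then have "(e, f) \<in> edges Q" using adj_append[OF as, of "[z]"] adj_Cons[of "as @ [z]" m] unfolding eQ by auto
        then show "\<not> crosses m z e f" by (rule z(3))
      qed
      have csgQ: "cyclic_signs Q = (det3 (last bs) m (hd as) > 0) # turn_signs (m # as @ [z]) @ (det3 (last as) z (hd bs) > 0) # turn_signs (z # bs @ [m])"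
        unfolding QQ by (rule cyclic_signs_split[OF as bs])
      have sg: "det3 x m y > 0" "det3 (last as) z (hd bs) > 0" "\<forall>s\<in>set (turn_signs (m # as @ [z])). s" "\<forall>s\<in>set (turn_signs (z # bs @ [m])). s"
        using cQ unfolding csgQ hd by auto
      have iz: "det3 z m y > 0" "det3 x z y > 0" "det3 x m z > 0" using z(2) sg(1) unfolding in_triangle_def by auto
      \<comment> \<open>\<open>z\<close> lies in the angle at \<open>m\<close>, so the chord divides
        this angle. With \<open>t2\<close> the same holds at \<open>z\<close>, and hence both parts
        have positive turns at the two ends of the chord.\<close>
      have nt: "\<not> t" unfolding t_def hd ccw_def
        using sg(1) iz det3_swap'(1)[of m z x] det3_swap'(1)[of m y z] det3_rot[of m y x] det3_rot[of m z x] det3_rot[of m y z]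
          det3_perms[where x=x and y=m and z=z] det3_perms[where x=z and y=m and z=y] by auto
      have hls: "hd bs \<in> set bs" "last as \<in> set as" using as bs by auto
      have zhb: "det3 z (hd bs) (last as) > 0" using sg(2) det3_rot[of z "hd bs" "last as"] by simp
      have n1: "det3 z (last as) m < 0"
      proof -
        have "det3 z (last as) m \<noteq> 0" using hls dQ QQ by (intro generic_det[OF okQ]) auto
        then show ?thesis using nt zhb unfolding t2[symmetric] ccw_def by auto
      qed
      have n2: "det3 z m (hd bs) < 0"
      proof -
        have "det3 z m (hd bs) \<noteq> 0" using hls dQ QQ by (intro generic_det[OF okQ]) auto
        then show ?thesis using nt zhb unfolding t2[symmetric] ccw_def by auto
      qed
      have cA: "convex_poly (m # as @ [z])"
      proof (rule less.hyps)
        have "cyclic_signs (m # as @ [z]) = (det3 z m (hd as) > 0) # turn_signs (m # as @ [z]) @ [det3 (last as) z m > 0]" by (rule cyclic_signs_close[OF as])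
        moreover have "det3 (last as) z m > 0" using n1 det3_swap[of z "last as" m] by linarith
        ultimately show "\<forall>s\<in>set (cyclic_signs (m # as @ [z])). s" using sg(3) iz(1) hd by auto
        show "simple (m # as @ [z])" by (rule s1) (use eA eQ in auto)
        show "length (m # as @ [z]) < length Q" using bs QQ by (cases bs) auto
        show "3 \<le> length (m # as @ [z])" using as by (cases as) auto
      qed (rule okA)
      have cB: "convex_poly (z # bs @ [m])"
      proof (rule less.hyps)
        have "cyclic_signs (z # bs @ [m]) = (det3 m z (hd bs) > 0) # turn_signs (z # bs @ [m]) @ [det3 (last bs) m z > 0]" by (rule cyclic_signs_close[OF bs])
        moreover have "det3 m z (hd bs) > 0" using n2 det3_swap[of z m "hd bs"] by linarith
        ultimately show "\<forall>s\<in>set (cyclic_signs (z # bs @ [m])). s" using sg(4) iz(3) hd by auto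
        show "simple (z # bs @ [m])" by (rule s1) (use eA eQ in auto)
        show "length (z # bs @ [m]) < length Q" using as QQ by (cases as) auto
        show "3 \<le> length (z # bs @ [m])" using bs by (cases bs) auto
      qed (rule okA)
      obtain as' where as': "as = y # as'" using as hd(1) by (cases as) auto
      obtain y' r where yr: "as' @ [z] = y' # r" by (cases as') auto
      have QR: "rotate 0 Q = m # y # y' # (r @ bs)"
      proof -
        have "as' @ z # bs = (as' @ [z]) @ bs" by simp
        then show ?thesis using QQ as' yr by simp
      qed
      have setA: "set (m # as @ [z]) = set (m # y # y' # r)" using as' yr by (metis Cons_eq_appendI list.set(2))
      show ?thesis
      proof (rule earI[OF QR], rule notI)
        fix w assume w: "w \<in> set (r @ bs)" and "in_triangle m y y' w"
        then obtain a b c d where p: "0 < a" "0 < b" "0 < c" "0 < d" and e: "d *\<^sub>R w = a *\<^sub>R m + b *\<^sub>R y + c *\<^sub>R y'" using in_triangle_combo by blast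
        have dR: "distinct (m # y # y' # (r @ bs))" using dQ QR by simp
        have wn: "w \<noteq> m" "w \<noteq> y" "w \<noteq> y'" using w dR by auto
        have fe: "d * det3 u v w = a * det3 u v m + b * det3 u v y + c * det3 u v y'" for u v
          using arg_cong[OF e, of "det3 u v"] by (simp add: det3_lin)
        from w consider "w \<in> set r" | "w \<in> set bs" by auto
        then show False
        proof cases
          case 1
          then have wA: "w \<in> set (m # as @ [z])" unfolding setA by simp
          then obtain w' where w': "(w, w') \<in> edges (m # as @ [z])" using edges_next by blast
          \<comment> \<open>\<open>w\<close> is a positive combination of \<open>m\<close>,
            \<open>y\<close>, \<open>y'\<close>. The functional of its own outgoing edge vanishes at
            \<open>w\<close>, but is nonnegative at these three and positive at \<open>m\<close> or
            \<open>y\<close>.\<close>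
          have ge: "det3 w w' q \<ge> 0" "q \<noteq> w' \<Longrightarrow> det3 w w' q > 0" if "q \<in> {m, y, y'}" for q
          proof -
            have "q \<in> set (m # as @ [z])" "q \<noteq> w" using that setA wn by auto
            then show "det3 w w' q \<ge> 0" "q \<noteq> w' \<Longrightarrow> det3 w w' q > 0" using convex_polyD[OF cA w', of q] by (cases "q = w'"; auto)+
          qed
          have "m \<noteq> w' \<or> y \<noteq> w'" using inQ by auto
          moreover have "0 = a * det3 w w' m + b * det3 w w' y + c * det3 w w' y'" using fe[of w w'] by simp
          moreover have "a * det3 w w' m \<ge> 0" "b * det3 w w' y \<ge> 0" "c * det3 w w' y' \<ge> 0" using ge p by auto
          moreover have "m \<noteq> w' \<Longrightarrow> a * det3 w w' m > 0" "y \<noteq> w' \<Longrightarrow> b * det3 w w' y > 0" using ge p by auto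
          ultimately show False by linarith
        next
          case 2
          \<comment> \<open>The great circle of the chord has the ear with tip \<open>y\<close> on
            one side and the second part on the other.\<close>
          have zm: "(z, m) \<in> edges (m # as @ [z])" "(m, z) \<in> edges (z # bs @ [m])" unfolding eA by auto
          have zy: "z \<noteq> y" "z \<noteq> m" using zn by auto
          have "det3 z m y > 0" by (rule iz)
          moreover have "det3 z m y' \<ge> 0"
          proof (cases "y' = z")
            case False
            have "y' \<in> set (m # as @ [z])" "y' \<noteq> m" using setA dR by auto
            then show ?thesis using convex_polyD[OF cA zm(1), of y'] False by auto
          qed simp
          ultimately have "b * det3 z m y > 0" "c * det3 z m y' \<ge> 0" using p by auto
          then have "d * det3 z m w > 0" using fe[of z m] by simp
          then have "det3 z m w > 0" using p by (simp add: zero_less_mult_iff)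
          moreover have "det3 m z w > 0" using convex_polyD[OF cB zm(2), of w] 2 dQ QQ by auto
          ultimately show False using det3_swap[of m z w] by linarith
        qed
      qed
    qed
  qed
qed

lemma locally_convex_unbalanced:
  assumes "generic V Q" "simple Q" "length Q \<ge> 3" "\<forall>s\<in>set (cyclic_signs Q). s" shows "\<not> balanced (set Q)"
proof
  assume b: "balanced (set Q)"
  note c = locally_convex_convex[OF assms]
  obtain p q R where Q: "Q = p # q # R" "R \<noteq> []" using assms(3) by (cases Q; cases "tl Q"; cases "tl (tl Q)") auto
  have e: "(p, q) \<in> edges Q" unfolding Q edges_def by simp
  have "hd R \<in> set R" using Q by auto
  then have "det3 p q (hd R) \<noteq> 0" using genericD(3)[OF assms(1)] Q by (intro generic_det[OF assms(1)]) auto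
  then obtain x where "x \<in> set Q" "det3 p q x < 0" by (rule balanced_linear[OF b linear_det3(1)])
  then show False using convex_polyD[OF c e, of x] by (cases "x = p"; cases "x = q") auto
qed

lemma balanced_two_inflections:
  assumes "generic V Q" "\<And>x. x \<in> V \<Longrightarrow> - x \<in> V" "simple Q" "length Q \<ge> 3" "balanced (set Q)" shows "2 \<le> cyclic_changes (cyclic_signs Q)"
proof -
  have ne: "Q \<noteq> []" using assms(4) by auto
  have F: "False \<in> set (cyclic_signs Q)" using locally_convex_unbalanced[OF assms(1,3,4)] assms(5) by (metis (full_types))
  have T: "True \<in> set (cyclic_signs Q)"
  proof (rule ccontr)
    assume "True \<notin> set (cyclic_signs Q)"
    then have "\<forall>s\<in>set (cyclic_signs (map uminus Q)). s" unfolding cyclic_signs_uminus[OF assms(1,4)] by auto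
    moreover have "simple (map uminus Q)" unfolding simple_def edges_uminus[OF ne]
      using simpleD(1)[OF assms(3)] by (auto split: prod.splits)
    ultimately have "\<not> balanced (set (map uminus Q))" using generic_uminus[OF assms(1,2)] assms(4) by (intro locally_convex_unbalanced) auto
    then show False using balanced_uminus[OF assms(5)] by simp
  qed
  obtain A B where A: "cyclic_signs Q = A @ True # B" using T by (meson split_list)
  have "cyclic_changes (cyclic_signs Q) = cyclic_changes ((True # B) @ A)" unfolding A by (rule cyclic_changes_rotate)
  moreover have "False \<in> set (B @ A)" using F A by auto
  then have "subseq [False] (B @ A)" by (simp add: subseq_singleton_left)
  then have "subseq [True, False] ((True # B) @ A)" by simp
  then have "cyclic_changes [True, False] \<le> cyclic_changes ((True # B) @ A)" by (intro cyclic_changes_subseq) auto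
  moreover have "cyclic_changes [True, False] = 2" by (simp add: cyclic_changes_def)
  ultimately show ?thesis by simp
qed

section \<open>Removing a crossing\<close>

text \<open>Crossing up to sign: either arc has its ends on opposite sides of the great circle of
  the other. The further sign condition in \<open>crosses\<close>, which tells an arc from its
  antipode, is dropped.\<close>

definition crosses_pm :: "real^3 \<Rightarrow> real^3 \<Rightarrow> real^3 \<Rightarrow> real^3 \<Rightarrow> bool" where
  "crosses_pm a b c d \<longleftrightarrow> det3 b c d * det3 a c d < 0 \<and> det3 a b d * det3 a b c < 0"

lemma mult_neg_cases: "(x::real) * y < 0 \<longleftrightarrow> (x < 0 \<and> 0 < y) \<or> (0 < x \<and> y < 0)"
  by (auto simp: mult_less_0_iff)

lemma crosses_pm_iff: "crosses_pm a b c d \<longleftrightarrow> crosses a b c d \<or> crosses a b (- c) (- d)"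
proof -
  have "det3 b c d < 0 \<and> 0 < det3 a c d \<or> 0 < det3 b c d \<and> det3 a c d < 0" if "crosses a b c d \<or> crosses a b (- c) (- d)"
    using that unfolding crosses_def by auto
  then show ?thesis unfolding crosses_pm_def crosses_def mult_neg_cases by auto
qed

lemma crosses_pm_sym: "crosses_pm b a c d = crosses_pm a b c d" "crosses_pm a b d c = crosses_pm a b c d" "crosses_pm c d a b = crosses_pm a b c d"
proof -
  show "crosses_pm b a c d = crosses_pm a b c d" unfolding crosses_pm_def det3_swap[of a b] by (simp add: mult.commute)
  show "crosses_pm a b d c = crosses_pm a b c d" unfolding crosses_pm_def det3_swap'(1)[of _ c d] by (simp add: mult.commute)
  show "crosses_pm c d a b = crosses_pm a b c d" unfolding crosses_pm_def det3_rot'[of c a b] det3_rot'[of d a b] det3_rot[of c d a] det3_rot[of c d b]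
    by (auto simp: mult.commute)
qed

lemma crosses_pm_minus [simp]: "crosses_pm (- a) (- b) c d = crosses_pm a b c d" "crosses_pm a b (- c) (- d) = crosses_pm a b c d"
  unfolding crosses_pm_def by simp_all

lemma crosses_pm_degen [simp]: "\<not> crosses_pm a b a d" "\<not> crosses_pm a b c a" "\<not> crosses_pm a b b d" "\<not> crosses_pm a b c b"
  unfolding crosses_pm_def by simp_all

lemma simple_pm_iff: "simple_pm Q \<longleftrightarrow> (\<forall>(a, b)\<in>edges Q. \<forall>(c, d)\<in>edges Q. \<not> crosses_pm a b c d)"
  unfolding simple_pm_def simple_def crosses_pm_iff by blast

lemma eventually_pos_right:
  fixes f g :: "real \<Rightarrow> real"
  assumes "\<And>e. f e = e ^ k * g e" "isCont g 0" "0 < g 0"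
  shows "\<forall>\<^sub>F e in at_right 0. 0 < f e"
proof -
  have "(g \<longlongrightarrow> g 0) (at_right 0)" using assms(2) unfolding isCont_def filterlim_at_split by blast
  then have "\<forall>\<^sub>F e in at_right 0. 0 < g e" using assms(3) by (rule order_tendstoD)
  moreover have "\<forall>\<^sub>F e::real in at_right 0. 0 < e" by (simp add: eventually_at_right_less)
  ultimately show ?thesis by eventually_elim (simp add: assms(1))
qed

text \<open>\<open>y\<close> has the sign of \<open>A + e B + e\<^sup>2 C\<close> for all small \<open>e > 0\<close>; no condition if \<open>A = B = C = 0\<close>.\<close>

definition leading_sign :: "real \<Rightarrow> real \<Rightarrow> real \<Rightarrow> real \<Rightarrow> bool" where
  "leading_sign A B C y \<longleftrightarrow> (A \<noteq> 0 \<longrightarrow> 0 < A * y) \<and> (A = 0 \<and> B \<noteq> 0 \<longrightarrow> 0 < B * y) \<and> (A = 0 \<and> B = 0 \<and> C \<noteq> 0 \<longrightarrow> 0 < C * y)"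

text \<open>For small \<open>e > 0\<close> a polynomial has the sign of its lowest nonvanishing
  coefficient. The prefactor and the cubic term are there for the determinant of two perturbed
  points, which is divisible by \<open>e\<close>.\<close>

lemma eventually_leading_sign:
  fixes D E :: real
  shows "\<forall>\<^sub>F e in at_right 0. leading_sign A B C (e ^ m * (A + e * B + e\<^sup>2 * C + e ^ 3 * D))"
proof -
  have 1: "\<forall>\<^sub>F e in at_right 0. A \<noteq> 0 \<longrightarrow> 0 < A * (e ^ m * (A + e * B + e\<^sup>2 * C + e ^ 3 * D))"
  proof (cases "A = 0")
    case False
    have "\<forall>\<^sub>F e in at_right 0. 0 < A * (e ^ m * (A + e * B + e\<^sup>2 * C + e ^ 3 * D))"
      by (rule eventually_pos_right[where k = m and g = "\<lambda>e. A * (A + e * B + e\<^sup>2 * C + e ^ 3 * D)"])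
        (use False in \<open>auto simp: zero_less_mult_iff linorder_neq_iff intro!: continuous_intros\<close>)
    then show ?thesis by eventually_elim blast
  qed simp
  have 2: "\<forall>\<^sub>F e in at_right 0. A = 0 \<and> B \<noteq> 0 \<longrightarrow> 0 < B * (e ^ m * (A + e * B + e\<^sup>2 * C + e ^ 3 * D))"
  proof (cases "A = 0 \<and> B \<noteq> 0")
    case True
    have "\<forall>\<^sub>F e in at_right 0. 0 < B * (e ^ m * (A + e * B + e\<^sup>2 * C + e ^ 3 * D))"
      by (rule eventually_pos_right[where k = "Suc m" and g = "\<lambda>e. B * (B + e * C + e\<^sup>2 * D)"])
        (use True in \<open>auto simp: zero_less_mult_iff linorder_neq_iff algebra_simps power2_eq_square power3_eq_cube intro!: continuous_intros\<close>)
    then show ?thesis by eventually_elim blast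
  qed simp
  have 3: "\<forall>\<^sub>F e in at_right 0. A = 0 \<and> B = 0 \<and> C \<noteq> 0 \<longrightarrow> 0 < C * (e ^ m * (A + e * B + e\<^sup>2 * C + e ^ 3 * D))"
  proof (cases "A = 0 \<and> B = 0 \<and> C \<noteq> 0")
    case True
    have "\<forall>\<^sub>F e in at_right 0. 0 < C * (e ^ m * (A + e * B + e\<^sup>2 * C + e ^ 3 * D))"
      by (rule eventually_pos_right[where k = "Suc (Suc m)" and g = "\<lambda>e. C * (C + e * D)"])
        (use True in \<open>auto simp: zero_less_mult_iff linorder_neq_iff algebra_simps power2_eq_square power3_eq_cube intro!: continuous_intros\<close>)
    then show ?thesis by eventually_elim blast
  qed simp
  show ?thesis unfolding leading_sign_def using 1 2 3 by (intro eventually_conj)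
qed

text \<open>Each of \<open>a\<close> and \<open>b\<close> is equal or opposite to at most one of the
  three points.\<close>

lemma npar_third: "npar r p \<Longrightarrow> npar r q \<Longrightarrow> npar p q \<Longrightarrow> npar a b \<Longrightarrow> \<exists>w\<in>{r, p, q}. npar w a \<and> npar w b"
  unfolding npar_def by (smt (verit) insertCI minus_minus)

text \<open>The new points start at \<open>x\<close> and move by \<open>e\<close> towards
  \<open>r\<close> and \<open>p\<close>, hence stay on the old edge to first order. The terms of
  second order, along \<open>q\<close> and \<open>t\<close>, bring them into general position. As
  \<open>V\<close> is finite, one small \<open>e\<close> fits all sign conditions.\<close>

lemma smoothing_points:
  assumes V: "general_position V" "finite V" "r \<in> V" "p \<in> V" "q \<in> V" "t \<in> V" "npar r p" "npar q t" "npar r q" "npar p q" "npar r t" "npar p t"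
    and c: "0 < \<alpha>" "0 < \<beta>" "0 < \<gamma>" "0 < \<delta>" and x: "x = \<alpha> *\<^sub>R r + \<beta> *\<^sub>R p" "x = \<gamma> *\<^sub>R q + \<delta> *\<^sub>R t"
  obtains x' x'' where
    "\<And>a b. a \<in> V \<Longrightarrow> b \<in> V \<Longrightarrow> leading_sign (det3 x a b) (det3 r a b) (det3 q a b) (det3 x' a b)"
    "\<And>a b. a \<in> V \<Longrightarrow> b \<in> V \<Longrightarrow> leading_sign (det3 x a b) (det3 p a b) (det3 t a b) (det3 x'' a b)"
    "\<And>a. a \<in> V \<Longrightarrow> npar a r \<Longrightarrow> npar a p \<Longrightarrow> 0 < det3 r p a * det3 x' x'' a"
    "det3 r p q * det3 x' x'' r < 0" "0 < det3 r p q * det3 x' x'' p"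
proof -
  define y where "y e = x + e *\<^sub>R r + e\<^sup>2 *\<^sub>R q" for e :: real
  define z where "z e = x + e *\<^sub>R p + e\<^sup>2 *\<^sub>R t" for e :: real
  \<comment> \<open>The first two coefficients of \<open>det3 (y e) (z e) a\<close> after division
    by \<open>e\<close>. \<open>A\<close> vanishes at \<open>r\<close> and \<open>p\<close>, so
    \<open>B\<close> decides there; this makes the signs at \<open>r\<close> and \<open>p\<close>
    opposite.\<close>
  define A B where "A a = (\<alpha> + \<beta>) * det3 r p a" and "B a = det3 x t a + det3 r p a + det3 q x a" for a
  have fin: "finite (V \<times> V)" using V(2) by simp
  have ly: "\<forall>\<^sub>F e in at_right 0. \<forall>(a, b)\<in>V \<times> V. leading_sign (det3 x a b) (det3 r a b) (det3 q a b) (det3 (y e) a b)"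
  proof (intro eventually_ball_finite[OF fin] ballI)
    fix ab
    have "leading_sign (det3 x a b) (det3 r a b) (det3 q a b) (det3 (y e) a b) = leading_sign (det3 x a b) (det3 r a b) (det3 q a b)
      (e ^ 0 * (det3 x a b + e * det3 r a b + e\<^sup>2 * det3 q a b + e ^ 3 * 0))" for a b e
      by (simp add: y_def det3_lin)
    then show "\<forall>\<^sub>F e in at_right 0. case ab of (a, b) \<Rightarrow> leading_sign (det3 x a b) (det3 r a b) (det3 q a b) (det3 (y e) a b)"
      unfolding case_prod_beta by (simp only: eventually_leading_sign)
  qed
  have lz: "\<forall>\<^sub>F e in at_right 0. \<forall>(a, b)\<in>V \<times> V. leading_sign (det3 x a b) (det3 p a b) (det3 t a b) (det3 (z e) a b)"
  proof (intro eventually_ball_finite[OF fin] ballI)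
    fix ab
    have "leading_sign (det3 x a b) (det3 p a b) (det3 t a b) (det3 (z e) a b) = leading_sign (det3 x a b) (det3 p a b) (det3 t a b)
      (e ^ 0 * (det3 x a b + e * det3 p a b + e\<^sup>2 * det3 t a b + e ^ 3 * 0))" for a b e
      by (simp add: z_def det3_lin)
    then show "\<forall>\<^sub>F e in at_right 0. case ab of (a, b) \<Rightarrow> leading_sign (det3 x a b) (det3 p a b) (det3 t a b) (det3 (z e) a b)"
      unfolding case_prod_beta by (simp only: eventually_leading_sign)
  qed
  have lyz: "\<forall>\<^sub>F e in at_right 0. \<forall>a\<in>V. leading_sign (A a) (B a) (det3 r t a + det3 q p a) (det3 (y e) (z e) a)"
  proof (intro eventually_ball_finite[OF V(2)] ballI)
    fix a
    have e1: "A a = det3 x p a + det3 r x a" unfolding A_def x(1) by (simp add: det3_lin algebra_simps)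
    have "det3 (y e) (z e) a = e ^ 1 * (A a + e * B a + e\<^sup>2 * (det3 r t a + det3 q p a) + e ^ 3 * det3 q t a)" for e
      unfolding e1 B_def y_def z_def by (simp add: det3_lin algebra_simps power2_eq_square power3_eq_cube)
    then show "\<forall>\<^sub>F e in at_right 0. leading_sign (A a) (B a) (det3 r t a + det3 q p a) (det3 (y e) (z e) a)"
      by (simp only: eventually_leading_sign)
  qed
  obtain e where e: "\<forall>(a, b)\<in>V \<times> V. leading_sign (det3 x a b) (det3 r a b) (det3 q a b) (det3 (y e) a b)"
    "\<forall>(a, b)\<in>V \<times> V. leading_sign (det3 x a b) (det3 p a b) (det3 t a b) (det3 (z e) a b)"
    "\<forall>a\<in>V. leading_sign (A a) (B a) (det3 r t a + det3 q p a) (det3 (y e) (z e) a)"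
    using eventually_happens[OF eventually_conj[OF ly eventually_conj[OF lz lyz]]] by auto
  have rpq: "det3 r p q \<noteq> 0" using V by (intro general_positionD[OF V(1)]) auto
  have g: "\<gamma> * det3 r p q + \<delta> * det3 r p t = 0"
    using arg_cong[OF x(2)[unfolded x(1)], of "det3 r p"] by (simp add: det3_lin)
  have tq: "\<delta> * (det3 r p q * det3 r p t) < 0"
  proof -
    have "\<delta> * (det3 r p q * det3 r p t) = - (\<gamma> * (det3 r p q)\<^sup>2)" using g by (simp add: power2_eq_square) algebra
    moreover have "0 < \<gamma> * (det3 r p q)\<^sup>2" using c(3) rpq by simp
    ultimately show ?thesis by linarith
  qed
  then have tq': "det3 r p q * det3 r p t < 0" using c(4) by (simp add: mult_less_0_iff)
  have AB: "A r = 0" "A p = 0" unfolding A_def by simp_all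
  have Br: "B r = \<beta> * (det3 r p t - det3 r p q)" unfolding B_def x(1)
    using det3_rot[of r p t] det3_swap'(1)[of r q p] det3_rot[of q p r] det3_perms[where x=r and y=p and z=q] det3_perms[where x=r and y=p and z=t]
    by (simp add: det3_lin algebra_simps)
  have Bp: "B p = \<alpha> * (det3 r p q - det3 r p t)" unfolding B_def x(1)
    using det3_perms[where x=r and y=p and z=q] det3_perms[where x=r and y=p and z=t]
    by (simp add: det3_lin algebra_simps)
  define s u where "s = det3 r p q" and "u = det3 r p t"
  have su: "s * u < 0" "s \<noteq> 0" using tq' rpq unfolding s_def u_def by simp_all
  have *: "(0 < s \<and> u < 0) \<or> (s < 0 \<and> 0 < u)" using su(1) unfolding mult_less_0_iff by auto
  show ?thesis
  proof
    show "leading_sign (det3 x a b) (det3 r a b) (det3 q a b) (det3 (y e) a b)" "leading_sign (det3 x a b) (det3 p a b) (det3 t a b) (det3 (z e) a b)"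
      if "a \<in> V" "b \<in> V" for a b using e(1,2) that by blast+
    show "0 < det3 r p a * det3 (y e) (z e) a" if a: "a \<in> V" "npar a r" "npar a p" for a
    proof -
      have "det3 r p a \<noteq> 0" using V a by (intro general_positionD[OF V(1)]) (auto simp: npar_sym)
      moreover have "0 < \<alpha> + \<beta>" using c by simp
      ultimately have "A a \<noteq> 0" unfolding A_def by simp
      then have "0 < (\<alpha> + \<beta>) * (det3 r p a * det3 (y e) (z e) a)" using e(3) a(1) unfolding leading_sign_def A_def by (auto simp: mult.assoc)
      then show ?thesis using \<open>0 < \<alpha> + \<beta>\<close> zero_less_mult_pos by blast
    qed
    have "B r \<noteq> 0" "B p \<noteq> 0" using * c unfolding Br Bp s_def[symmetric] u_def[symmetric] by auto
    then have 1: "0 < B r * det3 (y e) (z e) r" and 2: "0 < B p * det3 (y e) (z e) p" using e(3) V(3,4) AB unfolding leading_sign_def by blast+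
    show "det3 r p q * det3 (y e) (z e) r < 0" using 1 * c(2) unfolding Br s_def[symmetric] u_def[symmetric]
      by (auto simp: zero_less_mult_iff mult_less_0_iff)
    show "0 < det3 r p q * det3 (y e) (z e) p" using 2 * c(1) unfolding Bp s_def[symmetric] u_def[symmetric]
      by (auto simp: zero_less_mult_iff mult_less_0_iff)
  qed
qed

text \<open>If the circle of \<open>a\<close> and \<open>b\<close> passes through \<open>x\<close>
  and the circle of \<open>r\<close> and \<open>p\<close> separates \<open>a\<close> from
  \<open>b\<close>, then \<open>x\<close> or \<open>- x\<close> is an inner point of the arc from
  \<open>a\<close> to \<open>b\<close>, so this arc crosses both edges there.\<close>

lemma concurrent_crosses_pm:
  assumes V: "general_position V" "r \<in> V" "p \<in> V" "q \<in> V" "t \<in> V" "a \<in> V" "b \<in> V" and n: "npar r p" "npar q t" "npar a b"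
    and c: "0 < \<alpha>" "0 < \<beta>" "0 < \<gamma>" "0 < \<delta>" and x: "x = \<alpha> *\<^sub>R r + \<beta> *\<^sub>R p" "x = \<gamma> *\<^sub>R q + \<delta> *\<^sub>R t"
    and X: "det3 x a b = 0" and s: "det3 r p a * det3 r p b < 0" and ex: "npar a q \<and> npar a t \<or> npar b q \<and> npar b t"
  shows "crosses_pm r p a b \<and> crosses_pm q t a b"
proof -
  have "det3 x p w = \<alpha> * det3 r p w" "det3 x t w = \<gamma> * det3 q t w" for w by (simp add: x(1) det3_lin, simp add: x(2) det3_lin)
  then have "\<alpha> * \<gamma> * (det3 r p a * det3 q t b - det3 r p b * det3 q t a) = det3 x p a * det3 x t b - det3 x p b * det3 x t a"
    by (simp add: algebra_simps)
  also have "\<dots> = 0" using grassmann[of x p a t b] X det3_swap'(1)[of x a t] by simp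
  finally have e: "det3 r p a * det3 q t b = det3 r p b * det3 q t a" using c by simp
  have nz: "det3 q t a \<noteq> 0 \<or> det3 q t b \<noteq> 0"
    using ex general_positionD[OF V(1), of q t a] general_positionD[OF V(1), of q t b] V n npar_sym[of a q] npar_sym[of b q] npar_sym[of a t] npar_sym[of b t] by blast
  have g: "det3 q t a * det3 q t b < 0" using e s nz by (auto simp: mult_less_0_iff) (smt (verit) mult_eq_0_iff mult_neg_neg mult_neg_pos mult_pos_neg mult_pos_pos)+
  have 1: "det3 p a b * det3 r a b < 0" if l: "x = \<alpha> *\<^sub>R r + \<beta> *\<^sub>R p" "0 < \<alpha>" "0 < \<beta>" "r \<in> V" "p \<in> V" "npar r p" "det3 r p a * det3 r p b < 0" for r p \<alpha> \<beta>
  proof -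
    have E: "\<alpha> * det3 r a b + \<beta> * det3 p a b = 0" using X unfolding l(1) by (simp add: det3_lin)
    have "npar r a" "npar r b" using l(7) unfolding npar_def by (auto simp: mult_less_0_iff)
    then have "det3 r a b \<noteq> 0" using l(4) V n(3) by (intro general_positionD[OF V(1)]) auto
    have "\<beta> * (det3 p a b * det3 r a b) = - (\<alpha> * (det3 r a b)\<^sup>2)" using E by (simp add: power2_eq_square) algebra
    also have "\<dots> < 0" using l(2) \<open>det3 r a b \<noteq> 0\<close> by simp
    finally show ?thesis using l(3) by (simp add: mult_less_0_iff)
  qed
  have "det3 p a b * det3 r a b < 0" by (rule 1[OF x(1) c(1,2) V(2,3) n(1) s])
  moreover have "det3 t a b * det3 q a b < 0" by (rule 1[OF x(2) c(3,4) V(4,5) n(2) g])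
  ultimately show ?thesis using s g unfolding crosses_pm_def by (simp add: mult.commute)
qed

text \<open>The new edge from \<open>r\<close> to \<open>x'\<close> is a slightly moved half of the
  edge from \<open>r\<close> to \<open>p\<close>. The second conclusion records which half is met,
  and later shows that no crossing of the old edge is used twice.\<close>

lemma crosses_pm_half_edge:
  assumes V: "general_position V" "r \<in> V" "p \<in> V" "a \<in> V" "b \<in> V" and n: "npar r p" "npar a b"
    and c: "0 < \<alpha>" "0 < \<beta>" and x: "x = \<alpha> *\<^sub>R r + \<beta> *\<^sub>R p"
    and F: "\<And>a b. a \<in> V \<Longrightarrow> b \<in> V \<Longrightarrow> det3 x a b \<noteq> 0 \<Longrightarrow> 0 < det3 x a b * det3 x' a b"
    and X: "det3 r p a * det3 r p b < 0 \<Longrightarrow> det3 x a b \<noteq> 0"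
    and ex: "npar a r \<and> npar a p \<or> npar b r \<and> npar b p"
    and crosses: "crosses_pm r x' a b"
  shows "crosses_pm r p a b \<and> det3 x a b * det3 r a b < 0"
proof -
  have c1: "det3 x' a b * det3 r a b < 0" "det3 r x' b * det3 r x' a < 0" using crosses unfolding crosses_pm_def by blast+
  have nr: "npar a r" "npar b r" using c1(2) unfolding npar_def by (auto simp: mult_less_0_iff)
  have npar_vertices: "npar w p" if w: "w = a \<and> v = b \<or> w = b \<and> v = a" for w v
  proof (rule ccontr)
    assume "\<not> npar w p"
    then have wp: "w = p \<or> w = - p" unfolding npar_def by blast
    then have "npar v p" using n(2) w npar_sym[of a b] npar_minus(2)[of v p] by auto
    moreover have vr: "npar v r" using nr w by blast
    ultimately have pv: "npar p v" "npar r v" using npar_sym[of v p] npar_sym[of v r] by blast+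
    have "v \<in> V" using w V(4,5) by blast
    then have "det3 r p v \<noteq> 0" using general_positionD[OF V(1-3) _ n(1) pv] by blast
    then have "det3 r a b \<noteq> 0" using wp w det3_swap'(1)[of r v p] by auto
    moreover have "det3 x a b = \<alpha> * det3 r a b" using wp w unfolding x by (auto simp: det3_lin)
    ultimately have "0 < (\<alpha> * det3 r a b) * det3 x' a b" using F[OF V(4,5)] c by simp
    then have "0 < \<alpha> * (det3 r a b * det3 x' a b)" by (simp only: mult.assoc)
    then have "0 < det3 r a b * det3 x' a b" using c(1) zero_less_mult_pos by blast
    then show False using c1(1) by (simp add: mult.commute)
  qed
  have pos: "0 < det3 p r w * det3 x' r w" if w: "w = a \<or> w = b" for w
  proof -
    have "npar w p" "npar w r" "w \<in> V" using npar_vertices[of a b] npar_vertices[of b a] w nr V(4,5) by blast+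
    then have "det3 p r w \<noteq> 0" using general_positionD[OF V(1,3,2), of w] n(1) npar_sym[of p r] npar_sym[of w r] npar_sym[of w p] by blast
    moreover have e: "det3 x r w = \<beta> * det3 p r w" unfolding x by (simp add: det3_lin)
    ultimately have "0 < (\<beta> * det3 p r w) * det3 x' r w" using F[OF V(2), of w] V w c by auto
    then have "0 < \<beta> * (det3 p r w * det3 x' r w)" by (simp only: mult.assoc)
    then show ?thesis using c(2) zero_less_mult_pos by blast
  qed
  have "0 < (det3 p r a * det3 x' r a) * (det3 p r b * det3 x' r b)" using pos[of a] pos[of b] by simp
  also have "\<dots> = (det3 r p a * det3 r p b) * (det3 r x' b * det3 r x' a)"
    using det3_swap[of p r] det3_swap[of x' r] by simp
  finally have s: "det3 r p a * det3 r p b < 0" using c1(2) zero_less_mult_iff[of "det3 r p a * det3 r p b" "det3 r x' b * det3 r x' a"] by linarith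
  have "det3 x a b \<noteq> 0" using X[OF s] .
  then have "0 < det3 x a b * det3 x' a b" by (rule F[OF V(4,5)])
  then have n1: "det3 x a b * det3 r a b < 0" using c1(1) by (auto simp: zero_less_mult_iff mult_less_0_iff)
  moreover have "det3 x a b = \<alpha> * det3 r a b + \<beta> * det3 p a b" unfolding x by (simp add: det3_lin)
  ultimately have "\<alpha> * (det3 r a b * det3 r a b) + \<beta> * (det3 p a b * det3 r a b) < 0" by (simp add: algebra_simps)
  moreover have "0 \<le> \<alpha> * (det3 r a b * det3 r a b)" using c by simp
  ultimately have "\<beta> * (det3 p a b * det3 r a b) < 0" by linarith
  then have "det3 p a b * det3 r a b < 0" using c(2) by (simp add: mult_less_0_iff)
  then show ?thesis using s n1 unfolding crosses_pm_def by (simp add: mult.commute)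
qed

text \<open>Ordered pairs, so every crossing is counted twice.\<close>

definition crossings :: "((real^3) \<times> (real^3)) set \<Rightarrow> (((real^3) \<times> (real^3)) \<times> ((real^3) \<times> (real^3))) set" where
  "crossings E = {(e, f). e \<in> E \<and> f \<in> E \<and> crosses_pm (fst e) (snd e) (fst f) (snd f)}"

lemma finite_crossings: "finite E \<Longrightarrow> finite (crossings E)"
  unfolding crossings_def by (rule finite_subset[of _ "E \<times> E"]) auto

lemma finite_edges: "finite (edges Q)" unfolding edges_def adj_def by simp

lemma simple_pm_crossings: "simple_pm Q \<longleftrightarrow> crossings (edges Q) = {}"
  unfolding simple_pm_iff crossings_def by fastforce

lemma card_crossings_image:
  assumes "finite E" "\<And>e f. e \<in> E \<Longrightarrow> f \<in> E \<Longrightarrow> crosses_pm (fst (h e)) (snd (h e)) (fst (h f)) (snd (h f)) = crosses_pm (fst e) (snd e) (fst f) (snd f)"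
  shows "card (crossings (h ` E)) \<le> card (crossings E)"
proof -
  have "crossings (h ` E) \<subseteq> map_prod h h ` crossings E" unfolding crossings_def using assms(2) by (auto simp: image_iff) (metis fst_conv snd_conv)
  then show ?thesis by (meson assms(1) card_image_le card_mono finite_crossings finite_imageI le_trans)
qed

text \<open>For the edges \<open>N\<close> that are added: they do not cross each other, and a
  crossing with an old edge is counted in both orders.\<close>

lemma crossings_decompose:
  assumes "finite O'" "finite N" and n: "\<And>e f. e \<in> N \<Longrightarrow> f \<in> N \<Longrightarrow> \<not> crosses_pm (fst e) (snd e) (fst f) (snd f)"
  shows "card (crossings (O' \<union> N)) \<le> card (crossings O') + 2 * card {(e, f). e \<in> N \<and> f \<in> O' \<and> crosses_pm (fst e) (snd e) (fst f) (snd f)}"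
proof -
  let ?B = "{(e, f). e \<in> N \<and> f \<in> O' \<and> crosses_pm (fst e) (snd e) (fst f) (snd f)}"
  have fB: "finite ?B" by (rule finite_subset[of _ "N \<times> O'"]) (use assms in auto)
  have "crossings (O' \<union> N) \<subseteq> crossings O' \<union> (?B \<union> prod.swap ` ?B)"
    unfolding crossings_def using n by (auto simp: image_iff crosses_pm_sym(3))
  then have "card (crossings (O' \<union> N)) \<le> card (crossings O' \<union> (?B \<union> prod.swap ` ?B))"
    using assms(1) fB by (intro card_mono) (auto simp: finite_crossings)
  also have "\<dots> \<le> card (crossings O') + (card ?B + card (prod.swap ` ?B))"
    by (meson add_left_mono card_Un_le le_trans)
  also have "\<dots> = card (crossings O') + 2 * card ?B" by (simp add: card_image inj_on_def)
  finally show ?thesis .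
qed

text \<open>For the edges \<open>N\<close> that are removed: their mutual crossing contributes the
  additional 2.\<close>

lemma crossings_decompose':
  assumes "finite O'" "finite N" "O' \<inter> N = {}" and n: "g \<in> N" "h \<in> N" "crosses_pm (fst g) (snd g) (fst h) (snd h)"
  shows "card (crossings O') + 2 * card {(e, f). e \<in> N \<and> f \<in> O' \<and> crosses_pm (fst e) (snd e) (fst f) (snd f)} + 2 \<le> card (crossings (O' \<union> N))"
proof -
  let ?B = "{(e, f). e \<in> N \<and> f \<in> O' \<and> crosses_pm (fst e) (snd e) (fst f) (snd f)}"
  let ?C = "{(g, h), (h, g)}"
  have fB: "finite ?B" by (rule finite_subset[of _ "N \<times> O'"]) (use assms in auto)
  have fc: "finite (crossings O')" using assms(1) by (rule finite_crossings)
  have ne: "g \<noteq> h" using n(3) by auto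
  have "?C \<union> (crossings O' \<union> (?B \<union> prod.swap ` ?B)) \<subseteq> crossings (O' \<union> N)"
    unfolding crossings_def using n by (auto simp: crosses_pm_sym(3))
  then have "card (?C \<union> (crossings O' \<union> (?B \<union> prod.swap ` ?B))) \<le> card (crossings (O' \<union> N))"
    using assms by (intro card_mono) (auto simp: finite_crossings)
  moreover have "card (?C \<union> (crossings O' \<union> (?B \<union> prod.swap ` ?B))) = card ?C + card (crossings O' \<union> (?B \<union> prod.swap ` ?B))"
    using fc fB assms(3) n by (intro card_Un_disjoint) (auto simp: crossings_def)
  moreover have "card (crossings O' \<union> (?B \<union> prod.swap ` ?B)) = card (crossings O') + card (?B \<union> prod.swap ` ?B)"
    using fc fB assms(3) n by (intro card_Un_disjoint) (auto simp: crossings_def)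
  moreover have "card (?B \<union> prod.swap ` ?B) = card ?B + card (prod.swap ` ?B)"
    using assms fB by (intro card_Un_disjoint) auto
  moreover have "card (prod.swap ` ?B) = card ?B" by (simp add: card_image inj_on_def)
  moreover have "card ?C = 2" using ne by simp
  ultimately show ?thesis by linarith
qed

lemma turn_signs_ends:
  assumes "length L \<ge> 2" "(det3 a (hd L) (hd (tl L)) > 0) = (det3 a' (hd L) (hd (tl L)) > 0)"
    "(det3 (last (butlast L)) (last L) b > 0) = (det3 (last (butlast L)) (last L) b' > 0)"
  shows "turn_signs (a # L @ [b]) = turn_signs (a' # L @ [b'])"
proof -
  have 1: "turn_signs (L @ [b]) = turn_signs (L @ [b'])"
  proof -
    have "L \<noteq> []" "butlast L \<noteq> []" using assms(1) by (auto simp: butlast_conv_take)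
    moreover obtain y where "L = butlast L @ [y]" using append_butlast_last_id[of L] \<open>L \<noteq> []\<close> by metis
    ultimately obtain M y where L: "L = M @ [y]" "M \<noteq> []" by blast
    show ?thesis using turn_signs_append[OF L(2), of "[b]" y] turn_signs_append[OF L(2), of "[b']" y] assms(3) L by simp
  qed
  obtain u v L' where "L = u # v # L'" using assms(1) by (cases L; cases "tl L") auto
  then show ?thesis using 1 assms(2) by simp
qed

text \<open>Changes inside the blocks survive. The new junctions pair off: \<open>last A\<close>
  against \<open>w\<close> together with \<open>w\<close> against the negated \<open>hd B\<close>
  give at most one more than \<open>last A\<close> against \<open>hd B\<close>, and likewise for
  \<open>hd A\<close> and \<open>last B\<close>.\<close>

lemma cyclic_changes_smooth:
  assumes "A \<noteq> []" "B \<noteq> []" shows "cyclic_changes (A @ [w] @ rev (map Not B) @ [w]) \<le> cyclic_changes (A @ B) + 2"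
proof -
  have 1: "cyclic_changes (A @ B) = changes A + (if last A = hd B then 0 else 1) + changes B + (if last B = hd A then 0 else 1)"
    using assms by (simp add: cyclic_changes_def changes_append)
  have r: "changes (rev (map Not B)) = changes B" by (simp add: changes_rev changes_map_Not)
  have h: "hd (rev (map Not B)) = (\<not> last B)" "last (rev (map Not B)) = (\<not> hd B)" "rev (map Not B) \<noteq> []"
    using assms(2) by (simp_all add: hd_rev last_rev last_map hd_map)
  have 2: "cyclic_changes (A @ [w] @ rev (map Not B) @ [w]) = changes A + (if last A = w then 0 else 1) + (if w = (\<not> last B) then 0 else 1) + changes B
    + (if (\<not> hd B) = w then 0 else 1) + (if w = hd A then 0 else 1)"
  proof -
    define C where "C = rev (map Not B)"
    have "changes (C @ [w, hd A]) = changes C + (if last C = w then 0 else 1) + (if w = hd A then 0 else 1)"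
      using changes_append[of C "[w, hd A]"] h(3) unfolding C_def[symmetric] by simp
    moreover have "changes ([w] @ (C @ [w, hd A])) = (if w = hd C then 0 else 1) + changes (C @ [w, hd A])"
      using changes_append[of "[w]" "C @ [w, hd A]"] h(3) unfolding C_def[symmetric] by simp
    moreover have "changes (A @ ([w] @ (C @ [w, hd A]))) = changes A + (if last A = w then 0 else 1) + changes ([w] @ (C @ [w, hd A]))"
      using changes_append[of A "[w] @ (C @ [w, hd A])"] assms(1) by simp
    moreover have "cyclic_changes (A @ [w] @ C @ [w]) = changes (A @ ([w] @ (C @ [w, hd A])))" using assms(1) unfolding cyclic_changes_def by simp
    ultimately show ?thesis using h(1,2) r unfolding C_def by (simp only: add.assoc)
  qed
  show ?thesis unfolding 1 2 by auto
qed

lemma general_position_insert: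
  assumes "general_position V" "\<And>a b. a \<in> V \<Longrightarrow> b \<in> V \<Longrightarrow> npar a b \<Longrightarrow> det3 y a b \<noteq> 0" shows "general_position (insert y (insert (- y) V))"
proof -
  have k: "det3 z a b \<noteq> 0" "det3 a z b \<noteq> 0" "det3 a b z \<noteq> 0" if "z = y \<or> z = - y" "a \<in> V" "b \<in> V" "npar a b" for z a b
    using assms(2)[OF that(2-4)] that(1) det3_swap[of y a b] det3_rot'[of y a b] by auto
  have n: "\<not> npar z w" if "z = y \<or> z = - y" "w = y \<or> w = - y" for z w using that unfolding npar_def by auto
  show ?thesis unfolding general_position_def
  proof (intro ballI impI)
    fix a b c assume v: "a \<in> insert y (insert (- y) V)" "b \<in> insert y (insert (- y) V)" "c \<in> insert y (insert (- y) V)"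
      and npar_vertices: "npar a b" "npar b c" "npar a c"
    show "det3 a b c \<noteq> 0"
    proof (cases "a = y \<or> a = - y")
      case True
      then have "b \<in> V" "c \<in> V" using n[OF True] v npar_vertices by blast+
      then show ?thesis using k(1)[OF True _ _ npar_vertices(2)] by blast
    next
      case a: False
      show ?thesis
      proof (cases "b = y \<or> b = - y")
        case True
        then have "c \<in> V" using n[OF True] v npar_vertices by blast
        then show ?thesis using k(2)[OF True _ _ npar_vertices(3)] a v by blast
      next
        case False
        then show ?thesis using k(3)[of c, OF _ _ _ npar_vertices(1)] a v general_positionD[OF assms(1) _ _ _ npar_vertices] by blast
      qed
    qed
  qed
qed

text \<open>With either base point all antipodes of the other vertices lie on one side.
  \<open>- hd N\<close> links the two, because the base point cannot be moved past a vertex whose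
  antipode is being tested.\<close>

lemma polygon_side_neg_swap:
  assumes K: "generic V (a # M @ b # N)" "simple_pm (a # M @ b # N)" "\<And>x. x \<in> V \<Longrightarrow> - x \<in> V" "N \<noteq> []"
  shows "polygon_side (a # M @ b # N) (- b) = polygon_side (b # N @ a # M) (- a)"
proof -
  have n: "hd N \<in> set N" using K(4) by simp
  have dd: "distinct (a # M @ b # N)" using genericD(3)[OF K(1)] .
  have l: "length N \<ge> 1" using K(4) by (cases N) auto
  have "polygon_side (a # M @ b # N) (- b) = polygon_side (a # M @ b # N) (- hd N)"
    using polygon_side_neg_const[OF K(1,2) _ K(3), of b "hd N"] l n by simp
  also have "\<dots> = polygon_side (b # N @ a # M) (- hd N)"
  proof -
    have "polygon_side ((a # M) @ b # N) (- hd N) = polygon_side (b # N @ (a # M)) (- hd N)"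
    proof (rule polygon_side_rotate_to[of V])
      show "simple ((a # M) @ b # N)" using K(2) unfolding simple_pm_def by simp
      show "- hd N \<notin> set ((a # M) @ b # N)" using generic_neg_notin[OF K(1), of "hd N"] l n by auto
      show "- (- hd N) \<notin> set ((a # M) @ [b])" using dd n by auto
      show "- hd N \<in> V" using K(3) genericD(2)[OF K(1)] n by auto
    qed (use K(1) l in auto)
    then show ?thesis by simp
  qed
  also have "\<dots> = polygon_side (b # N @ a # M) (- a)"
  proof -
    have r: "b # N @ a # M = rotate (length (a # M)) ((a # M) @ b # N)" using rotate_append[of "a # M" "b # N"] by (simp only: append_Cons)
    have "generic V (b # N @ a # M)" "simple_pm (b # N @ a # M)" using K(1,2) unfolding r generic_rotate simple_pm_rotate by simp_all
    then show ?thesis using polygon_side_neg_const[of V b "N @ a # M" "hd N" a] K(3) l n by simp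
  qed
  finally show ?thesis .
qed

text \<open>The polygon \<open>R @ P\<close> has the crossing edges \<open>(r, p)\<close> and \<open>(last P, hd R)\<close>, the latter after applying \<open>s\<close>;
  \<open>x\<close> is the crossing point, and \<open>x' = x + e r + e\<^sup>2 q\<close>, \<open>x'' = x + e p + e\<^sup>2 t\<close> for a small \<open>e > 0\<close>. Only the
  resulting signs are recorded.\<close>

locale smoothing =
  fixes V :: "(real^3) set" and R P :: "(real^3) list" and s :: "real^3 \<Rightarrow> real^3"
    and r p q t x x' x'' :: "real^3" and \<alpha> \<beta> \<gamma> \<delta> :: real
  assumes V: "generic V (R @ P)" "\<And>v. v \<in> V \<Longrightarrow> - v \<in> V" and len: "length R \<ge> 2" "length P \<ge> 2"
    and s: "s = (\<lambda>v. v) \<or> s = uminus"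
    and pts: "r = last R" "p = hd P" "q = s (last P)" "t = s (hd R)"
    and pos: "0 < \<alpha>" "0 < \<beta>" "0 < \<gamma>" "0 < \<delta>" and x: "x = \<alpha> *\<^sub>R r + \<beta> *\<^sub>R p" "x = \<gamma> *\<^sub>R q + \<delta> *\<^sub>R t"
    and no_triple: "\<And>a b. (a, b) \<in> adj R \<union> adj P \<Longrightarrow> \<not> (crosses_pm r p a b \<and> crosses_pm q t a b)"
    and lex1: "\<And>a b. a \<in> V \<Longrightarrow> b \<in> V \<Longrightarrow> leading_sign (det3 x a b) (det3 r a b) (det3 q a b) (det3 x' a b)"
    and lex2: "\<And>a b. a \<in> V \<Longrightarrow> b \<in> V \<Longrightarrow> leading_sign (det3 x a b) (det3 p a b) (det3 t a b) (det3 x'' a b)"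
    and chord: "\<And>a. a \<in> V \<Longrightarrow> npar a r \<Longrightarrow> npar a p \<Longrightarrow> 0 < det3 r p a * det3 x' x'' a"
    and chord_r: "det3 r p q * det3 x' x'' r < 0" and chord_p: "0 < det3 r p q * det3 x' x'' p"
begin

lemma s_simps: "s (s v) = v" "crosses_pm (s a) (s b) c d = crosses_pm a b c d" "crosses_pm a b (s c) (s d) = crosses_pm a b c d"
    "v \<in> V \<Longrightarrow> s v \<in> V" "npar (s a) b = npar a b" "npar b (s a) = npar b a"
  using s V(2) by auto

lemma nonempty: "R \<noteq> []" "P \<noteq> []" using len by auto

lemma general_position_V: "general_position V" using genericD(1)[OF V(1)] .

lemma end_vertices: "hd R \<in> set R" "last R \<in> set R" "hd P \<in> set P" "last P \<in> set P" "hd R \<noteq> last R" "hd P \<noteq> last P" "set R \<inter> set P = {}"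
proof -
  have d: "distinct R" "distinct P" "set R \<inter> set P = {}" using genericD(3)[OF V(1)] by auto
  then show "set R \<inter> set P = {}" by blast
  show "hd R \<in> set R" "last R \<in> set R" "hd P \<in> set P" "last P \<in> set P" using nonempty by auto
  show "hd R \<noteq> last R" using len(1) d(1) by (cases R) auto
  show "hd P \<noteq> last P" using len(2) d(2) by (cases P) auto
qed

lemma ends_in_V: "r \<in> V" "p \<in> V" "q \<in> V" "t \<in> V"
proof -
  have "v \<in> V" if "v \<in> set (R @ P)" for v using genericD(2)[OF V(1) that] .
  then show "r \<in> V" "p \<in> V" "q \<in> V" "t \<in> V" unfolding pts using end_vertices s_simps(4) by auto
qed

lemma npar_vertices: "a \<in> set (R @ P) \<Longrightarrow> b \<in> set (R @ P) \<Longrightarrow> a \<noteq> b \<Longrightarrow> npar a b"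
  using genericD(5)[OF V(1)] .

lemma npar_ends: "npar r p" "npar q t" "npar r q" "npar p q" "npar r t" "npar p t"
  unfolding pts s_simps using end_vertices by (auto intro!: npar_vertices)

lemma det_rpq: "det3 r p q \<noteq> 0" "det3 r p t \<noteq> 0"
  using general_positionD[OF general_position_V] ends_in_V npar_ends by blast+

lemma det_signs: "0 < det3 r p q * det3 p r t" "0 < det3 r p q * det3 r t q" "0 < det3 r p q * det3 p q t"
proof -
  have 1: "\<gamma> * det3 r p q = \<delta> * det3 p r t"
    using arg_cong[OF x(2)[unfolded x(1)], of "det3 r p"] det3_swap[of r p t] by (simp add: det3_lin)
  have 2: "\<beta> * det3 r p q = \<delta> * det3 r t q"
    using arg_cong[OF x(2)[unfolded x(1)], of "\<lambda>v. det3 r v q"] by (simp add: det3_lin)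
  have 3: "\<alpha> * det3 r p q = \<delta> * det3 p q t"
    using arg_cong[OF x(2)[unfolded x(1)], of "\<lambda>v. det3 v p q"] det3_rot'[of t p q] by (simp add: det3_lin)
  have k: "0 < det3 r p q * z" if "a * det3 r p q = d * z" "0 < a" "0 < d" for a d z
  proof -
    have "d * (det3 r p q * z) = a * (det3 r p q * det3 r p q)" using that(1) by (simp add: mult_ac)
    moreover have "0 < a * (det3 r p q * det3 r p q)" using that(2) det_rpq(1) by (auto simp: zero_less_mult_iff)
    ultimately show ?thesis using that(3) zero_less_mult_pos by metis
  qed
  show "0 < det3 r p q * det3 p r t" "0 < det3 r p q * det3 r t q" "0 < det3 r p q * det3 p q t"
    using k[OF 1 pos(3,4)] k[OF 2 pos(2,4)] k[OF 3 pos(1,4)] .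
qed

lemma sign_x': "a \<in> V \<Longrightarrow> b \<in> V \<Longrightarrow> det3 x a b \<noteq> 0 \<Longrightarrow> 0 < det3 x a b * det3 x' a b"
  and sign_x'': "a \<in> V \<Longrightarrow> b \<in> V \<Longrightarrow> det3 x a b \<noteq> 0 \<Longrightarrow> 0 < det3 x a b * det3 x'' a b"
  using lex1 lex2 unfolding leading_sign_def by blast+

lemma same_sign: "0 < c \<Longrightarrow> det3 x a b = c * z \<Longrightarrow> z \<noteq> 0 \<Longrightarrow> a \<in> V \<Longrightarrow> b \<in> V \<Longrightarrow> (det3 x' a b > 0 \<longleftrightarrow> z > 0) \<and> (det3 x'' a b > 0 \<longleftrightarrow> z > 0)"
proof -
  assume a: "0 < c" "det3 x a b = c * z" "z \<noteq> 0" "a \<in> V" "b \<in> V"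
  have "det3 x a b \<noteq> 0" using a by simp
  from sign_x'[OF a(4,5) this] sign_x''[OF a(4,5) this] show ?thesis using a(1,3) unfolding a(2) by (auto simp: zero_less_mult_iff mult_less_0_iff)
qed

text \<open>If the leading coefficients all vanished, so would the determinants of \<open>r\<close>,
  \<open>p\<close> and \<open>q\<close> (for \<open>x''\<close>: of \<open>r\<close>,
  \<open>p\<close> and \<open>t\<close>) with \<open>a\<close> and \<open>b\<close>; but one of
  these points is not parallel to \<open>a\<close> or \<open>b\<close>, by
  \<open>npar_third\<close>.\<close>

lemma det_new: assumes "a \<in> V" "b \<in> V" "npar a b" shows "det3 x' a b \<noteq> 0" "det3 x'' a b \<noteq> 0"
proof -
  have g: "v \<in> V \<Longrightarrow> npar v a \<and> npar v b \<Longrightarrow> det3 v a b \<noteq> 0" for v using general_positionD[OF general_position_V _ assms(1,2)] assms(3) by blast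
  have X: "det3 x a b = \<alpha> * det3 r a b + \<beta> * det3 p a b" unfolding x(1) by (simp add: det3_lin)
  have X0: "det3 p a b = 0" "det3 r a b = 0" if "det3 x a b = 0" "det3 r a b = 0 \<or> det3 p a b = 0" using that pos(1,2) X by auto
  obtain w where w: "w \<in> {r, p, q}" "npar w a \<and> npar w b" using npar_third[OF npar_ends(1,3,4) assms(3)] by blast
  obtain w' where w': "w' \<in> {r, p, t}" "npar w' a \<and> npar w' b" using npar_third[OF npar_ends(1,5,6) assms(3)] by blast
  have "det3 r a b \<noteq> 0 \<or> det3 p a b \<noteq> 0 \<or> det3 q a b \<noteq> 0" using w g[of w] ends_in_V by blast
  then have "det3 x a b \<noteq> 0 \<or> det3 r a b \<noteq> 0 \<or> det3 q a b \<noteq> 0" using X0 by blast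
  then show "det3 x' a b \<noteq> 0" using lex1[OF assms(1,2)] unfolding leading_sign_def by auto
  have "det3 r a b \<noteq> 0 \<or> det3 p a b \<noteq> 0 \<or> det3 t a b \<noteq> 0" using w' g[of w'] ends_in_V by blast
  then have "det3 x a b \<noteq> 0 \<or> det3 p a b \<noteq> 0 \<or> det3 t a b \<noteq> 0" using X0 by blast
  then show "det3 x'' a b \<noteq> 0" using lex2[OF assms(1,2)] unfolding leading_sign_def by auto
qed

lemma det_chord: "a \<in> V \<Longrightarrow> det3 x' x'' a \<noteq> 0"
proof -
  assume a: "a \<in> V"
  consider "a = r \<or> a = - r" | "a = p \<or> a = - p" | "npar a r" "npar a p" unfolding npar_def by blast
  then show ?thesis using chord[OF a] chord_r chord_p by cases auto
qed

definition V' where "V' = insert x'' (insert (- x'') (insert x' (insert (- x') V)))"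

lemma general_position_V': "general_position V'"
  unfolding V'_def
proof (rule general_position_insert)
  show "general_position (insert x' (insert (- x') V))" using general_position_V det_new(1) by (rule general_position_insert)
  fix a b assume ab: "a \<in> insert x' (insert (- x') V)" "b \<in> insert x' (insert (- x') V)" "npar a b"
  have k: "det3 x'' a b \<noteq> 0" "det3 x'' b a \<noteq> 0" if "a = x' \<or> a = - x'" "b \<in> V" for a b
    using det_chord[OF that(2)] that(1) det3_swap[of x' x'' b] det3_swap'(1)[of x'' x' b] by auto
  have "\<not> (a \<in> {x', - x'} \<and> b \<in> {x', - x'})" using ab(3) unfolding npar_def by auto
  then show "det3 x'' a b \<noteq> 0" using ab k[of a b] k[of b a] det_new(2)[of a b] by blast
qed

lemma V'_sym: "v \<in> V' \<Longrightarrow> - v \<in> V'" unfolding V'_def using V(2) by auto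

lemma npar_new: "a \<in> V \<Longrightarrow> npar x' a" "a \<in> V \<Longrightarrow> npar x'' a" "npar x' x''"
proof -
  have e: "\<exists>b\<in>V. npar a b" if a: "a \<in> V" for a
  proof -
    have "npar a r \<or> npar a p" using npar_ends(1) unfolding npar_def by auto
    then show ?thesis using ends_in_V by blast
  qed
  show "npar x' a" if a: "a \<in> V" proof -
    obtain b where "b \<in> V" "npar a b" using e[OF a] by blast
    then have "det3 x' a b \<noteq> 0" using det_new(1) a by blast
    then show ?thesis unfolding npar_def by auto
  qed
  show "npar x'' a" if a: "a \<in> V" proof -
    obtain b where "b \<in> V" "npar a b" using e[OF a] by blast
    then have "det3 x'' a b \<noteq> 0" using det_new(2) a by blast
    then show ?thesis unfolding npar_def by auto
  qed
  show "npar x' x''" using det_chord[OF ends_in_V(1)] unfolding npar_def by auto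
qed

text \<open>\<open>s\<close> is an involution, so \<open>s t\<close> is \<open>hd R\<close>. The
  second new vertex joins the image of \<open>p\<close> to it and therefore appears as
  \<open>s x''\<close>.\<close>

definition Q' where "Q' = R @ x' # map s (rev P) @ [s x'']"

lemma set_Q': "set Q' = set R \<union> s ` set P \<union> {x', s x''}" unfolding Q'_def by auto

lemma generic_Q': "generic V' Q'"
proof -
  have sub: "set R \<subseteq> V" "s ` set P \<subseteq> V" using genericD(2)[OF V(1)] s_simps(4) by auto
  have xs: "s x'' = x'' \<or> s x'' = - x''" using s by auto
  have irr: "\<not> npar a a" for a unfolding npar_def by simp
  have nRP: "npar a b" "npar b a" if "a \<in> set R" "b \<in> set P" for a b
    using that end_vertices(7) by (auto intro!: npar_vertices)
  have nR: "npar a b" if a: "a \<in> set R \<union> s ` set P" "b \<in> set R \<union> s ` set P" "a \<noteq> b" for a b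
  proof -
    have "npar (s v) (s w)" if v: "v \<in> set P" "w \<in> set P" "s v \<noteq> s w" for v w
    proof -
      have "v \<noteq> w" using v(3) by blast
      then show ?thesis using npar_vertices[of v w] v(1,2) by (simp add: s_simps)
    qed
    moreover have "npar a (s v)" "npar (s v) a" if "a \<in> set R" "v \<in> set P" for a v using nRP[OF that] by (simp_all only: s_simps)
    moreover have "npar v w" if "v \<in> set R" "w \<in> set R" "v \<noteq> w" for v w using npar_vertices[of v w] that by simp
    ultimately show ?thesis using a by blast
  qed
  have nx: "npar x' a" "npar a x'" "npar (s x'') a" "npar a (s x'')" if a: "a \<in> set R \<union> s ` set P" for a
  proof -
    have "a \<in> V" using a sub by blast
    then show "npar x' a" "npar a x'" "npar (s x'') a" "npar a (s x'')"
      using npar_new(1,2)[of a] npar_sym[of a x'] npar_sym[of a x''] by (simp_all only: s_simps)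
  qed
  have nn: "npar x' (s x'')" "npar (s x'') x'" using npar_new(3) npar_sym[of x'' x'] by (simp_all only: s_simps)
  have 1: "pairwise_npar (set Q')" unfolding pairwise_npar_def set_Q' using nR nx nn by blast
  have inj: "inj_on s (set P)" using s by (auto simp: inj_on_def)
  have d1: "x' \<notin> set R \<union> s ` set P" "s x'' \<notin> set R \<union> s ` set P" "x' \<noteq> s x''" using nx(1,3) nn(1) irr by metis+
  have d2: "set R \<inter> s ` set P = {}"
  proof -
    have "npar a b" if "a \<in> set R" "b \<in> s ` set P" for a b using that nRP by (auto simp: s_simps)
    then show ?thesis using irr by blast
  qed
  have 2: "distinct Q'" using genericD(3)[OF V(1)] inj d1 d2 unfolding Q'_def by (auto simp: distinct_map)
  have 3: "set Q' \<subseteq> V'" unfolding set_Q' V'_def using sub xs by auto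
  show ?thesis unfolding generic_def using general_position_V' 1 2 3 by blast
qed

end

context smoothing
begin

lemma old_edge:
  assumes "(a, b) \<in> adj R \<union> adj P"
  shows "a \<in> V" "b \<in> V" "npar a b" "npar a r \<and> npar a p \<or> npar b r \<and> npar b p" "npar a q \<and> npar a t \<or> npar b q \<and> npar b t"
proof -
  have d: "distinct R" "distinct P" using genericD(3)[OF V(1)] by auto
  have m: "a \<in> set R \<and> b \<in> set R \<or> a \<in> set P \<and> b \<in> set P" "a \<noteq> b"
    using assms adj_set[of a b R] adj_set[of a b P] adj_neq[OF d(1), of a b] adj_neq[OF d(2), of a b] by blast+
  then have ab: "a \<in> set (R @ P)" "b \<in> set (R @ P)" by auto
  then show "a \<in> V" "b \<in> V" using genericD(2)[OF V(1)] by blast+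
  show "npar a b" using npar_vertices[OF ab m(2)] .
  have e: "last R \<in> set (R @ P)" "hd P \<in> set (R @ P)" "last P \<in> set (R @ P)" "hd R \<in> set (R @ P)" using end_vertices by auto
  have "a \<noteq> last R \<and> a \<noteq> hd P \<or> b \<noteq> last R \<and> b \<noteq> hd P" "a \<noteq> last P \<and> a \<noteq> hd R \<or> b \<noteq> last P \<and> b \<noteq> hd R"
    using m end_vertices by blast+
  then show "npar a r \<and> npar a p \<or> npar b r \<and> npar b p" "npar a q \<and> npar a t \<or> npar b q \<and> npar b t"
    unfolding pts s_simps using npar_vertices[OF ab(1) e(1)] npar_vertices[OF ab(1) e(2)] npar_vertices[OF ab(2) e(1)] npar_vertices[OF ab(2) e(2)]
      npar_vertices[OF ab(1) e(3)] npar_vertices[OF ab(1) e(4)] npar_vertices[OF ab(2) e(3)] npar_vertices[OF ab(2) e(4)] by blast+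
qed

lemma not_concurrent:
  assumes "(a, b) \<in> adj R \<union> adj P"
  shows "det3 r p a * det3 r p b < 0 \<Longrightarrow> det3 x a b \<noteq> 0" "det3 q t a * det3 q t b < 0 \<Longrightarrow> det3 x a b \<noteq> 0"
proof -
  note o = old_edge[OF assms]
  show "det3 x a b \<noteq> 0" if "det3 r p a * det3 r p b < 0"
    using concurrent_crosses_pm[OF general_position_V ends_in_V o(1,2) npar_ends(1,2) o(3) pos x _ that o(5)] no_triple[OF assms] by blast
  show "det3 x a b \<noteq> 0" if "det3 q t a * det3 q t b < 0"
    using concurrent_crosses_pm[OF general_position_V ends_in_V(3,4,1,2) o(1,2) npar_ends(2,1) o(3) pos(3,4,1,2) x(2,1) _ that o(4)] no_triple[OF assms] by blast
qed

text \<open>Four instances of \<open>crosses_pm_half_edge\<close>, one for each half of the two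
  crossing edges.\<close>

lemma crosses_pm_new_old:
  assumes ab: "(a, b) \<in> adj R \<union> adj P"
  shows "crosses_pm r x' a b \<Longrightarrow> crosses_pm r p a b \<and> det3 x a b * det3 r a b < 0"
    "crosses_pm p x'' a b \<Longrightarrow> crosses_pm r p a b \<and> det3 x a b * det3 p a b < 0"
    "crosses_pm q x' a b \<Longrightarrow> crosses_pm q t a b \<and> det3 x a b * det3 q a b < 0"
    "crosses_pm t x'' a b \<Longrightarrow> crosses_pm q t a b \<and> det3 x a b * det3 t a b < 0"
proof -
  note o = old_edge[OF ab]
  have sw: "det3 p r v = - det3 r p v" "det3 t q v = - det3 q t v" for v by (rule det3_swap)+
  have x': "x = \<beta> *\<^sub>R p + \<alpha> *\<^sub>R r" "x = \<delta> *\<^sub>R t + \<gamma> *\<^sub>R q" using x by (simp_all add: add.commute)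
  show "crosses_pm r x' a b \<Longrightarrow> crosses_pm r p a b \<and> det3 x a b * det3 r a b < 0"
    by (rule crosses_pm_half_edge[OF general_position_V ends_in_V(1,2) o(1,2) npar_ends(1) o(3) pos(1,2) x(1) sign_x' not_concurrent(1)[OF ab] o(4)])
  show "crosses_pm q x' a b \<Longrightarrow> crosses_pm q t a b \<and> det3 x a b * det3 q a b < 0"
    by (rule crosses_pm_half_edge[OF general_position_V ends_in_V(3,4) o(1,2) npar_ends(2) o(3) pos(3,4) x(2) sign_x' not_concurrent(2)[OF ab] o(5)])
  have "crosses_pm p x'' a b \<Longrightarrow> crosses_pm p r a b \<and> det3 x a b * det3 p a b < 0"
    by (rule crosses_pm_half_edge[OF general_position_V ends_in_V(2,1) o(1,2) _ o(3) pos(2,1) x'(1) sign_x''])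
      (use npar_ends(1) npar_sym[of p r] not_concurrent(1)[OF ab] o(4) in \<open>auto simp: sw\<close>)
  then show "crosses_pm p x'' a b \<Longrightarrow> crosses_pm r p a b \<and> det3 x a b * det3 p a b < 0" using crosses_pm_sym(1)[of r p a b] by blast
  have "crosses_pm t x'' a b \<Longrightarrow> crosses_pm t q a b \<and> det3 x a b * det3 t a b < 0"
    by (rule crosses_pm_half_edge[OF general_position_V ends_in_V(4,3) o(1,2) _ o(3) pos(4,3) x'(2) sign_x''])
      (use npar_ends(2) npar_sym[of t q] not_concurrent(2)[OF ab] o(5) in \<open>auto simp: sw\<close>)
  then show "crosses_pm t x'' a b \<Longrightarrow> crosses_pm q t a b \<and> det3 x a b * det3 t a b < 0" using crosses_pm_sym(1)[of q t a b] by blast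
qed

text \<open>\<open>x\<close> is a positive combination of \<open>r\<close> and \<open>p\<close>, and
  also of \<open>q\<close> and \<open>t\<close>, so a great circle cannot separate it from both ends
  of the edge.\<close>

lemma crosses_pm_new_exclusive:
  assumes ab: "(a, b) \<in> adj R \<union> adj P"
  shows "\<not> (crosses_pm r x' a b \<and> crosses_pm p x'' a b)" "\<not> (crosses_pm q x' a b \<and> crosses_pm t x'' a b)"
proof -
  have k: False if e: "X = a * y + b * z" "0 < a" "0 < b" "X * y < 0" "X * z < 0" for X y z a b :: real
  proof -
    have "X * X = a * (X * y) + b * (X * z)" unfolding e(1) by (simp add: algebra_simps)
    also have "\<dots> < 0" using e(2-5) by (meson add_neg_neg mult_pos_neg)
    finally show False by (simp add: not_less)
  qed
  have "det3 x a b = \<alpha> * det3 r a b + \<beta> * det3 p a b" unfolding x(1) by (simp add: det3_lin)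
  then show "\<not> (crosses_pm r x' a b \<and> crosses_pm p x'' a b)" using crosses_pm_new_old(1,2)[OF ab] pos(1,2) k by blast
  have "det3 x a b = \<gamma> * det3 q a b + \<delta> * det3 t a b" unfolding x(2) by (simp add: det3_lin)
  then show "\<not> (crosses_pm q x' a b \<and> crosses_pm t x'' a b)" using crosses_pm_new_old(3,4)[OF ab] pos(3,4) k by blast
qed

text \<open>All signs around the crossing, up to a common change of orientation given by the sign of
  \<open>det3 r p q\<close>.\<close>

lemma chord_sign: "det3 r p q > 0 \<and> det3 x' x'' q > 0 \<and> det3 x' x'' t < 0 \<and> det3 x' x'' r < 0 \<and> det3 x' x'' p > 0
    \<and> det3 p r t > 0 \<and> det3 r t q > 0 \<and> det3 p q t > 0
  \<or> det3 r p q < 0 \<and> det3 x' x'' q < 0 \<and> det3 x' x'' t > 0 \<and> det3 x' x'' r > 0 \<and> det3 x' x'' p < 0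
    \<and> det3 p r t < 0 \<and> det3 r t q < 0 \<and> det3 p q t < 0"
proof -
  have "0 < det3 r p q * det3 x' x'' q" "0 < det3 r p t * det3 x' x'' t"
    using chord ends_in_V npar_ends npar_sym[of q r] npar_sym[of q p] npar_sym[of t r] npar_sym[of t p] by blast+
  note f = this det_signs chord_r chord_p
  have u: "det3 r p t = - det3 p r t" by (rule det3_swap)
  show ?thesis
  proof (cases "0 < det3 r p q")
    case True
    then have "\<not> det3 r p q < 0" by simp
    with True show ?thesis using f unfolding u by (simp add: zero_less_mult_iff mult_less_0_iff)
  next
    case False
    then have "det3 r p q < 0" using det_rpq(1) by simp
    with False show ?thesis using f unfolding u by (simp add: zero_less_mult_iff mult_less_0_iff)
  qed
qed

lemma end_sign: "det3 r p q > 0 \<and> det3 x' r q < 0 \<and> det3 x'' p t < 0 \<and> det3 x' r p > 0 \<and> det3 x' r t > 0 \<and> det3 x' q p < 0 \<and> det3 x' q t < 0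
  \<or> det3 r p q < 0 \<and> det3 x' r q > 0 \<and> det3 x'' p t > 0 \<and> det3 x' r p < 0 \<and> det3 x' r t < 0 \<and> det3 x' q p > 0 \<and> det3 x' q t > 0"
proof -
  have z: "det3 x r p = 0" "det3 x q t = 0" by (simp add: x(1) det3_lin, simp add: x(2) det3_lin)
  have e1: "det3 x r q = \<beta> * det3 p r q" "det3 x r t = \<beta> * det3 p r t" "det3 x p t = \<alpha> * det3 r p t" "det3 x q p = \<alpha> * det3 r q p"
    by (simp_all add: x(1) det3_lin)
  have r1: "det3 q r p = det3 r p q" "det3 r q t = - det3 r t q" "det3 p r q = - det3 r p q" "det3 r q p = - det3 r p q" "det3 r p t = - det3 p r t"
    by (simp_all add: det3_expand algebra_simps)
  have nz: "det3 r t q \<noteq> 0" "det3 p r t \<noteq> 0" using det_signs by auto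
  have "0 < det3 q r p * det3 x' r p" using lex1[OF ends_in_V(1,2)] z(1) det_rpq(1) r1(1) unfolding leading_sign_def by simp
  moreover have "0 < det3 r q t * det3 x' q t" using lex1[OF ends_in_V(3,4)] z(2) nz(1) r1(2) unfolding leading_sign_def by simp
  moreover have "(0 < det3 x' r q) = (0 < det3 p r q)" "(0 < det3 x' r t) = (0 < det3 p r t)" "(0 < det3 x'' p t) = (0 < det3 r p t)" "(0 < det3 x' q p) = (0 < det3 r q p)"
    using same_sign[OF pos(2) e1(1)] same_sign[OF pos(2) e1(2)] same_sign[OF pos(1) e1(3)] same_sign[OF pos(1) e1(4)] ends_in_V det_rpq nz r1 by simp_all
  moreover have "det3 x' r q \<noteq> 0" "det3 x' r t \<noteq> 0" "det3 x'' p t \<noteq> 0" "det3 x' q p \<noteq> 0"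
    using det_new ends_in_V npar_ends npar_sym[of q p] by blast+
  moreover note chord_sign
  ultimately show ?thesis unfolding r1 by (elim disjE conjE) (simp_all add: zero_less_mult_iff mult_less_0_iff)
qed

lemma crosses_pm_new_new: "\<not> crosses_pm r x' p x''" "\<not> crosses_pm r x' t x''" "\<not> crosses_pm q x' p x''" "\<not> crosses_pm q x' t x''"
proof -
  have e: "det3 r x' x'' = det3 x' x'' r" "det3 q x' x'' = det3 x' x'' q" "det3 r x' p = - det3 x' r p" "det3 r x' t = - det3 x' r t"
    "det3 q x' p = - det3 x' q p" "det3 q x' t = - det3 x' q t" by (simp_all add: det3_expand algebra_simps)
  show "\<not> crosses_pm r x' p x''" "\<not> crosses_pm r x' t x''" "\<not> crosses_pm q x' p x''" "\<not> crosses_pm q x' t x''"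
    unfolding crosses_pm_def e mult_less_0_iff using chord_sign end_sign by auto
qed

text \<open>Both new points take their sign from \<open>x\<close> wherever that is not zero, so only
  an edge whose great circle passes through \<open>x\<close> could separate them. Such an edge would
  cross both removed edges.\<close>

lemma crosses_pm_chord:
  assumes ab: "(a, b) \<in> adj R \<union> adj P" shows "\<not> crosses_pm x' x'' a b"
proof
  assume c: "crosses_pm x' x'' a b"
  note o = old_edge[OF ab]
  have c1: "det3 x'' a b * det3 x' a b < 0" "det3 x' x'' b * det3 x' x'' a < 0" using c unfolding crosses_pm_def by blast+
  have X: "det3 x a b = 0"
  proof (rule ccontr)
    assume "det3 x a b \<noteq> 0"
    then show False using sign_x'[OF o(1,2)] sign_x''[OF o(1,2)] c1(1) by (auto simp: zero_less_mult_iff mult_less_0_iff)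
  qed
  have E: "det3 x a b = \<alpha> * det3 r a b + \<beta> * det3 p a b" unfolding x(1) by (simp add: det3_lin)
  have g: "npar v r \<and> npar v p" if w: "(v = a \<and> w = b) \<or> (v = b \<and> w = a)" for v w
  proof (rule ccontr)
    assume n: "\<not> (npar v r \<and> npar v p)"
    then have wn: "npar w r" "npar w p" using o(4) w by blast+
    have wV: "w \<in> V" using w o by blast
    have d: "det3 r p w \<noteq> 0" using general_positionD[OF general_position_V ends_in_V(1,2) wV npar_ends(1)] wn npar_sym[of w r] npar_sym[of w p] by blast
    have "v = r \<or> v = - r \<or> v = p \<or> v = - p" using n unfolding npar_def by blast
    moreover have "det3 x v w = 0" using X w det3_swap'(1)[of x a b] by auto
    moreover have "det3 x v w = \<alpha> * det3 r v w + \<beta> * det3 p v w" unfolding x(1) by (simp add: det3_lin)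
    ultimately show False using d pos(1,2) det3_swap[of r p w] by auto
  qed
  have "0 < det3 r p a * det3 x' x'' a" "0 < det3 r p b * det3 x' x'' b" using chord o(1,2) g[of a b] g[of b a] by blast+
  then have "det3 r p a * det3 r p b < 0" using c1(2) by (auto simp: zero_less_mult_iff mult_less_0_iff)
  then show False using not_concurrent(1)[OF ab] X by blast
qed

lemma edges_Q': "edges Q' = adj R \<union> (\<lambda>(a, b). (s b, s a)) ` adj P \<union> {(r, x'), (x', q), (s p, s x''), (s x'', s t)}"
proof -
  let ?M = "map s (rev P)"
  have M: "?M \<noteq> []" "hd ?M = q" "last ?M = s p" using nonempty pts by (simp_all add: hd_map last_map hd_rev last_rev)
  have a: "adj ?M = (\<lambda>(a, b). (s b, s a)) ` adj P" unfolding adj_map adj_rev by force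
  have "adj (x' # ?M @ [s x'']) = {(x', q), (s p, s x'')} \<union> adj ?M"
    using adj_Cons[of "?M @ [s x'']" x'] adj_append[of ?M "[s x'']"] M by auto
  then show ?thesis unfolding Q'_def using edges_append[OF nonempty(1), of "x' # ?M @ [s x'']"] a pts s_simps(1) by auto
qed

lemma new_not_old: "v \<in> set R \<union> set P \<Longrightarrow> v \<noteq> x'" "v \<in> set R \<union> set P \<Longrightarrow> v \<noteq> x''" "x' \<noteq> x''"
proof -
  show "x' \<noteq> x''" using npar_new(3) unfolding npar_def by blast
  assume "v \<in> set R \<union> set P"
  then have "v \<in> V" using genericD(2)[OF V(1)] by auto
  then show "v \<noteq> x'" "v \<noteq> x''" using npar_new(1,2)[of v] unfolding npar_def by blast+
qed

text \<open>The gain of 2 is the mutual crossing of the removed edges, taken as two ordered pairs;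
  every crossing with a new edge is paid for by one with a removed edge.\<close>

lemma card_crossings_smoothed: "card (crossings (edges Q')) + 2 \<le> card (crossings (edges (R @ P)))" if c: "crosses_pm r p q t"
proof -
  let ?O = "adj R \<union> adj P" and ?N = "{(r, x'), (q, x'), (p, x''), (t, x'')}" and ?D = "{(r, p), (last P, hd R)}"
  let ?B = "\<lambda>N. {(e, f). e \<in> N \<and> f \<in> ?O \<and> crosses_pm (fst e) (snd e) (fst f) (snd f)}"
  \<comment> \<open>Sends an edge before reversal and \<open>s\<close> to the corresponding edge of
    \<open>Q'\<close>. Neither operation affects \<open>crosses_pm\<close>, so the count can be made
    without them.\<close>
  define h where "h e = (if e \<in> adj R \<or> e = (r, x') then e else if e \<in> adj P then (s (snd e), s (fst e)) else if snd e = x' then (snd e, fst e)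
    else if fst e = p then (s (fst e), s (snd e)) else (s (snd e), s (fst e)))" for e
  have fO: "finite ?O" unfolding adj_def by simp
  have nadj: "(c, x') \<notin> adj R" "(c, x'') \<notin> adj R" "(c, x') \<notin> adj P" "(c, x'') \<notin> adj P" for c
    using adj_set[of c x' R] adj_set[of c x'' R] adj_set[of c x' P] adj_set[of c x'' P] new_not_old(1)[of x'] new_not_old(2)[of x''] by blast+
  have ne: "q \<noteq> r" "t \<noteq> p" using npar_ends unfolding npar_def by auto
  have sub: "edges Q' \<subseteq> h ` (?O \<union> ?N)"
  proof
    fix e assume "e \<in> edges Q'"
    then consider "e \<in> adj R" | a b where "(a, b) \<in> adj P" "e = (s b, s a)" | "e = (r, x')" | "e = (x', q)" | "e = (s p, s x'')" | "e = (s x'', s t)"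
      unfolding edges_Q' by auto
    then show "e \<in> h ` (?O \<union> ?N)"
    proof cases
      case 1 then have "e = h e" unfolding h_def by simp
      then show ?thesis by (rule image_eqI) (use 1 in simp)
    next
      case 2
      have "(a, b) \<notin> adj R" using 2(1) adj_set[of a b R] adj_set[of a b P] end_vertices(7) by blast
      moreover have "b \<noteq> x'" using 2(1) nadj(3) by blast
      ultimately have "e = h (a, b)" unfolding h_def using 2 by simp
      then show ?thesis by (rule image_eqI) (use 2(1) in simp)
    next
      case 3 then have "e = h (r, x')" unfolding h_def by simp
      then show ?thesis by (rule image_eqI) simp
    next
      case 4 then have "e = h (q, x')" unfolding h_def using nadj(1,3) ne by simp
      then show ?thesis by (rule image_eqI) simp
    next
      case 5 then have "e = h (p, x'')" unfolding h_def using nadj(2,4) ne new_not_old(3) by simp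
      then show ?thesis by (rule image_eqI) simp
    next
      case 6 then have "e = h (t, x'')" unfolding h_def using nadj(2,4) ne new_not_old(3) by simp
      then show ?thesis by (rule image_eqI) simp
    qed
  qed
  have hc: "crosses_pm (fst (h e)) (snd (h e)) a b = crosses_pm (fst e) (snd e) a b" for e a b
  proof -
    have "h e = e \<or> h e = (s (snd e), s (fst e)) \<or> h e = (snd e, fst e) \<or> h e = (s (fst e), s (snd e))" unfolding h_def by simp
    moreover have "crosses_pm (snd e) (fst e) a b = crosses_pm (fst e) (snd e) a b" by (rule crosses_pm_sym(1))
    ultimately show ?thesis by (elim disjE) (simp_all only: fst_conv snd_conv s_simps(2))
  qed
  have hc': "crosses_pm a b (fst (h e)) (snd (h e)) = crosses_pm a b (fst e) (snd e)" for e a b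
    using hc[of e a b] crosses_pm_sym(3)[of a b] by metis
  have fON: "finite (?O \<union> ?N)" using fO by simp
  have "crossings (edges Q') \<subseteq> crossings (h ` (?O \<union> ?N))" unfolding crossings_def using sub by blast
  then have "card (crossings (edges Q')) \<le> card (crossings (h ` (?O \<union> ?N)))" using fON by (intro card_mono) (auto intro!: finite_crossings simp del: image_Un)
  also have "\<dots> \<le> card (crossings (?O \<union> ?N))" by (rule card_crossings_image[OF fON]) (simp only: hc hc')
  also have "\<dots> \<le> card (crossings ?O) + 2 * card (?B ?N)"
  proof (rule crossings_decompose[OF fO])
    have k: "\<not> crosses_pm p x'' r x'" "\<not> crosses_pm t x'' r x'" "\<not> crosses_pm p x'' q x'" "\<not> crosses_pm t x'' q x'"
      using crosses_pm_new_new crosses_pm_sym(3)[of p x'' r x'] crosses_pm_sym(3)[of t x'' r x'] crosses_pm_sym(3)[of p x'' q x'] crosses_pm_sym(3)[of t x'' q x'] by blast+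
    fix e f assume ef: "e \<in> ?N" "f \<in> ?N"
    have "e = (r, x') \<or> e = (q, x') \<or> e = (p, x'') \<or> e = (t, x'')" using ef(1) by blast
    moreover have "f = (r, x') \<or> f = (q, x') \<or> f = (p, x'') \<or> f = (t, x'')" using ef(2) by blast
    ultimately show "\<not> crosses_pm (fst e) (snd e) (fst f) (snd f)"
      by (elim disjE) (simp_all add: crosses_pm_new_new k)
  qed simp
  \<comment> \<open>A crossing of a new edge is charged to the removed edge of which it is a half.
    By \<open>crosses_pm_new_exclusive\<close> the two halves do not meet the same old edge, so the
    charge is injective.\<close>
  also have "card (?B ?N) \<le> card (?B ?D)"
  proof (rule card_inj_on_le[where f = "\<lambda>(e, f). (if e \<in> {(r, x'), (p, x'')} then (r, p) else (last P, hd R), f)"])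
    have cl: "e \<in> {(r, x'), (p, x'')} \<or> e \<in> {(q, x'), (t, x'')}" if "e \<in> ?N" for e using that by blast
    have nn: "(r, p) \<noteq> (last P, hd R)" using end_vertices pts by auto
    have ex1: "e = e'" if "e \<in> {(r, x'), (p, x'')}" "e' \<in> {(r, x'), (p, x'')}" "f \<in> ?O" "crosses_pm (fst e) (snd e) (fst f) (snd f)" "crosses_pm (fst e') (snd e') (fst f) (snd f)" for e e' f
      using that crosses_pm_new_exclusive(1)[of "fst f" "snd f"] by auto
    have ex2: "e = e'" if "e \<in> {(q, x'), (t, x'')}" "e' \<in> {(q, x'), (t, x'')}" "f \<in> ?O" "crosses_pm (fst e) (snd e) (fst f) (snd f)" "crosses_pm (fst e') (snd e') (fst f) (snd f)" for e e' f
      using that crosses_pm_new_exclusive(2)[of "fst f" "snd f"] by auto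
    show "inj_on (\<lambda>(e, f). (if e \<in> {(r, x'), (p, x'')} then (r, p) else (last P, hd R), f)) (?B ?N)"
    proof (rule inj_onI)
      fix u v assume u: "u \<in> ?B ?N" "v \<in> ?B ?N"
        and e: "(case u of (e, f) \<Rightarrow> (if e \<in> {(r, x'), (p, x'')} then (r, p) else (last P, hd R), f)) = (case v of (e, f) \<Rightarrow> (if e \<in> {(r, x'), (p, x'')} then (r, p) else (last P, hd R), f))"
      obtain e1 f1 e2 f2 where uv: "u = (e1, f1)" "v = (e2, f2)" by (metis surj_pair)
      have f: "f1 = f2" "(e1 \<in> {(r, x'), (p, x'')}) = (e2 \<in> {(r, x'), (p, x'')})" using e nn unfolding uv by (auto split: if_splits)
      have m: "e1 \<in> ?N" "e2 \<in> ?N" "f1 \<in> ?O" "crosses_pm (fst e1) (snd e1) (fst f1) (snd f1)" "crosses_pm (fst e2) (snd e2) (fst f1) (snd f1)"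
        using u f(1) unfolding uv by blast+
      have "e1 = e2"
      proof (cases "e1 \<in> {(r, x'), (p, x'')}")
        case True then show ?thesis using ex1[OF True _ m(3-5)] f(2) by blast
      next
        case False then show ?thesis using ex2[OF _ _ m(3-5)] cl[OF m(1)] cl[OF m(2)] f(2) by blast
      qed
      then show "u = v" using uv f(1) by simp
    qed
    have c2: "crosses_pm (last P) (hd R) a b = crosses_pm q t a b" for a b unfolding pts by (simp only: s_simps)
    show "(\<lambda>(e, f). (if e \<in> {(r, x'), (p, x'')} then (r, p) else (last P, hd R), f)) ` (?B ?N) \<subseteq> ?B ?D"
    proof
      fix z assume "z \<in> (\<lambda>(e, f). (if e \<in> {(r, x'), (p, x'')} then (r, p) else (last P, hd R), f)) ` (?B ?N)"
      then obtain e f where z: "z = (if e \<in> {(r, x'), (p, x'')} then (r, p) else (last P, hd R), f)" and ef: "(e, f) \<in> ?B ?N" by force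
      have m: "e \<in> ?N" "(fst f, snd f) \<in> ?O" "crosses_pm (fst e) (snd e) (fst f) (snd f)" using ef by auto
      show "z \<in> ?B ?D"
      proof (cases "e \<in> {(r, x'), (p, x'')}")
        case True
        then have "crosses_pm r p (fst f) (snd f)" using crosses_pm_new_old(1,2)[OF m(2)] m(3) by auto
        then show ?thesis using True m(2) unfolding z by auto
      next
        case False
        then have "crosses_pm q t (fst f) (snd f)" using crosses_pm_new_old(3,4)[OF m(2)] m(3) cl[OF m(1)] by auto
        then show ?thesis using False m(2) c2 unfolding z by auto
      qed
    qed
    show "finite (?B ?D)" by (rule finite_subset[of _ "?D \<times> ?O"]) (use fO in auto)
  qed
  finally have 1: "card (crossings (edges Q')) \<le> card (crossings ?O) + 2 * card (?B ?D)" by simp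
  have "card (crossings ?O) + 2 * card (?B ?D) + 2 \<le> card (crossings (?O \<union> ?D))"
  proof (rule crossings_decompose'[OF fO, where g = "(r, p)" and h = "(last P, hd R)"])
    have "(a, b) \<notin> ?D" if "(a, b) \<in> ?O" for a b
      using that adj_set[of a b R] adj_set[of a b P] end_vertices pts by auto
    then show "?O \<inter> ?D = {}" by auto
    have "crosses_pm r p (last P) (hd R) = crosses_pm r p q t" unfolding pts(3,4) by (simp only: s_simps)
    then show "crosses_pm (fst (r, p)) (snd (r, p)) (fst (last P, hd R)) (snd (last P, hd R))" using c by simp
  qed simp_all
  moreover have "edges (R @ P) = ?O \<union> ?D" unfolding edges_append[OF nonempty] pts by auto
  ultimately show ?thesis using 1 by simp
qed

text \<open>Moving a neighbour of an old vertex along their common edge to near \<open>x\<close>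
  keeps the turn at that vertex. So the turns \<open>A\<close> along \<open>R\<close> remain, the
  turns \<open>B\<close> along \<open>P\<close> are reversed and negated, and both new vertices turn
  in the same sense \<open>w\<close>.\<close>

lemma cyclic_changes_smoothed:
  assumes id: "s = (\<lambda>v. v)" shows "cyclic_changes (cyclic_signs Q') \<le> cyclic_changes (cyclic_signs (R @ P)) + 2"
proof -
  define A B where "A = turn_signs (last P # R @ [hd P])" and "B = turn_signs (last R # P @ [hd R])"
  have qt: "q = last P" "t = hd R" using pts id by auto
  have dR: "distinct R" "distinct P" using genericD(3)[OF V(1)] by auto
  obtain r0 r1 R1 where R1: "R = r0 # r1 # R1" using len(1) by (cases R; cases "tl R") auto
  obtain p0 p1 P1 where P1: "P = p0 # p1 # P1" using len(2) by (cases P; cases "tl P") auto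
  have nb: "last (butlast L) \<in> set L \<and> last (butlast L) \<noteq> last L" if "length L \<ge> 2" "distinct L" for L :: "(real^3) list"
  proof -
    have bl: "butlast L \<noteq> []" "L \<noteq> []" using that(1) by (auto simp: butlast_conv_take)
    have "last (butlast L) \<in> set (butlast L)" using bl(1) by simp
    moreover have "distinct (butlast L @ [last L])" using that(2) bl(2) by simp
    ultimately show ?thesis by (auto dest: in_set_butlastD)
  qed
  define r' p' where "r' = last (butlast R)" and "p' = last (butlast P)"
  have rp': "r' \<in> set R" "r' \<noteq> r" "p' \<in> set P" "p' \<noteq> q" using nb[OF len(1) dR(1)] nb[OF len(2) dR(2)] unfolding r'_def p'_def qt pts by auto
  have inRP: "v \<in> V" if "v \<in> set R \<union> set P" for v using genericD(2)[OF V(1)] that by auto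
  have dn: "det3 a b c \<noteq> 0" if "a \<in> set R \<union> set P" "b \<in> set R \<union> set P" "c \<in> set R \<union> set P" "a \<noteq> b" "b \<noteq> c" "a \<noteq> c" for a b c
    using generic_det[OF V(1), of a b c] that by simp
  have mem: "r \<in> set R" "t \<in> set R" "r1 \<in> set R" "p \<in> set P" "q \<in> set P" "p1 \<in> set P" using end_vertices R1 P1 unfolding qt pts by auto
  have neq: "t \<noteq> r1" "p \<noteq> p1" "hd R = t" "hd P = p" using dR R1 P1 unfolding qt pts by auto
  have disj: "\<And>a b. a \<in> set R \<Longrightarrow> b \<in> set P \<Longrightarrow> a \<noteq> b" using end_vertices(7) by blast
  have s1: "turn_signs (x'' # R @ [x']) = A" unfolding A_def
  proof (rule turn_signs_ends[OF len(1)])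
    have "det3 q t r1 \<noteq> 0" using mem neq disj[of t q] disj[of r1 q] by (intro dn) auto
    moreover have "det3 x t r1 = \<gamma> * det3 q t r1" by (simp add: x(2) det3_lin)
    ultimately show "(0 < det3 x'' (hd R) (hd (tl R))) = (0 < det3 (last P) (hd R) (hd (tl R)))"
      using same_sign[OF pos(3), of t r1 "det3 q t r1"] ends_in_V(4) inRP[of r1] mem R1 qt by simp
    have "det3 p r' r \<noteq> 0" using mem rp' disj[of r p] disj[of r' p] by (intro dn) auto
    moreover have "det3 x r' r = \<beta> * det3 p r' r" by (simp add: x(1) det3_lin)
    ultimately have "(0 < det3 x' r' r) = (0 < det3 p r' r)"
      using same_sign[OF pos(2), of r' r "det3 p r' r"] ends_in_V(1) inRP[of r'] rp' by simp
    moreover have "det3 x' r' r = det3 r' r x'" "det3 p r' r = det3 r' r p" by (simp_all add: det3_expand algebra_simps)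
    ultimately show "(0 < det3 (last (butlast R)) (last R) x') = (0 < det3 (last (butlast R)) (last R) (hd P))"
      unfolding r'_def pts by simp
  qed
  have s2: "turn_signs (x'' # P @ [x']) = B" unfolding B_def
  proof (rule turn_signs_ends[OF len(2)])
    have "det3 r p p1 \<noteq> 0" using mem neq disj[of r p] disj[of r p1] by (intro dn) auto
    moreover have "det3 x p p1 = \<alpha> * det3 r p p1" by (simp add: x(1) det3_lin)
    ultimately show "(0 < det3 x'' (hd P) (hd (tl P))) = (0 < det3 (last R) (hd P) (hd (tl P)))"
      using same_sign[OF pos(1), of p p1 "det3 r p p1"] ends_in_V(2) inRP[of p1] mem P1 pts(1,2) by simp
    have "det3 t p' q \<noteq> 0" using mem rp' disj[of t p'] disj[of t q] by (intro dn) auto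
    moreover have "det3 x p' q = \<delta> * det3 t p' q" by (simp add: x(2) det3_lin)
    ultimately have "(0 < det3 x' p' q) = (0 < det3 t p' q)"
      using same_sign[OF pos(4), of p' q "det3 t p' q"] ends_in_V(3) inRP[of p'] rp' by simp
    moreover have "det3 x' p' q = det3 p' q x'" "det3 t p' q = det3 p' q t" by (simp_all add: det3_expand algebra_simps)
    ultimately show "(0 < det3 (last (butlast P)) (last P) x') = (0 < det3 (last (butlast P)) (last P) (hd R))"
      unfolding p'_def qt by simp
  qed
  define w where "w = (det3 r x' q > 0)"
  have w2: "(det3 p x'' t > 0) = w"
  proof -
    have "det3 r x' q = - det3 x' r q" "det3 p x'' t = - det3 x'' p t" by (rule det3_swap)+
    then show ?thesis unfolding w_def using end_sign by auto
  qed
  have Q: "Q' = (R @ [x']) @ (rev P @ [x''])" unfolding Q'_def by (simp add: id)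
  have okK: "generic V' (x'' # P @ [x'])"
    by (rule generic_subset[OF generic_Q']) (use set_Q' id dR new_not_old in auto)
  have rv: "turn_signs (x' # rev P @ [x'']) = rev (map Not B)"
  proof -
    have "turn_signs (rev (x'' # P @ [x'])) = rev (map Not (turn_signs (x'' # P @ [x'])))"
    proof (rule turn_signs_rev)
      fix U a b c W assume e: "x'' # P @ [x'] = U @ a # b # c # W"
      have "distinct (U @ a # b # c # W)" "set (x'' # P @ [x']) = set (U @ a # b # c # W)" using genericD(3)[OF okK] e by simp_all
      then show "det3 a b c \<noteq> 0" by (intro generic_det[OF okK]) auto
    qed
    then show ?thesis unfolding s2 by simp
  qed
  have f1: "turn_signs (x'' # (R @ [x']) @ [last P]) = A @ [w]"
    using turn_signs_append[of "x'' # R" "[last P]" x'] s1 nonempty(1) unfolding w_def qt pts(1) by simp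
  have f2: "turn_signs (x' # (rev P @ [x'']) @ [hd R]) = rev (map Not B) @ [w]"
    using turn_signs_append[of "x' # rev P" "[hd R]" x''] rv w2 nonempty(2) unfolding qt pts(2) by (simp add: last_rev)
  have "cyclic_signs Q' = A @ [w] @ rev (map Not B) @ [w]"
    unfolding Q using cyclic_signs_append[of "R @ [x']" "rev P @ [x'']"] f1 f2 nonempty by (simp add: hd_rev)
  moreover have "cyclic_signs (R @ P) = A @ B" unfolding A_def B_def by (rule cyclic_signs_append[OF nonempty])
  moreover have "A \<noteq> []" "B \<noteq> []" unfolding A_def B_def R1 P1 by (cases R1; cases P1; simp)+
  ultimately show ?thesis using cyclic_changes_smooth by simp
qed

text \<open>The arc between \<open>x'\<close> and \<open>x''\<close> crosses no edge of
  \<open>Q'\<close>, up to sign. So the side of \<open>x''\<close> read at \<open>x'\<close> and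
  that of \<open>- x'\<close> read at \<open>- x''\<close> are plain cyclic orders, which differ by
  \<open>chord_sign\<close>, while \<open>polygon_side_neg_swap\<close> equates them.\<close>

lemma smoothed_not_simple_pm:
  assumes neg: "s = uminus" shows "\<not> simple_pm Q'"
proof
  assume sQ: "simple_pm Q'"
  let ?M = "map uminus (rev P)"
  let ?K = "x' # ?M @ (- x'') # R"
  have Q: "Q' = R @ (x' # ?M @ [- x''])" unfolding Q'_def by (simp add: neg)
  have K: "?K = rotate (length R) Q'" unfolding Q using rotate_append[of R "x' # ?M @ [- x'']"] by simp
  have M: "?M \<noteq> []" "hd ?M = q" "last ?M = - p" using nonempty pts neg by (simp_all add: hd_map last_map hd_rev last_rev)
  have t: "hd R = - t" using pts neg by simp
  have aM: "adj ?M = (\<lambda>(a, b). (- b, - a)) ` adj P" unfolding adj_map adj_rev by force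
  have "polygon_side ?K (- (- x'')) = polygon_side ((- x'') # R @ x' # ?M) (- x')"
  proof (rule polygon_side_neg_swap)
    show "generic V' ?K" "simple_pm ?K" unfolding K generic_rotate simple_pm_rotate by (rule generic_Q', rule sQ)
  qed (use V'_sym nonempty in auto)
  moreover have "\<not> crossing_parity x' x'' (?M @ (- x'') # R)"
  proof (rule crossing_parity_free)
    fix c d assume "(c, d) \<in> adj (?M @ (- x'') # R)"
    then consider "(c, d) \<in> adj R" | a b where "(a, b) \<in> adj P" "c = - b" "d = - a" | "c = - p" "d = - x''" | "c = - x''" "d = - t"
      using adj_append[of ?M "(- x'') # R"] adj_Cons[OF nonempty(1), of "- x''"] M t aM by auto
    then have "\<not> crosses_pm x' x'' c d" using crosses_pm_chord[of c d] crosses_pm_chord crosses_pm_sym(2) by cases auto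
    then show "\<not> crosses x' x'' c d" unfolding crosses_pm_iff by blast
  qed
  moreover have "\<not> crossing_parity (- x'') (- x') (R @ x' # ?M)"
  proof (rule crossing_parity_free)
    fix c d assume "(c, d) \<in> adj (R @ x' # ?M)"
    then consider "(c, d) \<in> adj R" | a b where "(a, b) \<in> adj P" "c = - b" "d = - a" | "d = x'" | "c = x'"
      using adj_append[OF nonempty(1), of "x' # ?M"] adj_Cons[OF M(1), of x'] aM by auto
    then have "\<not> crosses_pm x'' x' c d" using crosses_pm_chord[of c d] crosses_pm_chord crosses_pm_sym(1,2) by cases auto
    then have "\<not> crosses_pm (- x'') (- x') c d" by simp
    then show "\<not> crosses (- x'') (- x') c d" unfolding crosses_pm_iff by blast
  qed
  ultimately have "ccw x' q x'' r = ccw (- x'') (- t) (- x') (- p)"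
    unfolding polygon_side_def using M t nonempty pts(1) by (simp add: hd_append)
  moreover have "det3 x' q x'' = - det3 x' x'' q" "det3 (- x'') (- t) (- x') = - det3 x' x'' t" "det3 (- x'') (- x') (- p) = det3 x' x'' p"
    by (simp_all add: det3_expand algebra_simps)
  ultimately show False unfolding ccw_def using chord_sign by auto
qed

end

lemma smoothing_exists:
  assumes V: "generic V (R @ P)" "\<And>v. v \<in> V \<Longrightarrow> - v \<in> V" "finite V" and len: "length R \<ge> 2" "length P \<ge> 2"
    and s: "s = (\<lambda>v. v) \<or> s = uminus" and c: "crosses (last R) (hd P) (s (last P)) (s (hd R))"
    and nt: "\<And>a b. (a, b) \<in> adj R \<union> adj P \<Longrightarrow> \<not> (crosses_pm (last R) (hd P) a b \<and> crosses_pm (last P) (hd R) a b)"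
  shows "\<exists>x x' x'' \<alpha> \<beta> \<gamma> \<delta>. smoothing V R P s (last R) (hd P) (s (last P)) (s (hd R)) x x' x'' \<alpha> \<beta> \<gamma> \<delta>"
proof -
  define r p q t where "r = last R" and "p = hd P" and "q = s (last P)" and "t = s (hd R)"
  have crosses: "crosses r p q t" using c unfolding r_def p_def q_def t_def .
  have d: "distinct R" "distinct P" "set R \<inter> set P = {}" using genericD(3)[OF V(1)] by auto
  have ne: "R \<noteq> []" "P \<noteq> []" using len by auto
  have m: "hd R \<in> set R" "last R \<in> set R" "hd P \<in> set P" "last P \<in> set P" using ne by auto
  have neq: "hd R \<noteq> last R" "hd P \<noteq> last P" using len d(1,2) by (cases R; simp; auto) (use len(2) d(2) in \<open>cases P; auto\<close>)
  have npar_vertices: "npar a b" if "a \<in> set R \<union> set P" "b \<in> set R \<union> set P" "a \<noteq> b" for a b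
    using genericD(5)[OF V(1), of a b] that by simp
  have sn: "npar (s a) b = npar a b" "npar a (s b) = npar a b" for a b using s by auto
  have npar_ends: "npar r p" "npar q t" "npar r q" "npar p q" "npar r t" "npar p t"
    unfolding r_def p_def q_def t_def sn using m neq d(3) by (auto intro!: npar_vertices)
  have inv: "v \<in> V" if "v \<in> set R \<union> set P" for v using genericD(2)[OF V(1), of v] that by simp
  have sV: "s v \<in> V" if "v \<in> V" for v using s V(2) that by auto
  have vs: "r \<in> V" "p \<in> V" "q \<in> V" "t \<in> V" unfolding r_def p_def q_def t_def using inv sV m by auto
  obtain \<alpha> \<beta> \<gamma> \<delta> where k: "0 < \<alpha>" "0 < \<beta>" "0 < \<gamma>" "0 < \<delta>" "\<alpha> *\<^sub>R r + \<beta> *\<^sub>R p = \<gamma> *\<^sub>R q + \<delta> *\<^sub>R t" using crossesE[OF crosses] by blast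
  obtain x where x: "x = \<alpha> *\<^sub>R r + \<beta> *\<^sub>R p" "x = \<gamma> *\<^sub>R q + \<delta> *\<^sub>R t" using k(5) by blast
  obtain x' x'' where pt:
    "\<And>a b. a \<in> V \<Longrightarrow> b \<in> V \<Longrightarrow> leading_sign (det3 x a b) (det3 r a b) (det3 q a b) (det3 x' a b)"
    "\<And>a b. a \<in> V \<Longrightarrow> b \<in> V \<Longrightarrow> leading_sign (det3 x a b) (det3 p a b) (det3 t a b) (det3 x'' a b)"
    "\<And>a. a \<in> V \<Longrightarrow> npar a r \<Longrightarrow> npar a p \<Longrightarrow> 0 < det3 r p a * det3 x' x'' a"
    "det3 r p q * det3 x' x'' r < 0" "0 < det3 r p q * det3 x' x'' p"
    by (rule smoothing_points[OF genericD(1)[OF V(1)] V(3) vs npar_ends k(1-4) x]) blast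
  have sc: "crosses_pm q t a b = crosses_pm (last P) (hd R) a b" for a b unfolding q_def t_def using s by auto
  have "smoothing V R P s r p q t x x' x'' \<alpha> \<beta> \<gamma> \<delta>"
    by unfold_locales (use V(1,2) len s k(1-4) x pt nt in \<open>simp_all add: sc\<close>, simp_all add: r_def p_def q_def t_def)
  then show ?thesis unfolding r_def p_def q_def t_def by blast
qed

lemma crossings_card_ge2: assumes "finite E" "crossings E \<noteq> {}" shows "2 \<le> card (crossings E)"
proof -
  obtain e f where e: "(e, f) \<in> crossings E" using assms(2) by auto
  then have "(f, e) \<in> crossings E" "e \<noteq> f" unfolding crossings_def using crosses_pm_sym(3)[of "fst e" "snd e" "fst f" "snd f"] by auto
  then have "{(e, f), (f, e)} \<subseteq> crossings E" "card {(e, f), (f, e)} = 2" using e by auto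
  then show ?thesis using card_mono[OF finite_crossings[OF assms(1)]] by metis
qed

text \<open>Three pairwise crossing edges account for six ordered pairs.\<close>

lemma crossings_no_triple:
  assumes "finite E" "card (crossings E) \<le> 4" "(a, b) \<in> E" "(c, d) \<in> E" "(e, f) \<in> E" "crosses_pm a b c d"
  shows "\<not> (crosses_pm a b e f \<and> crosses_pm c d e f)"
proof
  assume h: "crosses_pm a b e f \<and> crosses_pm c d e f"
  let ?S = "{((a, b), (c, d)), ((c, d), (a, b)), ((a, b), (e, f)), ((e, f), (a, b)), ((c, d), (e, f)), ((e, f), (c, d))}"
  have "?S \<subseteq> crossings E" unfolding crossings_def using assms(3-6) h crosses_pm_sym(3)[of a b c d] crosses_pm_sym(3)[of a b e f] crosses_pm_sym(3)[of c d e f] by auto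
  then have le: "card ?S \<le> card (crossings E)" by (rule card_mono[OF finite_crossings[OF assms(1)]])
  have ne: "(a, b) \<noteq> (c, d)" "(a, b) \<noteq> (e, f)" "(c, d) \<noteq> (e, f)" using assms(6) h by auto
  have "card {(i, j), (j, i), (i, k), (k, i), (j, k), (k, j)} = 6" if "i \<noteq> j" "i \<noteq> k" "j \<noteq> k" for i j k :: "(real^3) \<times> (real^3)"
    using that by auto
  from this[OF ne] show False using le assms(2) by simp
qed

text \<open>The polygon is first rotated to begin at \<open>b\<close> and end at \<open>a\<close>;
  cutting it at the other edge then leaves the two arcs.\<close>

lemma crossing_split:
  assumes "(a, b) \<in> edges Q" "(c, d) \<in> edges Q" "crosses_pm a b c d"
  obtains n R P where "rotate n Q = R @ P" "length R \<ge> 2" "length P \<ge> 2" "last R = a" "hd P = b" "last P = c" "hd R = d"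
proof -
  have adjD: "\<exists>U W. L = U @ v # w # W" if "(v, w) \<in> adj L" for v w and L :: "(real^3) list"
    using that
  proof (induction L rule: induct_list012)
    case (3 x y zs)
    show ?case
    proof (cases "(v, w) = (x, y)")
      case True then show ?thesis by (metis append_Nil prod.inject)
    next
      case False
      then have "(v, w) \<in> adj (y # zs)" using 3(3) by auto
      then obtain U W where "y # zs = U @ v # w # W" using 3(2) by blast
      then show ?thesis by (metis append_Cons)
    qed
  qed simp_all
  have ne: "a \<noteq> d" "b \<noteq> c" "(a, b) \<noteq> (c, d)" "Q \<noteq> []" using assms by (auto simp: edges_def)
  have "\<exists>n Z. rotate n Q = b # Z \<and> last (b # Z) = a"
  proof -
    obtain U W where U: "Q @ [hd Q] = U @ a # b # W" using adjD[of a b "Q @ [hd Q]"] assms(1) unfolding edges_def by blast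
    show ?thesis
    proof (cases W rule: rev_cases)
      case Nil
      then have Q: "Q = U @ [a]" "hd Q = b" using U by auto
      obtain Z where "Q = b # Z" using ne(4) Q(2) list.collapse by metis
      then have "rotate 0 Q = b # Z \<and> last (b # Z) = a" using Q(1) by (metis last_snoc rotate0 id_apply)
      then show ?thesis by blast
    next
      case (snoc W' y)
      then have "Q = (U @ [a]) @ (b # W')" using U by auto
      then have "rotate (length (U @ [a])) Q = (b # W') @ (U @ [a])" using rotate_append[of "U @ [a]" "b # W'"] by (simp only:)
      then have "rotate (length (U @ [a])) Q = b # (W' @ U @ [a])" "last (b # (W' @ U @ [a])) = a" by simp_all
      then show ?thesis by blast
    qed
  qed
  then obtain n Z where Z: "rotate n Q = b # Z" "last (b # Z) = a" by blast
  have "(c, d) \<in> edges (b # Z)" using assms(2) edges_rotate[of n Q] unfolding Z(1) by simp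
  moreover have "(c, d) \<noteq> (last (b # Z), b)" using ne(3) Z(2) by auto
  ultimately have "(c, d) \<in> adj (b # Z)" using adj_append[of "b # Z" "[b]"] unfolding edges_def by auto
  then obtain U W where U: "b # Z = U @ c # d # W" using adjD by blast
  define R P where "R = d # W" and "P = U @ [c]"
  have e: "b # Z = P @ R" unfolding R_def P_def U by simp
  have "rotate (length P) (rotate n Q) = R @ P" unfolding Z(1) e by (rule rotate_append)
  then have 1: "rotate (length P + n) Q = R @ P" by (simp only: rotate_rotate)
  have "last R = a" using Z(2) e unfolding R_def by simp
  moreover have "hd P = b" using e unfolding P_def by (metis hd_append2 list.sel(1) snoc_eq_iff_butlast)
  moreover have "last P = c" "hd R = d" unfolding R_def P_def by simp_all
  moreover have "length R \<ge> 2" using ne(1) \<open>last R = a\<close> unfolding R_def by (cases W) auto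
  moreover have "length P \<ge> 2" using ne(2) \<open>hd P = b\<close> unfolding P_def by (cases U) auto
  ultimately show ?thesis using that[OF 1] by blast
qed

text \<open>The bound 4 on ordered pairs enters through \<open>crossings_no_triple\<close>, which
  provides the assumption \<open>no_triple\<close> of the construction.\<close>

lemma smooth_crossing:
  assumes V: "generic V Q" "\<And>v. v \<in> V \<Longrightarrow> - v \<in> V" "finite V"
    and e: "(a, b) \<in> edges Q" "(c, d) \<in> edges Q" and s: "s = (\<lambda>v. v) \<or> s = uminus" "crosses a b (s c) (s d)"
    and card: "card (crossings (edges Q)) \<le> 4"
  obtains V' Q' where "generic V' Q'" "\<forall>v\<in>V'. - v \<in> V'" "finite V'" "length Q' \<ge> 3" "card (crossings (edges Q')) + 2 \<le> card (crossings (edges Q))"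
    "s = (\<lambda>v. v) \<longrightarrow> set Q \<subseteq> set Q' \<and> cyclic_changes (cyclic_signs Q') \<le> cyclic_changes (cyclic_signs Q) + 2" "s = uminus \<longrightarrow> \<not> simple_pm Q'"
proof -
  have c: "crosses_pm a b c d" using s unfolding crosses_pm_iff by auto
  obtain n R P where RP: "rotate n Q = R @ P" "length R \<ge> 2" "length P \<ge> 2" "last R = a" "hd P = b" "last P = c" "hd R = d"
    by (rule crossing_split[OF e c])
  have generic: "generic V (R @ P)" using V(1) unfolding RP(1)[symmetric] generic_rotate .
  have ed: "edges (R @ P) = edges Q" unfolding RP(1)[symmetric] by (rule edges_rotate)
  have ne: "R \<noteq> []" "P \<noteq> []" using RP by auto
  obtain x x' x'' \<alpha> \<beta> \<gamma> \<delta> where "smoothing V R P s (last R) (hd P) (s (last P)) (s (hd R)) x x' x'' \<alpha> \<beta> \<gamma> \<delta>"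
  proof -
    have "crosses (last R) (hd P) (s (last P)) (s (hd R))" using s(2) RP by simp
    moreover have "\<not> (crosses_pm (last R) (hd P) v w \<and> crosses_pm (last P) (hd R) v w)" if "(v, w) \<in> adj R \<union> adj P" for v w
    proof -
      have "(v, w) \<in> edges Q" using that unfolding ed[symmetric] edges_append[OF ne] by blast
      then show ?thesis using crossings_no_triple[OF finite_edges card e _ c] RP by simp
    qed
    ultimately show ?thesis using that smoothing_exists[OF generic V(2,3) RP(2,3) s(1)] by blast
  qed
  then interpret S: smoothing V R P s "last R" "hd P" "s (last P)" "s (hd R)" x x' x'' \<alpha> \<beta> \<gamma> \<delta> .
  have cp: "crosses_pm (last R) (hd P) (s (last P)) (s (hd R))" using s(2) RP unfolding crosses_pm_iff by simp
  have cq: "cyclic_changes (cyclic_signs (R @ P)) = cyclic_changes (cyclic_signs Q)" unfolding RP(1)[symmetric] by (rule cyclic_changes_rotate_polygon)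
  have sq: "set Q = set (R @ P)" unfolding RP(1)[symmetric] by simp
  show ?thesis
  proof (rule that)
    show "generic S.V' S.Q'" by (rule S.generic_Q')
    show "finite S.V'" using V(3) unfolding S.V'_def by simp
    show "length S.Q' \<ge> 3" using RP(2) unfolding S.Q'_def by simp
    show "card (crossings (edges S.Q')) + 2 \<le> card (crossings (edges Q))" using S.card_crossings_smoothed[OF cp] unfolding ed .
    show "s = (\<lambda>v. v) \<longrightarrow> set Q \<subseteq> set S.Q' \<and> cyclic_changes (cyclic_signs S.Q') \<le> cyclic_changes (cyclic_signs Q) + 2"
    proof
      assume id: "s = (\<lambda>v. v)"
      then have "set (R @ P) \<subseteq> set S.Q'" unfolding S.set_Q' by auto
      then show "set Q \<subseteq> set S.Q' \<and> cyclic_changes (cyclic_signs S.Q') \<le> cyclic_changes (cyclic_signs Q) + 2" using S.cyclic_changes_smoothed[OF id] unfolding cq sq by blast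
    qed
    show "\<forall>v\<in>S.V'. - v \<in> S.V'" using S.V'_sym by blast
    show "s = uminus \<longrightarrow> \<not> simple_pm S.Q'" using S.smoothed_not_simple_pm by blast
  qed
qed

text \<open>Ordered pairs are counted, so the bound 3 means at most one crossing. After its removal
  fewer than two ordered pairs are left, hence none.\<close>

lemma inflections_few_crossings:
  assumes "generic V Q" "\<And>v. v \<in> V \<Longrightarrow> - v \<in> V" "finite V" "length Q \<ge> 3" "balanced (set Q)" "card (crossings (edges Q)) \<le> 3"
  shows "6 \<le> card (crossings (edges Q)) + cyclic_changes (cyclic_signs Q)"
proof (cases "crossings (edges Q) = {}")
  case True
  then show ?thesis using simple_pm_balanced_six[OF assms(2,1) _ assms(5,4)] simple_pm_crossings by fastforce
next
  case False
  obtain a b c d where e: "(a, b) \<in> edges Q" "(c, d) \<in> edges Q" "crosses_pm a b c d" using False unfolding crossings_def by auto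
  obtain s :: "real^3 \<Rightarrow> real^3" where s: "s = (\<lambda>v. v) \<or> s = uminus" "crosses a b (s c) (s d)" using e(3) unfolding crosses_pm_iff by blast
  have le: "card (crossings (edges Q)) \<le> 4" using assms(6) by simp
  obtain V' Q' where Q': "generic V' Q'" "\<forall>v\<in>V'. - v \<in> V'" "finite V'" "length Q' \<ge> 3" "card (crossings (edges Q')) + 2 \<le> card (crossings (edges Q))"
    "s = (\<lambda>v. v) \<longrightarrow> set Q \<subseteq> set Q' \<and> cyclic_changes (cyclic_signs Q') \<le> cyclic_changes (cyclic_signs Q) + 2" "s = uminus \<longrightarrow> \<not> simple_pm Q'"
    by (rule smooth_crossing[OF assms(1-3) e(1,2) s le]) blast
  have "crossings (edges Q') = {}" using crossings_card_ge2[OF finite_edges, of Q'] Q'(5) assms(6) by linarith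
  then have sim: "simple_pm Q'" using simple_pm_crossings by blast
  then have id: "s = (\<lambda>v. v)" using Q'(7) s(1) by blast
  have "6 \<le> cyclic_changes (cyclic_signs Q')"
    using simple_pm_balanced_six[OF _ Q'(1) sim _ Q'(4)] Q'(2) balanced_mono[OF assms(5)] mp[OF Q'(6) id] by blast
  moreover have "2 \<le> card (crossings (edges Q))" by (rule crossings_card_ge2[OF finite_edges False])
  ultimately show ?thesis using mp[OF Q'(6) id] by linarith
qed

text \<open>Removing an ordinary crossing lowers the first summand by at least two and raises the
  second by at most two, so the sum for \<open>Q\<close> is at least that for \<open>Q'\<close>.
  Without an ordinary crossing, the four ordered pairs are completed by two inflections.\<close>

lemma inflections_crossings:
  assumes "generic V Q" "\<And>v. v \<in> V \<Longrightarrow> - v \<in> V" "finite V" "length Q \<ge> 3" "balanced (set Q)" "card (crossings (edges Q)) \<le> 4"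
  shows "6 \<le> card (crossings (edges Q)) + cyclic_changes (cyclic_signs Q)"
proof (cases "card (crossings (edges Q)) \<le> 3")
  case True then show ?thesis using assms by (intro inflections_few_crossings)
next
  case four: False
  show ?thesis
  proof (cases "simple Q")
    case True
    then show ?thesis using balanced_two_inflections[OF assms(1,2) True assms(4,5)] four by linarith
  next
    case False
    then obtain a b c d where e: "(a, b) \<in> edges Q" "(c, d) \<in> edges Q" "crosses a b c d" unfolding simple_def by blast
    define s :: "real^3 \<Rightarrow> real^3" where "s = (\<lambda>v. v)"
    have s: "s = (\<lambda>v. v) \<or> s = uminus" "crosses a b (s c) (s d)" using e(3) unfolding s_def by simp_all
    obtain V' Q' where Q': "generic V' Q'" "\<forall>v\<in>V'. - v \<in> V'" "finite V'" "length Q' \<ge> 3" "card (crossings (edges Q')) + 2 \<le> card (crossings (edges Q))"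
      "s = (\<lambda>v. v) \<longrightarrow> set Q \<subseteq> set Q' \<and> cyclic_changes (cyclic_signs Q') \<le> cyclic_changes (cyclic_signs Q) + 2" "s = uminus \<longrightarrow> \<not> simple_pm Q'"
      by (rule smooth_crossing[OF assms(1-3) e(1,2) s assms(6)]) blast
    have k: "set Q \<subseteq> set Q'" "cyclic_changes (cyclic_signs Q') \<le> cyclic_changes (cyclic_signs Q) + 2" using mp[OF Q'(6) s_def] by blast+
    have "6 \<le> card (crossings (edges Q')) + cyclic_changes (cyclic_signs Q')"
      using Q'(2,5) assms(6) balanced_mono[OF assms(5) k(1)] by (intro inflections_few_crossings[OF Q'(1) _ Q'(3,4)]) auto
    then show ?thesis using Q'(5) k(2) by linarith
  qed
qed

section \<open>Translation to indexed polygons\<close>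

lemma changes_card: "changes l = card {i. Suc i < length l \<and> l ! i \<noteq> l ! Suc i}"
proof (induction l rule: changes.induct)
  case (1 a b l)
  let ?S = "{i. Suc i < length (b # l) \<and> (b # l) ! i \<noteq> (b # l) ! Suc i}"
  have fin: "finite ?S" by (rule finite_subset[of _ "{..<length (b # l)}"]) auto
  have e: "{i. Suc i < length (a # b # l) \<and> (a # b # l) ! i \<noteq> (a # b # l) ! Suc i} = (if a = b then {} else {0}) \<union> Suc ` ?S" (is "?L = ?R")
  proof (rule set_eqI)
    fix i show "i \<in> ?L \<longleftrightarrow> i \<in> ?R" by (cases i) auto
  qed
  have "card ?R = card (if a = b then {} else {0::nat}) + card (Suc ` ?S)"
    using fin by (intro card_Un_disjoint) auto
  moreover have "card (Suc ` ?S) = card ?S" by (simp add: card_image)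
  ultimately show ?case unfolding e using 1 by simp
qed simp_all

lemma length_turn_signs: "length (turn_signs l) = length l - 2"
  by (induction l rule: turn_signs.induct) auto

lemma nth_turn_signs: "Suc (Suc i) < length l \<Longrightarrow> turn_signs l ! i = (det3 (l ! i) (l ! Suc i) (l ! Suc (Suc i)) > 0)"
proof (induction l arbitrary: i rule: turn_signs.induct)
  case (1 a b c l) then show ?case by (cases i) auto
qed auto

lemma cyclic_signs_polygon:
  fixes u :: "nat \<Rightarrow> real^3"
  assumes "n \<ge> 3" shows "cyclic_signs (map u [0..<n]) = map (\<lambda>i. det3 (u ((i + n - 1) mod n)) (u i) (u (Suc i mod n)) > 0) [0..<n]"
proof (rule nth_equalityI)
  let ?Q = "map u [0..<n]"
  have ends: "last ?Q = u (n - 1)" "hd ?Q = u 0" using assms by (auto simp: last_map hd_map last_upt)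
  show len: "length (cyclic_signs ?Q) = length (map (\<lambda>i. det3 (u ((i + n - 1) mod n)) (u i) (u (Suc i mod n)) > 0) [0..<n])"
    by (simp add: cyclic_signs_def length_turn_signs)
  fix i assume "i < length (cyclic_signs ?Q)"
  then have i: "i < n" using len by simp
  have 1: "(last ?Q # ?Q @ [hd ?Q]) ! i = u ((i + n - 1) mod n)"
  proof (cases i)
    case (Suc j)
    then have "(i + n - 1) mod n = j" using i by (simp add: mod_if)
    then show ?thesis using Suc i by (simp add: nth_append)
  qed (use ends assms in simp)
  have 2: "(?Q @ [hd ?Q]) ! i = u i" using i by (simp add: nth_append)
  have 3: "(?Q @ [hd ?Q]) ! Suc i = u (Suc i mod n)"
    using i ends assms by (cases "Suc i = n") (auto simp: nth_append)
  have "cyclic_signs ?Q ! i = (det3 ((last ?Q # ?Q @ [hd ?Q]) ! i) ((?Q @ [hd ?Q]) ! i) ((?Q @ [hd ?Q]) ! Suc i) > 0)"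
    unfolding cyclic_signs_def using nth_turn_signs[of i "last ?Q # ?Q @ [hd ?Q]"] i by simp
  then show "cyclic_signs ?Q ! i = map (\<lambda>i. det3 (u ((i + n - 1) mod n)) (u i) (u (Suc i mod n)) > 0) [0..<n] ! i"
    unfolding 1 2 3 using i by simp
qed

lemma cyclic_changes_card: "cyclic_changes l = card {i. i < length l \<and> l ! i \<noteq> l ! (Suc i mod length l)}"
proof (cases "l = []")
  case False
  have "(l @ [hd l]) ! Suc i = l ! (Suc i mod length l)" if "i < length l" for i
    using that False by (cases "Suc i = length l") (auto simp: nth_append hd_conv_nth)
  then show ?thesis unfolding cyclic_changes_def changes_card using False by (intro arg_cong[where f = card]) (auto simp: nth_append)
qed (simp add: cyclic_changes_def)

lemma crosses_sarc:
  assumes "crosses a b c d" shows "sarc a b \<inter> sarc c d \<noteq> {}"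
proof -
  obtain p q r s where k: "0 < p" "0 < q" "0 < r" "0 < s" "p *\<^sub>R a + q *\<^sub>R b = r *\<^sub>R c + s *\<^sub>R d" using crossesE[OF assms] by blast
  define y where "y = p *\<^sub>R a + q *\<^sub>R b"
  have "det3 y b c = p * det3 a b c" unfolding y_def by (simp add: det3_lin)
  moreover have "det3 a b c \<noteq> 0" using assms unfolding crosses_def by auto
  ultimately have y: "y \<noteq> 0" using k(1) by auto
  define m where "m = inverse (norm y)"
  have m: "0 < m" "norm (m *\<^sub>R y) = 1" using y unfolding m_def by simp_all
  have "m *\<^sub>R y = (m * p) *\<^sub>R a + (m * q) *\<^sub>R b" unfolding y_def by (simp add: scaleR_add_right)
  moreover have "m *\<^sub>R y = (m * r) *\<^sub>R c + (m * s) *\<^sub>R d" unfolding y_def k(5) by (simp add: scaleR_add_right)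
  moreover have "0 \<le> m * p" "0 \<le> m * q" "0 \<le> m * r" "0 \<le> m * s" using m(1) k by simp_all
  ultimately have "m *\<^sub>R y \<in> sarc a b" "m *\<^sub>R y \<in> sarc c d" unfolding sarc_def using m(2) by blast+
  then show ?thesis by blast
qed

lemma sarc_minus: "sarc (- a) (- b) \<subseteq> uminus ` sarc a b"
proof
  fix v assume "v \<in> sarc (- a) (- b)"
  then obtain s t where k: "s \<ge> 0" "t \<ge> 0" "v = s *\<^sub>R (- a) + t *\<^sub>R (- b)" "norm v = 1" unfolding sarc_def by blast
  then have "- v = s *\<^sub>R a + t *\<^sub>R b" by simp
  moreover have "norm (- v) = 1" using k(4) by (simp only: norm_minus_cancel)
  ultimately have "- v \<in> sarc a b" unfolding sarc_def using k(1,2) by blast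
  then show "v \<in> uminus ` sarc a b" by (metis image_eqI minus_minus)
qed

lemma edges_polygon: assumes "n \<ge> 1" shows "edges (map u [0..<n]) = (\<lambda>i. (u i, u (Suc i mod n))) ` {..<n}"
proof -
  have "map u [0..<n] @ [hd (map u [0..<n])] = map (\<lambda>i. u (i mod n)) [0..<Suc n]"
    using assms by (simp add: hd_map)
  moreover have "adj (map f [0..<Suc n]) = (\<lambda>i. (f i, f (Suc i))) ` {..<n}" for f :: "nat \<Rightarrow> real^3"
  proof (induction n)
    case (Suc n)
    have "adj (map f [0..<Suc n] @ [f (Suc n)]) = adj (map f [0..<Suc n]) \<union> {(f n, f (Suc n))}"
      using adj_append[of "map f [0..<Suc n]" "[f (Suc n)]"] by simp
    then show ?case using Suc by (simp add: lessThan_Suc insert_commute)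
  qed simp
  ultimately have "edges (map u [0..<n]) = (\<lambda>i. (u (i mod n), u (Suc i mod n))) ` {..<n}" unfolding edges_def by (simp only:)
  also have "\<dots> = (\<lambda>i. (u i, u (Suc i mod n))) ` {..<n}" by (intro image_cong) auto
  finally show ?thesis .
qed

text \<open>The factor two turns index pairs \<open>i < j\<close> into ordered pairs. An inequality
  suffices, as further intersections of arcs only enlarge the quantity to be bounded from
  below.\<close>

lemma card_crossings_polygon:
  assumes "n \<ge> 1" shows "card (crossings (edges (map u [0..<n]))) \<le> 2 * (num_self_int u n + num_antipodal_int u n)"
proof -
  define E where "E i = (u i, u (Suc i mod n))" for i
  define S where "S = {(i, j). i < j \<and> j < n \<and> nonadjacent n i j \<and> edge u n i \<inter> edge u n j \<noteq> {}}"
  define T where "T = {(i, j). i < j \<and> j < n \<and> nonadjacent n i j \<and> edge u n i \<inter> uminus ` edge u n j \<noteq> {}}"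
  have fin: "finite S" "finite T" unfolding S_def T_def by (rule finite_subset[of _ "{..<n} \<times> {..<n}"]; auto)+
  have key: "(i, j) \<in> S \<union> T" if ij: "i < j" "j < n" "crosses_pm (fst (E i)) (snd (E i)) (fst (E j)) (snd (E j))" for i j
  proof -
    have c: "crosses_pm (u i) (u (Suc i mod n)) (u j) (u (Suc j mod n))" using ij(3) unfolding E_def by simp
    have "nonadjacent n i j" unfolding nonadjacent_def using c ij(1) by auto
    moreover have "edge u n i = sarc (u i) (u (Suc i mod n))" "edge u n j = sarc (u j) (u (Suc j mod n))" unfolding edge_def using ij by simp_all
    moreover have "sarc (u i) (u (Suc i mod n)) \<inter> sarc (u j) (u (Suc j mod n)) \<noteq> {} \<or> sarc (u i) (u (Suc i mod n)) \<inter> uminus ` sarc (u j) (u (Suc j mod n)) \<noteq> {}"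
    proof (cases "crosses (u i) (u (Suc i mod n)) (u j) (u (Suc j mod n))")
      case True then show ?thesis using crosses_sarc by blast
    next
      case False
      then have "sarc (u i) (u (Suc i mod n)) \<inter> sarc (- u j) (- u (Suc j mod n)) \<noteq> {}" using c crosses_sarc unfolding crosses_pm_iff by blast
      then show ?thesis using sarc_minus[of "u j" "u (Suc j mod n)"] by blast
    qed
    ultimately show ?thesis using ij(1,2) unfolding S_def T_def by simp
  qed
  have sub: "crossings (edges (map u [0..<n])) \<subseteq> (\<lambda>(i, j). (E i, E j)) ` (S \<union> T) \<union> (\<lambda>(i, j). (E j, E i)) ` (S \<union> T)"
  proof
    fix ef assume ef: "ef \<in> crossings (edges (map u [0..<n]))"
    obtain i j where ij: "i < n" "j < n" "ef = (E i, E j)" "crosses_pm (fst (E i)) (snd (E i)) (fst (E j)) (snd (E j))"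
      using ef unfolding crossings_def edges_polygon[OF assms] E_def by auto
    have "i \<noteq> j" using ij(4) by auto
    then consider "i < j" | "j < i" by linarith
    then show "ef \<in> (\<lambda>(i, j). (E i, E j)) ` (S \<union> T) \<union> (\<lambda>(i, j). (E j, E i)) ` (S \<union> T)"
    proof cases
      case 1 then show ?thesis using key[OF 1 ij(2,4)] ij(3) by force
    next
      case 2
      have "crosses_pm (fst (E j)) (snd (E j)) (fst (E i)) (snd (E i))" using ij(4) by (simp only: crosses_pm_sym(3))
      then show ?thesis using key[OF 2 ij(1)] ij(3) by force
    qed
  qed
  then have "card (crossings (edges (map u [0..<n]))) \<le> card ((\<lambda>(i, j). (E i, E j)) ` (S \<union> T) \<union> (\<lambda>(i, j). (E j, E i)) ` (S \<union> T))"
    using fin by (intro card_mono) auto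
  also have "\<dots> \<le> card ((\<lambda>(i, j). (E i, E j)) ` (S \<union> T)) + card ((\<lambda>(i, j). (E j, E i)) ` (S \<union> T))" by (rule card_Un_le)
  also have "\<dots> \<le> card (S \<union> T) + card (S \<union> T)" using fin by (intro add_mono card_image_le) auto
  also have "\<dots> \<le> 2 * (card S + card T)" using card_Un_le[of S T] by simp
  finally show ?thesis unfolding num_self_int_def num_antipodal_int_def S_def T_def .
qed

lemma cyclic_changes_polygon:
  fixes u :: "nat \<Rightarrow> real^3"
  assumes n: "n \<ge> 3" and gen: "\<forall>i<n. \<forall>j<n. \<forall>k<n. i \<noteq> j \<and> j \<noteq> k \<and> i \<noteq> k \<longrightarrow> det3 (u i) (u j) (u k) \<noteq> 0"
  shows "cyclic_changes (cyclic_signs (map u [0..<n])) = num_inflections u n"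
proof -
  define c where "c i = det3 (u ((i + n - 1) mod n)) (u i) (u (Suc i mod n))" for i
  have sg: "cyclic_signs (map u [0..<n]) = map (\<lambda>i. c i > 0) [0..<n]" unfolding c_def by (rule cyclic_signs_polygon[OF n])
  have nz: "c i \<noteq> 0" if i: "i < n" for i
  proof -
    have 1: "(i + n - 1) mod n = (if i = 0 then n - 1 else i - 1)" using i n by (cases i) (simp_all add: mod_if)
    have 2: "Suc i mod n = (if Suc i = n then 0 else Suc i)" using i by simp
    have "(i + n - 1) mod n < n" "Suc i mod n < n" using n by simp_all
    moreover have "(i + n - 1) mod n \<noteq> i \<and> i \<noteq> Suc i mod n \<and> (i + n - 1) mod n \<noteq> Suc i mod n"
      unfolding 1 2 using i n by auto
    ultimately show ?thesis unfolding c_def using gen i by blast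
  qed
  have nx: "det3 (u (i mod n)) (u (Suc i mod n)) (u (Suc (Suc i) mod n)) = c (Suc i mod n)" if i: "i < n" for i
  proof -
    have "(Suc i mod n + n - 1) mod n = i" using i n by (cases "Suc i = n") auto
    moreover have "Suc (Suc i mod n) mod n = Suc (Suc i) mod n" by (rule mod_Suc_eq)
    ultimately show ?thesis unfolding c_def using i by simp
  qed
  have "{i. i < length (cyclic_signs (map u [0..<n])) \<and> cyclic_signs (map u [0..<n]) ! i \<noteq> cyclic_signs (map u [0..<n]) ! (Suc i mod length (cyclic_signs (map u [0..<n])))}
    = {i. i < n \<and> det3 (u ((i + n - 1) mod n)) (u (i mod n)) (u (Suc i mod n)) * det3 (u (i mod n)) (u (Suc i mod n)) (u (Suc (Suc i) mod n)) < 0}"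
  proof (rule Collect_cong)
    fix i
    show "i < length (cyclic_signs (map u [0..<n])) \<and> cyclic_signs (map u [0..<n]) ! i \<noteq> cyclic_signs (map u [0..<n]) ! (Suc i mod length (cyclic_signs (map u [0..<n])))
      \<longleftrightarrow> i < n \<and> det3 (u ((i + n - 1) mod n)) (u (i mod n)) (u (Suc i mod n)) * det3 (u (i mod n)) (u (Suc i mod n)) (u (Suc (Suc i) mod n)) < 0"
    proof (cases "i < n")
      case True
      have m: "Suc i mod n < n" using n by simp
      have "det3 (u ((i + n - 1) mod n)) (u (i mod n)) (u (Suc i mod n)) = c i" unfolding c_def using True by simp
      then show ?thesis unfolding nx[OF True] sg using True m nz[OF True] nz[OF m]
        by (auto simp: mult_less_0_iff linorder_neq_iff)
    qed (simp add: sg)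
  qed
  then show ?thesis unfolding num_inflections_def cyclic_changes_card by simp
qed

theorem theorem12:
  fixes u :: "nat \<Rightarrow> real^3" and n :: nat
  assumes "n \<ge> 6"
    and unit: "\<forall>i<n. norm (u i) = 1"
    and general: "\<forall>i<n. \<forall>j<n. \<forall>k<n. i \<noteq> j \<and> j \<noteq> k \<and> i \<noteq> k \<longrightarrow> det3 (u i) (u j) (u k) \<noteq> 0"
    and not_hemisphere: "\<not> (\<exists>v. v \<noteq> 0 \<and> (\<forall>i<n. v \<bullet> u i \<ge> 0))"
  shows "2 * (num_self_int u n + num_antipodal_int u n) + num_inflections u n \<ge> 6"
proof -
  define Q where "Q = map u [0..<n]"
  define V where "V = set Q \<union> uminus ` set Q"
  have npar_vertices: "npar (u i) (u j)" if ij: "i < n" "j < n" "i \<noteq> j" for i j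
  proof -
    \<comment> \<open>A third vertex: if \<open>u i\<close> and \<open>u j\<close> were equal or
      antipodal, its determinant with them would vanish.\<close>
    obtain k where k: "k < n" "k \<noteq> i" "k \<noteq> j"
    proof -
      have "card {i, j} \<le> 2" by (simp add: card_insert_if)
      then have "\<not> {..<n} \<subseteq> {i, j}" using card_mono[of "{i, j}" "{..<n}"] assms(1) by auto
      then show ?thesis using that by blast
    qed
    then have "det3 (u i) (u j) (u k) \<noteq> 0" using general ij by blast
    then show ?thesis unfolding npar_def by auto
  qed
  have VD: "\<exists>i<n. a = u i \<or> a = - u i" if "a \<in> V" for a using that unfolding V_def Q_def by auto
  have "general_position V" unfolding general_position_def
  proof (intro ballI impI)
    fix a b c assume abc: "a \<in> V" "b \<in> V" "c \<in> V" "npar a b" "npar b c" "npar a c"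
    obtain i j k where e: "i < n" "a = u i \<or> a = - u i" "j < n" "b = u j \<or> b = - u j" "k < n" "c = u k \<or> c = - u k"
      using VD[OF abc(1)] VD[OF abc(2)] VD[OF abc(3)] by blast
    have "i \<noteq> j" "j \<noteq> k" "i \<noteq> k" using abc(4-6) e unfolding npar_def by auto
    then have "det3 (u i) (u j) (u k) \<noteq> 0" using general e by blast
    then show "det3 a b c \<noteq> 0" using e by auto
  qed
  moreover have "pairwise_npar (set Q)" unfolding pairwise_npar_def Q_def using npar_vertices by fastforce
  moreover have "distinct Q" unfolding Q_def using npar_vertices by (fastforce simp: distinct_map inj_on_def npar_def)
  ultimately have "generic V Q" unfolding generic_def V_def by blast
  moreover have "- v \<in> V" if "v \<in> V" for v using that unfolding V_def by auto
  moreover have "finite V" unfolding V_def by simp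
  moreover have "balanced (set Q)" using not_hemisphere unfolding balanced_def Q_def by auto
  ultimately have main: "card (crossings (edges Q)) \<le> 4 \<Longrightarrow> 6 \<le> card (crossings (edges Q)) + cyclic_changes (cyclic_signs Q)"
    using inflections_crossings[of V Q] assms(1) unfolding Q_def by simp
  have le: "card (crossings (edges Q)) \<le> 2 * (num_self_int u n + num_antipodal_int u n)"
    unfolding Q_def by (rule card_crossings_polygon) (use assms(1) in simp)
  have I: "cyclic_changes (cyclic_signs Q) = num_inflections u n"
    unfolding Q_def by (rule cyclic_changes_polygon[OF _ general]) (use assms(1) in simp)
  \<comment> \<open>For \<open>D \<ge> 3\<close> the claim is immediate; otherwise there are at most
    four ordered pairs and \<open>main\<close> applies.\<close>
  have "6 \<le> 2 * D + I" if "C \<le> 4 \<Longrightarrow> 6 \<le> C + I" "C \<le> 2 * D" for C D I :: nat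
    using that by (cases "D \<le> 2") simp_all
  from this[OF main le] show ?thesis unfolding I by simp
qed

end
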